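(* Let $R$ be a two-sided noetherian ring, let $n\ge1$ and $j\ge0$ be integers, and let $M$ be a finitely generated right $R$-module. The following are equivalent. \begin{enumerate} \item[(1)] The inequality $\operatorname{grade}_{R^{\mathrm{op}}}\operatorname{Ext}_R^i(M,R)\ge i+j-1$ holds for all $1\le i\le n$. \item[(2)] For all $1\le i\le n$, the syzygy $\Omega^iM$ is $i$-torsionfree and the natural map $\psi^i_M:\operatorname{Tr}\Omega^i\operatorname{Tr}\Omega^iM\to M$ satisfies $(\mathrm{T}_j)$. \end{enumerate}
   Context: Modules are finitely generated right modules; left $R$-modules are viewed as $R^{\mathrm{op}}$-modules. $(-)^\ast=\operatorname{Hom}(-,R)$. For a module $X$ with projective resolution $\cdots\to P_1\xrightarrow{\partial_1}P_0\xrightarrow{\partial_0}X\to 0$ (finitely generated projectives), the $n$th syzygy is $\Omega^nX=\operatorname{Im}\partial_n$ ($\Omega^0X=X$) and the transpose is $\operatorname{Tr}X=\operatorname{Cok}(\partial_1^\ast)$, an $R^{\mathrm{op}}$-module; both are unique up to projective direct summands. They are functors on stable categories (morphisms modulo those factoring through projectives), $\operatorname{Tr}$ being contravariant: $f:X\to Y$ induces $\operatorname{Tr}f:\operatorname{Tr}Y\to\operatorname{Tr}X$. $f:X\to Y$ satisfies $(\mathrm{T}_n)$ ($n\ge1$) if the map $\operatorname{Ext}^i_{R^{\mathrm{op}}}(\operatorname{Tr}f,R):\operatorname{Ext}^i_{R^{\mathrm{op}}}(\operatorname{Tr}X,R)\to\operatorname{Ext}^i_{R^{\mathrm{op}}}(\operatorname{Tr}Y,R)$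 is bijective for $1\le i\le n-1$ and injective for $i=n$. Every homomorphism satisfies $(\mathrm{T}_0)$. This depends only on the class of $f$ in the stable category. $X$ is $n$-torsionfree if $\operatorname{Ext}^i_{R^{\mathrm{op}}}(\operatorname{Tr}X,R)=0$ for all $1\le i\le n$. The grade of $M$ is $\inf\{i\ge0:\operatorname{Ext}^i(M,R)\ne0\}$ ($\infty$ if none, e.g. for $M=0$). Natural map $\psi^n_M$ ($n\ge1$): let $\cdots\to P_1\to P_0\to M\to0$ be a projective resolution, and take a projective resolution of $\operatorname{Tr}\Omega^nM=\operatorname{Cok}(P_n^\ast\to P_{n+1}^\ast)$ of the form $\cdots\to Q_3\to Q_2\to Q_1=P_n^\ast\to Q_0=P_{n+1}^\ast\to\operatorname{Tr}\Omega^nM\to0$. Since the target is exact in the relevant degrees, the identities of $P_{n+1}^\ast$ and $P_n^\ast$ extend to a chain map $f_i:P_{n+1-i}^\ast\to Q_i$ ($0\le i\le n+1$) from the complex $P_0^\ast\to P_1^\ast\to\cdots\to P_n^\ast\to P_{n+1}^\ast$. One has $\operatorname{Tr}\Omega^n\operatorname{Tr}\Omega^nM=\operatorname{Cok}(Q_n^\ast\to Q_{n+1}^\ast)$, and the commutative square formed by $f_n^\ast:Q_n^\ast\to P_1$ and $f_{n+1}^\ast:Q_{n+1}^\ast\to P_0$ (identifying $P^{\ast\ast}=P$) induces on cokernels the map $\psi^n_M:\operatorname{Tr}\Omega^n\operatorname{Tr}\Omega^nM\to M$. Its class in the stable category is uniquely determined by $M$. *)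

theory Defs
  imports "HOL-Algebra.Module" "HOL-Algebra.AbelCoset" "HOL-Library.Extended_Nat"
begin

section \<open>Right modules over a not necessarily commutative ring\<close>

definition op_ring :: "('a, 'r) ring_scheme \<Rightarrow> ('a, 'r) ring_scheme" where
  "op_ring R = R\<lparr>mult := (\<lambda>a b. b \<otimes>\<^bsub>R\<^esub> a)\<rparr>"

text \<open>The locale \<open>module\<close> of the library requires a commutative ring, but its record type is
  reused here. The element \<open>a \<odot>\<^bsub>M\<^esub> x\<close> stands for the right action of \<open>a\<close> on \<open>x\<close>, that is for
  \<open>x a\<close>; hence the order of the factors in \<open>right_smult_assoc\<close>. A left \<open>R\<close>-module is a right
  module over \<open>op_ring R\<close>.\<close>

locale right_module = R?: ring R + M?: abelian_group M for R (structure) and M (structure) +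
  assumes right_smult_closed:
      "\<lbrakk>a \<in> carrier R; x \<in> carrier M\<rbrakk> \<Longrightarrow> a \<odot>\<^bsub>M\<^esub> x \<in> carrier M"
    and right_smult_distr_ring:
      "\<lbrakk>a \<in> carrier R; b \<in> carrier R; x \<in> carrier M\<rbrakk> \<Longrightarrow>
       (a \<oplus> b) \<odot>\<^bsub>M\<^esub> x = a \<odot>\<^bsub>M\<^esub> x \<oplus>\<^bsub>M\<^esub> b \<odot>\<^bsub>M\<^esub> x"
    and right_smult_distr_module:
      "\<lbrakk>a \<in> carrier R; x \<in> carrier M; y \<in> carrier M\<rbrakk> \<Longrightarrow>
       a \<odot>\<^bsub>M\<^esub> (x \<oplus>\<^bsub>M\<^esub> y) = a \<odot>\<^bsub>M\<^esub> x \<oplus>\<^bsub>M\<^esub> a \<odot>\<^bsub>M\<^esub> y"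
    and right_smult_assoc:
      "\<lbrakk>a \<in> carrier R; b \<in> carrier R; x \<in> carrier M\<rbrakk> \<Longrightarrow>
       (a \<otimes> b) \<odot>\<^bsub>M\<^esub> x = b \<odot>\<^bsub>M\<^esub> (a \<odot>\<^bsub>M\<^esub> x)"
    and right_smult_one:
      "x \<in> carrier M \<Longrightarrow> \<one> \<odot>\<^bsub>M\<^esub> x = x"

definition regular_module :: "('a, 'r) ring_scheme \<Rightarrow> ('a, 'a) module" where
  "regular_module R =
     \<lparr>carrier = carrier R, mult = mult R, one = one R, zero = zero R, add = add R,
      smult = (\<lambda>a x. x \<otimes>\<^bsub>R\<^esub> a)\<rparr>"

definition fin_gen :: "('a, 'r) ring_scheme \<Rightarrow> ('a, 'm) module \<Rightarrow> bool" where
  "fin_gen R M \<longleftrightarrow> (\<exists>A \<subseteq> carrier M. finite A \<and> carrier M = \<Inter>{H. submodule H R M \<and> A \<subseteq> H})"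

definition right_noetherian :: "('a, 'r) ring_scheme \<Rightarrow> bool" where
  "right_noetherian R \<longleftrightarrow>
     (\<forall>I. submodule I R (regular_module R) \<longrightarrow> fin_gen R ((regular_module R)\<lparr>carrier := I\<rparr>))"

text \<open>The locale \<open>noetherian_ring\<close> of the library concerns two-sided ideals, which is weaker.\<close>

definition two_sided_noetherian :: "('a, 'r) ring_scheme \<Rightarrow> bool" where
  "two_sided_noetherian R \<longleftrightarrow> ring R \<and> right_noetherian R \<and> right_noetherian (op_ring R)"

text \<open>Homomorphisms are total functions of which only the values on the carrier matter.\<close>

definition mod_hom :: "('a, 'r) ring_scheme \<Rightarrow> ('a, 'm) module \<Rightarrow> ('a, 'n) module \<Rightarrow> ('m \<Rightarrow> 'n) set"
  where
  "mod_hom R M N = {f \<in> carrier M \<rightarrow> carrier N.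
     (\<forall>x \<in> carrier M. \<forall>y \<in> carrier M. f (x \<oplus>\<^bsub>M\<^esub> y) = f x \<oplus>\<^bsub>N\<^esub> f y) \<and>
     (\<forall>a \<in> carrier R. \<forall>x \<in> carrier M. f (a \<odot>\<^bsub>M\<^esub> x) = a \<odot>\<^bsub>N\<^esub> f x)}"

text \<open>The fields \<open>mult\<close> and \<open>one\<close> of the record type play no role in a module.\<close>

definition quot_module :: "('a, 'm) module \<Rightarrow> 'm set \<Rightarrow> ('a, 'm set) module" where
  "quot_module M H =
     \<lparr>carrier = a_rcosets\<^bsub>M\<^esub> H, mult = undefined, one = undefined, zero = H, add = set_add M,
      smult = (\<lambda>a A. \<Union>x\<in>A. H +>\<^bsub>M\<^esub> (a \<odot>\<^bsub>M\<^esub> x))\<rparr>"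

text \<open>The map \<open>M/H \<rightarrow> N/K\<close> induced by \<open>h : M \<rightarrow> N\<close> with \<open>h H \<subseteq> K\<close>; the union is over equal sets.\<close>

definition quot_map :: "('a, 'n) module \<Rightarrow> 'n set \<Rightarrow> ('m \<Rightarrow> 'n) \<Rightarrow> 'm set \<Rightarrow> 'n set" where
  "quot_map N K h A = (\<Union>x\<in>A. K +>\<^bsub>N\<^esub> h x)"

text \<open>\<open>M\<^sup>* = Hom(M, R)\<close> with \<open>(a f)(x) = a f(x)\<close>, a right module over \<open>op_ring R\<close>.\<close>

definition dual :: "('a, 'r) ring_scheme \<Rightarrow> ('a, 'm) module \<Rightarrow> ('a, 'm \<Rightarrow> 'a) module" where
  "dual R M =
     \<lparr>carrier = mod_hom R M (regular_module R) \<inter> extensional (carrier M),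
      mult = undefined, one = undefined,
      zero = (\<lambda>x\<in>carrier M. \<zero>\<^bsub>R\<^esub>),
      add = (\<lambda>f g. \<lambda>x\<in>carrier M. f x \<oplus>\<^bsub>R\<^esub> g x),
      smult = (\<lambda>a f. \<lambda>x\<in>carrier M. a \<otimes>\<^bsub>R\<^esub> f x)\<rparr>"

text \<open>The map \<open>f\<^sup>* : N\<^sup>* \<rightarrow> M\<^sup>*\<close> for \<open>f : M \<rightarrow> N\<close>.\<close>

definition dual_map :: "('a, 'm) module \<Rightarrow> ('m \<Rightarrow> 'n) \<Rightarrow> ('n \<Rightarrow> 'a) \<Rightarrow> ('m \<Rightarrow> 'a)" where
  "dual_map M f g = (\<lambda>x\<in>carrier M. g (f x))"


section \<open>Projective resolutions\<close>

definition free_module :: "('a, 'r) ring_scheme \<Rightarrow> nat \<Rightarrow> ('a, nat \<Rightarrow> 'a) module" where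
  "free_module R k =
     \<lparr>carrier = {..<k} \<rightarrow>\<^sub>E carrier R, mult = undefined, one = undefined,
      zero = (\<lambda>i\<in>{..<k}. \<zero>\<^bsub>R\<^esub>),
      add = (\<lambda>v w. \<lambda>i\<in>{..<k}. v i \<oplus>\<^bsub>R\<^esub> w i),
      smult = (\<lambda>a v. \<lambda>i\<in>{..<k}. v i \<otimes>\<^bsub>R\<^esub> a)\<rparr>"

text \<open>Finitely generated projective: a direct summand of some \<open>R\<^sup>k\<close>. (A lifting property would
  have to quantify over modules of all types.)\<close>

definition fg_projective :: "('a, 'r) ring_scheme \<Rightarrow> ('a, 'p) module \<Rightarrow> bool" where
  "fg_projective R P \<longleftrightarrow> right_module R P \<and>
     (\<exists>k. \<exists>s \<in> mod_hom R P (free_module R k). \<exists>p \<in> mod_hom R (free_module R k) P.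
        \<forall>x \<in> carrier P. p (s x) = x)"

text \<open>A sequence \<open>\<dots> \<rightarrow> P 1 \<rightarrow> P 0 \<rightarrow> M\<close>, where \<open>bd C i : P i \<rightarrow> P (i - 1)\<close> for \<open>i \<ge> 1\<close>;
  the value \<open>bd C 0\<close> is not used, its place being taken by \<open>aug C : P 0 \<rightarrow> M\<close>.\<close>

record ('a, 'p, 'm) resolution =
  cx :: "nat \<Rightarrow> ('a, 'p) module"
  bd :: "nat \<Rightarrow> 'p \<Rightarrow> 'p"
  aug :: "'p \<Rightarrow> 'm"

definition projective_resolution ::
    "('a, 'r) ring_scheme \<Rightarrow> ('a, 'm) module \<Rightarrow> ('a, 'p, 'm) resolution \<Rightarrow> bool" where
  "projective_resolution R M C \<longleftrightarrow>
     (\<forall>i. fg_projective R (cx C i)) \<and>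
     (\<forall>i. bd C (Suc i) \<in> mod_hom R (cx C (Suc i)) (cx C i)) \<and>
     aug C \<in> mod_hom R (cx C 0) M \<and>
     aug C ` carrier (cx C 0) = carrier M \<and>
     {x \<in> carrier (cx C 0). aug C x = \<zero>\<^bsub>M\<^esub>} = bd C 1 ` carrier (cx C 1) \<and>
     (\<forall>i. {x \<in> carrier (cx C (Suc i)). bd C (Suc i) x = \<zero>\<^bsub>cx C i\<^esub>} =
            bd C (Suc (Suc i)) ` carrier (cx C (Suc (Suc i))))"

text \<open>An arbitrary projective resolution of \<open>M\<close>, fixed once and for all. The type \<open>nat \<Rightarrow> 'a\<close>
  contains the carriers of all \<open>R\<^sup>k\<close>, so that over a right noetherian ring every finitely
  generated module has a resolution of this type.\<close>

definition resol ::
    "('a, 'r) ring_scheme \<Rightarrow> ('a, 'm) module \<Rightarrow> ('a, nat \<Rightarrow> 'a, 'm) resolution" where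
  "resol R M = (SOME C. projective_resolution R M C)"

definition lifts_along ::
    "('a, 'r) ring_scheme \<Rightarrow> ('a, 'm) module \<Rightarrow> ('m \<Rightarrow> 'n) \<Rightarrow>
     ('a, 'p, 'm) resolution \<Rightarrow> ('a, 'q, 'n) resolution \<Rightarrow> (nat \<Rightarrow> 'p \<Rightarrow> 'q) \<Rightarrow> bool" where
  "lifts_along R M f C D \<phi> \<longleftrightarrow>
     (\<forall>i. \<phi> i \<in> mod_hom R (cx C i) (cx D i)) \<and>
     (\<forall>x \<in> carrier (cx C 0). aug D (\<phi> 0 x) = f (aug C x)) \<and>
     (\<forall>i. \<forall>x \<in> carrier (cx C (Suc i)). bd D (Suc i) (\<phi> (Suc i) x) = \<phi> i (bd C (Suc i) x))"

definition resol_lift ::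
    "('a, 'r) ring_scheme \<Rightarrow> ('a, 'm) module \<Rightarrow> ('a, 'n) module \<Rightarrow> ('m \<Rightarrow> 'n) \<Rightarrow>
     nat \<Rightarrow> (nat \<Rightarrow> 'a) \<Rightarrow> (nat \<Rightarrow> 'a)" where
  "resol_lift R M N f = (SOME \<phi>. lifts_along R M f (resol R M) (resol R N) \<phi>)"


section \<open>Ext and grade\<close>

definition ext_cocycles ::
    "('a, 'r) ring_scheme \<Rightarrow> ('a, 'p, 'm) resolution \<Rightarrow> nat \<Rightarrow> ('p \<Rightarrow> 'a) set" where
  "ext_cocycles R C i = {g \<in> carrier (dual R (cx C i)).
     dual_map (cx C (Suc i)) (bd C (Suc i)) g = \<zero>\<^bsub>dual R (cx C (Suc i))\<^esub>}"

definition ext_coboundaries ::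
    "('a, 'r) ring_scheme \<Rightarrow> ('a, 'p, 'm) resolution \<Rightarrow> nat \<Rightarrow> ('p \<Rightarrow> 'a) set" where
  "ext_coboundaries R C i =
     (if i = 0 then {\<zero>\<^bsub>dual R (cx C 0)\<^esub>}
      else dual_map (cx C i) (bd C i) ` carrier (dual R (cx C (i - 1))))"

text \<open>\<open>Ext\<^sup>i(M, R)\<close>, a right module over \<open>op_ring R\<close>.\<close>

definition Ext :: "('a, 'r) ring_scheme \<Rightarrow> nat \<Rightarrow> ('a, 'm) module \<Rightarrow>
    ('a, ((nat \<Rightarrow> 'a) \<Rightarrow> 'a) set) module" where
  "Ext R i M = (let C = resol R M in
     quot_module ((dual R (cx C i))\<lparr>carrier := ext_cocycles R C i\<rparr>) (ext_coboundaries R C i))"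

text \<open>The map \<open>Ext\<^sup>i(N, R) \<rightarrow> Ext\<^sup>i(M, R)\<close> for \<open>f : M \<rightarrow> N\<close>.\<close>

definition Ext_map :: "('a, 'r) ring_scheme \<Rightarrow> nat \<Rightarrow> ('a, 'm) module \<Rightarrow> ('a, 'n) module \<Rightarrow>
    ('m \<Rightarrow> 'n) \<Rightarrow> ((nat \<Rightarrow> 'a) \<Rightarrow> 'a) set \<Rightarrow> ((nat \<Rightarrow> 'a) \<Rightarrow> 'a) set" where
  "Ext_map R i M N f = (let C = resol R M in
     quot_map (dual R (cx C i)) (ext_coboundaries R C i)
       (dual_map (cx C i) (resol_lift R M N f i)))"

definition zero_module :: "('a, 'm) module \<Rightarrow> bool" where
  "zero_module M \<longleftrightarrow> carrier M = {\<zero>\<^bsub>M\<^esub>}"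

definition grade :: "('a, 'r) ring_scheme \<Rightarrow> ('a, 'm) module \<Rightarrow> enat" where
  "grade R M = Inf (enat ` {i. \<not> zero_module (Ext R i M)})"


section \<open>Syzygies, transposes and torsionfreeness\<close>

text \<open>\<open>\<Omega>\<^sup>n M\<close> as the image of \<open>bd C n\<close>; meaningful for \<open>n \<ge> 1\<close> only.\<close>

definition syzygy :: "('a, 'r) ring_scheme \<Rightarrow> nat \<Rightarrow> ('a, 'm) module \<Rightarrow> ('a, nat \<Rightarrow> 'a) module" where
  "syzygy R n M = (let C = resol R M in
     (cx C (n - 1))\<lparr>carrier := bd C n ` carrier (cx C n)\<rparr>)"

text \<open>The cokernel of \<open>f\<^sup>* : B\<^sup>* \<rightarrow> A\<^sup>*\<close> for \<open>f : A \<rightarrow> B\<close>.\<close>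

definition cok_dual :: "('a, 'r) ring_scheme \<Rightarrow> ('a, 'p) module \<Rightarrow> ('a, 'q) module \<Rightarrow> ('p \<Rightarrow> 'q) \<Rightarrow>
    ('a, ('p \<Rightarrow> 'a) set) module" where
  "cok_dual R A B f = quot_module (dual R A) (dual_map A f ` carrier (dual R B))"

definition Tr :: "('a, 'r) ring_scheme \<Rightarrow> ('a, 'm) module \<Rightarrow> ('a, ((nat \<Rightarrow> 'a) \<Rightarrow> 'a) set) module"
  where
  "Tr R M = (let C = resol R M in cok_dual R (cx C 1) (cx C 0) (bd C 1))"

text \<open>The map \<open>Tr N \<rightarrow> Tr M\<close> for \<open>f : M \<rightarrow> N\<close>.\<close>

definition Tr_map :: "('a, 'r) ring_scheme \<Rightarrow> ('a, 'm) module \<Rightarrow> ('a, 'n) module \<Rightarrow> ('m \<Rightarrow> 'n) \<Rightarrow>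
    ((nat \<Rightarrow> 'a) \<Rightarrow> 'a) set \<Rightarrow> ((nat \<Rightarrow> 'a) \<Rightarrow> 'a) set" where
  "Tr_map R M N f = (let C = resol R M in
     quot_map (dual R (cx C 1)) (dual_map (cx C 1) (bd C 1) ` carrier (dual R (cx C 0)))
       (dual_map (cx C 1) (resol_lift R M N f 1)))"

definition torsionfree :: "('a, 'r) ring_scheme \<Rightarrow> nat \<Rightarrow> ('a, 'm) module \<Rightarrow> bool" where
  "torsionfree R n M \<longleftrightarrow> (\<forall>i \<in> {1..n}. zero_module (Ext (op_ring R) i (Tr R M)))"

text \<open>Condition \<open>(T\<^sub>n)\<close> for a homomorphism \<open>f : M \<rightarrow> N\<close>.\<close>

definition satisfies_T ::
    "('a, 'r) ring_scheme \<Rightarrow> nat \<Rightarrow> ('a, 'm) module \<Rightarrow> ('a, 'n) module \<Rightarrow> ('m \<Rightarrow> 'n) \<Rightarrow> bool" where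
  "satisfies_T R n M N f \<longleftrightarrow> f \<in> mod_hom R M N \<and>
     (n \<ge> 1 \<longrightarrow>
       (\<forall>i \<in> {1..n - 1}.
          bij_betw (Ext_map (op_ring R) i (Tr R N) (Tr R M) (Tr_map R M N f))
            (carrier (Ext (op_ring R) i (Tr R M))) (carrier (Ext (op_ring R) i (Tr R N)))) \<and>
       inj_on (Ext_map (op_ring R) n (Tr R N) (Tr R M) (Tr_map R M N f))
         (carrier (Ext (op_ring R) n (Tr R M))))"


section \<open>The natural map\<close>

text \<open>The choices in the construction of \<open>\<psi>\<^sup>n\<close> from a projective resolution \<open>C\<close> of \<open>M\<close>, with terms
  \<open>P i\<close>: a resolution \<open>Q\<close> of \<open>Tr \<Omega>\<^sup>n M = Cok(P n\<^sup>* \<rightarrow> P (n + 1)\<^sup>*)\<close> that begins with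
  \<open>P n\<^sup>* \<rightarrow> P (n + 1)\<^sup>*\<close>, and maps \<open>h i : P (n + 1 - i)\<^sup>* \<rightarrow> Q i\<close> for \<open>i \<le> n + 1\<close> that commute with the
  differentials and are identities for \<open>i = 0, 1\<close>.\<close>

definition psi_data ::
    "('a, 'r) ring_scheme \<Rightarrow> nat \<Rightarrow> ('a, 'p, 'm) resolution \<Rightarrow>
     ('a, 'p \<Rightarrow> 'a, ('p \<Rightarrow> 'a) set) resolution \<times> (nat \<Rightarrow> ('p \<Rightarrow> 'a) \<Rightarrow> ('p \<Rightarrow> 'a)) \<Rightarrow> bool" where
  "psi_data R n C = (\<lambda>(Q, h).
     projective_resolution (op_ring R)
       (cok_dual R (cx C (n + 1)) (cx C n) (bd C (n + 1))) Q \<and>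
     cx Q 0 = dual R (cx C (n + 1)) \<and>
     cx Q 1 = dual R (cx C n) \<and>
     (\<forall>g \<in> carrier (cx Q 0).
        aug Q g = dual_map (cx C (n + 1)) (bd C (n + 1)) ` carrier (dual R (cx C n)) +>\<^bsub>cx Q 0\<^esub> g) \<and>
     (\<forall>g \<in> carrier (cx Q 1). bd Q 1 g = dual_map (cx C (n + 1)) (bd C (n + 1)) g) \<and>
     (\<forall>i \<le> n + 1. h i \<in> mod_hom (op_ring R) (dual R (cx C (n + 1 - i))) (cx Q i)) \<and>
     (\<forall>g \<in> carrier (cx Q 0). h 0 g = g) \<and>
     (\<forall>g \<in> carrier (cx Q 1). h 1 g = g) \<and>
     (\<forall>i \<le> n. \<forall>g \<in> carrier (dual R (cx C (n - i))).
        bd Q (Suc i) (h (Suc i) g) = h i (dual_map (cx C (n + 1 - i)) (bd C (n + 1 - i)) g)))"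

text \<open>The stable class of the natural map does not depend on the choice made here.\<close>

definition psi_choice ::
    "('a, 'r) ring_scheme \<Rightarrow> nat \<Rightarrow> ('a, 'm) module \<Rightarrow>
     ('a, (nat \<Rightarrow> 'a) \<Rightarrow> 'a, ((nat \<Rightarrow> 'a) \<Rightarrow> 'a) set) resolution \<times>
     (nat \<Rightarrow> ((nat \<Rightarrow> 'a) \<Rightarrow> 'a) \<Rightarrow> ((nat \<Rightarrow> 'a) \<Rightarrow> 'a))" where
  "psi_choice R n M = (SOME D. psi_data R n (resol R M) D)"

text \<open>\<open>Tr \<Omega>\<^sup>n Tr \<Omega>\<^sup>n M = Cok(Q n\<^sup>* \<rightarrow> Q (n + 1)\<^sup>*)\<close>, a right \<open>R\<close>-module.\<close>

definition psi_domain ::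
    "('a, 'r) ring_scheme \<Rightarrow> nat \<Rightarrow> ('a, 'm) module \<Rightarrow> ('a, (((nat \<Rightarrow> 'a) \<Rightarrow> 'a) \<Rightarrow> 'a) set) module"
  where
  "psi_domain R n M = (let Q = fst (psi_choice R n M) in
     cok_dual (op_ring R) (cx Q (n + 1)) (cx Q n) (bd Q (n + 1)))"

text \<open>The class of \<open>u \<in> Q (n + 1)\<^sup>*\<close> is sent to the class in \<open>M = Cok(P 1 \<rightarrow> P 0)\<close> of the element
  \<open>p\<close> of \<open>P 0 = P 0\<^sup>*\<^sup>*\<close> such that evaluation at \<open>p\<close> is the composite of \<open>h (n + 1)\<close> and \<open>u\<close>.\<close>

definition psi ::
    "('a, 'r) ring_scheme \<Rightarrow> nat \<Rightarrow> ('a, 'm) module \<Rightarrow> (((nat \<Rightarrow> 'a) \<Rightarrow> 'a) \<Rightarrow> 'a) set \<Rightarrow> 'm" where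
  "psi R n M A = (let C = resol R M; h = snd (psi_choice R n M) in
     THE y. \<exists>u \<in> A. \<exists>p \<in> carrier (cx C 0).
       (\<forall>g \<in> carrier (dual R (cx C 0)). g p = u (h (n + 1) g)) \<and> y = aug C p)"

end

theory Submission
  imports Defs
begin

text \<open>
  Write \<open>X i = Tr \<Omega>\<^sup>i M = Cok (P i\<^sup>* \<rightarrow> P (i + 1)\<^sup>*)\<close>. The module \<open>Ext\<^sup>i(M, R)\<close> is the kernel of the
  surjection \<open>X (i - 1) \<rightarrow> \<Omega>(X i)\<close>, whose dual is onto, so by the long exact sequence its grade is at
  least \<open>i + j - 1\<close> if and only if \<open>Ext\<^sup>k\<^sup>+\<^sup>1(X i, R) \<rightarrow> Ext\<^sup>k(X (i - 1), R)\<close> is bijective for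
  \<open>1 \<le> k \<le> i + j - 2\<close> and injective for \<open>k = i + j - 1\<close>. On the other side, \<open>\<Omega>\<^sup>i M\<close> is \<open>i\<close>-torsionfree
  when \<open>Ext\<^sup>k(X i, R) = 0\<close> for \<open>1 \<le> k \<le> i\<close>, and \<open>Tr \<psi>\<^sup>i\<close> is, up to maps that factor through
  projectives, the composite \<open>X 0 \<rightarrow> \<Omega>(X 1) \<rightarrow> \<dots> \<rightarrow> \<Omega>\<^sup>i(X i)\<close>. The equivalence then follows by
  induction on \<open>i\<close>.

  The argument is carried out on complexes of projectives. Instead of a long exact sequence, an
  explicit resolution of \<open>Ext\<^sup>i(M, R)\<close> is read off from the mapping cone of \<open>X (i - 1) \<rightarrow> \<Omega>(X i)\<close>.
  Transposes of maps are formed along perfect pairings, which treat \<open>P \<times> P\<^sup>* \<rightarrow> R\<close> and \<open>Q\<^sup>* \<times> Q \<rightarrow> R\<close>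
  alike and make double duals unnecessary.
\<close>

section \<open>Modules and linear maps\<close>

text \<open>Two mechanisms meet at degree i. Below i the map from \<open>X (i - 1)\<close> to the
  syzygy of \<open>X i\<close> is judged by the Ext groups themselves, since a map between vanishing
  groups is bijective; exactness of \<open>P\<close> gives \<open>Ext^1(X i, R) = 0\<close> for i
  \<ge> 1, which starts the vanishing. From degree i on, the same map is the last factor of the
  composite from \<open>X 0\<close> and is cancelled against the factors before it. There degree
  \<open>k + i\<close> on \<open>X i\<close> corresponds to degree \<open>k\<close> on
  \<open>X 0\<close>, which is how j enters the bound. The main obstacle is that resolutions, lifts
  and the natural map are arbitrary choices, and that a transpose is functorial only up to maps
  through projectives. Hence each notion is expressed by cocycles of some complex and shown to be
  independent of that complex. Cohomology in degree zero does detect maps through projectives, so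
  comparisons of transposes are stated in degrees \<open>Suc k\<close> only. A further constraint is
  that all terms of a complex share one type, which shapes the covers and the cone.\<close>

context abelian_group
begin

lemma minus_eq_zero_iff: "x \<in> carrier G \<Longrightarrow> y \<in> carrier G \<Longrightarrow> x \<ominus> y = \<zero> \<longleftrightarrow> x = y"
  by (metis a_minus_def add.inv_closed add.inv_solve_right' l_zero r_neg zero_closed)

lemma minus_add_cancel: "x \<in> carrier G \<Longrightarrow> y \<in> carrier G \<Longrightarrow> (x \<ominus> y) \<oplus> y = x"
  by (simp add: a_minus_def a_assoc l_neg)

lemma add_minus_cancel: "x \<in> carrier G \<Longrightarrow> y \<in> carrier G \<Longrightarrow> (x \<oplus> y) \<ominus> y = x"
  by (simp add: a_minus_def a_assoc r_neg)

lemma minus_swap: "x \<in> carrier G \<Longrightarrow> y \<in> carrier G \<Longrightarrow> \<ominus> (x \<ominus> y) = y \<ominus> x"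
  by (simp add: a_minus_def minus_add a_comm)

lemma minus_trans:
  assumes "x \<in> carrier G" "y \<in> carrier G" "z \<in> carrier G"
  shows "(x \<ominus> y) \<oplus> (y \<ominus> z) = x \<ominus> z"
proof -
  have "(x \<ominus> y) \<oplus> (y \<ominus> z) = ((x \<ominus> y) \<oplus> y) \<oplus> \<ominus> z"
    using assms by (simp add: a_minus_def a_assoc)
  then show ?thesis using assms by (simp add: minus_add_cancel) (simp add: a_minus_def)
qed

lemma eq_minus_iff: "x \<in> carrier G \<Longrightarrow> y \<in> carrier G \<Longrightarrow> z \<in> carrier G \<Longrightarrow> x \<ominus> y = z \<longleftrightarrow> x = z \<oplus> y"
  using minus_add_cancel add_minus_cancel by metis

lemma minus_zero_right: "x \<in> carrier G \<Longrightarrow> x \<ominus> \<zero> = x"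
  using eq_minus_iff[of x \<zero> x] by simp

end

lemma op_ring_simps [simp]:
  "carrier (op_ring R) = carrier R" "add (op_ring R) = add R" "zero (op_ring R) = zero R"
  "one (op_ring R) = one R" "x \<otimes>\<^bsub>op_ring R\<^esub> y = y \<otimes>\<^bsub>R\<^esub> x" "op_ring (op_ring R) = R"
  by (simp_all add: op_ring_def)

lemma ring_op_ring:
  assumes "ring R"
  shows "ring (op_ring R)"
proof -
  interpret ring R by fact
  show ?thesis
  proof (rule ringI)
    show "abelian_group (op_ring R)"
    proof (rule abelian_groupI)
      show "\<exists>y\<in>carrier (op_ring R). y \<oplus>\<^bsub>op_ring R\<^esub> x = \<zero>\<^bsub>op_ring R\<^esub>" if "x \<in> carrier (op_ring R)" for x
        using that l_neg a_inv_closed by fastforce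
    qed (auto simp: a_ac)
    show "monoid (op_ring R)"
      by unfold_locales (auto simp: m_assoc)
  qed (auto simp: l_distr r_distr)
qed

context right_module
begin

lemma smult_zero_left [simp]: "x \<in> carrier M \<Longrightarrow> \<zero> \<odot>\<^bsub>M\<^esub> x = \<zero>\<^bsub>M\<^esub>"
  using right_smult_distr_ring[of \<zero> \<zero> x] right_smult_closed[of \<zero> x]
  by (metis M.add.r_cancel_one' R.l_zero R.zero_closed)

lemma smult_zero_right [simp]: "a \<in> carrier R \<Longrightarrow> a \<odot>\<^bsub>M\<^esub> \<zero>\<^bsub>M\<^esub> = \<zero>\<^bsub>M\<^esub>"
  using right_smult_distr_module[of a "\<zero>\<^bsub>M\<^esub>" "\<zero>\<^bsub>M\<^esub>"] right_smult_closed[of a "\<zero>\<^bsub>M\<^esub>"]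
  by (metis M.add.r_cancel_one' M.l_zero M.zero_closed)

lemma smult_neg_left:
  assumes "a \<in> carrier R" "x \<in> carrier M"
  shows "(\<ominus> a) \<odot>\<^bsub>M\<^esub> x = \<ominus>\<^bsub>M\<^esub> (a \<odot>\<^bsub>M\<^esub> x)"
proof -
  have "(\<ominus> a) \<odot>\<^bsub>M\<^esub> x \<oplus>\<^bsub>M\<^esub> a \<odot>\<^bsub>M\<^esub> x = \<zero>\<^bsub>M\<^esub>"
    using right_smult_distr_ring[of "\<ominus> a" a x] assms by (simp add: R.l_neg)
  then show ?thesis
    using assms right_smult_closed by (metis M.minus_equality R.a_inv_closed)
qed

lemma smult_neg_right:
  assumes "a \<in> carrier R" "x \<in> carrier M"
  shows "a \<odot>\<^bsub>M\<^esub> (\<ominus>\<^bsub>M\<^esub> x) = \<ominus>\<^bsub>M\<^esub> (a \<odot>\<^bsub>M\<^esub> x)"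
proof -
  have "a \<odot>\<^bsub>M\<^esub> (\<ominus>\<^bsub>M\<^esub> x) \<oplus>\<^bsub>M\<^esub> a \<odot>\<^bsub>M\<^esub> x = \<zero>\<^bsub>M\<^esub>"
    using right_smult_distr_module[of a "\<ominus>\<^bsub>M\<^esub> x" x] assms by (simp add: M.l_neg)
  then show ?thesis
    using assms right_smult_closed by (metis M.minus_equality M.a_inv_closed)
qed

lemma submoduleI':
  assumes "H \<subseteq> carrier M" "\<zero>\<^bsub>M\<^esub> \<in> H" "\<And>x y. x \<in> H \<Longrightarrow> y \<in> H \<Longrightarrow> x \<oplus>\<^bsub>M\<^esub> y \<in> H"
    "\<And>a x. a \<in> carrier R \<Longrightarrow> x \<in> H \<Longrightarrow> a \<odot>\<^bsub>M\<^esub> x \<in> H"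
  shows "submodule H R M"
proof -
  have "\<ominus>\<^bsub>M\<^esub> x \<in> H" if "x \<in> H" for x
  proof -
    have "(\<ominus> \<one>) \<odot>\<^bsub>M\<^esub> x \<in> H" using assms(4) that by blast
    then show ?thesis using that assms(1) by (simp add: smult_neg_left right_smult_one subsetD)
  qed
  then show ?thesis
    using assms by (intro submodule.intro subgroup.intro submodule_axioms.intro)
      (auto simp: a_inv_def)
qed

end

lemma submoduleD:
  assumes "submodule H R M"
  shows "H \<subseteq> carrier M" "\<zero>\<^bsub>M\<^esub> \<in> H" "\<And>x y. x \<in> H \<Longrightarrow> y \<in> H \<Longrightarrow> x \<oplus>\<^bsub>M\<^esub> y \<in> H"
    "\<And>a x. a \<in> carrier R \<Longrightarrow> x \<in> H \<Longrightarrow> a \<odot>\<^bsub>M\<^esub> x \<in> H"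
    "\<And>x. x \<in> H \<Longrightarrow> \<ominus>\<^bsub>M\<^esub> x \<in> H"
proof -
  interpret submodule H R M by fact
  show "H \<subseteq> carrier M" "\<zero>\<^bsub>M\<^esub> \<in> H" "\<And>x y. x \<in> H \<Longrightarrow> y \<in> H \<Longrightarrow> x \<oplus>\<^bsub>M\<^esub> y \<in> H"
    "\<And>a x. a \<in> carrier R \<Longrightarrow> x \<in> H \<Longrightarrow> a \<odot>\<^bsub>M\<^esub> x \<in> H"
    "\<And>x. x \<in> H \<Longrightarrow> \<ominus>\<^bsub>M\<^esub> x \<in> H"
    using subset one_closed m_closed m_inv_closed smult_closed by (auto simp: a_inv_def)
qed

lemma right_moduleI:
  assumes "ring R" "abelian_group M"
    and "\<And>a x. \<lbrakk>a \<in> carrier R; x \<in> carrier M\<rbrakk> \<Longrightarrow> a \<odot>\<^bsub>M\<^esub> x \<in> carrier M"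
    and "\<And>a b x. \<lbrakk>a \<in> carrier R; b \<in> carrier R; x \<in> carrier M\<rbrakk> \<Longrightarrow>
       (a \<oplus>\<^bsub>R\<^esub> b) \<odot>\<^bsub>M\<^esub> x = a \<odot>\<^bsub>M\<^esub> x \<oplus>\<^bsub>M\<^esub> b \<odot>\<^bsub>M\<^esub> x"
    and "\<And>a x y. \<lbrakk>a \<in> carrier R; x \<in> carrier M; y \<in> carrier M\<rbrakk> \<Longrightarrow>
       a \<odot>\<^bsub>M\<^esub> (x \<oplus>\<^bsub>M\<^esub> y) = a \<odot>\<^bsub>M\<^esub> x \<oplus>\<^bsub>M\<^esub> a \<odot>\<^bsub>M\<^esub> y"
    and "\<And>a b x. \<lbrakk>a \<in> carrier R; b \<in> carrier R; x \<in> carrier M\<rbrakk> \<Longrightarrow>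
       (a \<otimes>\<^bsub>R\<^esub> b) \<odot>\<^bsub>M\<^esub> x = b \<odot>\<^bsub>M\<^esub> (a \<odot>\<^bsub>M\<^esub> x)"
    and "\<And>x. x \<in> carrier M \<Longrightarrow> \<one>\<^bsub>R\<^esub> \<odot>\<^bsub>M\<^esub> x = x"
  shows "right_module R M"
  using assms by (intro right_module.intro right_module_axioms.intro) auto

lemma right_module_restrict:
  assumes "right_module R M" "submodule H R M"
  shows "right_module R (M\<lparr>carrier := H\<rparr>)"
proof -
  interpret M: right_module R M by fact
  note H = submoduleD[OF assms(2)]
  note HM = subsetD[OF H(1)]
  show ?thesis
  proof (rule right_moduleI)
    show "abelian_group (M\<lparr>carrier := H\<rparr>)"
    proof (rule abelian_groupI)
      fix x assume "x \<in> carrier (M\<lparr>carrier := H\<rparr>)"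
      then show "\<exists>y\<in>carrier (M\<lparr>carrier := H\<rparr>). y \<oplus>\<^bsub>M\<lparr>carrier := H\<rparr>\<^esub> x = \<zero>\<^bsub>M\<lparr>carrier := H\<rparr>\<^esub>"
        using H(5)[of x] HM[of x] by (auto simp: M.M.l_neg intro!: bexI[of _ "\<ominus>\<^bsub>M\<^esub> x"])
    qed (use H HM in \<open>auto simp: M.M.a_ac\<close>)
  qed (use M.R.ring_axioms H HM in \<open>auto simp: M.right_smult_distr_ring M.right_smult_distr_module
      M.right_smult_assoc M.right_smult_one\<close>)
qed

lemma right_module_regular:
  assumes "ring R"
  shows "right_module R (regular_module R)"
proof -
  interpret ring R by fact
  show ?thesis
  proof (rule right_moduleI)
    show "abelian_group (regular_module R)"
    proof (rule abelian_groupI)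
      show "\<exists>y\<in>carrier (regular_module R). y \<oplus>\<^bsub>regular_module R\<^esub> x = \<zero>\<^bsub>regular_module R\<^esub>"
        if "x \<in> carrier (regular_module R)" for x
        using that l_neg a_inv_closed by (fastforce simp: regular_module_def)
    qed (auto simp: regular_module_def a_ac)
  qed (use assms in \<open>auto simp: regular_module_def l_distr r_distr m_assoc\<close>)
qed

lemma regular_module_simps [simp]:
  "carrier (regular_module R) = carrier R" "add (regular_module R) = add R"
  "zero (regular_module R) = zero R" "a \<odot>\<^bsub>regular_module R\<^esub> x = x \<otimes>\<^bsub>R\<^esub> a"
  "finsum (regular_module R) f A = finsum R f A"
  by (simp_all add: regular_module_def finsum_def finprod_def)

lemma a_inv_regular [simp]:
  "\<ominus>\<^bsub>regular_module R\<^esub> x = \<ominus>\<^bsub>R\<^esub> x" "x \<ominus>\<^bsub>regular_module R\<^esub> y = x \<ominus>\<^bsub>R\<^esub> y"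
  by (simp_all add: a_inv_def m_inv_def a_minus_def)

text \<open>Both module structures are part of the predicate, so one hypothesis about a map supplies
  everything about its source and target.\<close>

definition lin :: "('a, 'r) ring_scheme \<Rightarrow> ('a, 'm) module \<Rightarrow> ('a, 'n) module \<Rightarrow> ('m \<Rightarrow> 'n) \<Rightarrow> bool"
  where "lin R M N f \<longleftrightarrow> right_module R M \<and> right_module R N \<and> f \<in> mod_hom R M N"

lemma linI:
  assumes "right_module R M" "right_module R N"
    and "\<And>x. x \<in> carrier M \<Longrightarrow> f x \<in> carrier N"
    and "\<And>x y. \<lbrakk>x \<in> carrier M; y \<in> carrier M\<rbrakk> \<Longrightarrow> f (x \<oplus>\<^bsub>M\<^esub> y) = f x \<oplus>\<^bsub>N\<^esub> f y"
    and "\<And>a x. \<lbrakk>a \<in> carrier R; x \<in> carrier M\<rbrakk> \<Longrightarrow> f (a \<odot>\<^bsub>M\<^esub> x) = a \<odot>\<^bsub>N\<^esub> f x"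
  shows "lin R M N f"
  using assms by (simp add: lin_def mod_hom_def)

lemma lin_modules:
  assumes "lin R M N f"
  shows "right_module R M" "right_module R N" "abelian_group M" "abelian_group N"
  using assms by (auto simp: lin_def right_module_def)

lemma lin_mod_hom: "lin R M N f \<Longrightarrow> f \<in> mod_hom R M N"
  by (simp add: lin_def)

lemma lin_closed: "lin R M N f \<Longrightarrow> x \<in> carrier M \<Longrightarrow> f x \<in> carrier N"
  by (auto simp: lin_def mod_hom_def)

lemma lin_add: "lin R M N f \<Longrightarrow> x \<in> carrier M \<Longrightarrow> y \<in> carrier M \<Longrightarrow> f (x \<oplus>\<^bsub>M\<^esub> y) = f x \<oplus>\<^bsub>N\<^esub> f y"
  by (auto simp: lin_def mod_hom_def)

lemma lin_smult: "lin R M N f \<Longrightarrow> a \<in> carrier R \<Longrightarrow> x \<in> carrier M \<Longrightarrow> f (a \<odot>\<^bsub>M\<^esub> x) = a \<odot>\<^bsub>N\<^esub> f x"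
  by (auto simp: lin_def mod_hom_def)

lemma lin_zero:
  assumes "lin R M N f"
  shows "f \<zero>\<^bsub>M\<^esub> = \<zero>\<^bsub>N\<^esub>"
proof -
  interpret M: abelian_group M using lin_modules[OF assms] by auto
  interpret N: abelian_group N using lin_modules[OF assms] by auto
  show ?thesis
    using lin_add[OF assms, of "\<zero>\<^bsub>M\<^esub>" "\<zero>\<^bsub>M\<^esub>"] lin_closed[OF assms, of "\<zero>\<^bsub>M\<^esub>"]
    by (metis M.l_zero M.zero_closed N.add.r_cancel_one')
qed

lemma lin_neg:
  assumes "lin R M N f" "x \<in> carrier M"
  shows "f (\<ominus>\<^bsub>M\<^esub> x) = \<ominus>\<^bsub>N\<^esub> f x"
proof -
  interpret M: abelian_group M using lin_modules[OF assms(1)] by auto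
  interpret N: abelian_group N using lin_modules[OF assms(1)] by auto
  have "f (\<ominus>\<^bsub>M\<^esub> x) \<oplus>\<^bsub>N\<^esub> f x = \<zero>\<^bsub>N\<^esub>"
    using lin_add[OF assms(1), of "\<ominus>\<^bsub>M\<^esub> x" x] assms by (simp add: M.l_neg lin_zero)
  then show ?thesis
    using lin_closed[OF assms(1)] assms(2) by (metis N.minus_equality M.a_inv_closed)
qed

lemma lin_minus:
  assumes "lin R M N f" "x \<in> carrier M" "y \<in> carrier M"
  shows "f (x \<ominus>\<^bsub>M\<^esub> y) = f x \<ominus>\<^bsub>N\<^esub> f y"
proof -
  interpret M: abelian_group M using lin_modules[OF assms(1)] by auto
  show ?thesis
    using assms by (simp add: a_minus_def lin_add lin_neg)
qed

lemma lin_cong: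
  assumes "lin R M N f" "\<And>x. x \<in> carrier M \<Longrightarrow> g x = f x"
  shows "lin R M N g"
proof -
  interpret M: right_module R M using lin_modules[OF assms(1)] by auto
  show ?thesis
    using assms M.right_smult_closed by (intro linI)
      (auto simp: lin_modules lin_closed lin_add lin_smult)
qed

lemma lin_cong_iff:
  assumes "\<And>x. x \<in> carrier M \<Longrightarrow> g x = f x"
  shows "lin R M N g \<longleftrightarrow> lin R M N f"
  using lin_cong assms by metis

lemma lin_comp:
  assumes "lin R M N f" "lin R N K g"
  shows "lin R M K (\<lambda>x. g (f x))"
  using assms by (intro linI) (auto simp: lin_modules lin_closed lin_add lin_smult)

lemma lin_id: "right_module R M \<Longrightarrow> lin R M M (\<lambda>x. x)"
  by (simp add: lin_def mod_hom_def)

lemma lin_const_zero: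
  assumes "right_module R M" "right_module R N"
  shows "lin R M N (\<lambda>x. \<zero>\<^bsub>N\<^esub>)"
proof -
  interpret N: right_module R N by fact
  show ?thesis using assms by (intro linI) auto
qed

lemma lin_sum:
  assumes "lin R M N f" "lin R M N g"
  shows "lin R M N (\<lambda>x. f x \<oplus>\<^bsub>N\<^esub> g x)"
proof -
  interpret N: right_module R N using lin_modules[OF assms(1)] by auto
  show ?thesis
    using assms by (intro linI)
      (auto simp: lin_modules lin_closed lin_add lin_smult N.M.a_ac N.right_smult_distr_module)
qed

lemma lin_uminus:
  assumes "lin R M N f"
  shows "lin R M N (\<lambda>x. \<ominus>\<^bsub>N\<^esub> f x)"
proof -
  interpret N: right_module R N using lin_modules[OF assms(1)] by auto
  show ?thesis
    using assms by (intro linI)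
      (auto simp: lin_modules lin_closed lin_add lin_smult N.M.minus_add N.smult_neg_right)
qed

lemma lin_diff:
  assumes "lin R M N f" "lin R M N g"
  shows "lin R M N (\<lambda>x. f x \<ominus>\<^bsub>N\<^esub> g x)"
  using lin_sum[OF assms(1) lin_uminus[OF assms(2)]] by (simp add: a_minus_def)

lemma lin_restrict_dom:
  assumes "lin R M N f" "submodule H R M"
  shows "lin R (M\<lparr>carrier := H\<rparr>) N f"
  using assms submoduleD(1)[OF assms(2)]
  by (intro linI) (auto simp: lin_modules lin_closed lin_add lin_smult right_module_restrict subsetD)

lemma lin_restrict_cod:
  assumes "lin R M N f" "submodule H R N" "\<And>x. x \<in> carrier M \<Longrightarrow> f x \<in> H"
  shows "lin R M (N\<lparr>carrier := H\<rparr>) f"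
  using assms
  by (intro linI) (auto simp: lin_modules lin_closed lin_add lin_smult right_module_restrict)

lemma submodule_kernel:
  assumes "lin R M N f"
  shows "submodule {x \<in> carrier M. f x = \<zero>\<^bsub>N\<^esub>} R M"
proof -
  interpret M: right_module R M using lin_modules[OF assms] by auto
  interpret N: right_module R N using lin_modules[OF assms] by auto
  show ?thesis
    by (rule M.submoduleI')
      (use assms M.right_smult_closed in \<open>auto simp: lin_zero lin_add lin_smult\<close>)
qed

lemma submodule_image:
  assumes "lin R M N f"
  shows "submodule (f ` carrier M) R N"
proof -
  interpret M: right_module R M using lin_modules[OF assms] by auto
  interpret N: right_module R N using lin_modules[OF assms] by auto
  show ?thesis
  proof (rule N.submoduleI')
    show "\<zero>\<^bsub>N\<^esub> \<in> f ` carrier M"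
      using lin_zero[OF assms] by (metis M.M.zero_closed imageI)
    show "x \<oplus>\<^bsub>N\<^esub> y \<in> f ` carrier M" if "x \<in> f ` carrier M" "y \<in> f ` carrier M" for x y
      using that by (auto simp: lin_add[OF assms, symmetric])
    show "a \<odot>\<^bsub>N\<^esub> x \<in> f ` carrier M" if "a \<in> carrier R" "x \<in> f ` carrier M" for a x
      using that M.right_smult_closed by (auto simp: lin_smult[OF assms, symmetric])
  qed (auto simp: lin_closed[OF assms])
qed

lemma submodule_image_of_submodule:
  assumes "lin R M N f" "submodule H R M"
  shows "submodule (f ` H) R N"
  using submodule_image[OF lin_restrict_dom[OF assms]] by simp


subsection \<open>Finite linear combinations\<close>

text \<open>Indexing by an initial segment of the naturals lets an element of
  \<open>free_module R k\<close> serve directly as the coefficient family \<open>r\<close>.\<close>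

definition comb :: "('a, 'm) module \<Rightarrow> nat \<Rightarrow> (nat \<Rightarrow> 'a) \<Rightarrow> (nat \<Rightarrow> 'm) \<Rightarrow> 'm" where
  "comb M k r x = (\<Oplus>\<^bsub>M\<^esub>i\<in>{..<k}. r i \<odot>\<^bsub>M\<^esub> x i)"

lemma comb_0: "abelian_group M \<Longrightarrow> comb M 0 r x = \<zero>\<^bsub>M\<^esub>"
  by (simp add: comb_def abelian_monoid.finsum_empty abelian_group.axioms(1))

lemma comb_Suc:
  assumes "right_module R M" "\<And>i. i < Suc k \<Longrightarrow> r i \<in> carrier R" "\<And>i. i < Suc k \<Longrightarrow> x i \<in> carrier M"
  shows "comb M (Suc k) r x = r k \<odot>\<^bsub>M\<^esub> x k \<oplus>\<^bsub>M\<^esub> comb M k r x"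
proof -
  interpret M: right_module R M by fact
  show ?thesis
    using assms(2,3) by (simp add: comb_def lessThan_Suc M.M.finsum_insert M.right_smult_closed)
qed

lemma comb_closed:
  assumes "right_module R M" "\<And>i. i < k \<Longrightarrow> r i \<in> carrier R" "\<And>i. i < k \<Longrightarrow> x i \<in> carrier M"
  shows "comb M k r x \<in> carrier M"
proof -
  interpret M: right_module R M by fact
  show ?thesis
    using assms(2,3) by (auto simp: comb_def M.right_smult_closed intro!: M.M.finsum_closed)
qed

lemma comb_cong:
  assumes "right_module R M" "\<And>i. i < k \<Longrightarrow> r i \<in> carrier R" "\<And>i. i < k \<Longrightarrow> x i \<in> carrier M"
    "\<And>i. i < k \<Longrightarrow> r' i = r i" "\<And>i. i < k \<Longrightarrow> x' i = x i"
  shows "comb M k r' x' = comb M k r x"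
proof -
  interpret M: right_module R M by fact
  show ?thesis
    unfolding comb_def using assms by (intro M.M.finsum_cong') (auto simp: M.right_smult_closed)
qed

lemma lin_comb:
  assumes "lin R M N f" "\<And>i. i < k \<Longrightarrow> r i \<in> carrier R" "\<And>i. i < k \<Longrightarrow> x i \<in> carrier M"
  shows "f (comb M k r x) = comb N k r (\<lambda>i. f (x i))"
  using assms(2,3)
proof (induction k)
  case 0
  then show ?case using assms(1) by (simp add: comb_0 lin_modules lin_zero)
next
  case (Suc k)
  interpret M: right_module R M using lin_modules[OF assms(1)] by auto
  have "f (comb M (Suc k) r x) = f (r k \<odot>\<^bsub>M\<^esub> x k \<oplus>\<^bsub>M\<^esub> comb M k r x)"
    using comb_Suc[OF lin_modules(1)[OF assms(1)], of k r x] Suc.prems by auto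
  also have "\<dots> = r k \<odot>\<^bsub>N\<^esub> f (x k) \<oplus>\<^bsub>N\<^esub> comb N k r (\<lambda>i. f (x i))"
    using Suc assms(1) comb_closed[OF lin_modules(1)[OF assms(1)], of k r x]
    by (simp add: lin_add lin_smult M.right_smult_closed)
  also have "\<dots> = comb N (Suc k) r (\<lambda>i. f (x i))"
    using comb_Suc[OF lin_modules(2)[OF assms(1)], of k r "\<lambda>i. f (x i)"] Suc.prems
      lin_closed[OF assms(1)] by auto
  finally show ?case .
qed

lemma comb_add:
  assumes "right_module R M" "\<And>i. i < k \<Longrightarrow> r i \<in> carrier R" "\<And>i. i < k \<Longrightarrow> s i \<in> carrier R"
    "\<And>i. i < k \<Longrightarrow> x i \<in> carrier M"
  shows "comb M k (\<lambda>i. r i \<oplus>\<^bsub>R\<^esub> s i) x = comb M k r x \<oplus>\<^bsub>M\<^esub> comb M k s x"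
proof -
  interpret M: right_module R M by fact
  show ?thesis using assms(2-)
  proof (induction k)
    case 0
    then show ?case by (simp add: comb_0 M.M.abelian_group_axioms)
  next
    case (Suc k)
    have c: "r k \<odot>\<^bsub>M\<^esub> x k \<in> carrier M" "s k \<odot>\<^bsub>M\<^esub> x k \<in> carrier M"
      "comb M k r x \<in> carrier M" "comb M k s x \<in> carrier M"
      using Suc.prems by (auto intro!: M.right_smult_closed comb_closed[OF assms(1)])
    have "comb M (Suc k) (\<lambda>i. r i \<oplus>\<^bsub>R\<^esub> s i) x =
        (r k \<oplus>\<^bsub>R\<^esub> s k) \<odot>\<^bsub>M\<^esub> x k \<oplus>\<^bsub>M\<^esub> comb M k (\<lambda>i. r i \<oplus>\<^bsub>R\<^esub> s i) x"
      by (rule comb_Suc[OF assms(1)]) (use Suc.prems in auto)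
    also have "\<dots> = (r k \<odot>\<^bsub>M\<^esub> x k \<oplus>\<^bsub>M\<^esub> s k \<odot>\<^bsub>M\<^esub> x k) \<oplus>\<^bsub>M\<^esub> (comb M k r x \<oplus>\<^bsub>M\<^esub> comb M k s x)"
      using Suc by (simp add: M.right_smult_distr_ring)
    also have "\<dots> = comb M (Suc k) r x \<oplus>\<^bsub>M\<^esub> comb M (Suc k) s x"
      using Suc.prems c by (simp add: comb_Suc[OF assms(1)] M.M.a_ac)
    finally show ?case .
  qed
qed

lemma comb_smult:
  assumes "right_module R M" "\<And>i. i < k \<Longrightarrow> r i \<in> carrier R" "a \<in> carrier R"
    "\<And>i. i < k \<Longrightarrow> x i \<in> carrier M"
  shows "comb M k (\<lambda>i. r i \<otimes>\<^bsub>R\<^esub> a) x = a \<odot>\<^bsub>M\<^esub> comb M k r x"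
proof -
  interpret M: right_module R M by fact
  show ?thesis using assms(2-)
  proof (induction k)
    case 0
    then show ?case by (simp add: comb_0 M.M.abelian_group_axioms)
  next
    case (Suc k)
    then show ?case
      using comb_closed[OF assms(1), of k r x]
      by (simp add: comb_Suc[OF assms(1)] M.right_smult_assoc M.right_smult_closed
          M.right_smult_distr_module)
  qed
qed

text \<open>Maps of this shape factor through the free module of rank \<open>k\<close>; with a dual
  basis in place of \<open>f\<close>, lifts out of a projective module are built in this
  way.\<close>

lemma lin_comb_map:
  assumes "right_module R P" "right_module R M"
    "\<And>i. i < k \<Longrightarrow> lin R P (regular_module R) (f i)" "\<And>i. i < k \<Longrightarrow> x i \<in> carrier M"
  shows "lin R P M (\<lambda>y. comb M k (\<lambda>i. f i y) x)"
proof (rule linI)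
  have c: "f i y \<in> carrier R" if "i < k" "y \<in> carrier P" for i y
    using lin_closed[OF assms(3)] that by auto
  show "comb M k (\<lambda>i. f i y) x \<in> carrier M" if "y \<in> carrier P" for y
    using comb_closed[OF assms(2)] c assms(4) that by auto
  fix y z assume yz: "y \<in> carrier P" "z \<in> carrier P"
  interpret P: right_module R P by fact
  have "comb M k (\<lambda>i. f i (y \<oplus>\<^bsub>P\<^esub> z)) x = comb M k (\<lambda>i. f i y \<oplus>\<^bsub>R\<^esub> f i z) x"
    by (rule comb_cong[OF assms(2)]) (use c assms(4) lin_add[OF assms(3)] yz in auto)
  then show "comb M k (\<lambda>i. f i (y \<oplus>\<^bsub>P\<^esub> z)) x = comb M k (\<lambda>i. f i y) x \<oplus>\<^bsub>M\<^esub> comb M k (\<lambda>i. f i z) x"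
    using comb_add[OF assms(2)] c assms(4) yz by simp
next
  fix a y assume ay: "a \<in> carrier R" "y \<in> carrier P"
  have c: "f i y \<in> carrier R" if "i < k" for i
    using lin_closed[OF assms(3)] that ay by auto
  interpret P: right_module R P by fact
  have "comb M k (\<lambda>i. f i (a \<odot>\<^bsub>P\<^esub> y)) x = comb M k (\<lambda>i. f i y \<otimes>\<^bsub>R\<^esub> a) x"
    by (rule comb_cong[OF assms(2)]) (use c assms(4) lin_smult[OF assms(3)] ay in auto)
  then show "comb M k (\<lambda>i. f i (a \<odot>\<^bsub>P\<^esub> y)) x = a \<odot>\<^bsub>M\<^esub> comb M k (\<lambda>i. f i y) x"
    using comb_smult[OF assms(2)] c assms(4) ay by simp
qed (use assms in auto)

lemma comb_append:
  assumes "right_module R M" "\<And>i. i < k \<Longrightarrow> r i \<in> carrier R" "\<And>i. i < k \<Longrightarrow> x i \<in> carrier M"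
    "\<And>i. i < l \<Longrightarrow> s i \<in> carrier R" "\<And>i. i < l \<Longrightarrow> y i \<in> carrier M"
  shows "comb M (k + l) (\<lambda>i. if i < k then r i else s (i - k)) (\<lambda>i. if i < k then x i else y (i - k)) =
    comb M k r x \<oplus>\<^bsub>M\<^esub> comb M l s y"
proof -
  interpret M: right_module R M by fact
  let ?r = "\<lambda>i. if i < k then r i else s (i - k)" and ?x = "\<lambda>i. if i < k then x i else y (i - k)"
  note c = comb_closed[OF assms(1), of k r x, OF assms(2,3)]
  show ?thesis using assms(4-)
  proof (induction l)
    case 0
    have "comb M k ?r ?x = comb M k r x"
      by (rule comb_cong[OF assms(1)]) (use assms(2,3) in auto)
    then show ?case
      using c by (simp add: comb_0 M.M.abelian_group_axioms)
  next
    case (Suc l)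
    have d: "s l \<odot>\<^bsub>M\<^esub> y l \<in> carrier M" "comb M l s y \<in> carrier M"
      using Suc.prems by (auto intro!: M.right_smult_closed comb_closed[OF assms(1)])
    have "comb M (Suc (k + l)) ?r ?x = ?r (k + l) \<odot>\<^bsub>M\<^esub> ?x (k + l) \<oplus>\<^bsub>M\<^esub> comb M (k + l) ?r ?x"
      by (rule comb_Suc[OF assms(1)]) (use Suc.prems assms(2,3) in auto)
    also have "\<dots> = s l \<odot>\<^bsub>M\<^esub> y l \<oplus>\<^bsub>M\<^esub> (comb M k r x \<oplus>\<^bsub>M\<^esub> comb M l s y)"
      using Suc by simp
    also have "\<dots> = comb M k r x \<oplus>\<^bsub>M\<^esub> (s l \<odot>\<^bsub>M\<^esub> y l \<oplus>\<^bsub>M\<^esub> comb M l s y)"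
      by (rule M.M.a_lcomm[OF d(1) c d(2)])
    also have "s l \<odot>\<^bsub>M\<^esub> y l \<oplus>\<^bsub>M\<^esub> comb M l s y = comb M (Suc l) s y"
      by (rule comb_Suc[OF assms(1), symmetric]) (use Suc.prems in auto)
    finally show ?case by simp
  qed
qed

lemma comb_zero:
  assumes "right_module R M" "\<And>i. i < k \<Longrightarrow> r i \<in> carrier R" "\<And>i. i < k \<Longrightarrow> x i \<in> carrier M"
    "\<And>i. i < k \<Longrightarrow> r i \<odot>\<^bsub>M\<^esub> x i = \<zero>\<^bsub>M\<^esub>"
  shows "comb M k r x = \<zero>\<^bsub>M\<^esub>"
proof -
  interpret M: right_module R M by fact
  show ?thesis using assms(2-)
    by (induction k) (auto simp: comb_0 M.M.abelian_group_axioms comb_Suc[OF assms(1)])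
qed

lemma comb_single:
  assumes "right_module R M" "\<And>i. i < k \<Longrightarrow> r i \<in> carrier R" "\<And>i. i < k \<Longrightarrow> x i \<in> carrier M"
    "j < k" "\<And>i. i < k \<Longrightarrow> i \<noteq> j \<Longrightarrow> r i \<odot>\<^bsub>M\<^esub> x i = \<zero>\<^bsub>M\<^esub>"
  shows "comb M k r x = r j \<odot>\<^bsub>M\<^esub> x j"
proof -
  interpret M: right_module R M by fact
  show ?thesis using assms(2-)
  proof (induction k)
    case (Suc k)
    show ?case
    proof (cases "j = k")
      case True
      have "comb M k r x = \<zero>\<^bsub>M\<^esub>"
        by (rule comb_zero[OF assms(1)]) (use Suc True in auto)
      then show ?thesis
        using True Suc by (simp add: comb_Suc[OF assms(1)] M.right_smult_closed)
    next
      case False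
      then have "comb M k r x = r j \<odot>\<^bsub>M\<^esub> x j" using Suc by auto
      then show ?thesis using Suc.prems False
        by (simp add: comb_Suc[OF assms(1)] M.right_smult_closed)
    qed
  qed auto
qed

section \<open>Finitely generated and projective modules\<close>

lemma free_module_simps [simp]:
  "carrier (free_module R k) = {..<k} \<rightarrow>\<^sub>E carrier R"
  "\<zero>\<^bsub>free_module R k\<^esub> = (\<lambda>i\<in>{..<k}. \<zero>\<^bsub>R\<^esub>)"
  "v \<oplus>\<^bsub>free_module R k\<^esub> w = (\<lambda>i\<in>{..<k}. v i \<oplus>\<^bsub>R\<^esub> w i)"
  "a \<odot>\<^bsub>free_module R k\<^esub> v = (\<lambda>i\<in>{..<k}. v i \<otimes>\<^bsub>R\<^esub> a)"
  by (simp_all add: free_module_def)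

lemma free_module_ext:
  assumes "v \<in> carrier (free_module R k)" "w \<in> carrier (free_module R k)"
    and "\<And>i. i < k \<Longrightarrow> v i = w i"
  shows "v = w"
  by (rule PiE_ext[of v "{..<k}" "\<lambda>_. carrier R"]) (use assms in auto)

lemma right_module_free:
  assumes "ring R"
  shows "right_module R (free_module R k)"
proof -
  interpret ring R by fact
  let ?F = "free_module R k"
  have c: "v i \<in> carrier R" if "v \<in> carrier ?F" "i < k" for v i
    using that by auto
  have ac: "v \<oplus>\<^bsub>?F\<^esub> w \<in> carrier ?F" if "v \<in> carrier ?F" "w \<in> carrier ?F" for v w
    using c that by simp
  have sc: "a \<odot>\<^bsub>?F\<^esub> v \<in> carrier ?F" if "a \<in> carrier R" "v \<in> carrier ?F" for a v
    using c that by simp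
  have zc: "\<zero>\<^bsub>?F\<^esub> \<in> carrier ?F" by simp
  show ?thesis
  proof (rule right_moduleI)
    show "abelian_group ?F"
    proof (rule abelian_groupI)
      fix x y z assume x: "x \<in> carrier ?F" and y: "y \<in> carrier ?F" and z: "z \<in> carrier ?F"
      show "x \<oplus>\<^bsub>?F\<^esub> y \<oplus>\<^bsub>?F\<^esub> z = x \<oplus>\<^bsub>?F\<^esub> (y \<oplus>\<^bsub>?F\<^esub> z)"
        by (rule free_module_ext[OF ac[OF ac[OF x y] z] ac[OF x ac[OF y z]]])
          (simp add: c[OF x] c[OF y] c[OF z] a_assoc)
      show "x \<oplus>\<^bsub>?F\<^esub> y = y \<oplus>\<^bsub>?F\<^esub> x"
        by (rule free_module_ext[OF ac[OF x y] ac[OF y x]]) (simp add: c[OF x] c[OF y] a_comm)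
      show "\<zero>\<^bsub>?F\<^esub> \<oplus>\<^bsub>?F\<^esub> x = x"
        by (rule free_module_ext[OF ac[OF zc x] x]) (simp add: c[OF x])
      have n: "(\<lambda>i\<in>{..<k}. \<ominus>\<^bsub>R\<^esub> x i) \<in> carrier ?F" using c[OF x] by simp
      show "\<exists>y\<in>carrier ?F. y \<oplus>\<^bsub>?F\<^esub> x = \<zero>\<^bsub>?F\<^esub>"
        by (rule bexI[OF _ n], rule free_module_ext[OF ac[OF n x] zc]) (simp add: c[OF x] l_neg)
    qed (use ac zc in blast)+
  next
    fix a b x assume a: "a \<in> carrier R" and b: "b \<in> carrier R" and x: "x \<in> carrier ?F"
    show "(a \<oplus>\<^bsub>R\<^esub> b) \<odot>\<^bsub>?F\<^esub> x = a \<odot>\<^bsub>?F\<^esub> x \<oplus>\<^bsub>?F\<^esub> b \<odot>\<^bsub>?F\<^esub> x"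
      by (rule free_module_ext[OF sc[OF a_closed[OF a b] x] ac[OF sc[OF a x] sc[OF b x]]])
        (simp add: a b c[OF x] r_distr)
    show "(a \<otimes>\<^bsub>R\<^esub> b) \<odot>\<^bsub>?F\<^esub> x = b \<odot>\<^bsub>?F\<^esub> (a \<odot>\<^bsub>?F\<^esub> x)"
      by (rule free_module_ext[OF sc[OF m_closed[OF a b] x] sc[OF b sc[OF a x]]])
        (simp add: a b c[OF x] m_assoc)
  next
    fix a x y assume a: "a \<in> carrier R" and x: "x \<in> carrier ?F" and y: "y \<in> carrier ?F"
    show "a \<odot>\<^bsub>?F\<^esub> (x \<oplus>\<^bsub>?F\<^esub> y) = a \<odot>\<^bsub>?F\<^esub> x \<oplus>\<^bsub>?F\<^esub> a \<odot>\<^bsub>?F\<^esub> y"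
      by (rule free_module_ext[OF sc[OF a ac[OF x y]] ac[OF sc[OF a x] sc[OF a y]]])
        (simp add: a c[OF x] c[OF y] l_distr)
  next
    fix x assume x: "x \<in> carrier ?F"
    show "\<one>\<^bsub>R\<^esub> \<odot>\<^bsub>?F\<^esub> x = x"
      by (rule free_module_ext[OF sc[OF one_closed x] x]) (simp add: c[OF x])
  qed (use assms sc in blast)+
qed

lemma lin_coordinate:
  assumes "ring R" "i < k"
  shows "lin R (free_module R k) (regular_module R) (\<lambda>v. v i)"
  using assms by (intro linI right_module_free right_module_regular) auto

lemma lin_to_free:
  assumes "right_module R P" "\<And>i. i < k \<Longrightarrow> lin R P (regular_module R) (f i)"
  shows "lin R P (free_module R k) (\<lambda>y. \<lambda>i\<in>{..<k}. f i y)"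
proof -
  interpret P: right_module R P by fact
  show ?thesis
    using assms P.R.ring_axioms
    by (intro linI right_module_free)
      (auto intro!: restrict_ext simp: lin_add[OF assms(2)] lin_smult[OF assms(2)]
        dest: lin_closed[OF assms(2)])
qed

lemma lin_from_free:
  assumes "right_module R M" "\<And>i. i < k \<Longrightarrow> x i \<in> carrier M"
  shows "lin R (free_module R k) M (\<lambda>v. comb M k v x)"
proof -
  interpret M: right_module R M by fact
  show ?thesis
    by (rule lin_comb_map[OF right_module_free assms(1)])
      (use lin_coordinate assms(2) M.R.ring_axioms in auto)
qed

definition unit_vec :: "('a, 'r) ring_scheme \<Rightarrow> nat \<Rightarrow> nat \<Rightarrow> nat \<Rightarrow> 'a" where
  "unit_vec R k i = (\<lambda>j\<in>{..<k}. if j = i then \<one>\<^bsub>R\<^esub> else \<zero>\<^bsub>R\<^esub>)"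

lemma unit_vec_closed: "ring R \<Longrightarrow> unit_vec R k i \<in> carrier (free_module R k)"
  by (auto simp: unit_vec_def ring.ring_simprules)

lemma comb_unit_vec:
  assumes "ring R" "v \<in> carrier (free_module R k)"
  shows "comb (free_module R k) k v (unit_vec R k) = v"
proof -
  interpret ring R by fact
  note F = right_module_free[OF assms(1), of k]
  have c: "v i \<in> carrier R" if "i < k" for i using assms(2) that by auto
  show ?thesis
  proof (rule PiE_ext)
    show "comb (free_module R k) k v (unit_vec R k) \<in> {..<k} \<rightarrow>\<^sub>E carrier R"
      using comb_closed[OF F, of k v "unit_vec R k"] c unit_vec_closed[OF assms(1)] by simp
    fix j assume "j \<in> {..<k}"
    then have j: "j < k" by simp
    have "comb (free_module R k) k v (unit_vec R k) j =
        comb (regular_module R) k v (\<lambda>i. unit_vec R k i j)"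
      by (rule lin_comb[OF lin_coordinate[OF assms(1) j]]) (use c unit_vec_closed[OF assms(1)] in auto)
    also have "\<dots> = v j \<odot>\<^bsub>regular_module R\<^esub> unit_vec R k j j"
      by (rule comb_single[OF right_module_regular[OF assms(1)]]) (use c j in \<open>auto simp: unit_vec_def\<close>)
    finally show "comb (free_module R k) k v (unit_vec R k) j = v j"
      using c j by (simp add: unit_vec_def)
  qed (use assms(2) in auto)
qed

lemma comb_of_unit_vec:
  assumes "right_module R M" "\<And>i. i < k \<Longrightarrow> x i \<in> carrier M" "j < k"
  shows "comb M k (unit_vec R k j) x = x j"
proof -
  interpret M: right_module R M by fact
  have "comb M k (unit_vec R k j) x = unit_vec R k j j \<odot>\<^bsub>M\<^esub> x j"
    by (rule comb_single[OF assms(1)]) (use assms(2,3) in \<open>auto simp: unit_vec_def\<close>)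
  then show ?thesis using assms(2,3) by (simp add: unit_vec_def M.right_smult_one)
qed

text \<open>The finite dual basis of a projective module: coordinates \<open>f i\<close> that
  reconstruct each element from the vectors \<open>x i\<close>. It turns a splitting off a free
  module into formulas for lifts and duals.\<close>

definition dual_basis ::
    "('a, 'r) ring_scheme \<Rightarrow> ('a, 'p) module \<Rightarrow> nat \<Rightarrow> (nat \<Rightarrow> 'p) \<Rightarrow> (nat \<Rightarrow> 'p \<Rightarrow> 'a) \<Rightarrow> bool" where
  "dual_basis R P k x f \<longleftrightarrow> (\<forall>i<k. x i \<in> carrier P) \<and> (\<forall>i<k. lin R P (regular_module R) (f i)) \<and>
     (\<forall>y\<in>carrier P. comb P k (\<lambda>i. f i y) x = y)"

text \<open>The coordinates of the section \<open>s\<close> are the functionals, and the images of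
  the unit vectors under the retraction \<open>p\<close> are the vectors; conversely the two
  families assemble to a section and a retraction.\<close>

lemma fg_projective_iff:
  "fg_projective R P \<longleftrightarrow> right_module R P \<and> (\<exists>k x f. dual_basis R P k x f)"
proof (intro iffI conjI; (elim conjE exE)?)
  assume P: "fg_projective R P"
  then show rP: "right_module R P" by (simp add: fg_projective_def)
  interpret P: right_module R P by fact
  note ring = P.R.ring_axioms
  from P obtain k s p where "s \<in> mod_hom R P (free_module R k)" "p \<in> mod_hom R (free_module R k) P"
    and ps: "\<And>x. x \<in> carrier P \<Longrightarrow> p (s x) = x" by (auto simp: fg_projective_def)
  then have s: "lin R P (free_module R k) s" and p: "lin R (free_module R k) P p"
    using rP right_module_free[OF ring] by (auto simp: lin_def)
  have sc: "s y i \<in> carrier R" if "y \<in> carrier P" "i < k" for y i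
    using lin_closed[OF s that(1)] that(2) by auto
  have "comb P k (\<lambda>i. s y i) (\<lambda>i. p (unit_vec R k i)) = y" if y: "y \<in> carrier P" for y
  proof -
    have "comb P k (s y) (\<lambda>i. p (unit_vec R k i)) = p (comb (free_module R k) k (s y) (unit_vec R k))"
      by (rule lin_comb[OF p, symmetric]) (use sc y unit_vec_closed[OF ring] in auto)
    then show ?thesis using comb_unit_vec[OF ring lin_closed[OF s y]] ps[OF y] by simp
  qed
  then have "dual_basis R P k (\<lambda>i. p (unit_vec R k i)) (\<lambda>i y. s y i)"
    using lin_closed[OF p] unit_vec_closed[OF ring] lin_comp[OF s lin_coordinate[OF ring]]
    by (auto simp: dual_basis_def)
  then show "\<exists>k x f. dual_basis R P k x f" by blast
next
  fix k x f assume rP: "right_module R P" and b: "dual_basis R P k x f"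
  then have f: "\<And>i. i < k \<Longrightarrow> lin R P (regular_module R) (f i)" and x: "\<And>i. i < k \<Longrightarrow> x i \<in> carrier P"
    by (auto simp: dual_basis_def)
  have "comb P k (\<lambda>i\<in>{..<k}. f i y) x = y" if "y \<in> carrier P" for y
    using comb_cong[OF rP, of k "\<lambda>i. f i y" x "\<lambda>i\<in>{..<k}. f i y" x] x lin_closed[OF f] that b
    by (auto simp: dual_basis_def)
  then show "fg_projective R P"
    unfolding fg_projective_def
    by (intro conjI rP exI[of _ k] bexI[OF _ lin_mod_hom[OF lin_to_free[OF rP f]]]
        bexI[OF _ lin_mod_hom[OF lin_from_free[OF rP x]]] ballI) simp_all
qed

lemma fg_projective_module: "fg_projective R P \<Longrightarrow> right_module R P"
  by (simp add: fg_projective_def)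

lemma fg_projective_free:
  assumes "ring R"
  shows "fg_projective R (free_module R k)"
  unfolding fg_projective_def
  by (intro conjI right_module_free[OF assms] exI[of _ k]
      bexI[OF _ lin_mod_hom[OF lin_id[OF right_module_free[OF assms]]]] ballI refl)

text \<open>Preimages are chosen only for the finitely many values \<open>f (x i)\<close> at a dual
  basis and then extended linearly, so the lift is linear by construction.\<close>

lemma projective_lift:
  assumes "fg_projective R P" "lin R P N f" "lin R L N g"
    "\<And>y. y \<in> carrier P \<Longrightarrow> f y \<in> g ` carrier L"
  shows "\<exists>f'. lin R P L f' \<and> (\<forall>y\<in>carrier P. g (f' y) = f y)"
proof -
  obtain k x \<phi> where rP: "right_module R P" and b: "dual_basis R P k x \<phi>"
    using assms(1) fg_projective_iff by blast
  then have \<phi>: "\<And>i. i < k \<Longrightarrow> lin R P (regular_module R) (\<phi> i)" and x: "\<And>i. i < k \<Longrightarrow> x i \<in> carrier P"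
    by (auto simp: dual_basis_def)
  have "\<exists>l. \<forall>i<k. l i \<in> carrier L \<and> g (l i) = f (x i)"
    using assms(4) x by (intro choice_iff[THEN iffD1] allI) (metis imageE)
  then obtain l where l: "\<And>i. i < k \<Longrightarrow> l i \<in> carrier L" "\<And>i. i < k \<Longrightarrow> g (l i) = f (x i)" by blast
  have "g (comb L k (\<lambda>i. \<phi> i y) l) = f y" if y: "y \<in> carrier P" for y
  proof -
    have c: "\<phi> i y \<in> carrier R" if "i < k" for i using lin_closed[OF \<phi>[OF that] y] by simp
    have "g (comb L k (\<lambda>i. \<phi> i y) l) = comb N k (\<lambda>i. \<phi> i y) (\<lambda>i. g (l i))"
      by (rule lin_comb[OF assms(3)]) (use c l in auto)
    also have "\<dots> = comb N k (\<lambda>i. \<phi> i y) (\<lambda>i. f (x i))"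
      by (rule comb_cong[OF lin_modules(2)[OF assms(2)]]) (use c l lin_closed[OF assms(2)] x in auto)
    also have "\<dots> = f (comb P k (\<lambda>i. \<phi> i y) x)"
      by (rule lin_comb[OF assms(2), symmetric]) (use c x in auto)
    finally show ?thesis using b y by (simp add: dual_basis_def)
  qed
  then show ?thesis
    using lin_comb_map[OF rP lin_modules(1)[OF assms(3)], of k \<phi> l] \<phi> l(1) by blast
qed

text \<open>The mapping cone needs a zero module of the same type as its other terms; it is cut out
  inside a given module.\<close>

lemma fg_projective_zero:
  assumes "right_module R M"
  shows "fg_projective R (M\<lparr>carrier := {\<zero>\<^bsub>M\<^esub>}\<rparr>)"
proof -
  interpret M: right_module R M by fact
  have "submodule {\<zero>\<^bsub>M\<^esub>} R M" by (rule M.submoduleI') auto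
  then have r: "right_module R (M\<lparr>carrier := {\<zero>\<^bsub>M\<^esub>}\<rparr>)"
    by (rule right_module_restrict[OF assms])
  then have "dual_basis R (M\<lparr>carrier := {\<zero>\<^bsub>M\<^esub>}\<rparr>) 0 x f" for x f
    by (auto simp: dual_basis_def comb_0 right_module_def)
  then show ?thesis using r fg_projective_iff by blast
qed

section \<open>Direct sums of two modules\<close>

definition prod_module :: "('a, 'm) module \<Rightarrow> ('a, 'n) module \<Rightarrow> ('a, 'm \<times> 'n) module" where
  "prod_module M N = \<lparr>carrier = carrier M \<times> carrier N, mult = undefined, one = undefined,
     zero = (\<zero>\<^bsub>M\<^esub>, \<zero>\<^bsub>N\<^esub>), add = (\<lambda>x y. (fst x \<oplus>\<^bsub>M\<^esub> fst y, snd x \<oplus>\<^bsub>N\<^esub> snd y)),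
     smult = (\<lambda>a x. (a \<odot>\<^bsub>M\<^esub> fst x, a \<odot>\<^bsub>N\<^esub> snd x))\<rparr>"

lemma prod_module_simps [simp]:
  "carrier (prod_module M N) = carrier M \<times> carrier N"
  "\<zero>\<^bsub>prod_module M N\<^esub> = (\<zero>\<^bsub>M\<^esub>, \<zero>\<^bsub>N\<^esub>)"
  "x \<oplus>\<^bsub>prod_module M N\<^esub> y = (fst x \<oplus>\<^bsub>M\<^esub> fst y, snd x \<oplus>\<^bsub>N\<^esub> snd y)"
  "a \<odot>\<^bsub>prod_module M N\<^esub> x = (a \<odot>\<^bsub>M\<^esub> fst x, a \<odot>\<^bsub>N\<^esub> snd x)"
  by (simp_all add: prod_module_def)

lemma right_module_prod:
  assumes "right_module R M" "right_module R N"
  shows "right_module R (prod_module M N)"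
proof -
  interpret M: right_module R M by fact
  interpret N: right_module R N by fact
  show ?thesis
  proof (rule right_moduleI)
    show "abelian_group (prod_module M N)"
    proof (rule abelian_groupI)
      show "\<exists>y\<in>carrier (prod_module M N). y \<oplus>\<^bsub>prod_module M N\<^esub> x = \<zero>\<^bsub>prod_module M N\<^esub>"
        if "x \<in> carrier (prod_module M N)" for x
        by (rule bexI[of _ "(\<ominus>\<^bsub>M\<^esub> fst x, \<ominus>\<^bsub>N\<^esub> snd x)"])
          (use that in \<open>auto simp: M.M.l_neg N.M.l_neg\<close>)
    qed (auto simp: M.M.a_ac N.M.a_ac)
  qed (auto simp: M.R.ring_axioms M.right_smult_closed N.right_smult_closed M.right_smult_distr_ring
      N.right_smult_distr_ring M.right_smult_distr_module N.right_smult_distr_module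
      M.right_smult_assoc N.right_smult_assoc M.right_smult_one N.right_smult_one)
qed

lemma lin_prod:
  assumes "right_module R M" "right_module R N"
  shows "lin R (prod_module M N) M fst" "lin R (prod_module M N) N snd"
    and "lin R M (prod_module M N) (\<lambda>x. (x, \<zero>\<^bsub>N\<^esub>))" "lin R N (prod_module M N) (\<lambda>y. (\<zero>\<^bsub>M\<^esub>, y))"
proof -
  interpret M: right_module R M by fact
  interpret N: right_module R N by fact
  show "lin R (prod_module M N) M fst" "lin R (prod_module M N) N snd"
    and "lin R M (prod_module M N) (\<lambda>x. (x, \<zero>\<^bsub>N\<^esub>))" "lin R N (prod_module M N) (\<lambda>y. (\<zero>\<^bsub>M\<^esub>, y))"
    using assms by (auto intro!: linI right_module_prod)
qed

lemma lin_pair: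
  assumes "lin R L M f" "lin R L N g"
  shows "lin R L (prod_module M N) (\<lambda>x. (f x, g x))"
  using assms by (intro linI) (auto simp: lin_modules right_module_prod lin_closed lin_add lin_smult)

text \<open>The dual bases of the summands are put one after the other, each functional being
  composed with its projection.\<close>

lemma fg_projective_prod:
  assumes "fg_projective R M" "fg_projective R N"
  shows "fg_projective R (prod_module M N)"
proof -
  obtain k x f where rM: "right_module R M" and b: "dual_basis R M k x f"
    using assms(1) fg_projective_iff by blast
  obtain l y g where rN: "right_module R N" and b': "dual_basis R N l y g"
    using assms(2) fg_projective_iff by blast
  interpret M: right_module R M by fact
  interpret N: right_module R N by fact
  let ?P = "prod_module M N"
  note P = right_module_prod[OF rM rN] and pr = lin_prod[OF rM rN]
  have xc: "\<And>i. i < k \<Longrightarrow> x i \<in> carrier M" and yc: "\<And>i. i < l \<Longrightarrow> y i \<in> carrier N"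
    and fl: "\<And>i. i < k \<Longrightarrow> lin R M (regular_module R) (f i)"
    and gl: "\<And>i. i < l \<Longrightarrow> lin R N (regular_module R) (g i)"
    using b b' by (auto simp: dual_basis_def)
  have fc: "f i u \<in> carrier R" if "i < k" "u \<in> carrier M" for i u
    using lin_closed[OF fl[OF that(1)] that(2)] by simp
  have gc: "g i u \<in> carrier R" if "i < l" "u \<in> carrier N" for i u
    using lin_closed[OF gl[OF that(1)] that(2)] by simp
  let ?x = "\<lambda>i. if i < k then (x i, \<zero>\<^bsub>N\<^esub>) else (\<zero>\<^bsub>M\<^esub>, y (i - k))"
  let ?f = "\<lambda>i z. if i < k then f i (fst z) else g (i - k) (snd z)"
  have "comb ?P (k + l) (\<lambda>i. ?f i z) ?x = z" if z: "z \<in> carrier ?P" for z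
  proof -
    have "comb ?P (k + l) (\<lambda>i. ?f i z) ?x =
        comb ?P k (\<lambda>i. f i (fst z)) (\<lambda>i. (x i, \<zero>\<^bsub>N\<^esub>)) \<oplus>\<^bsub>?P\<^esub> comb ?P l (\<lambda>i. g i (snd z)) (\<lambda>i. (\<zero>\<^bsub>M\<^esub>, y i))"
      by (rule comb_append[OF P]) (use z fc gc xc yc in auto)
    also have "comb ?P k (\<lambda>i. f i (fst z)) (\<lambda>i. (x i, \<zero>\<^bsub>N\<^esub>)) = (comb M k (\<lambda>i. f i (fst z)) x, \<zero>\<^bsub>N\<^esub>)"
      by (rule lin_comb[OF pr(3), symmetric]) (use z fc xc in auto)
    also have "comb M k (\<lambda>i. f i (fst z)) x = fst z" using b z by (auto simp: dual_basis_def)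
    also have "comb ?P l (\<lambda>i. g i (snd z)) (\<lambda>i. (\<zero>\<^bsub>M\<^esub>, y i)) = (\<zero>\<^bsub>M\<^esub>, comb N l (\<lambda>i. g i (snd z)) y)"
      by (rule lin_comb[OF pr(4), symmetric]) (use z gc yc in auto)
    also have "comb N l (\<lambda>i. g i (snd z)) y = snd z" using b' z by (auto simp: dual_basis_def)
    finally show ?thesis using z by auto
  qed
  moreover have "lin R ?P (regular_module R) (?f i)" if "i < k + l" for i
    using that lin_comp[OF pr(1) fl] lin_comp[OF pr(2) gl] by (cases "i < k") auto
  ultimately have "dual_basis R ?P (k + l) ?x ?f"
    using xc yc by (auto simp: dual_basis_def)
  then show ?thesis using P fg_projective_iff by blast
qed

subsection \<open>Noetherian rings\<close>

text \<open>Generation by explicit combinations passes easily to images and extensions. The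
  description by an intersection of submodules is converted once, in
  \<open>fin_gen_imp_fgen\<close>.\<close>

definition fgen :: "('a, 'r) ring_scheme \<Rightarrow> ('a, 'm) module \<Rightarrow> bool" where
  "fgen R M \<longleftrightarrow> right_module R M \<and> (\<exists>k x. (\<forall>i<k. x i \<in> carrier M) \<and>
     (\<forall>y\<in>carrier M. \<exists>r. (\<forall>i<k. r i \<in> carrier R) \<and> y = comb M k r x))"

lemma fgenI:
  assumes "right_module R M" "\<And>i. i < k \<Longrightarrow> x i \<in> carrier M"
    "\<And>y. y \<in> carrier M \<Longrightarrow> \<exists>r. (\<forall>i<k. r i \<in> carrier R) \<and> y = comb M k r x"
  shows "fgen R M"
  using assms unfolding fgen_def by blast

lemma fgen_module: "fgen R M \<Longrightarrow> right_module R M"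
  by (simp add: fgen_def)

lemma fgenE:
  assumes "fgen R M"
  obtains k e where "lin R (free_module R k) M e" "e ` carrier (free_module R k) = carrier M"
proof -
  from assms obtain k x where M: "right_module R M" and x: "\<And>i. i < k \<Longrightarrow> x i \<in> carrier M"
    and g: "\<And>y. y \<in> carrier M \<Longrightarrow> \<exists>r. (\<forall>i<k. r i \<in> carrier R) \<and> y = comb M k r x"
    unfolding fgen_def by blast
  note e = lin_from_free[of R M k x, OF M x]
  have "carrier M \<subseteq> (\<lambda>v. comb M k v x) ` carrier (free_module R k)"
  proof
    fix y assume "y \<in> carrier M"
    then obtain r where r: "\<And>i. i < k \<Longrightarrow> r i \<in> carrier R" "y = comb M k r x" using g by blast
    have "comb M k (\<lambda>i\<in>{..<k}. r i) x = comb M k r x"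
      by (rule comb_cong[OF M]) (use r x in auto)
    then show "y \<in> (\<lambda>v. comb M k v x) ` carrier (free_module R k)"
      using r by (intro image_eqI[of _ _ "\<lambda>i\<in>{..<k}. r i"]) auto
  qed
  then have "(\<lambda>v. comb M k v x) ` carrier (free_module R k) = carrier M"
    using lin_closed[OF e] by blast
  with e show ?thesis by (rule that)
qed

lemma fgen_image:
  assumes "fgen R M" "lin R M N f" "f ` carrier M = carrier N"
  shows "fgen R N"
proof -
  from assms(1) obtain k x where M: "right_module R M" and x: "\<And>i. i < k \<Longrightarrow> x i \<in> carrier M"
    and g: "\<And>y. y \<in> carrier M \<Longrightarrow> \<exists>r. (\<forall>i<k. r i \<in> carrier R) \<and> y = comb M k r x"
    unfolding fgen_def by blast
  show ?thesis
  proof (rule fgenI)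
    fix z assume "z \<in> carrier N"
    then obtain y where y: "y \<in> carrier M" "z = f y" using assms(3) by auto
    then obtain r where r: "\<And>i. i < k \<Longrightarrow> r i \<in> carrier R" "y = comb M k r x" using g by blast
    then show "\<exists>r. (\<forall>i<k. r i \<in> carrier R) \<and> z = comb N k r (\<lambda>i. f (x i))"
      using lin_comb[OF assms(2), of k r x] x y by auto
  qed (use x in \<open>auto simp: lin_modules(2)[OF assms(2)] lin_closed[OF assms(2)]\<close>)
qed

lemma fgen_free:
  assumes "ring R"
  shows "fgen R (free_module R k)"
proof (rule fgenI)
  fix y assume y: "y \<in> carrier (free_module R k)"
  then show "\<exists>r. (\<forall>i<k. r i \<in> carrier R) \<and> y = comb (free_module R k) k r (unit_vec R k)"
    by (intro exI[of _ y]) (use comb_unit_vec[OF assms y] in auto)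
qed (use assms right_module_free unit_vec_closed in blast)+

lemma fgen_projective:
  assumes "fg_projective R P"
  shows "fgen R P"
proof -
  obtain k x f where b: "dual_basis R P k x f" using assms fg_projective_iff by blast
  show ?thesis
  proof (rule fgenI[OF fg_projective_module[OF assms]])
    show "x i \<in> carrier P" if "i < k" for i using b that by (simp add: dual_basis_def)
    show "\<exists>r. (\<forall>i<k. r i \<in> carrier R) \<and> y = comb P k r x" if y: "y \<in> carrier P" for y
    proof (intro exI conjI allI impI)
      show "f i y \<in> carrier R" if "i < k" for i
        using b that y lin_closed[of R P "regular_module R" "f i" y] by (simp add: dual_basis_def)
      show "y = comb P k (\<lambda>i. f i y) x" using b y by (simp add: dual_basis_def)
    qed
  qed
qed

lemma fin_gen_imp_fgen:
  fixes M :: "('a, 'm) module"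
  assumes "right_module R M" "fin_gen R M"
  shows "fgen R M"
proof -
  interpret M: right_module R M by fact
  obtain A where A: "A \<subseteq> carrier M" "finite A" "carrier M = \<Inter>{H. submodule H R M \<and> A \<subseteq> H}"
    using assms(2) by (auto simp: fin_gen_def)
  obtain k and x :: "nat \<Rightarrow> 'm" where x: "A = x ` {i. i < k}"
    using finite_imp_nat_seg_image_inj_on[OF A(2)] by metis
  then have xc: "\<And>i. i < k \<Longrightarrow> x i \<in> carrier M" using A by auto
  note e = lin_from_free[of R M k x, OF assms(1) xc]
  let ?I = "(\<lambda>v. comb M k v x) ` carrier (free_module R k)"
  have "x i \<in> ?I" if "i < k" for i
    using comb_of_unit_vec[OF assms(1), of k x i] xc that unit_vec_closed[OF M.R.ring_axioms, of k i]
    by (metis image_eqI)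
  \<comment> \<open>The image of the free module is one of the submodules in the intersection that
    defines \<open>fin_gen\<close>.\<close>
  then have "carrier M \<subseteq> ?I" using A(3) submodule_image[OF e] x by auto
  then have "carrier M = ?I" using lin_closed[OF e] by auto
  then show ?thesis using fgen_image[OF fgen_free[OF M.R.ring_axioms] e] by simp
qed

lemma lin_inclusion:
  assumes "right_module R M" "submodule H R M"
  shows "lin R (M\<lparr>carrier := H\<rparr>) M (\<lambda>x. x)"
  using lin_restrict_dom[OF lin_id[OF assms(1)] assms(2)] .

text \<open>Lifts of generators of the image together with generators of the kernel suffice:
  subtracting a combination of the former moves any element into the kernel.\<close>

lemma fgen_extension:
  assumes f: "lin R M N f"
    and im: "fgen R (N\<lparr>carrier := f ` carrier M\<rparr>)"
    and ker: "fgen R (M\<lparr>carrier := {x \<in> carrier M. f x = \<zero>\<^bsub>N\<^esub>}\<rparr>)" (is "fgen R ?K")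
  shows "fgen R M"
proof -
  note M = lin_modules(1)[OF f] and N = lin_modules(2)[OF f]
  interpret M: right_module R M by (rule M)
  interpret N: right_module R N by (rule N)
  let ?I = "N\<lparr>carrier := f ` carrier M\<rparr>"
  note iI = lin_inclusion[OF N submodule_image[OF f]]
  note iK = lin_inclusion[OF M submodule_kernel[OF f]]
  from im obtain k x' where x': "\<And>i. i < k \<Longrightarrow> x' i \<in> carrier ?I"
    and g: "\<And>y. y \<in> carrier ?I \<Longrightarrow> \<exists>r. (\<forall>i<k. r i \<in> carrier R) \<and> y = comb ?I k r x'"
    unfolding fgen_def by blast
  have "\<exists>x. \<forall>i<k. x i \<in> carrier M \<and> f (x i) = x' i"
    using x' by (intro choice_iff[THEN iffD1] allI) fastforce
  then obtain x where x: "\<And>i. i < k \<Longrightarrow> x i \<in> carrier M" "\<And>i. i < k \<Longrightarrow> f (x i) = x' i" by blast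
  from ker obtain l z where z: "\<And>i. i < l \<Longrightarrow> z i \<in> carrier ?K"
    and h: "\<And>y. y \<in> carrier ?K \<Longrightarrow> \<exists>r. (\<forall>i<l. r i \<in> carrier R) \<and> y = comb ?K l r z"
    unfolding fgen_def by blast
  show ?thesis
  proof (rule fgenI[OF M, of "k + l" "\<lambda>i. if i < k then x i else z (i - k)"])
    show "(if i < k then x i else z (i - k)) \<in> carrier M" if "i < k + l" for i
      using that x z[of "i - k"] by auto
    fix y assume y: "y \<in> carrier M"
    then have "f y \<in> carrier ?I" by simp
    then obtain r where r: "\<And>i. i < k \<Longrightarrow> r i \<in> carrier R" "f y = comb ?I k r x'" using g by blast
    have c: "comb M k r x \<in> carrier M" by (rule comb_closed[OF M]) (use r(1) x(1) in auto)
    have "f y = comb N k r x'"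
      unfolding r(2) by (rule lin_comb[OF iI, of k r x']) (use r(1) x' in auto)
    also have "\<dots> = comb N k r (\<lambda>i. f (x i))"
      by (rule comb_cong[OF N]) (use r x(1) lin_closed[OF f] in \<open>auto simp: x(2)[symmetric]\<close>)
    also have "\<dots> = f (comb M k r x)"
      by (rule lin_comb[OF f, symmetric]) (use r(1) x(1) in auto)
    finally have "f (y \<ominus>\<^bsub>M\<^esub> comb M k r x) = \<zero>\<^bsub>N\<^esub>"
      using lin_minus[OF f y c] lin_closed[OF f c] by (simp add: N.M.r_neg a_minus_def)
    then have "y \<ominus>\<^bsub>M\<^esub> comb M k r x \<in> carrier ?K" using y c by simp
    then obtain s where s: "\<And>i. i < l \<Longrightarrow> s i \<in> carrier R" "y \<ominus>\<^bsub>M\<^esub> comb M k r x = comb ?K l s z"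
      using h by blast
    then have s': "y \<ominus>\<^bsub>M\<^esub> comb M k r x = comb M l s z"
      using lin_comb[OF iK, of l s z, OF s(1) z] by simp
    have "y = comb M k r x \<oplus>\<^bsub>M\<^esub> (y \<ominus>\<^bsub>M\<^esub> comb M k r x)"
      using y c by (simp add: a_minus_def M.M.a_lcomm M.M.r_neg)
    also have "\<dots> = comb M (k + l) (\<lambda>i. if i < k then r i else s (i - k))
        (\<lambda>i. if i < k then x i else z (i - k))"
      unfolding s' by (rule comb_append[OF M, symmetric]) (use r(1) x(1) s(1) z in auto)
    finally show "\<exists>r. (\<forall>i<k + l. r i \<in> carrier R) \<and>
        y = comb M (k + l) r (\<lambda>i. if i < k then x i else z (i - k))"
      using r(1) s(1) by (intro exI[of _ "\<lambda>i. if i < k then r i else s (i - k)"]) auto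
  qed
qed

text \<open>Induction on the rank. The last coordinates of \<open>H\<close> form a right ideal,
  which is finitely generated, and the vectors of \<open>H\<close> with last coordinate zero come
  from a submodule of the free module of rank \<open>k\<close>.\<close>

lemma noetherian_free:
  assumes "ring R" "right_noetherian R" "submodule H R (free_module R k)"
  shows "fgen R ((free_module R k)\<lparr>carrier := H\<rparr>)"
  using assms(3)
proof (induction k arbitrary: H)
  case 0
  note sub = submoduleD[OF "0"]
  let ?M = "(free_module R 0)\<lparr>carrier := H\<rparr>"
  note M = right_module_restrict[OF right_module_free[OF assms(1)] "0"]
  show ?case
    by (rule fgenI[OF M, of 0]) (use sub(1) M in \<open>auto simp: comb_0 right_module_def restrict_def\<close>)
next
  case (Suc k)
  interpret ring R by fact
  note sub = submoduleD[OF Suc.prems]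
  let ?F = "free_module R (Suc k)" and ?F' = "free_module R k"
  let ?M = "?F\<lparr>carrier := H\<rparr>"
  note F = right_module_free[OF assms(1), of "Suc k"] and F' = right_module_free[OF assms(1), of k]
  note M = right_module_restrict[OF F Suc.prems]
  interpret F': right_module R ?F' by fact
  have p: "lin R ?M (regular_module R) (\<lambda>v. v k)"
    by (rule lin_restrict_dom[OF lin_coordinate Suc.prems]) (auto simp: assms)
  \<comment> \<open>Vectors of different rank are functions with different domains, so the passage
    from rank \<open>k\<close> to rank \<open>Suc k\<close> is an explicit extension by
    zero.\<close>
  define e where "e = (\<lambda>w. \<lambda>i\<in>{..<Suc k}. if i < k then w i else \<zero>\<^bsub>R\<^esub>)"
  have e: "lin R ?F' ?F e"
    unfolding e_def
  proof (rule lin_to_free[OF F'])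
    show "lin R ?F' (regular_module R) (\<lambda>w. if i < k then w i else \<zero>\<^bsub>R\<^esub>)" for i
      using lin_coordinate[OF assms(1), of i k] lin_const_zero[OF F' right_module_regular[OF assms(1)]]
      by (cases "i < k") auto
  qed
  let ?H' = "{w \<in> carrier ?F'. e w \<in> H}"
  have H': "submodule ?H' R ?F'"
  proof (rule F'.submoduleI')
    show "\<zero>\<^bsub>?F'\<^esub> \<in> ?H'" using lin_zero[OF e] sub(2) F'.M.zero_closed by simp
    show "x \<oplus>\<^bsub>?F'\<^esub> y \<in> ?H'" if "x \<in> ?H'" "y \<in> ?H'" for x y
      using that lin_add[OF e, of x y] sub(3)[of "e x" "e y"] F'.M.a_closed[of x y] by simp
    show "a \<odot>\<^bsub>?F'\<^esub> x \<in> ?H'" if "a \<in> carrier R" "x \<in> ?H'" for a x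
      using that lin_smult[OF e, of a x] sub(4)[of a "e x"] F'.right_smult_closed[of a x] by simp
  qed auto
  let ?K = "{v \<in> carrier ?M. v k = \<zero>\<^bsub>regular_module R\<^esub>}"
  have sK: "submodule ?K R ?M" by (rule submodule_kernel[OF p])
  have eK: "e w \<in> ?K" if "w \<in> ?H'" for w using that by (auto simp: e_def)
  have "v \<in> e ` ?H'" if v: "v \<in> ?K" for v
  proof -
    have "v \<in> H" and vk: "v k = \<zero>\<^bsub>R\<^esub>" using v by simp_all
    then have vF: "v \<in> carrier ?F" using sub(1) by blast
    have vF': "restrict v {..<k} \<in> carrier ?F'" using vF by (simp add: PiE_iff)
    have e': "e (restrict v {..<k}) = v"
    proof (rule free_module_ext[of _ R "Suc k"])
      show "e (restrict v {..<k}) i = v i" if "i < Suc k" for i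
        using that vk by (cases "i = k") (simp_all add: e_def)
    qed (fact lin_closed[OF e vF'], fact vF)
    have "restrict v {..<k} \<in> ?H'" using e' \<open>v \<in> H\<close> vF' by simp
    then have "e (restrict v {..<k}) \<in> e ` ?H'" by (rule imageI)
    then show ?thesis by (simp only: e')
  qed
  then have im: "e ` ?H' = ?K" using eK by blast
  have "lin R (?F'\<lparr>carrier := ?H'\<rparr>) (?M\<lparr>carrier := ?K\<rparr>) e"
  proof (rule lin_restrict_cod[OF _ sK])
    show "lin R (?F'\<lparr>carrier := ?H'\<rparr>) ?M e"
      by (rule lin_restrict_cod[OF lin_restrict_dom[OF e H'] Suc.prems]) auto
  qed (use eK in auto)
  then have "fgen R (?M\<lparr>carrier := ?K\<rparr>)"
    by (rule fgen_image[OF Suc.IH[OF H']]) (use im in simp)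
  moreover have "fgen R ((regular_module R)\<lparr>carrier := (\<lambda>v. v k) ` carrier ?M\<rparr>)"
  proof (rule fin_gen_imp_fgen)
    show "right_module R ((regular_module R)\<lparr>carrier := (\<lambda>v. v k) ` carrier ?M\<rparr>)"
      by (rule right_module_restrict[OF right_module_regular[OF assms(1)] submodule_image[OF p]])
    show "fin_gen R ((regular_module R)\<lparr>carrier := (\<lambda>v. v k) ` carrier ?M\<rparr>)"
      using assms(2) submodule_image[OF p] by (simp add: right_noetherian_def)
  qed
  ultimately show ?case by (intro fgen_extension[OF p])
qed

text \<open>The section embeds \<open>H\<close> in a free module, and the retraction maps its image
  back onto \<open>H\<close>.\<close>

lemma noetherian_projective:
  assumes "right_noetherian R" "fg_projective R P" "submodule H R P"
  shows "fgen R (P\<lparr>carrier := H\<rparr>)"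
proof -
  note rP = fg_projective_module[OF assms(2)]
  interpret P: right_module R P by fact
  note ring = P.R.ring_axioms
  from assms(2) obtain k s p where "s \<in> mod_hom R P (free_module R k)" "p \<in> mod_hom R (free_module R k) P"
    and ps: "\<And>x. x \<in> carrier P \<Longrightarrow> p (s x) = x" by (auto simp: fg_projective_def)
  then have s: "lin R P (free_module R k) s" and p: "lin R (free_module R k) P p"
    using rP right_module_free[OF ring] by (auto simp: lin_def)
  have ps': "p (s x) = x" if "x \<in> H" for x using ps submoduleD(1)[OF assms(3)] that by auto
  note sH = submodule_image_of_submodule[OF s assms(3)]
  have "lin R ((free_module R k)\<lparr>carrier := s ` H\<rparr>) (P\<lparr>carrier := H\<rparr>) p"
    by (rule lin_restrict_cod[OF lin_restrict_dom[OF p sH] assms(3)]) (auto simp: ps')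
  moreover have "p ` (s ` H) = H"
    using ps' by (force simp: image_iff)
  ultimately show ?thesis
    by (intro fgen_image[OF noetherian_free[OF ring assms(1) sH]]) auto
qed

lemma noetherian_kernel:
  assumes "right_noetherian R" "fg_projective R P" "lin R P N f"
  shows "fgen R (P\<lparr>carrier := {x \<in> carrier P. f x = \<zero>\<^bsub>N\<^esub>}\<rparr>)"
  by (rule noetherian_projective[OF assms(1,2) submodule_kernel[OF assms(3)]])

section \<open>Complexes and their cohomology\<close>

definition proj_complex ::
    "('a, 'r) ring_scheme \<Rightarrow> (nat \<Rightarrow> ('a, 'p) module) \<Rightarrow> (nat \<Rightarrow> 'p \<Rightarrow> 'p) \<Rightarrow> bool" where
  "proj_complex R C d \<longleftrightarrow> (\<forall>i. fg_projective R (C i)) \<and> (\<forall>i. lin R (C (Suc i)) (C i) (d (Suc i))) \<and>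
     (\<forall>i. \<forall>x\<in>carrier (C (Suc (Suc i))). d (Suc i) (d (Suc (Suc i)) x) = \<zero>\<^bsub>C i\<^esub>)"

text \<open>Exactness starts in degree one, so such a complex resolves the cokernel of
  \<open>d 1\<close>; that module stays implicit, which suits complexes that only serve to compute
  cohomology.\<close>

definition acyclic_complex ::
    "('a, 'r) ring_scheme \<Rightarrow> (nat \<Rightarrow> ('a, 'p) module) \<Rightarrow> (nat \<Rightarrow> 'p \<Rightarrow> 'p) \<Rightarrow> bool" where
  "acyclic_complex R C d \<longleftrightarrow> proj_complex R C d \<and>
     (\<forall>i. \<forall>x\<in>carrier (C (Suc i)). d (Suc i) x = \<zero>\<^bsub>C i\<^esub> \<longrightarrow> x \<in> d (Suc (Suc i)) ` carrier (C (Suc (Suc i))))"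

lemma acyclic_proj: "acyclic_complex R C d \<Longrightarrow> proj_complex R C d"
  by (simp add: acyclic_complex_def)

lemma proj_complexD:
  assumes "proj_complex R C d"
  shows "fg_projective R (C i)" "right_module R (C i)" "lin R (C (Suc i)) (C i) (d (Suc i))"
    "x \<in> carrier (C (Suc (Suc i))) \<Longrightarrow> d (Suc i) (d (Suc (Suc i)) x) = \<zero>\<^bsub>C i\<^esub>"
  using assms fg_projective_module[of R "C i"] unfolding proj_complex_def by simp_all

lemma acyclic_exact:
  "acyclic_complex R C d \<Longrightarrow> x \<in> carrier (C (Suc i)) \<Longrightarrow> d (Suc i) x = \<zero>\<^bsub>C i\<^esub> \<Longrightarrow>
    x \<in> d (Suc (Suc i)) ` carrier (C (Suc (Suc i)))"
  by (simp add: acyclic_complex_def)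

section \<open>Chain maps, their extension, and homotopies\<close>

definition chain_map ::
    "('a, 'r) ring_scheme \<Rightarrow> (nat \<Rightarrow> ('a, 'p) module) \<Rightarrow> (nat \<Rightarrow> 'p \<Rightarrow> 'p) \<Rightarrow>
     (nat \<Rightarrow> ('a, 'q) module) \<Rightarrow> (nat \<Rightarrow> 'q \<Rightarrow> 'q) \<Rightarrow> (nat \<Rightarrow> 'p \<Rightarrow> 'q) \<Rightarrow> bool" where
  "chain_map R C d C' d' F \<longleftrightarrow> (\<forall>i. lin R (C i) (C' i) (F i)) \<and>
     (\<forall>i. \<forall>x\<in>carrier (C (Suc i)). d' (Suc i) (F (Suc i) x) = F i (d (Suc i) x))"

lemma chain_mapD:
  assumes "chain_map R C d C' d' F"
  shows "lin R (C i) (C' i) (F i)"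
    "x \<in> carrier (C (Suc i)) \<Longrightarrow> d' (Suc i) (F (Suc i) x) = F i (d (Suc i) x)"
  using assms by (simp_all add: chain_map_def)

lemma chain_map_comp:
  assumes "chain_map R C d C' d' F" "chain_map R C' d' C'' d'' G"
  shows "chain_map R C d C'' d'' (\<lambda>i x. G i (F i x))"
  unfolding chain_map_def
  using lin_comp[OF chain_mapD(1)[OF assms(1)] chain_mapD(1)[OF assms(2)]]
    chain_mapD(2)[OF assms(1)] chain_mapD(2)[OF assms(2)] lin_closed[OF chain_mapD(1)[OF assms(1)]]
  by simp

lemma chain_map_id:
  assumes "proj_complex R C d"
  shows "chain_map R C d C d (\<lambda>i x. x)"
  using assms by (simp add: chain_map_def lin_id proj_complexD)

lemma chain_map_diff:
  assumes "chain_map R C d C' d' F" "chain_map R C d C' d' G" "proj_complex R C d" "proj_complex R C' d'"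
  shows "chain_map R C d C' d' (\<lambda>i x. F i x \<ominus>\<^bsub>C' i\<^esub> G i x)"
proof -
  note F = chain_mapD[OF assms(1)] and G = chain_mapD[OF assms(2)]
  have "d' (Suc i) (F (Suc i) x \<ominus>\<^bsub>C' (Suc i)\<^esub> G (Suc i) x) = F i (d (Suc i) x) \<ominus>\<^bsub>C' i\<^esub> G i (d (Suc i) x)"
    if "x \<in> carrier (C (Suc i))" for i x
    using that by (simp add: lin_minus[OF proj_complexD(3)[OF assms(4)]] lin_closed[OF F(1)]
        lin_closed[OF G(1)] F(2) G(2))
  then show ?thesis
    using lin_diff[OF F(1) G(1)] by (simp add: chain_map_def)
qed

text \<open>The comparison theorem, by projectivity of the source and exactness of the target. That
  \<open>f\<close> sends boundaries to boundaries takes the place of a map between the resolved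
  modules.\<close>

lemma chain_map_extend:
  assumes C: "proj_complex R C d" and C': "acyclic_complex R C' d'" and f: "lin R (C 0) (C' 0) f"
    and fd: "\<And>x. x \<in> carrier (C 1) \<Longrightarrow> f (d 1 x) \<in> d' 1 ` carrier (C' 1)"
  shows "\<exists>F. chain_map R C d C' d' F \<and> F 0 = f"
proof -
  note D = proj_complexD[OF C] and D' = proj_complexD[OF acyclic_proj[OF C']]
  \<comment> \<open>\<open>P\<close> carries what the next lift requires, namely that boundaries are
    sent into boundaries; \<open>Q\<close> is the commuting square between neighbouring
    degrees.\<close>
  define P where "P n g \<longleftrightarrow> (n = 0 \<longrightarrow> g = f) \<and> lin R (C n) (C' n) g \<and>
    (\<forall>x\<in>carrier (C (Suc n)). g (d (Suc n) x) \<in> d' (Suc n) ` carrier (C' (Suc n)))" for n g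
  define Q where "Q n g h \<longleftrightarrow> (\<forall>x\<in>carrier (C (Suc n)). d' (Suc n) (h x) = g (d (Suc n) x))" for n g h
  have "\<exists>F. \<forall>n. P n (F n) \<and> Q n (F n) (F (Suc n))"
  proof (rule dependent_nat_choice)
    show "\<exists>g. P 0 g" using f fd by (intro exI[of _ f]) (simp add: P_def)
    fix g n assume g: "P n g"
    then have gl: "lin R (C n) (C' n) g"
      and gd: "\<And>x. x \<in> carrier (C (Suc n)) \<Longrightarrow> g (d (Suc n) x) \<in> d' (Suc n) ` carrier (C' (Suc n))"
      by (simp_all add: P_def)
    obtain h where h: "lin R (C (Suc n)) (C' (Suc n)) h"
      "\<And>x. x \<in> carrier (C (Suc n)) \<Longrightarrow> d' (Suc n) (h x) = g (d (Suc n) x)"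
      using projective_lift[OF D(1) lin_comp[OF D(3) gl] D'(3) gd] by blast
    have "h (d (Suc (Suc n)) x) \<in> d' (Suc (Suc n)) ` carrier (C' (Suc (Suc n)))"
      if x: "x \<in> carrier (C (Suc (Suc n)))" for x
    proof (rule acyclic_exact[OF C'])
      note dx = lin_closed[OF D(3) x]
      show "h (d (Suc (Suc n)) x) \<in> carrier (C' (Suc n))" by (rule lin_closed[OF h(1) dx])
      show "d' (Suc n) (h (d (Suc (Suc n)) x)) = \<zero>\<^bsub>C' n\<^esub>"
        using h(2)[OF dx] D(4)[OF x] lin_zero[OF gl] by simp
    qed
    then show "\<exists>h. P (Suc n) h \<and> Q n g h"
      using h by (intro exI[of _ h]) (simp add: P_def Q_def)
  qed
  then obtain F where F: "\<And>n. P n (F n)" "\<And>n. Q n (F n) (F (Suc n))" by blast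
  have "F 0 = f" using F(1)[of 0] by (simp add: P_def)
  moreover have "chain_map R C d C' d' F"
    using F by (simp add: chain_map_def P_def Q_def)
  ultimately show ?thesis by blast
qed

lemma null_homotopy:
  assumes C: "proj_complex R C d" and C': "acyclic_complex R C' d'" and T: "chain_map R C d C' d' T"
    and T0: "\<And>x. x \<in> carrier (C 0) \<Longrightarrow> T 0 x \<in> d' 1 ` carrier (C' 1)"
  shows "\<exists>s. (\<forall>i. lin R (C i) (C' (Suc i)) (s i)) \<and> (\<forall>x\<in>carrier (C 0). T 0 x = d' 1 (s 0 x)) \<and>
    (\<forall>i. \<forall>x\<in>carrier (C (Suc i)). T (Suc i) x = d' (Suc (Suc i)) (s (Suc i) x) \<oplus>\<^bsub>C' (Suc i)\<^esub> s i (d (Suc i) x))"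
proof -
  note D = proj_complexD[OF C] and D' = proj_complexD[OF acyclic_proj[OF C']] and T = chain_mapD[OF T]
  \<comment> \<open>The invariant says that \<open>d' s d\<close> equals \<open>T d\<close>. Hence
    \<open>T - s d\<close>, taken one degree higher, has values in cycles, where it can be
    lifted.\<close>
  define P where "P n s \<longleftrightarrow> (n = 0 \<longrightarrow> (\<forall>x\<in>carrier (C 0). T 0 x = d' 1 (s x))) \<and>
    lin R (C n) (C' (Suc n)) s \<and>
    (\<forall>x\<in>carrier (C (Suc n)). d' (Suc n) (s (d (Suc n) x)) = T n (d (Suc n) x))" for n s
  define Q where "Q n s s' \<longleftrightarrow> (\<forall>x\<in>carrier (C (Suc n)).
    T (Suc n) x = d' (Suc (Suc n)) (s' x) \<oplus>\<^bsub>C' (Suc n)\<^esub> s (d (Suc n) x))" for n s s'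
  have "\<exists>s. \<forall>n. P n (s n) \<and> Q n (s n) (s (Suc n))"
  proof (rule dependent_nat_choice)
    obtain s where s: "lin R (C 0) (C' (Suc 0)) s" "\<And>x. x \<in> carrier (C 0) \<Longrightarrow> d' 1 (s x) = T 0 x"
      using projective_lift[OF D(1)[of 0] T(1)[of 0] D'(3)[of 0]] T0 by auto
    then show "\<exists>s. P 0 s"
      using lin_closed[OF D(3)] by (intro exI[of _ s]) (simp add: P_def)
    fix s n assume "P n s"
    then have sl: "lin R (C n) (C' (Suc n)) s"
      and sd: "\<And>x. x \<in> carrier (C (Suc n)) \<Longrightarrow> d' (Suc n) (s (d (Suc n) x)) = T n (d (Suc n) x)"
      by (simp_all add: P_def)
    interpret N: right_module R "C' n" by (rule D'(2))
    interpret N': right_module R "C' (Suc n)" by (rule D'(2))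
    define U where "U x = T (Suc n) x \<ominus>\<^bsub>C' (Suc n)\<^esub> s (d (Suc n) x)" for x
    have U: "lin R (C (Suc n)) (C' (Suc n)) U"
      unfolding U_def by (rule lin_diff[OF T(1) lin_comp[OF D(3) sl]])
    have "U x \<in> d' (Suc (Suc n)) ` carrier (C' (Suc (Suc n)))" if x: "x \<in> carrier (C (Suc n))" for x
    proof (rule acyclic_exact[OF C' lin_closed[OF U x]])
      have "d' (Suc n) (U x) = d' (Suc n) (T (Suc n) x) \<ominus>\<^bsub>C' n\<^esub> d' (Suc n) (s (d (Suc n) x))"
        unfolding U_def by (rule lin_minus[OF D'(3)])
          (intro lin_closed[OF T(1)] lin_closed[OF sl] lin_closed[OF D(3)] x)+
      also have "\<dots> = \<zero>\<^bsub>C' n\<^esub>"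
        using T(2)[OF x] sd[OF x] lin_closed[OF T(1) lin_closed[OF D(3) x]]
        by (simp add: N.M.minus_eq_zero_iff)
      finally show "d' (Suc n) (U x) = \<zero>\<^bsub>C' n\<^esub>" .
    qed
    then obtain s' where s': "lin R (C (Suc n)) (C' (Suc (Suc n))) s'"
      "\<And>x. x \<in> carrier (C (Suc n)) \<Longrightarrow> d' (Suc (Suc n)) (s' x) = U x"
      using projective_lift[OF D(1) U D'(3)] by blast
    have "d' (Suc (Suc n)) (s' (d (Suc (Suc n)) x)) = T (Suc n) (d (Suc (Suc n)) x)"
      if x: "x \<in> carrier (C (Suc (Suc n)))" for x
    proof -
      note dx = lin_closed[OF D(3) x]
      show ?thesis
        using s'(2)[OF dx] D(4)[OF x] lin_zero[OF sl] lin_closed[OF T(1) dx]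
        by (simp add: U_def a_minus_def)
    qed
    moreover have "T (Suc n) x = d' (Suc (Suc n)) (s' x) \<oplus>\<^bsub>C' (Suc n)\<^esub> s (d (Suc n) x)"
      if x: "x \<in> carrier (C (Suc n))" for x
      using s'(2)[OF x] lin_closed[OF T(1) x] lin_closed[OF sl lin_closed[OF D(3) x]]
      by (simp add: U_def N'.M.minus_add_cancel)
    ultimately show "\<exists>s'. P (Suc n) s' \<and> Q n s s'"
      using s'(1) by (intro exI[of _ s']) (simp add: P_def Q_def)
  qed
  then obtain s where s: "\<And>n. P n (s n)" "\<And>n. Q n (s n) (s (Suc n))" by blast
  show ?thesis
    by (rule exI[of _ s]) (use s s(1)[of 0] in \<open>simp add: P_def Q_def\<close>)
qed


subsection \<open>Cohomology of the dual complex\<close>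

definition cocycle ::
    "('a, 'r) ring_scheme \<Rightarrow> (nat \<Rightarrow> ('a, 'p) module) \<Rightarrow> (nat \<Rightarrow> 'p \<Rightarrow> 'p) \<Rightarrow> nat \<Rightarrow> ('p \<Rightarrow> 'a) \<Rightarrow> bool" where
  "cocycle R C d k g \<longleftrightarrow> lin R (C k) (regular_module R) g \<and>
     (\<forall>x\<in>carrier (C (Suc k)). g (d (Suc k) x) = \<zero>\<^bsub>R\<^esub>)"

text \<open>No map enters degree zero, so only functionals that vanish on the carrier count there,
  and degree zero cohomology is the dual of the resolved module.\<close>

definition coboundary ::
    "('a, 'r) ring_scheme \<Rightarrow> (nat \<Rightarrow> ('a, 'p) module) \<Rightarrow> (nat \<Rightarrow> 'p \<Rightarrow> 'p) \<Rightarrow> nat \<Rightarrow> ('p \<Rightarrow> 'a) \<Rightarrow> bool" where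
  "coboundary R C d k g \<longleftrightarrow> (case k of 0 \<Rightarrow> \<forall>x\<in>carrier (C 0). g x = \<zero>\<^bsub>R\<^esub>
     | Suc l \<Rightarrow> \<exists>g'. lin R (C l) (regular_module R) g' \<and> (\<forall>x\<in>carrier (C (Suc l)). g x = g' (d (Suc l) x)))"

text \<open>The statements that \<open>Ext\<^sup>k\<close> vanishes and that \<open>Ext\<^sup>k\<close> of a map is injective or surjective are
  phrased in terms of cocycles, so that no quotient is formed.\<close>

definition coh_zero where
  "coh_zero R C d k \<longleftrightarrow> (\<forall>g. cocycle R C d k g \<longrightarrow> coboundary R C d k g)"

definition coh_inj where
  "coh_inj R C d C' d' k f \<longleftrightarrow>
     (\<forall>g. cocycle R C' d' k g \<longrightarrow> coboundary R C d k (\<lambda>x. g (f x)) \<longrightarrow> coboundary R C' d' k g)"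

definition coh_surj where
  "coh_surj R C d C' d' k f \<longleftrightarrow>
     (\<forall>g. cocycle R C d k g \<longrightarrow> (\<exists>g'. cocycle R C' d' k g' \<and> coboundary R C d k (\<lambda>x. g x \<ominus>\<^bsub>R\<^esub> g' (f x))))"

definition coh_eq where
  "coh_eq R C d C' d' k f f' \<longleftrightarrow>
     (\<forall>g. cocycle R C' d' k g \<longrightarrow> coboundary R C d k (\<lambda>x. g (f x) \<ominus>\<^bsub>R\<^esub> g (f' x)))"

lemma coboundary_0: "coboundary R C d 0 g \<longleftrightarrow> (\<forall>x\<in>carrier (C 0). g x = \<zero>\<^bsub>R\<^esub>)"
  by (simp add: coboundary_def)

lemma coboundary_Suc: "coboundary R C d (Suc l) g \<longleftrightarrow>
    (\<exists>g'. lin R (C l) (regular_module R) g' \<and> (\<forall>x\<in>carrier (C (Suc l)). g x = g' (d (Suc l) x)))"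
  by (simp add: coboundary_def)

lemma cocycle_value: "cocycle R C d k g \<Longrightarrow> x \<in> carrier (C k) \<Longrightarrow> g x \<in> carrier R"
  using lin_closed[of R "C k" "regular_module R" g x] by (simp add: cocycle_def)

lemma coboundary_cong:
  assumes "coboundary R C d k g" "\<And>x. x \<in> carrier (C k) \<Longrightarrow> g' x = g x"
  shows "coboundary R C d k g'"
  using assms by (cases k) (auto simp: coboundary_0 coboundary_Suc)

lemma coboundary_add:
  assumes "proj_complex R C d" "coboundary R C d k g" "coboundary R C d k h"
  shows "coboundary R C d k (\<lambda>x. g x \<oplus>\<^bsub>R\<^esub> h x)"
proof (cases k)
  case 0
  interpret C: right_module R "C 0" by (rule proj_complexD[OF assms(1)])
  show ?thesis using assms(2,3) 0 by (simp add: coboundary_0)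
next
  case (Suc l)
  with assms obtain g' h' where "lin R (C l) (regular_module R) g'" "lin R (C l) (regular_module R) h'"
    "\<And>x. x \<in> carrier (C k) \<Longrightarrow> g x = g' (d k x)" "\<And>x. x \<in> carrier (C k) \<Longrightarrow> h x = h' (d k x)"
    by (auto simp: coboundary_Suc)
  with Suc show ?thesis
    using lin_sum[of R "C l" "regular_module R" g' h']
    by (auto simp: coboundary_Suc intro!: exI[of _ "\<lambda>x. g' x \<oplus>\<^bsub>R\<^esub> h' x"])
qed

lemma coboundary_neg:
  assumes "proj_complex R C d" "coboundary R C d k g"
  shows "coboundary R C d k (\<lambda>x. \<ominus>\<^bsub>R\<^esub> g x)"
proof (cases k)
  case 0
  interpret C: right_module R "C 0" by (rule proj_complexD[OF assms(1)])
  show ?thesis using assms(2) 0 by (simp add: coboundary_0)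
next
  case (Suc l)
  with assms obtain g' where "lin R (C l) (regular_module R) g'"
    "\<And>x. x \<in> carrier (C k) \<Longrightarrow> g x = g' (d k x)"
    by (auto simp: coboundary_Suc)
  with Suc show ?thesis
    using lin_uminus[of R "C l" "regular_module R" g']
    by (auto simp: coboundary_Suc intro!: exI[of _ "\<lambda>x. \<ominus>\<^bsub>R\<^esub> g' x"])
qed

lemma coboundary_diff:
  assumes "proj_complex R C d" "coboundary R C d k g" "coboundary R C d k h"
  shows "coboundary R C d k (\<lambda>x. g x \<ominus>\<^bsub>R\<^esub> h x)"
  unfolding a_minus_def
  by (rule coboundary_add[OF assms(1,2) coboundary_neg[OF assms(1,3)]])

lemma coboundary_eq_iff:
  assumes "proj_complex R C d" "coboundary R C d k (\<lambda>x. g x \<ominus>\<^bsub>R\<^esub> h x)"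
    "\<And>x. x \<in> carrier (C k) \<Longrightarrow> g x \<in> carrier R" "\<And>x. x \<in> carrier (C k) \<Longrightarrow> h x \<in> carrier R"
  shows "coboundary R C d k g \<longleftrightarrow> coboundary R C d k h"
proof -
  interpret C: right_module R "C 0" by (rule proj_complexD[OF assms(1)])
  show ?thesis
  proof
    assume "coboundary R C d k h"
    from coboundary_add[OF assms(1,2) this] show "coboundary R C d k g"
      by (rule coboundary_cong) (simp add: assms C.R.minus_add_cancel)
  next
    assume "coboundary R C d k g"
    from coboundary_diff[OF assms(1) this assms(2)] show "coboundary R C d k h"
    proof (rule coboundary_cong)
      fix x assume x: "x \<in> carrier (C k)"
      have "g x \<ominus>\<^bsub>R\<^esub> (g x \<ominus>\<^bsub>R\<^esub> h x) = (g x \<oplus>\<^bsub>R\<^esub> \<ominus>\<^bsub>R\<^esub> g x) \<oplus>\<^bsub>R\<^esub> h x"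
        using assms(3,4)[OF x] by (simp add: a_minus_def C.R.minus_add C.R.a_assoc)
      then show "h x = g x \<ominus>\<^bsub>R\<^esub> (g x \<ominus>\<^bsub>R\<^esub> h x)" using assms(3,4)[OF x] by (simp add: C.R.r_neg)
    qed
  qed
qed

lemma cocycle_comp:
  assumes "proj_complex R C d" "chain_map R C d C' d' F" "cocycle R C' d' k g"
  shows "cocycle R C d k (\<lambda>x. g (F k x))"
proof -
  have "g (F k (d (Suc k) x)) = \<zero>\<^bsub>R\<^esub>" if x: "x \<in> carrier (C (Suc k))" for x
    using assms(3) chain_mapD(2)[OF assms(2) x] lin_closed[OF chain_mapD(1)[OF assms(2)] x]
    by (simp add: cocycle_def flip: chain_mapD(2)[OF assms(2) x])
  then show ?thesis
    using lin_comp[OF chain_mapD(1)[OF assms(2)], of k "regular_module R" g] assms(3)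
    by (simp add: cocycle_def)
qed

lemma cocycle_diff:
  assumes "proj_complex R C d" "cocycle R C d k g" "cocycle R C d k h"
  shows "cocycle R C d k (\<lambda>x. g x \<ominus>\<^bsub>R\<^esub> h x)"
proof -
  interpret C: right_module R "C 0" by (rule proj_complexD[OF assms(1)])
  show ?thesis
    using assms(2,3) lin_diff[of R "C k" "regular_module R" g h]
    by (simp add: cocycle_def a_minus_def)
qed

lemma coboundary_comp:
  assumes "proj_complex R C d" "chain_map R C d C' d' F" "coboundary R C' d' k g"
  shows "coboundary R C d k (\<lambda>x. g (F k x))"
proof (cases k)
  case 0
  then show ?thesis using assms(3) lin_closed[OF chain_mapD(1)[OF assms(2)]] by (simp add: coboundary_0)
next
  case (Suc l)
  with assms(3) obtain g' where g': "lin R (C' l) (regular_module R) g'"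
    "\<And>x. x \<in> carrier (C' (Suc l)) \<Longrightarrow> g x = g' (d' (Suc l) x)"
    by (auto simp: coboundary_Suc)
  have "g (F k x) = g' (F l (d k x))" if "x \<in> carrier (C k)" for x
    using g'(2)[OF lin_closed[OF chain_mapD(1)[OF assms(2)]]] that chain_mapD(2)[OF assms(2), of x l] Suc
    by simp
  then show ?thesis
    using lin_comp[OF chain_mapD(1)[OF assms(2)] g'(1)] Suc
    by (auto simp: coboundary_Suc intro!: exI[of _ "\<lambda>x. g' (F l x)"])
qed

lemma coh_eq_refl:
  assumes C: "proj_complex R C d" and f: "lin R (C k) (C' k) f"
  shows "coh_eq R C d C' d' k f f"
  unfolding coh_eq_def
proof (intro allI impI)
  fix g assume g: "cocycle R C' d' k g"
  interpret C: right_module R "C 0" by (rule proj_complexD(2)[OF C])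
  have "coboundary R C d k (\<lambda>x. \<zero>\<^bsub>R\<^esub>)"
    using lin_const_zero[OF proj_complexD(2)[OF C] right_module_regular[OF C.R.ring_axioms]]
    by (cases k) (auto simp: coboundary_0 coboundary_Suc)
  then show "coboundary R C d k (\<lambda>x. g (f x) \<ominus>\<^bsub>R\<^esub> g (f x))"
    by (rule coboundary_cong) (simp add: C.R.minus_eq_zero_iff cocycle_value[OF g] lin_closed[OF f])
qed

lemma coh_eq_sym:
  assumes "proj_complex R C d" "lin R (C k) (C' k) f" "lin R (C k) (C' k) f'" "coh_eq R C d C' d' k f f'"
  shows "coh_eq R C d C' d' k f' f"
  unfolding coh_eq_def
proof (intro allI impI)
  interpret C: right_module R "C 0" by (rule proj_complexD[OF assms(1)])
  fix g assume g: "cocycle R C' d' k g"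
  with assms(4) have "coboundary R C d k (\<lambda>x. \<ominus>\<^bsub>R\<^esub> (g (f x) \<ominus>\<^bsub>R\<^esub> g (f' x)))"
    using coboundary_neg[OF assms(1)] by (simp add: coh_eq_def)
  then show "coboundary R C d k (\<lambda>x. g (f' x) \<ominus>\<^bsub>R\<^esub> g (f x))"
    by (rule coboundary_cong)
      (simp add: C.R.minus_swap cocycle_value[OF g] lin_closed[OF assms(2)] lin_closed[OF assms(3)])
qed

lemma coh_inj_cong:
  assumes "proj_complex R C d" "lin R (C k) (C' k) f" "lin R (C k) (C' k) f'" "coh_eq R C d C' d' k f f'"
  shows "coh_inj R C d C' d' k f \<longleftrightarrow> coh_inj R C d C' d' k f'"
proof -
  have "coboundary R C d k (\<lambda>x. g (f x)) \<longleftrightarrow> coboundary R C d k (\<lambda>x. g (f' x))"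
    if g: "cocycle R C' d' k g" for g
    by (rule coboundary_eq_iff[OF assms(1)])
      (use assms g cocycle_value[OF g] lin_closed[OF assms(2)] lin_closed[OF assms(3)]
        in \<open>simp_all add: coh_eq_def\<close>)
  then show ?thesis by (auto simp: coh_inj_def)
qed

lemma coh_surj_cong:
  assumes "proj_complex R C d" "lin R (C k) (C' k) f" "lin R (C k) (C' k) f'" "coh_eq R C d C' d' k f f'"
  shows "coh_surj R C d C' d' k f \<longleftrightarrow> coh_surj R C d C' d' k f'"
proof -
  interpret C: right_module R "C 0" by (rule proj_complexD[OF assms(1)])
  have *: "coh_surj R C d C' d' k f'"
    if f: "lin R (C k) (C' k) f" and f': "lin R (C k) (C' k) f'"
      and e: "coh_eq R C d C' d' k f f'" and s: "coh_surj R C d C' d' k f" for f f'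
    unfolding coh_surj_def
  proof (intro allI impI)
    fix g assume g: "cocycle R C d k g"
    then obtain g' where g': "cocycle R C' d' k g'" "coboundary R C d k (\<lambda>x. g x \<ominus>\<^bsub>R\<^esub> g' (f x))"
      using s by (auto simp: coh_surj_def)
    then have "coboundary R C d k (\<lambda>x. (g x \<ominus>\<^bsub>R\<^esub> g' (f x)) \<oplus>\<^bsub>R\<^esub> (g' (f x) \<ominus>\<^bsub>R\<^esub> g' (f' x)))"
      using e by (intro coboundary_add[OF assms(1)]) (simp_all add: coh_eq_def)
    then have "coboundary R C d k (\<lambda>x. g x \<ominus>\<^bsub>R\<^esub> g' (f' x))"
      by (rule coboundary_cong)
        (simp add: C.R.minus_trans cocycle_value[OF g] cocycle_value[OF g'(1)] lin_closed[OF f] lin_closed[OF f'])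
    with g' show "\<exists>g'. cocycle R C' d' k g' \<and> coboundary R C d k (\<lambda>x. g x \<ominus>\<^bsub>R\<^esub> g' (f' x))" by blast
  qed
  show ?thesis
    using *[OF assms(2,3,4)] *[OF assms(3,2) coh_eq_sym[OF assms]] by blast
qed

text \<open>A map \<open>t\<close> with \<open>t d = 0\<close> in degree \<open>0\<close> extends by zero to a chain map and factors through the
  projective module \<open>C' 0\<close>; it is invisible in positive degrees.\<close>

definition stably_eq where
  "stably_eq R C d C' d' f f' \<longleftrightarrow> (\<exists>t. lin R (C 0) (C' 0) t \<and>
     (\<forall>x\<in>carrier (C 1). t (d 1 x) = \<zero>\<^bsub>C' 0\<^esub>) \<and>
     (\<forall>x\<in>carrier (C 0). f x \<ominus>\<^bsub>C' 0\<^esub> (f' x \<oplus>\<^bsub>C' 0\<^esub> t x) \<in> d' 1 ` carrier (C' 1)))"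

text \<open>A cocycle vanishes on boundaries, so of a homotopy it sees only the term that factors
  through \<open>d\<close>, and this term is a coboundary.\<close>

lemma homotopic_coh_eq:
  assumes C: "proj_complex R C d" and C': "acyclic_complex R C' d'"
    and F: "chain_map R C d C' d' F" and G: "chain_map R C d C' d' G"
    and *: "\<And>x. x \<in> carrier (C 0) \<Longrightarrow> F 0 x \<ominus>\<^bsub>C' 0\<^esub> G 0 x \<in> d' 1 ` carrier (C' 1)"
  shows "coh_eq R C d C' d' k (F k) (G k)"
  unfolding coh_eq_def
proof (intro allI impI)
  fix g assume g: "cocycle R C' d' k g"
  then have gl: "lin R (C' k) (regular_module R) g"
    and gd: "\<And>x. x \<in> carrier (C' (Suc k)) \<Longrightarrow> g (d' (Suc k) x) = \<zero>\<^bsub>R\<^esub>"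
    by (simp_all add: cocycle_def)
  note D = proj_complexD[OF C] and D' = proj_complexD[OF acyclic_proj[OF C']]
  interpret C0: right_module R "C 0" by (rule D(2))
  obtain s where s: "\<And>i. lin R (C i) (C' (Suc i)) (s i)"
    "\<And>x. x \<in> carrier (C 0) \<Longrightarrow> F 0 x \<ominus>\<^bsub>C' 0\<^esub> G 0 x = d' 1 (s 0 x)"
    "\<And>i x. x \<in> carrier (C (Suc i)) \<Longrightarrow> F (Suc i) x \<ominus>\<^bsub>C' (Suc i)\<^esub> G (Suc i) x =
      d' (Suc (Suc i)) (s (Suc i) x) \<oplus>\<^bsub>C' (Suc i)\<^esub> s i (d (Suc i) x)"
    using null_homotopy[OF C C' chain_map_diff[OF F G C acyclic_proj[OF C']]] * by blast
  have gm: "g (F k x) \<ominus>\<^bsub>R\<^esub> g (G k x) = g (F k x \<ominus>\<^bsub>C' k\<^esub> G k x)" if "x \<in> carrier (C k)" for x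
    using lin_minus[OF gl lin_closed[OF chain_mapD(1)[OF F] that] lin_closed[OF chain_mapD(1)[OF G] that]]
    by simp
  show "coboundary R C d k (\<lambda>x. g (F k x) \<ominus>\<^bsub>R\<^esub> g (G k x))"
  proof (cases k)
    case 0
    then show ?thesis using s(2) gd lin_closed[OF s(1)] gm by (simp add: coboundary_0)
  next
    case (Suc l)
    have "g (F k x) \<ominus>\<^bsub>R\<^esub> g (G k x) = g (s l (d (Suc l) x))" if x: "x \<in> carrier (C (Suc l))" for x
    proof -
      have "g (F k x) \<ominus>\<^bsub>R\<^esub> g (G k x) = g (d' (Suc (Suc l)) (s (Suc l) x) \<oplus>\<^bsub>C' (Suc l)\<^esub> s l (d (Suc l) x))"
        using gm x Suc s(3)[OF x] by simp
      also have "\<dots> = g (d' (Suc (Suc l)) (s (Suc l) x)) \<oplus>\<^bsub>R\<^esub> g (s l (d (Suc l) x))"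
        using lin_add[OF gl] Suc lin_closed[OF D'(3) lin_closed[OF s(1) x]]
          lin_closed[OF s(1) lin_closed[OF D(3) x]] by simp
      also have "g (d' (Suc (Suc l)) (s (Suc l) x)) = \<zero>\<^bsub>R\<^esub>"
        using gd Suc lin_closed[OF s(1) x] by simp
      finally show ?thesis
        using lin_closed[OF gl] Suc lin_closed[OF s(1) lin_closed[OF D(3) x]] by simp
    qed
    then show ?thesis
      using lin_comp[OF s(1)[of l], of "regular_module R" g] gl Suc
      by (auto simp: coboundary_Suc intro!: exI[of _ "\<lambda>x. g (s l x)"])
  qed
qed

lemma stably_eq_coh_eq:
  assumes C: "proj_complex R C d" and C': "acyclic_complex R C' d'"
    and F: "chain_map R C d C' d' F" and G: "chain_map R C d C' d' G"
    and st: "stably_eq R C d C' d' (F 0) (G 0)"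
  shows "coh_eq R C d C' d' (Suc k) (F (Suc k)) (G (Suc k))"
proof -
  note D = proj_complexD[OF C] and D' = proj_complexD[OF acyclic_proj[OF C']]
  from st obtain t where t: "lin R (C 0) (C' 0) t" "\<And>x. x \<in> carrier (C 1) \<Longrightarrow> t (d 1 x) = \<zero>\<^bsub>C' 0\<^esub>"
    "\<And>x. x \<in> carrier (C 0) \<Longrightarrow> F 0 x \<ominus>\<^bsub>C' 0\<^esub> (G 0 x \<oplus>\<^bsub>C' 0\<^esub> t x) \<in> d' 1 ` carrier (C' 1)"
    unfolding stably_eq_def by blast
  interpret N: right_module R "C' 0" by (rule D'(2))
  \<comment> \<open>Adding \<open>t\<close> in degree zero keeps a chain map because
    \<open>t\<close> vanishes on boundaries, and it leaves the degrees \<open>Suc k\<close> as they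
    are.\<close>
  define G' where "G' i = (case i of 0 \<Rightarrow> (\<lambda>x. G 0 x \<oplus>\<^bsub>C' 0\<^esub> t x) | Suc l \<Rightarrow> G (Suc l))" for i
  have "chain_map R C d C' d' G'"
    unfolding chain_map_def
  proof (intro conjI allI ballI)
    show "lin R (C i) (C' i) (G' i)" for i
      using lin_sum[OF chain_mapD(1)[OF G] t(1)] chain_mapD(1)[OF G] by (cases i) (simp_all add: G'_def)
    show "d' (Suc i) (G' (Suc i) x) = G' i (d (Suc i) x)" if x: "x \<in> carrier (C (Suc i))" for i x
      using chain_mapD(2)[OF G x] t(2) x lin_closed[OF chain_mapD(1)[OF G] lin_closed[OF D(3) x]]
      by (cases i) (simp_all add: G'_def)
  qed
  from homotopic_coh_eq[OF C C' F this, of "Suc k"] t(3) show ?thesis by (simp add: G'_def)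
qed

section \<open>Composition and cancellation for induced maps on cohomology\<close>

lemma coh_equivalence:
  assumes C: "proj_complex R C d" and C': "proj_complex R C' d'"
    and F: "chain_map R C d C' d' F" and G: "chain_map R C' d' C d G"
    and GF: "coh_eq R C d C d k (\<lambda>x. G k (F k x)) (\<lambda>x. x)"
    and FG: "coh_eq R C' d' C' d' k (\<lambda>x. F k (G k x)) (\<lambda>x. x)"
  shows "coh_inj R C d C' d' k (F k)" "coh_surj R C d C' d' k (F k)"
proof -
  interpret C0: right_module R "C 0" by (rule proj_complexD[OF C])
  show "coh_inj R C d C' d' k (F k)"
    unfolding coh_inj_def
  proof (intro allI impI)
    fix g assume g: "cocycle R C' d' k g" and "coboundary R C d k (\<lambda>x. g (F k x))"
    then have "coboundary R C' d' k (\<lambda>x. g (F k (G k x)))"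
      using coboundary_comp[OF C' G] by fastforce
    moreover have "coboundary R C' d' k (\<lambda>x. g (F k (G k x)) \<ominus>\<^bsub>R\<^esub> g x)"
      using FG g by (simp add: coh_eq_def)
    ultimately show "coboundary R C' d' k g"
      using coboundary_eq_iff[OF C', of k "\<lambda>x. g (F k (G k x))" g] cocycle_value[OF g]
        lin_closed[OF chain_mapD(1)[OF F]] lin_closed[OF chain_mapD(1)[OF G]] by simp
  qed
  show "coh_surj R C d C' d' k (F k)"
    unfolding coh_surj_def
  proof (intro allI impI)
    fix g assume g: "cocycle R C d k g"
    have "coboundary R C d k (\<lambda>x. \<ominus>\<^bsub>R\<^esub> (g (G k (F k x)) \<ominus>\<^bsub>R\<^esub> g x))"
      using GF g by (intro coboundary_neg[OF C]) (simp add: coh_eq_def)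
    then have "coboundary R C d k (\<lambda>x. g x \<ominus>\<^bsub>R\<^esub> g (G k (F k x)))"
      by (rule coboundary_cong) (simp add: C0.R.minus_swap cocycle_value[OF g]
          lin_closed[OF chain_mapD(1)[OF F]] lin_closed[OF chain_mapD(1)[OF G]])
    then show "\<exists>g'. cocycle R C' d' k g' \<and> coboundary R C d k (\<lambda>x. g x \<ominus>\<^bsub>R\<^esub> g' (F k x))"
      using cocycle_comp[OF C' G g] by blast
  qed
qed

lemma coh_inj_comp:
  assumes "proj_complex R C' d'" "chain_map R C' d' C'' d'' G"
    "coh_inj R C d C' d' k f" "coh_inj R C' d' C'' d'' k (G k)"
  shows "coh_inj R C d C'' d'' k (\<lambda>x. G k (f x))"
  using assms(3,4) cocycle_comp[OF assms(1,2)] by (auto simp: coh_inj_def)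

lemma coh_surj_comp:
  assumes C: "proj_complex R C d" and F: "chain_map R C d C' d' F" and G: "chain_map R C' d' C'' d'' G"
    and f: "coh_surj R C d C' d' k (F k)" and g: "coh_surj R C' d' C'' d'' k (G k)"
  shows "coh_surj R C d C'' d'' k (\<lambda>x. G k (F k x))"
  unfolding coh_surj_def
proof (intro allI impI)
  interpret C0: right_module R "C 0" by (rule proj_complexD[OF C])
  fix u assume u: "cocycle R C d k u"
  with f obtain u' where u': "cocycle R C' d' k u'" "coboundary R C d k (\<lambda>x. u x \<ominus>\<^bsub>R\<^esub> u' (F k x))"
    by (auto simp: coh_surj_def)
  with g obtain v where v: "cocycle R C'' d'' k v" "coboundary R C' d' k (\<lambda>x. u' x \<ominus>\<^bsub>R\<^esub> v (G k x))"
    by (auto simp: coh_surj_def)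
  have "coboundary R C d k (\<lambda>x. (u x \<ominus>\<^bsub>R\<^esub> u' (F k x)) \<oplus>\<^bsub>R\<^esub> (u' (F k x) \<ominus>\<^bsub>R\<^esub> v (G k (F k x))))"
    by (rule coboundary_add[OF C u'(2) coboundary_comp[OF C F v(2)]])
  then have "coboundary R C d k (\<lambda>x. u x \<ominus>\<^bsub>R\<^esub> v (G k (F k x)))"
    by (rule coboundary_cong) (simp add: C0.R.minus_trans cocycle_value[OF u] cocycle_value[OF u'(1)]
        cocycle_value[OF v(1)] lin_closed[OF chain_mapD(1)[OF F]] lin_closed[OF chain_mapD(1)[OF G]])
  with v show "\<exists>v. cocycle R C'' d'' k v \<and> coboundary R C d k (\<lambda>x. u x \<ominus>\<^bsub>R\<^esub> v (G k (F k x)))" by blast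
qed

lemma coh_inj_cancel:
  assumes C: "proj_complex R C d" and F: "chain_map R C d C' d' F"
    and "coh_inj R C d C'' d'' k (\<lambda>x. g (F k x))"
  shows "coh_inj R C' d' C'' d'' k g"
  using assms(3) coboundary_comp[OF C F, of k] by (fastforce simp: coh_inj_def)

text \<open>Since \<open>F\<close> is injective on cohomology, the defect between \<open>u\<close>
  and the pullback of \<open>v\<close> along \<open>G\<close> is a coboundary as soon as its
  pullback along \<open>F\<close> is one. This isolates the last factor of a composite.\<close>

lemma coh_surj_cancel:
  assumes C: "proj_complex R C d" and C': "proj_complex R C' d'"
    and F: "chain_map R C d C' d' F" and G: "chain_map R C' d' C'' d'' G"
    and "coh_inj R C d C' d' k (F k)" and "coh_surj R C d C'' d'' k (\<lambda>x. G k (F k x))"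
  shows "coh_surj R C' d' C'' d'' k (G k)"
  unfolding coh_surj_def
proof (intro allI impI)
  fix u assume u: "cocycle R C' d' k u"
  then obtain v where v: "cocycle R C'' d'' k v" "coboundary R C d k (\<lambda>x. u (F k x) \<ominus>\<^bsub>R\<^esub> v (G k (F k x)))"
    using assms(6) cocycle_comp[OF C F u] by (auto simp: coh_surj_def)
  have "cocycle R C' d' k (\<lambda>x. u x \<ominus>\<^bsub>R\<^esub> v (G k x))"
    by (rule cocycle_diff[OF C' u cocycle_comp[OF C' G v(1)]])
  then have "coboundary R C' d' k (\<lambda>x. u x \<ominus>\<^bsub>R\<^esub> v (G k x))"
    using assms(5) v(2) by (simp add: coh_inj_def)
  with v show "\<exists>v. cocycle R C'' d'' k v \<and> coboundary R C' d' k (\<lambda>x. u x \<ominus>\<^bsub>R\<^esub> v (G k x))" by blast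
qed

lemma coh_zero_imp_inj: "coh_zero R C' d' k \<Longrightarrow> coh_inj R C d C' d' k f"
  by (simp add: coh_zero_def coh_inj_def)

lemma coh_zero_imp_surj:
  assumes "proj_complex R C d" "proj_complex R C' d'" "lin R (C k) (C' k) f" "coh_zero R C d k"
  shows "coh_surj R C d C' d' k f"
  unfolding coh_surj_def
proof (intro allI impI)
  interpret C0: right_module R "C k" by (rule proj_complexD[OF assms(1)])
  fix g assume g: "cocycle R C d k g"
  have "cocycle R C' d' k (\<lambda>x. \<zero>\<^bsub>R\<^esub>)"
    using lin_const_zero[OF proj_complexD(2)[OF assms(2)] right_module_regular[OF C0.R.ring_axioms]]
    by (simp add: cocycle_def)
  moreover have "coboundary R C d k g" using assms(4) g by (simp add: coh_zero_def)
  then have "coboundary R C d k (\<lambda>x. g x \<ominus>\<^bsub>R\<^esub> \<zero>\<^bsub>R\<^esub>)"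
    by (rule coboundary_cong) (simp add: a_minus_def cocycle_value[OF g])
  ultimately show "\<exists>g'. cocycle R C' d' k g' \<and> coboundary R C d k (\<lambda>x. g x \<ominus>\<^bsub>R\<^esub> g' (f x))" by blast
qed

lemma coh_zero_target:
  assumes "proj_complex R C d" "chain_map R C d C' d' F" "coh_inj R C d C' d' k (F k)" "coh_zero R C d k"
  shows "coh_zero R C' d' k"
  using assms(3,4) cocycle_comp[OF assms(1,2)] by (simp add: coh_zero_def coh_inj_def)

lemma coh_zero_source:
  assumes "proj_complex R C d" "chain_map R C d C' d' F" "coh_surj R C d C' d' k (F k)" "coh_zero R C' d' k"
  shows "coh_zero R C d k"
  unfolding coh_zero_def
proof (intro allI impI)
  fix g assume g: "cocycle R C d k g"
  then obtain g' where g': "cocycle R C' d' k g'" "coboundary R C d k (\<lambda>x. g x \<ominus>\<^bsub>R\<^esub> g' (F k x))"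
    using assms(3) by (auto simp: coh_surj_def)
  have "coboundary R C d k (\<lambda>x. g' (F k x))"
    using assms(4) g'(1) coboundary_comp[OF assms(1,2)] by (simp add: coh_zero_def)
  then show "coboundary R C d k g"
    using coboundary_eq_iff[OF assms(1) g'(2)] cocycle_value[OF g] cocycle_value[OF g'(1)]
      lin_closed[OF chain_mapD(1)[OF assms(2)]] by simp
qed

section \<open>Dual modules and perfect pairings\<close>

lemma dual_simps:
  "carrier (dual R M) = mod_hom R M (regular_module R) \<inter> extensional (carrier M)"
  "\<zero>\<^bsub>dual R M\<^esub> = (\<lambda>x\<in>carrier M. \<zero>\<^bsub>R\<^esub>)"
  "f \<oplus>\<^bsub>dual R M\<^esub> g = (\<lambda>x\<in>carrier M. f x \<oplus>\<^bsub>R\<^esub> g x)"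
  "a \<odot>\<^bsub>dual R M\<^esub> f = (\<lambda>x\<in>carrier M. a \<otimes>\<^bsub>R\<^esub> f x)"
  by (simp_all add: dual_def)

lemma mem_dual_iff:
  assumes "right_module R M"
  shows "g \<in> carrier (dual R M) \<longleftrightarrow> lin R M (regular_module R) g \<and> g \<in> extensional (carrier M)"
proof -
  interpret M: right_module R M by fact
  show ?thesis using assms right_module_regular[OF M.R.ring_axioms] by (auto simp: dual_simps lin_def)
qed

lemma dual_lin: "right_module R M \<Longrightarrow> g \<in> carrier (dual R M) \<Longrightarrow> lin R M (regular_module R) g"
  by (simp add: mem_dual_iff)

lemma restrict_mem_dual:
  assumes "lin R M (regular_module R) g"
  shows "restrict g (carrier M) \<in> carrier (dual R M)"
  using assms by (simp add: mem_dual_iff[OF lin_modules(1)[OF assms]] lin_cong_iff[of M "restrict g (carrier M)" g])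

lemma dual_ext:
  assumes "right_module R M" "g \<in> carrier (dual R M)" "h \<in> carrier (dual R M)"
    "\<And>x. x \<in> carrier M \<Longrightarrow> g x = h x"
  shows "g = h"
  by (rule extensionalityI[of _ "carrier M"]) (use assms in \<open>auto simp: mem_dual_iff\<close>)

lemma right_module_dual:
  assumes M: "right_module R M"
  shows "right_module (op_ring R) (dual R M)"
proof -
  interpret M: right_module R M by fact
  let ?D = "dual R M"
  note reg = right_module_regular[OF M.R.ring_axioms]
  have c: "g x \<in> carrier R" if "g \<in> carrier ?D" "x \<in> carrier M" for g x
    using lin_closed[OF dual_lin[OF M that(1)] that(2)] by simp
  have zc: "\<zero>\<^bsub>?D\<^esub> \<in> carrier ?D"
    using restrict_mem_dual[OF lin_const_zero[OF M reg]] by (simp add: dual_simps(2))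
  have ac: "g \<oplus>\<^bsub>?D\<^esub> h \<in> carrier ?D" if "g \<in> carrier ?D" "h \<in> carrier ?D" for g h
    using restrict_mem_dual[OF lin_sum[OF dual_lin[OF M that(1)] dual_lin[OF M that(2)]]]
    by (simp add: dual_simps(3))
  have nc: "(\<lambda>x\<in>carrier M. \<ominus>\<^bsub>R\<^esub> g x) \<in> carrier ?D" if "g \<in> carrier ?D" for g
    using restrict_mem_dual[OF lin_uminus[OF dual_lin[OF M that]]] by simp
  have sc: "a \<odot>\<^bsub>?D\<^esub> g \<in> carrier ?D" if a: "a \<in> carrier R" and g: "g \<in> carrier ?D" for a g
  proof -
    have "lin R M (regular_module R) (\<lambda>x. a \<otimes>\<^bsub>R\<^esub> g x)"
      by (rule linI[OF M reg])
        (use a c[OF g] in \<open>simp_all add: lin_add[OF dual_lin[OF M g]] lin_smult[OF dual_lin[OF M g]]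
           M.R.r_distr M.R.m_assoc\<close>)
    then show ?thesis using restrict_mem_dual by (fastforce simp: dual_simps(4))
  qed
  note e = dual_ext[OF M]
  show ?thesis
  proof (rule right_moduleI)
    show "abelian_group ?D"
    proof (rule abelian_groupI)
      fix f g h assume f: "f \<in> carrier ?D" and g: "g \<in> carrier ?D" and h: "h \<in> carrier ?D"
      show "f \<oplus>\<^bsub>?D\<^esub> g \<oplus>\<^bsub>?D\<^esub> h = f \<oplus>\<^bsub>?D\<^esub> (g \<oplus>\<^bsub>?D\<^esub> h)"
        by (rule e[OF ac[OF ac[OF f g] h] ac[OF f ac[OF g h]]])
          (simp add: dual_simps(3) c[OF f] c[OF g] c[OF h] M.R.a_assoc)
    next
      fix f g assume f: "f \<in> carrier ?D" and g: "g \<in> carrier ?D"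
      show "f \<oplus>\<^bsub>?D\<^esub> g = g \<oplus>\<^bsub>?D\<^esub> f"
        by (rule e[OF ac[OF f g] ac[OF g f]]) (simp add: dual_simps(3) c[OF f] c[OF g] M.R.a_comm)
    next
      fix f assume f: "f \<in> carrier ?D"
      show "\<zero>\<^bsub>?D\<^esub> \<oplus>\<^bsub>?D\<^esub> f = f"
        by (rule e[OF ac[OF zc f] f]) (simp add: dual_simps(2,3) c[OF f])
      show "\<exists>g\<in>carrier ?D. g \<oplus>\<^bsub>?D\<^esub> f = \<zero>\<^bsub>?D\<^esub>"
        by (rule bexI[OF _ nc[OF f]], rule e[OF ac[OF nc[OF f] f] zc])
          (simp add: dual_simps(2,3) c[OF f] M.R.l_neg)
    qed (use ac zc in simp_all)
  next
    fix a b f assume a: "a \<in> carrier (op_ring R)" and b: "b \<in> carrier (op_ring R)" and f: "f \<in> carrier ?D"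
    then have a': "a \<in> carrier R" and b': "b \<in> carrier R" by simp_all
    have ab: "a \<oplus>\<^bsub>R\<^esub> b \<in> carrier R" "b \<otimes>\<^bsub>R\<^esub> a \<in> carrier R" using a' b' by simp_all
    show "(a \<oplus>\<^bsub>op_ring R\<^esub> b) \<odot>\<^bsub>?D\<^esub> f = a \<odot>\<^bsub>?D\<^esub> f \<oplus>\<^bsub>?D\<^esub> b \<odot>\<^bsub>?D\<^esub> f"
      unfolding op_ring_simps
      by (rule e[OF sc[OF ab(1) f] ac[OF sc[OF a' f] sc[OF b' f]]])
        (simp add: dual_simps(3,4) c[OF f] a' b' M.R.l_distr)
    show "(a \<otimes>\<^bsub>op_ring R\<^esub> b) \<odot>\<^bsub>?D\<^esub> f = b \<odot>\<^bsub>?D\<^esub> (a \<odot>\<^bsub>?D\<^esub> f)"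
      unfolding op_ring_simps
      by (rule e[OF sc[OF ab(2) f] sc[OF b' sc[OF a' f]]])
        (simp add: dual_simps(3,4) c[OF f] a' b' M.R.m_assoc)
  next
    fix a f g assume a: "a \<in> carrier (op_ring R)" and f: "f \<in> carrier ?D" and g: "g \<in> carrier ?D"
    then have a': "a \<in> carrier R" by simp
    show "a \<odot>\<^bsub>?D\<^esub> (f \<oplus>\<^bsub>?D\<^esub> g) = a \<odot>\<^bsub>?D\<^esub> f \<oplus>\<^bsub>?D\<^esub> a \<odot>\<^bsub>?D\<^esub> g"
      by (rule e[OF sc[OF a' ac[OF f g]] ac[OF sc[OF a' f] sc[OF a' g]]])
        (simp add: dual_simps(3,4) c[OF f] c[OF g] a' M.R.r_distr)
  next
    fix f assume f: "f \<in> carrier ?D"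
    show "\<one>\<^bsub>op_ring R\<^esub> \<odot>\<^bsub>?D\<^esub> f = f"
      unfolding op_ring_simps
      by (rule e[OF sc[OF M.R.one_closed f] f]) (simp add: dual_simps(4) c[OF f])
  qed (use sc ring_op_ring[OF M.R.ring_axioms] in simp_all)
qed

lemma lin_eval:
  assumes M: "right_module R M" and x: "x \<in> carrier M"
  shows "lin (op_ring R) (dual R M) (regular_module (op_ring R)) (\<lambda>g. g x)"
proof -
  interpret M: right_module R M by fact
  show ?thesis
    by (rule linI[OF right_module_dual[OF M] right_module_regular[OF ring_op_ring[OF M.R.ring_axioms]]])
      (use x lin_closed[OF dual_lin[OF M] x] in \<open>simp_all add: dual_simps(3,4)\<close>)
qed

lemma lin_dual_map:
  assumes f: "lin R M N f"
  shows "lin (op_ring R) (dual R N) (dual R M) (dual_map M f)"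
proof -
  note M = lin_modules(1)[OF f] and N = lin_modules(2)[OF f]
  have c: "dual_map M f g \<in> carrier (dual R M)" if "g \<in> carrier (dual R N)" for g
    using restrict_mem_dual[OF lin_comp[OF f dual_lin[OF N that]]] by (simp add: dual_map_def)
  interpret D: right_module "op_ring R" "dual R N" by (rule right_module_dual[OF N])
  interpret D': right_module "op_ring R" "dual R M" by (rule right_module_dual[OF M])
  show ?thesis
  proof (rule linI[OF right_module_dual[OF N] right_module_dual[OF M] c])
    fix g h assume g: "g \<in> carrier (dual R N)" and h: "h \<in> carrier (dual R N)"
    show "dual_map M f (g \<oplus>\<^bsub>dual R N\<^esub> h) = dual_map M f g \<oplus>\<^bsub>dual R M\<^esub> dual_map M f h"
      by (rule dual_ext[OF M c[OF D.M.a_closed[OF g h]] D'.M.a_closed[OF c[OF g] c[OF h]]])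
        (simp add: dual_map_def dual_simps(3) lin_closed[OF f])
  next
    fix a g assume a: "a \<in> carrier (op_ring R)" and g: "g \<in> carrier (dual R N)"
    show "dual_map M f (a \<odot>\<^bsub>dual R N\<^esub> g) = a \<odot>\<^bsub>dual R M\<^esub> dual_map M f g"
      by (rule dual_ext[OF M c[OF D.right_smult_closed[OF a g]] D'.right_smult_closed[OF a c[OF g]]])
        (simp add: dual_map_def dual_simps(4) lin_closed[OF f])
  qed
qed

lemma finsum_op_ring [simp]: "finsum (op_ring R) f A = finsum R f A"
  by (simp add: finsum_def finprod_def)

lemma a_inv_op_ring [simp]: "\<ominus>\<^bsub>op_ring R\<^esub> x = \<ominus>\<^bsub>R\<^esub> x" "x \<ominus>\<^bsub>op_ring R\<^esub> y = x \<ominus>\<^bsub>R\<^esub> y"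
  by (simp_all add: a_inv_def m_inv_def a_minus_def)

lemma comb_regular_op: "comb (regular_module (op_ring R)) k r x = comb (regular_module R) k x r"
  by (simp add: comb_def)

text \<open>Vectors and functionals exchange roles: the vectors become evaluations on the
  dual.\<close>

lemma dual_basis_dual:
  assumes P: "right_module R P" and b: "dual_basis R P k x f"
  shows "dual_basis (op_ring R) (dual R P) k (\<lambda>i. restrict (f i) (carrier P)) (\<lambda>i g. g (x i))"
proof -
  have f: "\<And>i. i < k \<Longrightarrow> lin R P (regular_module R) (f i)" and x: "\<And>i. i < k \<Longrightarrow> x i \<in> carrier P"
    and bb: "\<And>y. y \<in> carrier P \<Longrightarrow> comb P k (\<lambda>i. f i y) x = y"
    using b by (simp_all add: dual_basis_def)
  note fc = restrict_mem_dual[OF f] and D = right_module_dual[OF P]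
  interpret P: right_module R P by fact
  note reg = right_module_regular[OF P.R.ring_axioms]
  let ?f = "\<lambda>i. restrict (f i) (carrier P)"
  have "comb (dual R P) k (\<lambda>i. g (x i)) ?f = g" if g: "g \<in> carrier (dual R P)" for g
  proof (rule dual_ext[OF P _ g])
    have gc: "g (x i) \<in> carrier R" if "i < k" for i
      using lin_closed[OF dual_lin[OF P g] x[OF that]] by simp
    show "comb (dual R P) k (\<lambda>i. g (x i)) ?f \<in> carrier (dual R P)"
      by (rule comb_closed[OF D]) (use gc fc in simp_all)
    fix y assume y: "y \<in> carrier P"
    have "comb (dual R P) k (\<lambda>i. g (x i)) ?f y = comb (regular_module (op_ring R)) k (\<lambda>i. g (x i)) (\<lambda>i. ?f i y)"
      by (rule lin_comb[OF lin_eval[OF P y]]) (use gc fc in simp_all)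
    also have "\<dots> = comb (regular_module R) k (\<lambda>i. f i y) (\<lambda>i. g (x i))"
      using y by (simp add: comb_regular_op)
    also have "\<dots> = g (comb P k (\<lambda>i. f i y) x)"
      by (rule lin_comb[OF dual_lin[OF P g], symmetric]) (use lin_closed[OF f y] x in simp_all)
    finally show "comb (dual R P) k (\<lambda>i. g (x i)) ?f y = g y" using bb[OF y] by simp
  qed
  then show ?thesis using fc x lin_eval[OF P] by (simp add: dual_basis_def)
qed

lemma fg_projective_dual:
  assumes "fg_projective R P"
  shows "fg_projective (op_ring R) (dual R P)"
  using assms dual_basis_dual right_module_dual unfolding fg_projective_iff by blast

text \<open>Each side represents all functionals on the other, and faithfully. The clauses come in
  pairs exchanged by passing to the opposite ring, which is why one notion serves for a projective
  module paired with its dual in either order.\<close>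

definition perfect ::
    "('a, 'r) ring_scheme \<Rightarrow> ('a, 'm) module \<Rightarrow> ('a, 'n) module \<Rightarrow> ('m \<Rightarrow> 'n \<Rightarrow> 'a) \<Rightarrow> bool" where
  "perfect R G W B \<longleftrightarrow> right_module R G \<and> right_module (op_ring R) W \<and>
     (\<forall>w\<in>carrier W. lin R G (regular_module R) (\<lambda>x. B x w)) \<and>
     (\<forall>x\<in>carrier G. lin (op_ring R) W (regular_module (op_ring R)) (B x)) \<and>
     (\<forall>f. lin R G (regular_module R) f \<longrightarrow> (\<exists>w\<in>carrier W. \<forall>x\<in>carrier G. f x = B x w)) \<and>
     (\<forall>f. lin (op_ring R) W (regular_module (op_ring R)) f \<longrightarrow> (\<exists>x\<in>carrier G. \<forall>w\<in>carrier W. f w = B x w)) \<and>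
     (\<forall>w\<in>carrier W. (\<forall>x\<in>carrier G. B x w = \<zero>\<^bsub>R\<^esub>) \<longrightarrow> w = \<zero>\<^bsub>W\<^esub>) \<and>
     (\<forall>x\<in>carrier G. (\<forall>w\<in>carrier W. B x w = \<zero>\<^bsub>R\<^esub>) \<longrightarrow> x = \<zero>\<^bsub>G\<^esub>)"

lemma perfectD:
  assumes "perfect R G W B"
  shows "right_module R G" "right_module (op_ring R) W"
    "w \<in> carrier W \<Longrightarrow> lin R G (regular_module R) (\<lambda>x. B x w)"
    "x \<in> carrier G \<Longrightarrow> lin (op_ring R) W (regular_module (op_ring R)) (B x)"
    "lin R G (regular_module R) f \<Longrightarrow> \<exists>w\<in>carrier W. \<forall>x\<in>carrier G. f x = B x w"
    "lin (op_ring R) W (regular_module (op_ring R)) h \<Longrightarrow> \<exists>x\<in>carrier G. \<forall>w\<in>carrier W. h w = B x w"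
    "w \<in> carrier W \<Longrightarrow> (\<And>x. x \<in> carrier G \<Longrightarrow> B x w = \<zero>\<^bsub>R\<^esub>) \<Longrightarrow> w = \<zero>\<^bsub>W\<^esub>"
    "x \<in> carrier G \<Longrightarrow> (\<And>w. w \<in> carrier W \<Longrightarrow> B x w = \<zero>\<^bsub>R\<^esub>) \<Longrightarrow> x = \<zero>\<^bsub>G\<^esub>"
  using assms unfolding perfect_def by blast+

lemma perfect_swap:
  assumes "perfect R G W B"
  shows "perfect (op_ring R) W G (\<lambda>w x. B x w)"
  using assms unfolding perfect_def op_ring_simps by blast

lemma perfect_eqI:
  assumes "perfect R G W B" "w \<in> carrier W" "w' \<in> carrier W" "\<And>x. x \<in> carrier G \<Longrightarrow> B x w = B x w'"
  shows "w = w'"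
proof -
  note D = perfectD[OF assms(1)]
  interpret G: right_module R G by (rule D(1))
  interpret W: right_module "op_ring R" W by (rule D(2))
  have "B x (w \<ominus>\<^bsub>W\<^esub> w') = \<zero>\<^bsub>R\<^esub>" if "x \<in> carrier G" for x
    using lin_minus[OF D(4)[OF that] assms(2,3)] lin_closed[OF D(4)[OF that] assms(2)] assms(4)[OF that]
      lin_closed[OF D(4)[OF that] assms(3)]
    by (simp add: G.R.minus_eq_zero_iff)
  then have "w \<ominus>\<^bsub>W\<^esub> w' = \<zero>\<^bsub>W\<^esub>" using D(7) assms(2,3) by simp
  then show ?thesis using assms(2,3) W.M.minus_eq_zero_iff by simp
qed

text \<open>Reflexivity of finitely generated projective modules, made explicit by a dual
  basis.\<close>

lemma perfect_dual:
  assumes fP: "fg_projective R P"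
  shows "perfect R P (dual R P) (\<lambda>x g. g x)"
proof -
  obtain k x f where P: "right_module R P" and b: "dual_basis R P k x f"
    using fP fg_projective_iff by blast
  have f: "\<And>i. i < k \<Longrightarrow> lin R P (regular_module R) (f i)" and x: "\<And>i. i < k \<Longrightarrow> x i \<in> carrier P"
    and bb: "\<And>y. y \<in> carrier P \<Longrightarrow> comb P k (\<lambda>i. f i y) x = y"
    using b by (simp_all add: dual_basis_def)
  interpret P: right_module R P by fact
  note D = right_module_dual[OF P]
  let ?f = "\<lambda>i. restrict (f i) (carrier P)"
  note fc = restrict_mem_dual[OF f]
  have bd: "comb (dual R P) k (\<lambda>i. g (x i)) ?f = g" if "g \<in> carrier (dual R P)" for g
    using dual_basis_dual[OF P b] that by (simp add: dual_basis_def)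
  have 1: "\<exists>y\<in>carrier P. \<forall>g\<in>carrier (dual R P). h g = g y"
    if h: "lin (op_ring R) (dual R P) (regular_module (op_ring R)) h" for h
  proof -
    have hc: "h (?f i) \<in> carrier R" if "i < k" for i using lin_closed[OF h fc[OF that]] by simp
    show ?thesis
    proof (intro bexI ballI)
      \<comment> \<open>If \<open>h\<close> is evaluation at an element, the dual basis leaves only
        this candidate, with coordinates \<open>h (?f i)\<close>.\<close>
      show yc: "comb P k (\<lambda>i. h (?f i)) x \<in> carrier P"
        by (rule comb_closed[OF P]) (use hc x in simp_all)
      fix g assume g: "g \<in> carrier (dual R P)"
      have gc: "g (x i) \<in> carrier R" if "i < k" for i
        using lin_closed[OF dual_lin[OF P g] x[OF that]] by simp
      have "h g = h (comb (dual R P) k (\<lambda>i. g (x i)) ?f)" using bd[OF g] by simp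
      also have "\<dots> = comb (regular_module (op_ring R)) k (\<lambda>i. g (x i)) (\<lambda>i. h (?f i))"
        by (rule lin_comb[OF h]) (use gc fc in simp_all)
      also have "\<dots> = g (comb P k (\<lambda>i. h (?f i)) x)"
        unfolding comb_regular_op
        by (rule lin_comb[OF dual_lin[OF P g], symmetric]) (use hc x in simp_all)
      finally show "h g = g (comb P k (\<lambda>i. h (?f i)) x)" .
    qed
  qed
  have 2: "\<exists>w\<in>carrier (dual R P). \<forall>y\<in>carrier P. g y = w y" if "lin R P (regular_module R) g" for g
    by (rule bexI[OF _ restrict_mem_dual[OF that]]) simp
  have 3: "g = \<zero>\<^bsub>dual R P\<^esub>" if "g \<in> carrier (dual R P)" "\<forall>y\<in>carrier P. g y = \<zero>\<^bsub>R\<^esub>" for g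
  proof -
    interpret D: right_module "op_ring R" "dual R P" by (rule D)
    show ?thesis by (rule dual_ext[OF P that(1) D.M.zero_closed]) (use that(2) in \<open>simp add: dual_simps(2)\<close>)
  qed
  have 4: "y = \<zero>\<^bsub>P\<^esub>" if y: "y \<in> carrier P" and z: "\<forall>w\<in>carrier (dual R P). w y = \<zero>\<^bsub>R\<^esub>" for y
  proof -
    have "f i y = \<zero>\<^bsub>R\<^esub>" if "i < k" for i using z fc[OF that] y by fastforce
    then have "comb P k (\<lambda>i. f i y) x = \<zero>\<^bsub>P\<^esub>"
      by (intro comb_zero[OF P]) (use x in simp_all)
    then show ?thesis using bb[OF y] by simp
  qed
  show ?thesis
    unfolding perfect_def
    using P D lin_eval[OF P] dual_lin[OF P] 1 2 3 4 by (intro conjI ballI allI impI) simp_all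
qed

text \<open>For fixed \<open>w\<close> the functional \<open>\<lambda>x. B' (c x) w\<close> has a
  representative in \<open>W\<close>; since representatives are unique, the choice is linear in
  \<open>w\<close>.\<close>

lemma transpose_exists:
  assumes p: "perfect R G W B" and p': "perfect R G' W' B'" and c: "lin R G G' c"
  shows "\<exists>c'. lin (op_ring R) W' W c' \<and> (\<forall>x\<in>carrier G. \<forall>w\<in>carrier W'. B' (c x) w = B x (c' w))"
proof -
  note D = perfectD[OF p] and D' = perfectD[OF p']
  have "\<exists>v. v \<in> carrier W \<and> (\<forall>x\<in>carrier G. B' (c x) w = B x v)" if "w \<in> carrier W'" for w
    using D(5)[OF lin_comp[OF c D'(3)[OF that]]] by blast
  then have "\<exists>c'. \<forall>w\<in>carrier W'. c' w \<in> carrier W \<and> (\<forall>x\<in>carrier G. B' (c x) w = B x (c' w))"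
    by (intro bchoice) blast
  then obtain c' where c': "\<And>w. w \<in> carrier W' \<Longrightarrow> c' w \<in> carrier W"
    "\<And>x w. x \<in> carrier G \<Longrightarrow> w \<in> carrier W' \<Longrightarrow> B' (c x) w = B x (c' w)" by blast
  interpret W: right_module "op_ring R" W by (rule D(2))
  interpret W': right_module "op_ring R" W' by (rule D'(2))
  have "lin (op_ring R) W' W c'"
  proof (rule linI[OF D'(2) D(2) c'(1)])
    fix v w assume v: "v \<in> carrier W'" and w: "w \<in> carrier W'"
    show "c' (v \<oplus>\<^bsub>W'\<^esub> w) = c' v \<oplus>\<^bsub>W\<^esub> c' w"
    proof (rule perfect_eqI[OF p])
      fix x assume x: "x \<in> carrier G"
      note cx = lin_closed[OF c x]
      show "B x (c' (v \<oplus>\<^bsub>W'\<^esub> w)) = B x (c' v \<oplus>\<^bsub>W\<^esub> c' w)"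
        using v w x by (simp flip: c'(2) add: lin_add[OF D(4)[OF x]] lin_add[OF D'(4)[OF cx]] c'(1))
    qed (use v w c'(1) in simp_all)
  next
    fix a w assume a: "a \<in> carrier (op_ring R)" and w: "w \<in> carrier W'"
    show "c' (a \<odot>\<^bsub>W'\<^esub> w) = a \<odot>\<^bsub>W\<^esub> c' w"
    proof (rule perfect_eqI[OF p])
      fix x assume x: "x \<in> carrier G"
      note cx = lin_closed[OF c x]
      show "B x (c' (a \<odot>\<^bsub>W'\<^esub> w)) = B x (a \<odot>\<^bsub>W\<^esub> c' w)"
        using w x by (simp flip: c'(2) add: lin_smult[OF D(4)[OF x] a] lin_smult[OF D'(4)[OF cx] a]
            c'(1) W'.right_smult_closed[OF a])
    qed (use a w c'(1) W.right_smult_closed W'.right_smult_closed in blast)+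
  qed
  with c'(2) show ?thesis by blast
qed


section \<open>Resolutions\<close>

text \<open>The content of \<open>projective_resolution\<close> without the record, so that
  complexes given by separate families of modules and maps can be compared with the chosen
  ones.\<close>

definition resolves where
  "resolves R C d M e \<longleftrightarrow> acyclic_complex R C d \<and> lin R (C 0) M e \<and> e ` carrier (C 0) = carrier M \<and>
     {x \<in> carrier (C 0). e x = \<zero>\<^bsub>M\<^esub>} = d 1 ` carrier (C 1)"

lemma resolvesD:
  assumes "resolves R C d M e"
  shows "acyclic_complex R C d" "proj_complex R C d" "lin R (C 0) M e" "e ` carrier (C 0) = carrier M"
    "x \<in> carrier (C 0) \<Longrightarrow> e x = \<zero>\<^bsub>M\<^esub> \<longleftrightarrow> x \<in> d 1 ` carrier (C 1)" "right_module R M"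
    "x \<in> carrier (C 1) \<Longrightarrow> e (d 1 x) = \<zero>\<^bsub>M\<^esub>"
proof -
  note * = assms[unfolded resolves_def]
  show "acyclic_complex R C d" "proj_complex R C d" "lin R (C 0) M e" "e ` carrier (C 0) = carrier M"
    using * acyclic_proj by blast+
  show "x \<in> carrier (C 0) \<Longrightarrow> e x = \<zero>\<^bsub>M\<^esub> \<longleftrightarrow> x \<in> d 1 ` carrier (C 1)"
    "x \<in> carrier (C 1) \<Longrightarrow> e (d 1 x) = \<zero>\<^bsub>M\<^esub>" using * by blast+
  show "right_module R M" using * lin_modules(2) by blast
qed

lemma resolves_iff:
  assumes "right_module R M"
  shows "projective_resolution R M X \<longleftrightarrow> resolves R (cx X) (bd X) M (aug X)"
proof
  assume p: "projective_resolution R M X"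
  then have P: "\<And>i. fg_projective R (cx X i)" and b: "\<And>i. bd X (Suc i) \<in> mod_hom R (cx X (Suc i)) (cx X i)"
    and e: "\<And>i. {x \<in> carrier (cx X (Suc i)). bd X (Suc i) x = \<zero>\<^bsub>cx X i\<^esub>} =
            bd X (Suc (Suc i)) ` carrier (cx X (Suc (Suc i)))"
    by (simp_all add: projective_resolution_def)
  have "lin R (cx X (Suc i)) (cx X i) (bd X (Suc i))" for i
    using P b by (simp add: lin_def fg_projective_module)
  then have "acyclic_complex R (cx X) (bd X)"
    using P e unfolding acyclic_complex_def proj_complex_def by blast
  moreover have "lin R (cx X 0) M (aug X)"
    using P p assms by (simp add: lin_def fg_projective_module projective_resolution_def)
  ultimately show "resolves R (cx X) (bd X) M (aug X)"
    using p by (simp add: resolves_def projective_resolution_def)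
next
  assume p: "resolves R (cx X) (bd X) M (aug X)"
  note D = proj_complexD[OF resolvesD(2)[OF p]]
  have "{x \<in> carrier (cx X (Suc i)). bd X (Suc i) x = \<zero>\<^bsub>cx X i\<^esub>} =
            bd X (Suc (Suc i)) ` carrier (cx X (Suc (Suc i)))" for i
    using acyclic_exact[OF resolvesD(1)[OF p]] D(4) lin_closed[OF D(3)] by fastforce
  then show "projective_resolution R M X"
    using D(1) lin_mod_hom[OF D(3)] lin_mod_hom[OF resolvesD(3)[OF p]] p
    by (simp add: projective_resolution_def resolves_def)
qed

text \<open>Projectivity and the surjection \<open>e'\<close> start the lift, and exactness of the
  target continues it.\<close>

lemma lift_exists:
  assumes C: "proj_complex R C d" and e: "lin R (C 0) M e" "\<And>x. x \<in> carrier (C 1) \<Longrightarrow> e (d 1 x) = \<zero>\<^bsub>M\<^esub>"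
    and C': "resolves R C' d' N e'" and f: "lin R M N f"
  shows "\<exists>F. chain_map R C d C' d' F \<and> (\<forall>x\<in>carrier (C 0). e' (F 0 x) = f (e x))"
proof -
  have "f (e x) \<in> e' ` carrier (C' 0)" if "x \<in> carrier (C 0)" for x
    using that lin_closed[OF f] lin_closed[OF e(1)] resolvesD(4)[OF C'] by blast
  then obtain f0 where f0: "lin R (C 0) (C' 0) f0" "\<And>x. x \<in> carrier (C 0) \<Longrightarrow> e' (f0 x) = f (e x)"
    using projective_lift[OF proj_complexD(1)[OF C] lin_comp[OF e(1) f] resolvesD(3)[OF C']] by blast
  have "f0 (d 1 x) \<in> d' 1 ` carrier (C' 1)" if x: "x \<in> carrier (C 1)" for x
  proof -
    have dx: "d 1 x \<in> carrier (C 0)" using lin_closed[OF proj_complexD(3)[OF C, of 0]] x by simp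
    have "e' (f0 (d 1 x)) = \<zero>\<^bsub>N\<^esub>" using f0(2)[OF dx] e(2)[OF x] lin_zero[OF f] by simp
    then show ?thesis using resolvesD(5)[OF C' lin_closed[OF f0(1) dx]] by simp
  qed
  then obtain F where "chain_map R C d C' d' F" "F 0 = f0"
    using chain_map_extend[OF C resolvesD(1)[OF C'] f0(1)] by blast
  with f0(2) show ?thesis by blast
qed

text \<open>Elements with equal augmentation differ by a boundary. This supplies the degree zero
  hypothesis of \<open>homotopic_coh_eq\<close> for two lifts of one homomorphism.\<close>

lemma lifts_homotopic:
  assumes C': "resolves R C' d' N e'" and f: "lin R A (C' 0) f" and g: "lin R A (C' 0) g"
    and "x \<in> carrier A" "e' (f x) = e' (g x)"
  shows "f x \<ominus>\<^bsub>C' 0\<^esub> g x \<in> d' 1 ` carrier (C' 1)"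
proof -
  note r = resolvesD[OF C']
  interpret N: right_module R N by (rule r(6))
  interpret N': right_module R "C' 0" by (rule proj_complexD[OF r(2)])
  note fx = lin_closed[OF f assms(4)] and gx = lin_closed[OF g assms(4)]
  have "e' (f x \<ominus>\<^bsub>C' 0\<^esub> g x) = \<zero>\<^bsub>N\<^esub>"
    using lin_minus[OF r(3) fx gx] assms(5) lin_closed[OF r(3) gx] by (simp add: N.M.minus_eq_zero_iff)
  then show ?thesis using r(5) N'.M.minus_closed[OF fx gx] by blast
qed

text \<open>A lift of the identity in the opposite direction is an inverse up to homotopy.\<close>

lemma resolution_equivalence:
  assumes C: "resolves R C d M e" and C': "resolves R C' d' M e'"
    and F: "chain_map R C d C' d' F" "\<And>x. x \<in> carrier (C 0) \<Longrightarrow> e' (F 0 x) = e x"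
  shows "coh_inj R C d C' d' k (F k)" "coh_surj R C d C' d' k (F k)"
proof -
  note r = resolvesD[OF C] and r' = resolvesD[OF C']
  obtain G where G: "chain_map R C' d' C d G" "\<And>x. x \<in> carrier (C' 0) \<Longrightarrow> e (G 0 x) = e' x"
    using lift_exists[OF r'(2,3,7) C lin_id[OF r(6)]] by blast
  have "coh_eq R C d C d k (\<lambda>x. G k (F k x)) (\<lambda>x. x)"
    by (rule homotopic_coh_eq[OF r(2,1) chain_map_comp[OF F(1) G(1)] chain_map_id[OF r(2)]],
        rule lifts_homotopic[OF C chain_mapD(1)[OF chain_map_comp[OF F(1) G(1)], where i=0] chain_mapD(1)[OF chain_map_id[OF r(2)], where i=0]])
      (use F(2) G(2) lin_closed[OF chain_mapD(1)[OF F(1)]] in simp_all)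
  moreover have "coh_eq R C' d' C' d' k (\<lambda>x. F k (G k x)) (\<lambda>x. x)"
    by (rule homotopic_coh_eq[OF r'(2,1) chain_map_comp[OF G(1) F(1)] chain_map_id[OF r'(2)]],
        rule lifts_homotopic[OF C' chain_mapD(1)[OF chain_map_comp[OF G(1) F(1)], where i=0] chain_mapD(1)[OF chain_map_id[OF r'(2)], where i=0]])
      (use F(2) G(2) lin_closed[OF chain_mapD(1)[OF G(1)]] in simp_all)
  ultimately show "coh_inj R C d C' d' k (F k)" "coh_surj R C d C' d' k (F k)"
    using coh_equivalence[OF r(2) r'(2) F(1) G(1)] by blast+
qed

lemma coh_zero_independent:
  assumes C: "resolves R C d M e" and C': "resolves R C' d' M e'"
  shows "coh_zero R C d k \<longleftrightarrow> coh_zero R C' d' k"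
proof -
  note r = resolvesD[OF C]
  obtain F where F: "chain_map R C d C' d' F" "\<And>x. x \<in> carrier (C 0) \<Longrightarrow> e' (F 0 x) = e x"
    using lift_exists[OF r(2,3,7) C' lin_id[OF r(6)]] by blast
  show ?thesis
    using coh_zero_target[OF r(2) F(1) resolution_equivalence(1)[OF C C' F]]
      coh_zero_source[OF r(2) F(1) resolution_equivalence(2)[OF C C' F]] by blast
qed

section \<open>Existence of resolutions within a prescribed type\<close>

definition enough_projectives :: "('a, 'r) ring_scheme \<Rightarrow> 'q itself \<Rightarrow> bool" where
  "enough_projectives R T \<longleftrightarrow> (\<forall>k. \<exists>(U :: ('a, 'q) module) p. fg_projective R U \<and>
     lin R U (free_module R k) p \<and> p ` carrier U = carrier (free_module R k))"

lemma enough_projectives_free: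
  assumes "ring (R :: ('a, 'r) ring_scheme)"
  shows "enough_projectives R TYPE(nat \<Rightarrow> 'a)"
  unfolding enough_projectives_def
  using fg_projective_free[OF assms] lin_id[OF right_module_free[OF assms]] by (metis image_ident)

text \<open>Resolutions of transposes start with duals of modules of type
  \<open>nat \<Rightarrow> 'a\<close>, so all their terms consist of functionals on vectors. Duals
  of free modules are the covers available in that type.\<close>

lemma enough_projectives_dual:
  fixes R :: "('a, 'r) ring_scheme"
  assumes R: "ring R"
  shows "enough_projectives (op_ring R) TYPE((nat \<Rightarrow> 'a) \<Rightarrow> 'a)"
  unfolding enough_projectives_def
proof (intro allI exI conjI)
  fix k
  note F = right_module_free[OF R, of k] and reg = right_module_regular[OF R]
  let ?U = "dual R (free_module R k)" and ?S = "op_ring R"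
  let ?p = "\<lambda>g. \<lambda>i\<in>{..<k}. g (unit_vec R k i)"
  show "fg_projective ?S ?U" by (rule fg_projective_dual[OF fg_projective_free[OF R]])
  show p: "lin ?S ?U (free_module ?S k) ?p"
    by (rule lin_to_free[OF right_module_dual[OF F] lin_eval[OF F unit_vec_closed[OF R]]])
  have "v \<in> ?p ` carrier ?U" if v: "v \<in> carrier (free_module ?S k)" for v
  proof -
    have vc: "v i \<in> carrier (regular_module R)" if "i < k" for i
      using lin_closed[OF lin_coordinate[OF ring_op_ring[OF R] that] v] by simp
    \<comment> \<open>The linear extension of the prescribed values \<open>v\<close> at the unit
      vectors.\<close>
    let ?g = "restrict (\<lambda>x. comb (regular_module R) k x v) (carrier (free_module R k))"
    have g: "?g \<in> carrier ?U" by (rule restrict_mem_dual[OF lin_from_free[OF reg vc]])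
    have "?p ?g = v"
    proof (rule free_module_ext[OF lin_closed[OF p g] v])
      fix i assume i: "i < k"
      have "?p ?g i = ?g (unit_vec R k i)" using i by (simp only: restrict_apply lessThan_iff if_True)
      also have "\<dots> = comb (regular_module R) k (unit_vec R k i) v"
        using unit_vec_closed[OF R, of k i] by (simp only: restrict_apply if_True)
      also have "\<dots> = v i" by (rule comb_of_unit_vec[OF reg vc i])
      finally show "?p ?g i = v i" .
    qed
    moreover have "?p ?g \<in> ?p ` carrier ?U" using g by (rule imageI)
    ultimately show ?thesis by (simp only:)
  qed
  then show "?p ` carrier ?U = carrier (free_module ?S k)" using lin_closed[OF p] by blast
qed

lemma projective_cover:
  fixes R :: "('a, 'r) ring_scheme"
  assumes "enough_projectives R TYPE('q)" "fgen R N"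
  shows "\<exists>(U :: ('a, 'q) module) e. fg_projective R U \<and> lin R U N e \<and> e ` carrier U = carrier N"
proof -
  obtain k e where e: "lin R (free_module R k) N e" "e ` carrier (free_module R k) = carrier N"
    by (rule fgenE[OF assms(2)])
  obtain U :: "('a, 'q) module" and p where U: "fg_projective R U" "lin R U (free_module R k) p"
    "p ` carrier U = carrier (free_module R k)"
    using assms(1) unfolding enough_projectives_def by blast
  have "(\<lambda>x. e (p x)) ` carrier U = carrier N" using e(2) U(3) by (metis image_image)
  with U(1) lin_comp[OF U(2) e(1)] show ?thesis by blast
qed

text \<open>Resolutions of transposes have to begin with a given dual map. The first differential is
  therefore prescribed, and each further term covers the kernel before it.\<close>

lemma acyclic_extend:
  fixes P0 P1 :: "('a, 'q) module"
  assumes noeth: "right_noetherian R" and enough: "enough_projectives R TYPE('q)"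
    and P: "fg_projective R P0" "fg_projective R P1" and \<delta>: "lin R P1 P0 \<delta>"
  shows "\<exists>C d. acyclic_complex R C d \<and> C 0 = P0 \<and> C 1 = P1 \<and> d 1 = \<delta>"
proof -
  \<comment> \<open>The state at stage \<open>n\<close> is the differential \<open>f\<close> from
    \<open>U\<close> to \<open>V\<close> in degree \<open>Suc n\<close>; \<open>Q\<close> says that
    the next differential starts where this one does and has its kernel as image.\<close>
  define S where "S n s \<longleftrightarrow> (case s of (U, V, f) \<Rightarrow> fg_projective R U \<and> fg_projective R V \<and> lin R U V f \<and>
    (n = 0 \<longrightarrow> U = P1 \<and> V = P0 \<and> f = \<delta>))" for n :: nat and s :: "('a, 'q) module \<times> ('a, 'q) module \<times> ('q \<Rightarrow> 'q)"
  define Q where "Q n s s' \<longleftrightarrow> (case (s, s') of ((U, V, f), (U', V', f')) \<Rightarrow> V' = U \<and>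
    f' ` carrier U' = {x \<in> carrier U. f x = \<zero>\<^bsub>V\<^esub>})"
    for n :: nat and s s' :: "('a, 'q) module \<times> ('a, 'q) module \<times> ('q \<Rightarrow> 'q)"
  have "\<exists>s. \<forall>n. S n (s n) \<and> Q n (s n) (s (Suc n))"
  proof (rule dependent_nat_choice)
    show "\<exists>s. S 0 s" using P \<delta> by (intro exI[of _ "(P1, P0, \<delta>)"]) (simp add: S_def)
    fix s n assume s: "S n s"
    obtain U V f where Uf: "s = (U, V, f)" by (cases s)
    with s have U: "fg_projective R U" "fg_projective R V" "lin R U V f" by (simp_all add: S_def)
    let ?K = "{x \<in> carrier U. f x = \<zero>\<^bsub>V\<^esub>}"
    obtain U' :: "('a, 'q) module" and e where U': "fg_projective R U'" "lin R U' (U\<lparr>carrier := ?K\<rparr>) e"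
      "e ` carrier U' = ?K"
      using projective_cover[OF enough noetherian_kernel[OF noeth U(1,3)]] by auto
    note i = lin_inclusion[OF fg_projective_module[OF U(1)] submodule_kernel[OF U(3)]]
    show "\<exists>s'. S (Suc n) s' \<and> Q n s s'"
      by (rule exI[of _ "(U', U, e)"]) (use U U'(1,3) lin_comp[OF U'(2) i] Uf in \<open>simp add: S_def Q_def\<close>)
  qed
  then obtain s where s: "\<And>n. S n (s n)" "\<And>n. Q n (s n) (s (Suc n))" by blast
  define C where "C n = (case n of 0 \<Rightarrow> P0 | Suc m \<Rightarrow> fst (s m))" for n
  define d where "d n = snd (snd (s (n - 1)))" for n
  have sC: "s n = (C (Suc n), C n, d (Suc n))" for n
  proof (cases n)
    case 0
    then show ?thesis using s(1)[of 0] by (auto simp: S_def C_def d_def split: prod.splits)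
  next
    case (Suc m)
    then show ?thesis using s(2)[of m] by (auto simp: Q_def C_def d_def split: prod.splits)
  qed
  have e: "d (Suc (Suc n)) ` carrier (C (Suc (Suc n))) = {x \<in> carrier (C (Suc n)). d (Suc n) x = \<zero>\<^bsub>C n\<^esub>}" for n
    using s(2)[of n] sC[of n] sC[of "Suc n"] by (simp add: Q_def)
  have "d (Suc n) (d (Suc (Suc n)) x) = \<zero>\<^bsub>C n\<^esub>" if "x \<in> carrier (C (Suc (Suc n)))" for n x
    using e[of n] that by blast
  then have "proj_complex R C d"
    unfolding proj_complex_def using s(1) sC by (simp add: S_def)
  then have "acyclic_complex R C d" using e by (auto simp: acyclic_complex_def)
  moreover have "C 0 = P0" "C 1 = P1" "d 1 = \<delta>"
    using s(1)[of 0] sC[of 0] by (simp_all add: S_def)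
  ultimately show ?thesis by blast
qed

lemma resolution_exists:
  fixes R :: "('a, 'r) ring_scheme"
  assumes noeth: "right_noetherian R" and enough: "enough_projectives R TYPE('q)" and M: "fgen R M"
  shows "\<exists>(C :: nat \<Rightarrow> ('a, 'q) module) d e. resolves R C d M e"
proof -
  obtain P0 :: "('a, 'q) module" and e where P0: "fg_projective R P0" "lin R P0 M e" "e ` carrier P0 = carrier M"
    using projective_cover[OF enough M] by blast
  let ?K = "{x \<in> carrier P0. e x = \<zero>\<^bsub>M\<^esub>}"
  obtain P1 :: "('a, 'q) module" and \<delta> where P1: "fg_projective R P1" "lin R P1 (P0\<lparr>carrier := ?K\<rparr>) \<delta>"
    "\<delta> ` carrier P1 = ?K"
    using projective_cover[OF enough noetherian_kernel[OF noeth P0(1,2)]] by auto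
  note i = lin_inclusion[OF fg_projective_module[OF P0(1)] submodule_kernel[OF P0(2)]]
  obtain C d where "acyclic_complex R C d" "C 0 = P0" "C 1 = P1" "d 1 = \<delta>"
    using acyclic_extend[OF noeth enough P0(1) P1(1) lin_comp[OF P1(2) i]] by blast
  then have "resolves R C d M e" using P0 P1(3) by (simp add: resolves_def)
  then show ?thesis by blast
qed

text \<open>The choice behind \<open>resol\<close> is inhabited because all free modules of finite
  rank live in the type \<open>nat \<Rightarrow> 'a\<close>.\<close>

lemma resol_resolves:
  fixes R :: "('a, 'r) ring_scheme"
  assumes "right_noetherian R" "fgen R M"
  shows "resolves R (cx (resol R M)) (bd (resol R M)) M (aug (resol R M))"
proof -
  note M = fgen_module[OF assms(2)]
  interpret M: right_module R M by (rule M)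
  obtain C :: "nat \<Rightarrow> ('a, nat \<Rightarrow> 'a) module" and d e where "resolves R C d M e"
    using resolution_exists[OF assms(1) enough_projectives_free[OF M.R.ring_axioms] assms(2)] by blast
  then have "projective_resolution R M \<lparr>cx = C, bd = d, aug = e\<rparr>" by (simp add: resolves_iff[OF M])
  then have "projective_resolution R M (resol R M)" unfolding resol_def by (rule someI)
  then show ?thesis by (simp add: resolves_iff[OF M])
qed

section \<open>Quotient modules\<close>

lemma coset_restrict [simp]: "H +>\<^bsub>M\<lparr>carrier := Z\<rparr>\<^esub> x = H +>\<^bsub>M\<^esub> x"
  by (simp add: a_r_coset_def r_coset_def)

lemma quot_map_restrict [simp]: "quot_map (M\<lparr>carrier := Z\<rparr>) K h = quot_map M K h"
  by (simp add: quot_map_def fun_eq_iff)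

lemma quot_module_simps:
  "carrier (quot_module M H) = (\<lambda>x. H +>\<^bsub>M\<^esub> x) ` carrier M"
  "\<zero>\<^bsub>quot_module M H\<^esub> = H"
  "A \<oplus>\<^bsub>quot_module M H\<^esub> B = A <+>\<^bsub>M\<^esub> B"
  "a \<odot>\<^bsub>quot_module M H\<^esub> A = (\<Union>x\<in>A. H +>\<^bsub>M\<^esub> (a \<odot>\<^bsub>M\<^esub> x))"
  by (auto simp: quot_module_def A_RCOSETS_def')

lemma abelian_subgroup_submodule:
  assumes "right_module R M" "submodule H R M"
  shows "abelian_subgroup H M"
proof -
  interpret M: right_module R M by fact
  show ?thesis
    using assms(2) by (intro abelian_subgroupI3 additive_subgroupI)
      (simp_all add: submodule_def M.M.abelian_group_axioms)
qed

context
  fixes R :: "('a, 'r) ring_scheme" and M :: "('a, 'm) module" and H :: "'m set"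
  assumes M: "right_module R M" and H: "submodule H R M"
begin

interpretation M: right_module R M by (rule M)

interpretation H: abelian_subgroup H M by (rule abelian_subgroup_submodule[OF M H])

lemma mem_coset_iff:
  assumes x: "x \<in> carrier M" and y: "y \<in> carrier M"
  shows "y \<in> H +>\<^bsub>M\<^esub> x \<longleftrightarrow> y \<ominus>\<^bsub>M\<^esub> x \<in> H"
proof -
  have "y \<in> H +>\<^bsub>M\<^esub> x \<longleftrightarrow> (\<exists>h\<in>H. y = h \<oplus>\<^bsub>M\<^esub> x)" by (simp add: a_r_coset_def')
  also have "\<dots> \<longleftrightarrow> (\<exists>h\<in>H. y \<ominus>\<^bsub>M\<^esub> x = h)"
    using M.M.eq_minus_iff[OF y x] submoduleD(1)[OF H] by (intro bex_cong refl) blast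
  finally show ?thesis by simp
qed

lemma coset_closed: "x \<in> carrier M \<Longrightarrow> y \<in> H +>\<^bsub>M\<^esub> x \<Longrightarrow> y \<in> carrier M"
  using H.a_elemrcos_carrier by blast

lemma coset_eq_iff:
  assumes "x \<in> carrier M" "y \<in> carrier M"
  shows "H +>\<^bsub>M\<^esub> x = H +>\<^bsub>M\<^esub> y \<longleftrightarrow> x \<ominus>\<^bsub>M\<^esub> y \<in> H"
proof
  assume "H +>\<^bsub>M\<^esub> x = H +>\<^bsub>M\<^esub> y"
  then have "x \<in> H +>\<^bsub>M\<^esub> y" using H.a_rcos_self[OF assms(1)] by simp
  then show "x \<ominus>\<^bsub>M\<^esub> y \<in> H" using mem_coset_iff assms by blast
next
  assume "x \<ominus>\<^bsub>M\<^esub> y \<in> H"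
  then have "x \<in> H +>\<^bsub>M\<^esub> y" using mem_coset_iff assms by blast
  then show "H +>\<^bsub>M\<^esub> x = H +>\<^bsub>M\<^esub> y" using H.a_repr_independence'[OF _ assms(2)] by blast
qed

lemma coset_zero_iff: "x \<in> carrier M \<Longrightarrow> H +>\<^bsub>M\<^esub> x = H \<longleftrightarrow> x \<in> H"
  using coset_eq_iff[of x "\<zero>\<^bsub>M\<^esub>"] by (simp add: M.M.minus_zero_right M.M.a_coset_add_zero[OF H.a_subset])

lemma coset_add:
  "x \<in> carrier M \<Longrightarrow> y \<in> carrier M \<Longrightarrow> (H +>\<^bsub>M\<^esub> x) <+>\<^bsub>M\<^esub> (H +>\<^bsub>M\<^esub> y) = H +>\<^bsub>M\<^esub> (x \<oplus>\<^bsub>M\<^esub> y)"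
  by (rule H.a_rcos_sum)

text \<open>The union that defines the action runs over equal cosets, since differences of
  representatives stay in \<open>H\<close> under scalars.\<close>

lemma quot_smult:
  assumes "a \<in> carrier R" "x \<in> carrier M"
  shows "a \<odot>\<^bsub>quot_module M H\<^esub> (H +>\<^bsub>M\<^esub> x) = H +>\<^bsub>M\<^esub> (a \<odot>\<^bsub>M\<^esub> x)"
proof -
  have "H +>\<^bsub>M\<^esub> (a \<odot>\<^bsub>M\<^esub> y) = H +>\<^bsub>M\<^esub> (a \<odot>\<^bsub>M\<^esub> x)" if y: "y \<in> H +>\<^bsub>M\<^esub> x" for y
  proof -
    note yc = coset_closed[OF assms(2) y]
    have "a \<odot>\<^bsub>M\<^esub> (y \<ominus>\<^bsub>M\<^esub> x) \<in> H"
      using submoduleD(4)[OF H assms(1)] y mem_coset_iff[OF assms(2) yc] by blast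
    then have "a \<odot>\<^bsub>M\<^esub> y \<ominus>\<^bsub>M\<^esub> a \<odot>\<^bsub>M\<^esub> x \<in> H"
      using assms yc by (simp add: a_minus_def M.right_smult_distr_module M.smult_neg_right)
    then show ?thesis using coset_eq_iff assms yc M.right_smult_closed by simp
  qed
  moreover have "x \<in> H +>\<^bsub>M\<^esub> x" by (rule H.a_rcos_self[OF assms(2)])
  ultimately show ?thesis unfolding quot_module_simps by blast
qed

lemma right_module_quot: "right_module R (quot_module M H)"
proof (rule right_moduleI)
  let ?Q = "quot_module M H"
  note s = quot_module_simps(1-3)
  have z: "\<zero>\<^bsub>?Q\<^esub> = H +>\<^bsub>M\<^esub> \<zero>\<^bsub>M\<^esub>" by (simp add: s M.M.a_coset_add_zero[OF H.a_subset])
  show "abelian_group ?Q"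
  proof (rule abelian_groupI)
    show "\<exists>y\<in>carrier ?Q. y \<oplus>\<^bsub>?Q\<^esub> x = \<zero>\<^bsub>?Q\<^esub>" if "x \<in> carrier ?Q" for x
    proof -
      from that obtain u where u: "u \<in> carrier M" "x = H +>\<^bsub>M\<^esub> u" by (auto simp: s)
      show ?thesis
        by (rule bexI[of _ "H +>\<^bsub>M\<^esub> (\<ominus>\<^bsub>M\<^esub> u)"])
          (use u in \<open>simp_all add: z\<close>, simp_all add: s coset_add M.M.l_neg)
    qed
  qed (unfold z, auto simp: s coset_add M.M.a_ac)
  fix a b x assume a: "a \<in> carrier R" and b: "b \<in> carrier R" and "x \<in> carrier ?Q"
  then obtain u where u: "u \<in> carrier M" "x = H +>\<^bsub>M\<^esub> u" by (auto simp: s)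
  show "(a \<oplus>\<^bsub>R\<^esub> b) \<odot>\<^bsub>?Q\<^esub> x = a \<odot>\<^bsub>?Q\<^esub> x \<oplus>\<^bsub>?Q\<^esub> b \<odot>\<^bsub>?Q\<^esub> x"
    using a b u by (simp add: quot_smult) (simp add: s coset_add M.right_smult_closed M.right_smult_distr_ring)
  show "(a \<otimes>\<^bsub>R\<^esub> b) \<odot>\<^bsub>?Q\<^esub> x = b \<odot>\<^bsub>?Q\<^esub> (a \<odot>\<^bsub>?Q\<^esub> x)"
    using a b u by (simp add: quot_smult M.right_smult_closed M.right_smult_assoc)
next
  let ?Q = "quot_module M H"
  note s = quot_module_simps(1-3)
  fix a x y assume a: "a \<in> carrier R" and "x \<in> carrier ?Q" "y \<in> carrier ?Q"
  then obtain u v where u: "u \<in> carrier M" "x = H +>\<^bsub>M\<^esub> u" and v: "v \<in> carrier M" "y = H +>\<^bsub>M\<^esub> v"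
    by (auto simp: s)
  have "a \<odot>\<^bsub>?Q\<^esub> (H +>\<^bsub>M\<^esub> (u \<oplus>\<^bsub>M\<^esub> v)) = a \<odot>\<^bsub>?Q\<^esub> (H +>\<^bsub>M\<^esub> u) <+>\<^bsub>M\<^esub> a \<odot>\<^bsub>?Q\<^esub> (H +>\<^bsub>M\<^esub> v)"
    using a u(1) v(1) by (simp add: quot_smult coset_add M.right_smult_closed M.right_smult_distr_module)
  then show "a \<odot>\<^bsub>?Q\<^esub> (x \<oplus>\<^bsub>?Q\<^esub> y) = a \<odot>\<^bsub>?Q\<^esub> x \<oplus>\<^bsub>?Q\<^esub> a \<odot>\<^bsub>?Q\<^esub> y"
    using u v by (simp add: s coset_add)
next
  let ?Q = "quot_module M H"
  fix x assume "x \<in> carrier ?Q"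
  then obtain u where u: "u \<in> carrier M" "x = H +>\<^bsub>M\<^esub> u" by (auto simp: quot_module_simps(1))
  show "\<one>\<^bsub>R\<^esub> \<odot>\<^bsub>?Q\<^esub> x = x" using u by (simp add: quot_smult M.right_smult_one)
  fix a assume "a \<in> carrier R"
  with u show "a \<odot>\<^bsub>?Q\<^esub> x \<in> carrier ?Q"
    by (simp add: quot_smult) (simp add: quot_module_simps(1) M.right_smult_closed)
qed (rule M.R.ring_axioms)

lemma lin_quot: "lin R M (quot_module M H) (\<lambda>x. H +>\<^bsub>M\<^esub> x)"
  by (rule linI[OF M right_module_quot])
    (simp_all add: quot_smult, simp_all add: quot_module_simps(1-3) coset_add)

lemma zero_module_quot: "zero_module (quot_module M H) \<longleftrightarrow> (\<forall>x\<in>carrier M. x \<in> H)"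
proof -
  have "carrier M \<noteq> {}" using M.M.zero_closed by blast
  then have "zero_module (quot_module M H) \<longleftrightarrow> (\<forall>x\<in>carrier M. H +>\<^bsub>M\<^esub> x = H)"
    by (auto simp: zero_module_def quot_module_simps(1,2))
  then show ?thesis using coset_zero_iff by blast
qed

end

lemma fgen_quot:
  assumes "fgen R M" "submodule H R M"
  shows "fgen R (quot_module M H)"
  by (rule fgen_image[OF assms(1) lin_quot[OF fgen_module[OF assms(1)] assms(2)]])
    (simp add: quot_module_simps(1))

context
  fixes R :: "('a, 'r) ring_scheme" and M :: "('a, 'm) module" and N :: "('a, 'n) module" and H K h
  assumes h: "lin R M N h" and H: "submodule H R M" and K: "submodule K R N" and hH: "h ` H \<subseteq> K"
begin

text \<open>As \<open>h\<close> maps \<open>H\<close> into \<open>K\<close>, every representative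
  contributes the same coset to the union in \<open>quot_map\<close>.\<close>

lemma quot_map_coset:
  assumes x: "x \<in> carrier M"
  shows "quot_map N K h (H +>\<^bsub>M\<^esub> x) = K +>\<^bsub>N\<^esub> h x"
proof -
  note M = lin_modules(1)[OF h] and N = lin_modules(2)[OF h]
  interpret M: right_module R M by (rule M)
  have "K +>\<^bsub>N\<^esub> h y = K +>\<^bsub>N\<^esub> h x" if y: "y \<in> H +>\<^bsub>M\<^esub> x" for y
  proof -
    note yc = coset_closed[OF M H x y]
    have "h y \<ominus>\<^bsub>N\<^esub> h x \<in> K"
      using y mem_coset_iff[OF M H x yc] hH lin_minus[OF h yc x] by auto
    then show ?thesis using coset_eq_iff[OF N K lin_closed[OF h yc] lin_closed[OF h x]] by simp
  qed
  moreover have "x \<in> H +>\<^bsub>M\<^esub> x"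
    using mem_coset_iff[OF M H x x] submoduleD(2)[OF H] x by (simp add: M.M.minus_eq_zero_iff[THEN iffD2])
  ultimately show ?thesis unfolding quot_map_def by blast
qed

lemma lin_quot_map: "lin R (quot_module M H) (quot_module N K) (quot_map N K h)"
proof -
  note M = lin_modules(1)[OF h] and N = lin_modules(2)[OF h]
  note QM = right_module_quot[OF M H] and pM = lin_quot[OF M H] and pN = lin_quot[OF N K]
  interpret M: right_module R M by (rule M)
  show ?thesis
  proof (rule linI[OF QM right_module_quot[OF N K]])
    show "quot_map N K h x \<in> carrier (quot_module N K)" if "x \<in> carrier (quot_module M H)" for x
      using that lin_closed[OF h] by (auto simp: quot_module_simps(1) quot_map_coset)
    fix x y assume "x \<in> carrier (quot_module M H)" "y \<in> carrier (quot_module M H)"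
    then obtain u v where u: "u \<in> carrier M" "x = H +>\<^bsub>M\<^esub> u" and v: "v \<in> carrier M" "y = H +>\<^bsub>M\<^esub> v"
      by (auto simp: quot_module_simps(1))
    show "quot_map N K h (x \<oplus>\<^bsub>quot_module M H\<^esub> y) = quot_map N K h x \<oplus>\<^bsub>quot_module N K\<^esub> quot_map N K h y"
      using u v by (simp add: quot_map_coset lin_closed[OF h] lin_add[OF h] flip: lin_add[OF pM] lin_add[OF pN])
  next
    fix a x assume a: "a \<in> carrier R" and "x \<in> carrier (quot_module M H)"
    then obtain u where u: "u \<in> carrier M" "x = H +>\<^bsub>M\<^esub> u" by (auto simp: quot_module_simps(1))
    show "quot_map N K h (a \<odot>\<^bsub>quot_module M H\<^esub> x) = a \<odot>\<^bsub>quot_module N K\<^esub> quot_map N K h x"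
      using a u by (simp add: quot_map_coset lin_closed[OF h] lin_smult[OF h] M.right_smult_closed
          flip: lin_smult[OF pM] lin_smult[OF pN])
  qed
qed

lemma inj_on_quot_map:
  "inj_on (quot_map N K h) (carrier (quot_module M H)) \<longleftrightarrow> (\<forall>x\<in>carrier M. h x \<in> K \<longrightarrow> x \<in> H)"
proof -
  note M = lin_modules(1)[OF h] and N = lin_modules(2)[OF h]
  interpret M: right_module R M by (rule M)
  interpret N: right_module R N by (rule N)
  have "inj_on (quot_map N K h) (carrier (quot_module M H)) \<longleftrightarrow>
      (\<forall>x\<in>carrier M. \<forall>y\<in>carrier M. K +>\<^bsub>N\<^esub> h x = K +>\<^bsub>N\<^esub> h y \<longrightarrow> H +>\<^bsub>M\<^esub> x = H +>\<^bsub>M\<^esub> y)"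
    unfolding inj_on_def quot_module_simps(1) ball_simps by (simp add: quot_map_coset)
  also have "\<dots> \<longleftrightarrow> (\<forall>x\<in>carrier M. \<forall>y\<in>carrier M. h (x \<ominus>\<^bsub>M\<^esub> y) \<in> K \<longrightarrow> x \<ominus>\<^bsub>M\<^esub> y \<in> H)"
    by (simp add: coset_eq_iff[OF M H] coset_eq_iff[OF N K] lin_closed[OF h] lin_minus[OF h])
  also have "\<dots> \<longleftrightarrow> (\<forall>x\<in>carrier M. h x \<in> K \<longrightarrow> x \<in> H)"
  proof (intro iffI ballI impI)
    fix x assume *: "\<forall>x\<in>carrier M. \<forall>y\<in>carrier M. h (x \<ominus>\<^bsub>M\<^esub> y) \<in> K \<longrightarrow> x \<ominus>\<^bsub>M\<^esub> y \<in> H"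
      and x: "x \<in> carrier M" "h x \<in> K"
    have "x \<ominus>\<^bsub>M\<^esub> \<zero>\<^bsub>M\<^esub> = x" using x by (simp add: M.M.minus_zero_right)
    with * x show "x \<in> H" using M.M.zero_closed by metis
  qed auto
  finally show ?thesis .
qed

lemma image_quot_map:
  "quot_map N K h ` carrier (quot_module M H) = carrier (quot_module N K) \<longleftrightarrow>
    (\<forall>y\<in>carrier N. \<exists>x\<in>carrier M. y \<ominus>\<^bsub>N\<^esub> h x \<in> K)"
proof -
  note N = lin_modules(2)[OF h]
  have *: "quot_map N K h ` carrier (quot_module M H) = (\<lambda>x. K +>\<^bsub>N\<^esub> h x) ` carrier M"
    by (simp add: quot_module_simps(1) quot_map_coset image_image)
  have "(\<lambda>x. K +>\<^bsub>N\<^esub> h x) ` carrier M \<subseteq> (\<lambda>y. K +>\<^bsub>N\<^esub> y) ` carrier N"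
    using lin_closed[OF h] by blast
  then have "(\<lambda>x. K +>\<^bsub>N\<^esub> h x) ` carrier M = (\<lambda>y. K +>\<^bsub>N\<^esub> y) ` carrier N \<longleftrightarrow>
      (\<lambda>y. K +>\<^bsub>N\<^esub> y) ` carrier N \<subseteq> (\<lambda>x. K +>\<^bsub>N\<^esub> h x) ` carrier M"
    by (simp only: set_eq_subset simp_thms)
  also have "\<dots> \<longleftrightarrow> (\<forall>y\<in>carrier N. \<exists>x\<in>carrier M. K +>\<^bsub>N\<^esub> y = K +>\<^bsub>N\<^esub> h x)"
    unfolding image_subset_iff image_iff ..
  finally have "quot_map N K h ` carrier (quot_module M H) = carrier (quot_module N K) \<longleftrightarrow>
      (\<forall>y\<in>carrier N. \<exists>x\<in>carrier M. K +>\<^bsub>N\<^esub> y = K +>\<^bsub>N\<^esub> h x)"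
    using * by (simp only: quot_module_simps(1))
  then show ?thesis using coset_eq_iff[OF N K] lin_closed[OF h] by simp
qed

end

text \<open>The cokernel of the first differential has the projection as its augmentation;
  transposes are resolved in this form.\<close>

lemma resolves_quot:
  assumes "acyclic_complex R C d"
  shows "resolves R C d (quot_module (C 0) (d 1 ` carrier (C 1))) (\<lambda>x. d 1 ` carrier (C 1) +>\<^bsub>C 0\<^esub> x)"
proof -
  note D = proj_complexD[OF acyclic_proj[OF assms]]
  have H: "submodule (d 1 ` carrier (C 1)) R (C 0)"
    using submodule_image[OF D(3)[of 0]] by simp
  show ?thesis
    unfolding resolves_def
    using assms lin_quot[OF D(2) H] coset_zero_iff[OF D(2) H] submoduleD(1)[OF H]
    by (auto simp: quot_module_simps(1,2))
qed


section \<open>Ext\<close>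

lemma restrict_eq_iff: "restrict f A = restrict g A \<longleftrightarrow> (\<forall>x\<in>A. f x = g x)"
  using fun_cong[of "restrict f A" "restrict g A"] by (auto intro: restrict_ext) (metis restrict_apply')

context
  fixes R :: "('a, 'r) ring_scheme" and X :: "('a, 'p, 'm) resolution"
  assumes X: "proj_complex R (cx X) (bd X)"
begin

text \<open>Values off the carrier are arbitrary for \<open>cocycle\<close>, whereas the elements of
  a dual module are extensional. The facts of this context translate between the two views by
  restriction.\<close>

lemma ext_cocycles_iff:
  "g \<in> ext_cocycles R X i \<longleftrightarrow> cocycle R (cx X) (bd X) i g \<and> g \<in> extensional (carrier (cx X i))"
proof -
  note D = proj_complexD[OF X]
  have "dual_map (cx X (Suc i)) (bd X (Suc i)) g = \<zero>\<^bsub>dual R (cx X (Suc i))\<^esub> \<longleftrightarrow>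
      (\<forall>x\<in>carrier (cx X (Suc i)). g (bd X (Suc i) x) = \<zero>\<^bsub>R\<^esub>)"
    unfolding dual_map_def dual_simps by (rule restrict_eq_iff)
  then show ?thesis
    using mem_dual_iff[OF D(2)] unfolding ext_cocycles_def cocycle_def by blast
qed

lemma ext_coboundaries_iff:
  "g \<in> ext_coboundaries R X i \<longleftrightarrow> coboundary R (cx X) (bd X) i g \<and> g \<in> extensional (carrier (cx X i))"
proof (cases i)
  case 0
  have "g = (\<lambda>x\<in>carrier (cx X 0). \<zero>\<^bsub>R\<^esub>) \<longleftrightarrow> (\<forall>x\<in>carrier (cx X 0). g x = \<zero>\<^bsub>R\<^esub>) \<and> g \<in> extensional (carrier (cx X 0))"
    by (auto intro: extensionalityI)
  with 0 show ?thesis by (simp add: ext_coboundaries_def coboundary_0 dual_simps(2))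
next
  case (Suc l)
  note D = proj_complexD[OF X]
  show ?thesis
  proof
    assume "g \<in> ext_coboundaries R X i"
    then obtain g' where "g' \<in> carrier (dual R (cx X l))" "g = dual_map (cx X i) (bd X i) g'"
      using Suc by (auto simp: ext_coboundaries_def)
    then show "coboundary R (cx X) (bd X) i g \<and> g \<in> extensional (carrier (cx X i))"
      using Suc dual_lin[OF D(2)] by (auto simp: coboundary_Suc dual_map_def)
  next
    assume *: "coboundary R (cx X) (bd X) i g \<and> g \<in> extensional (carrier (cx X i))"
    then obtain g' where g': "lin R (cx X l) (regular_module R) g'"
      "\<And>x. x \<in> carrier (cx X i) \<Longrightarrow> g x = g' (bd X i x)"
      using Suc by (auto simp: coboundary_Suc)
    have "g = dual_map (cx X i) (bd X i) (restrict g' (carrier (cx X l)))"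
      by (rule extensionalityI[of _ "carrier (cx X i)"])
        (use * g'(2) lin_closed[OF D(3)[of l]] Suc in \<open>auto simp: dual_map_def\<close>)
    then show "g \<in> ext_coboundaries R X i"
      using restrict_mem_dual[OF g'(1)] Suc by (auto simp: ext_coboundaries_def)
  qed
qed

lemma submodule_ext_cocycles: "submodule (ext_cocycles R X i) (op_ring R) (dual R (cx X i))"
  using submodule_kernel[OF lin_dual_map[OF proj_complexD(3)[OF X]]] unfolding ext_cocycles_def .

lemma coboundary_cocycle:
  assumes "g \<in> ext_coboundaries R X i"
  shows "g \<in> ext_cocycles R X i"
proof (cases i)
  case 0
  interpret D: right_module "op_ring R" "dual R (cx X 0)" by (rule right_module_dual[OF proj_complexD(2)[OF X]])
  have "\<zero>\<^bsub>dual R (cx X 0)\<^esub> \<in> ext_cocycles R X 0" by (rule submoduleD(2)[OF submodule_ext_cocycles])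
  with assms 0 show ?thesis by (simp add: ext_coboundaries_def)
next
  case (Suc l)
  note D = proj_complexD[OF X]
  from assms Suc obtain g' where g': "g' \<in> carrier (dual R (cx X l))" "g = dual_map (cx X i) (bd X i) g'"
    by (auto simp: ext_coboundaries_def)
  have "g \<in> carrier (dual R (cx X i))" using g' lin_closed[OF lin_dual_map[OF D(3)[of l]]] Suc by simp
  moreover have "g (bd X (Suc i) x) = \<zero>\<^bsub>R\<^esub>" if "x \<in> carrier (cx X (Suc i))" for x
    using that g'(2) Suc lin_closed[OF D(3)[of i] that] D(4)[of x l] lin_zero[OF dual_lin[OF D(2) g'(1)]]
    by (simp add: dual_map_def)
  ultimately show ?thesis
    unfolding ext_cocycles_iff cocycle_def using mem_dual_iff[OF D(2)] by blast
qed

lemma submodule_ext_coboundaries: "submodule (ext_coboundaries R X i) (op_ring R) (dual R (cx X i))"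
proof (cases i)
  case 0
  interpret D: right_module "op_ring R" "dual R (cx X 0)" by (rule right_module_dual[OF proj_complexD(2)[OF X]])
  have "submodule {\<zero>\<^bsub>dual R (cx X 0)\<^esub>} (op_ring R) (dual R (cx X 0))" by (rule D.submoduleI') auto
  with 0 show ?thesis by (simp add: ext_coboundaries_def)
next
  case (Suc l)
  then show ?thesis using submodule_image[OF lin_dual_map[OF proj_complexD(3)[OF X, of l]]]
    by (simp add: ext_coboundaries_def)
qed

lemma submodule_restrict:
  assumes "submodule K S N" "submodule Z S N" "K \<subseteq> Z" "right_module S N"
  shows "submodule K S (N\<lparr>carrier := Z\<rparr>)"
proof -
  interpret right_module S "N\<lparr>carrier := Z\<rparr>" by (rule right_module_restrict[OF assms(4,2)])
  show ?thesis by (rule submoduleI') (use assms(3) submoduleD[OF assms(1)] in auto)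
qed

lemma submodule_coboundaries_cocycles:
  "submodule (ext_coboundaries R X i) (op_ring R) ((dual R (cx X i))\<lparr>carrier := ext_cocycles R X i\<rparr>)"
  by (rule submodule_restrict[OF submodule_ext_coboundaries submodule_ext_cocycles])
    (auto intro: coboundary_cocycle right_module_dual proj_complexD(2)[OF X])

lemma right_module_cocycles: "right_module (op_ring R) ((dual R (cx X i))\<lparr>carrier := ext_cocycles R X i\<rparr>)"
  by (rule right_module_restrict[OF right_module_dual[OF proj_complexD(2)[OF X]] submodule_ext_cocycles])

lemma cocycle_restrict:
  assumes "cocycle R (cx X) (bd X) i g"
  shows "restrict g (carrier (cx X i)) \<in> ext_cocycles R X i"
  using assms lin_closed[OF proj_complexD(3)[OF X]]
  by (simp add: ext_cocycles_iff cocycle_def lin_cong_iff[of _ "restrict g (carrier (cx X i))" g])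

lemma coboundary_restrict_iff:
  "restrict g (carrier (cx X i)) \<in> ext_coboundaries R X i \<longleftrightarrow> coboundary R (cx X) (bd X) i g"
  by (auto simp: ext_coboundaries_iff intro: coboundary_cong)

end

lemma Ext_zero_iff:
  assumes "resolves R (cx (resol R M)) (bd (resol R M)) M (aug (resol R M))"
  shows "zero_module (Ext R i M) \<longleftrightarrow> coh_zero R (cx (resol R M)) (bd (resol R M)) i"
proof -
  note X = resolvesD(2)[OF assms]
  have "zero_module (Ext R i M) \<longleftrightarrow> (\<forall>g\<in>ext_cocycles R (resol R M) i. g \<in> ext_coboundaries R (resol R M) i)"
    using zero_module_quot[OF right_module_cocycles[OF X] submodule_coboundaries_cocycles[OF X]]
    by (simp add: Ext_def Let_def)
  also have "\<dots> \<longleftrightarrow> coh_zero R (cx (resol R M)) (bd (resol R M)) i"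
    unfolding coh_zero_def using cocycle_restrict[OF X] coboundary_restrict_iff[OF X]
    by (metis ext_cocycles_iff[OF X] ext_coboundaries_iff[OF X])
  finally show ?thesis .
qed

lemma Ext_fgen:
  assumes "right_noetherian (op_ring R)" "resolves R (cx (resol R M)) (bd (resol R M)) M (aug (resol R M))"
  shows "fgen (op_ring R) (Ext R i M)"
proof -
  note X = resolvesD(2)[OF assms(2)]
  show ?thesis
    unfolding Ext_def Let_def
    by (rule fgen_quot[OF noetherian_projective[OF assms(1) fg_projective_dual[OF proj_complexD(1)[OF X]]
          submodule_ext_cocycles[OF X]] submodule_coboundaries_cocycles[OF X]])
qed

lemma resol_lift_chain_map:
  assumes "resolves R (cx (resol R M)) (bd (resol R M)) M (aug (resol R M))"
    and "resolves R (cx (resol R N)) (bd (resol R N)) N (aug (resol R N))" and f: "lin R M N f"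
  shows "chain_map R (cx (resol R M)) (bd (resol R M)) (cx (resol R N)) (bd (resol R N)) (resol_lift R M N f)"
    and "x \<in> carrier (cx (resol R M) 0) \<Longrightarrow>
      aug (resol R N) (resol_lift R M N f 0 x) = f (aug (resol R M) x)"
proof -
  note r = resolvesD[OF assms(1)] and r' = resolvesD[OF assms(2)]
  obtain F where F: "chain_map R (cx (resol R M)) (bd (resol R M)) (cx (resol R N)) (bd (resol R N)) F"
    "\<And>x. x \<in> carrier (cx (resol R M) 0) \<Longrightarrow> aug (resol R N) (F 0 x) = f (aug (resol R M) x)"
    using lift_exists[OF r(2,3) _ assms(2) f] r(7) by blast
  have "lifts_along R M f (resol R M) (resol R N) F"
    using F lin_mod_hom[OF chain_mapD(1)[OF F(1)]] chain_mapD(2)[OF F(1)] by (simp add: lifts_along_def)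
  then have *: "lifts_along R M f (resol R M) (resol R N) (resol_lift R M N f)"
    unfolding resol_lift_def
    by (rule someI[where P = "lifts_along R M f (resol R M) (resol R N)"])
  then show "chain_map R (cx (resol R M)) (bd (resol R M)) (cx (resol R N)) (bd (resol R N)) (resol_lift R M N f)"
    using proj_complexD(2)[OF r(2)] proj_complexD(2)[OF r'(2)]
    by (simp add: lifts_along_def chain_map_def lin_def)
  show "aug (resol R N) (resol_lift R M N f 0 x) = f (aug (resol R M) x)"
    if "x \<in> carrier (cx (resol R M) 0)" using * that by (simp add: lifts_along_def)
qed

lemma Ext_map_iff:
  assumes M: "resolves R (cx (resol R M)) (bd (resol R M)) M (aug (resol R M))"
    and N: "resolves R (cx (resol R N)) (bd (resol R N)) N (aug (resol R N))" and f: "lin R M N f"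
  shows "inj_on (Ext_map R i M N f) (carrier (Ext R i N)) \<longleftrightarrow>
      coh_inj R (cx (resol R M)) (bd (resol R M)) (cx (resol R N)) (bd (resol R N)) i (resol_lift R M N f i)"
      (is "?A \<longleftrightarrow> ?B")
    and "bij_betw (Ext_map R i M N f) (carrier (Ext R i N)) (carrier (Ext R i M)) \<longleftrightarrow>
      coh_inj R (cx (resol R M)) (bd (resol R M)) (cx (resol R N)) (bd (resol R N)) i (resol_lift R M N f i) \<and>
      coh_surj R (cx (resol R M)) (bd (resol R M)) (cx (resol R N)) (bd (resol R N)) i (resol_lift R M N f i)"
proof -
  let ?X = "resol R M" and ?Y = "resol R N" and ?\<phi> = "resol_lift R M N f"
  note X = resolvesD(2)[OF M] and Y = resolvesD(2)[OF N]
  note DX = proj_complexD[OF X] and DY = proj_complexD[OF Y]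
  note \<phi> = resol_lift_chain_map(1)[OF M N f]
  let ?C = "(dual R (cx ?X i))\<lparr>carrier := ext_cocycles R ?X i\<rparr>"
  let ?D = "(dual R (cx ?Y i))\<lparr>carrier := ext_cocycles R ?Y i\<rparr>"
  let ?h = "dual_map (cx ?X i) (?\<phi> i)"
  have hx: "?h g = restrict (\<lambda>x. g (?\<phi> i x)) (carrier (cx ?X i))" for g by (simp add: dual_map_def)
  have hZ: "?h g \<in> ext_cocycles R ?X i" if "g \<in> ext_cocycles R ?Y i" for g
    unfolding hx using that ext_cocycles_iff[OF Y] cocycle_comp[OF X \<phi>] cocycle_restrict[OF X] by blast
  have hB: "?h ` ext_coboundaries R ?Y i \<subseteq> ext_coboundaries R ?X i"
    unfolding hx using ext_coboundaries_iff[OF Y] coboundary_comp[OF X \<phi>] coboundary_restrict_iff[OF X] by blast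
  have h: "lin (op_ring R) ?D ?C ?h"
    by (rule lin_restrict_cod[OF lin_restrict_dom[OF lin_dual_map[OF chain_mapD(1)[OF \<phi>]]
            submodule_ext_cocycles[OF Y]] submodule_ext_cocycles[OF X]]) (use hZ in simp)
  note * = h submodule_coboundaries_cocycles[OF Y] submodule_coboundaries_cocycles[OF X] hB
  have E: "Ext_map R i M N f = quot_map ?C (ext_coboundaries R ?X i) ?h"
    "Ext R i N = quot_module ?D (ext_coboundaries R ?Y i)"
    "Ext R i M = quot_module ?C (ext_coboundaries R ?X i)"
    by (simp_all add: Ext_map_def Ext_def Let_def)
  have "(\<forall>g\<in>carrier ?D. ?h g \<in> ext_coboundaries R ?X i \<longrightarrow> g \<in> ext_coboundaries R ?Y i) \<longleftrightarrow>
      coh_inj R (cx ?X) (bd ?X) (cx ?Y) (bd ?Y) i (?\<phi> i)" (is "?L \<longleftrightarrow> ?R")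
  proof
    assume ?L
    show ?R
      unfolding coh_inj_def
    proof (intro allI impI)
      fix g assume g: "cocycle R (cx ?Y) (bd ?Y) i g" "coboundary R (cx ?X) (bd ?X) i (\<lambda>x. g (?\<phi> i x))"
      let ?g = "restrict g (carrier (cx ?Y i))"
      have "?h ?g = restrict (\<lambda>x. g (?\<phi> i x)) (carrier (cx ?X i))"
        using lin_closed[OF chain_mapD(1)[OF \<phi>]] by (auto simp: hx intro!: restrict_ext)
      then have "?h ?g \<in> ext_coboundaries R ?X i" using coboundary_restrict_iff[OF X] g(2) by simp
      then have "?g \<in> ext_coboundaries R ?Y i" using \<open>?L\<close> cocycle_restrict[OF Y g(1)] by simp
      then show "coboundary R (cx ?Y) (bd ?Y) i g" using coboundary_restrict_iff[OF Y] by blast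
    qed
  next
    assume ?R
    then show ?L
      using ext_cocycles_iff[OF Y] ext_coboundaries_iff[OF Y] coboundary_restrict_iff[OF X]
      unfolding coh_inj_def hx by simp
  qed
  with inj_on_quot_map[OF *] show inj: "?A \<longleftrightarrow> ?B" by (simp add: E)
  \<comment> \<open>Subtraction in the module of cocycles goes through an abstract inverse. It is
    computed by checking that the pointwise difference \<open>?r\<close> and \<open>?h g\<close> add
    up to \<open>y\<close>.\<close>
  have d: "y \<ominus>\<^bsub>?C\<^esub> ?h g = restrict (\<lambda>x. y x \<ominus>\<^bsub>R\<^esub> g (?\<phi> i x)) (carrier (cx ?X i))"
    if y: "y \<in> ext_cocycles R ?X i" and g: "g \<in> ext_cocycles R ?Y i" for y g
  proof -
    interpret C: right_module "op_ring R" ?C by (rule right_module_cocycles[OF X])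
    interpret R: ring R using DX(2)[of 0] by (simp add: right_module_def)
    let ?r = "restrict (\<lambda>x. y x \<ominus>\<^bsub>R\<^esub> g (?\<phi> i x)) (carrier (cx ?X i))"
    have yc: "cocycle R (cx ?X) (bd ?X) i y" and gc: "cocycle R (cx ?Y) (bd ?Y) i g"
      using y g ext_cocycles_iff[OF X] ext_cocycles_iff[OF Y] by blast+
    have r: "?r \<in> ext_cocycles R ?X i"
      by (rule cocycle_restrict[OF X cocycle_diff[OF X yc cocycle_comp[OF X \<phi> gc]]])
    have "y = ?r \<oplus>\<^bsub>?C\<^esub> ?h g"
      by (rule extensionalityI[of _ "carrier (cx ?X i)"])
        (use y ext_cocycles_iff[OF X] cocycle_value[OF yc] cocycle_value[OF gc] lin_closed[OF chain_mapD(1)[OF \<phi>]]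
          in \<open>auto simp: dual_simps(3) hx R.minus_add_cancel\<close>)
    then show ?thesis
      using C.M.eq_minus_iff[of y "?h g" ?r] y hZ[OF g] r by simp
  qed
  have "(\<forall>y\<in>carrier ?C. \<exists>g\<in>carrier ?D. y \<ominus>\<^bsub>?C\<^esub> ?h g \<in> ext_coboundaries R ?X i) \<longleftrightarrow>
      coh_surj R (cx ?X) (bd ?X) (cx ?Y) (bd ?Y) i (?\<phi> i)" (is "?L \<longleftrightarrow> ?R")
  proof
    assume L: ?L
    show ?R
      unfolding coh_surj_def
    proof (intro allI impI)
      fix y assume y: "cocycle R (cx ?X) (bd ?X) i y"
      let ?y = "restrict y (carrier (cx ?X i))"
      obtain g where g: "g \<in> ext_cocycles R ?Y i" "?y \<ominus>\<^bsub>?C\<^esub> ?h g \<in> ext_coboundaries R ?X i"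
        using L cocycle_restrict[OF X y] by auto
      then have "coboundary R (cx ?X) (bd ?X) i (\<lambda>x. ?y x \<ominus>\<^bsub>R\<^esub> g (?\<phi> i x))"
        using d[OF cocycle_restrict[OF X y] g(1)] coboundary_restrict_iff[OF X] by simp
      then have "coboundary R (cx ?X) (bd ?X) i (\<lambda>x. y x \<ominus>\<^bsub>R\<^esub> g (?\<phi> i x))"
        by (rule coboundary_cong) simp
      then show "\<exists>g. cocycle R (cx ?Y) (bd ?Y) i g \<and> coboundary R (cx ?X) (bd ?X) i (\<lambda>x. y x \<ominus>\<^bsub>R\<^esub> g (?\<phi> i x))"
        using g(1) ext_cocycles_iff[OF Y] by blast
    qed
  next
    assume R: ?R
    show ?L
    proof
      fix y assume "y \<in> carrier ?C"
      then have y: "y \<in> ext_cocycles R ?X i" by simp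
      then obtain g where g: "cocycle R (cx ?Y) (bd ?Y) i g"
        "coboundary R (cx ?X) (bd ?X) i (\<lambda>x. y x \<ominus>\<^bsub>R\<^esub> g (?\<phi> i x))"
        using R ext_cocycles_iff[OF X] unfolding coh_surj_def by blast
      let ?g = "restrict g (carrier (cx ?Y i))"
      have "coboundary R (cx ?X) (bd ?X) i (\<lambda>x. y x \<ominus>\<^bsub>R\<^esub> ?g (?\<phi> i x))"
        by (rule coboundary_cong[OF g(2)]) (use lin_closed[OF chain_mapD(1)[OF \<phi>]] in simp)
      then have "y \<ominus>\<^bsub>?C\<^esub> ?h ?g \<in> ext_coboundaries R ?X i"
        using d[OF y cocycle_restrict[OF Y g(1)]] coboundary_restrict_iff[OF X] by simp
      then show "\<exists>g\<in>carrier ?D. y \<ominus>\<^bsub>?C\<^esub> ?h g \<in> ext_coboundaries R ?X i"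
        using cocycle_restrict[OF Y g(1)] by auto
    qed
  qed
  with image_quot_map[OF *] inj
  show "bij_betw (Ext_map R i M N f) (carrier (Ext R i N)) (carrier (Ext R i M)) \<longleftrightarrow>
      coh_inj R (cx ?X) (bd ?X) (cx ?Y) (bd ?Y) i (?\<phi> i) \<and> coh_surj R (cx ?X) (bd ?X) (cx ?Y) (bd ?Y) i (?\<phi> i)"
    by (simp add: E bij_betw_def)
qed

text \<open>The lifts \<open>I\<close> and \<open>J\<close> of identities are equivalences, and
  \<open>F1\<close> is homotopic to the composite of \<open>I\<close>, \<open>F\<close> and
  \<open>J\<close> because both lie over \<open>f\<close>.\<close>

lemma coh_independent_aux:
  assumes C: "resolves R C d M e" and C1: "resolves R C1 d1 M e1"
    and D: "resolves R D \<delta> N \<epsilon>" and D1: "resolves R D1 \<delta>1 N \<epsilon>1"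
    and F: "chain_map R C d D \<delta> F" "\<And>x. x \<in> carrier (C 0) \<Longrightarrow> \<epsilon> (F 0 x) = f (e x)"
    and F1: "chain_map R C1 d1 D1 \<delta>1 F1" "\<And>x. x \<in> carrier (C1 0) \<Longrightarrow> \<epsilon>1 (F1 0 x) = f (e1 x)"
  shows "coh_inj R C d D \<delta> k (F k) \<Longrightarrow> coh_inj R C1 d1 D1 \<delta>1 k (F1 k)"
    and "coh_surj R C d D \<delta> k (F k) \<Longrightarrow> coh_surj R C1 d1 D1 \<delta>1 k (F1 k)"
proof -
  note c = resolvesD[OF C] and c1 = resolvesD[OF C1] and dd = resolvesD[OF D] and dd1 = resolvesD[OF D1]
  obtain I where I: "chain_map R C1 d1 C d I" "\<And>x. x \<in> carrier (C1 0) \<Longrightarrow> e (I 0 x) = e1 x"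
    using lift_exists[OF c1(2,3) _ C lin_id[OF c1(6)]] c1(7) by blast
  obtain J where J: "chain_map R D \<delta> D1 \<delta>1 J" "\<And>x. x \<in> carrier (D 0) \<Longrightarrow> \<epsilon>1 (J 0 x) = \<epsilon> x"
    using lift_exists[OF dd(2,3) _ D1 lin_id[OF dd(6)]] dd(7) by blast
  note FI = chain_map_comp[OF I(1) F(1)]
  note JFI = chain_map_comp[OF FI J(1)]
  have eq: "coh_eq R C1 d1 D1 \<delta>1 k (\<lambda>x. J k (F k (I k x))) (F1 k)"
    by (rule homotopic_coh_eq[OF c1(2) dd1(1) JFI F1(1)],
        rule lifts_homotopic[OF D1 chain_mapD(1)[OF JFI, where i=0] chain_mapD(1)[OF F1(1), where i=0]])
      (use I(2) J(2) F(2) F1(2) lin_closed[OF chain_mapD(1)[OF I(1)]] lin_closed[OF chain_mapD(1)[OF FI]]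
        in simp_all)
  note l = chain_mapD(1)[OF JFI] chain_mapD(1)[OF F1(1)]
  note Ie = resolution_equivalence[OF C1 C I] and Je = resolution_equivalence[OF D D1 J]
  show "coh_inj R C1 d1 D1 \<delta>1 k (F1 k)" if "coh_inj R C d D \<delta> k (F k)"
    using coh_inj_comp[OF dd(2) J(1) coh_inj_comp[OF c(2) F(1) Ie(1) that] Je(1)]
      coh_inj_cong[OF c1(2) l eq] by blast
  show "coh_surj R C1 d1 D1 \<delta>1 k (F1 k)" if "coh_surj R C d D \<delta> k (F k)"
    using coh_surj_comp[OF c1(2) FI J(1) coh_surj_comp[OF c1(2) I(1) F(1) Ie(2) that] Je(2)]
      coh_surj_cong[OF c1(2) l eq] by blast
qed

lemma coh_independent:
  assumes C: "resolves R C d M e" and C1: "resolves R C1 d1 M e1"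
    and D: "resolves R D \<delta> N \<epsilon>" and D1: "resolves R D1 \<delta>1 N \<epsilon>1"
    and F: "chain_map R C d D \<delta> F" "\<And>x. x \<in> carrier (C 0) \<Longrightarrow> \<epsilon> (F 0 x) = f (e x)"
    and F1: "chain_map R C1 d1 D1 \<delta>1 F1" "\<And>x. x \<in> carrier (C1 0) \<Longrightarrow> \<epsilon>1 (F1 0 x) = f (e1 x)"
  shows "coh_inj R C d D \<delta> k (F k) \<longleftrightarrow> coh_inj R C1 d1 D1 \<delta>1 k (F1 k)"
    and "coh_surj R C d D \<delta> k (F k) \<longleftrightarrow> coh_surj R C1 d1 D1 \<delta>1 k (F1 k)"
  using coh_independent_aux[OF C C1 D D1 F F1] coh_independent_aux[OF C1 C D1 D F1 F] by blast+


section \<open>The transpose\<close>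

text \<open>A presentation \<open>G1 \<rightarrow> G0 \<rightarrow> N \<rightarrow> 0\<close> together with a resolution \<open>D\<close> of the transpose, where \<open>D 0\<close> and
  \<open>D 1\<close> need not be the modules \<open>G1\<^sup>*\<close> and \<open>G0\<^sup>*\<close> but are identified with them by perfect pairings.\<close>

definition tr_res where
  "tr_res R G1 G0 d N e B1 B0 D \<delta> \<longleftrightarrow> fg_projective R G1 \<and> fg_projective R G0 \<and> lin R G1 G0 d \<and>
     lin R G0 N e \<and> e ` carrier G0 = carrier N \<and> {y \<in> carrier G0. e y = \<zero>\<^bsub>N\<^esub>} = d ` carrier G1 \<and>
     acyclic_complex (op_ring R) D \<delta> \<and> perfect R G1 (D 0) B1 \<and> perfect R G0 (D 1) B0 \<and>
     (\<forall>x\<in>carrier G1. \<forall>w\<in>carrier (D 1). B1 x (\<delta> 1 w) = B0 (d x) w)"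

lemma tr_resD:
  assumes "tr_res R G1 G0 d N e B1 B0 D \<delta>"
  shows "fg_projective R G1" "fg_projective R G0" "lin R G1 G0 d" "lin R G0 N e"
    "e ` carrier G0 = carrier N" "y \<in> carrier G0 \<Longrightarrow> e y = \<zero>\<^bsub>N\<^esub> \<longleftrightarrow> y \<in> d ` carrier G1"
    "acyclic_complex (op_ring R) D \<delta>" "proj_complex (op_ring R) D \<delta>"
    "perfect R G1 (D 0) B1" "perfect R G0 (D 1) B0"
    "x \<in> carrier G1 \<Longrightarrow> w \<in> carrier (D 1) \<Longrightarrow> B1 x (\<delta> 1 w) = B0 (d x) w"
  using assms unfolding tr_res_def by (simp_all add: acyclic_proj set_eq_iff) blast

text \<open>The map \<open>F\<close> between resolutions of the transposes runs backwards. It is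
  tied to \<open>f\<close> through degree zero, where it is the adjoint of \<open>c1\<close>; this
  fixes the higher degrees up to homotopy.\<close>

definition tr_lift where
  "tr_lift R G1 G0 d e B1 D \<delta> G1' G0' d' e' B1' D' \<delta>' f c1 c0 F \<longleftrightarrow>
     lin R G1 G1' c1 \<and> lin R G0 G0' c0 \<and> (\<forall>x\<in>carrier G1. c0 (d x) = d' (c1 x)) \<and>
     (\<forall>y\<in>carrier G0. e' (c0 y) = f (e y)) \<and> chain_map (op_ring R) D' \<delta>' D \<delta> F \<and>
     (\<forall>x\<in>carrier G1. \<forall>w\<in>carrier (D' 0). B1' (c1 x) w = B1 x (F 0 w))"

lemma tr_liftD:
  assumes "tr_lift R G1 G0 d e B1 D \<delta> G1' G0' d' e' B1' D' \<delta>' f c1 c0 F"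
  shows "lin R G1 G1' c1" "lin R G0 G0' c0" "x \<in> carrier G1 \<Longrightarrow> c0 (d x) = d' (c1 x)"
    "y \<in> carrier G0 \<Longrightarrow> e' (c0 y) = f (e y)" "chain_map (op_ring R) D' \<delta>' D \<delta> F"
    "x \<in> carrier G1 \<Longrightarrow> w \<in> carrier (D' 0) \<Longrightarrow> B1' (c1 x) w = B1 x (F 0 w)"
  using assms unfolding tr_lift_def by blast+

text \<open>Two lifts differ in degree one by \<open>s d + u\<close> with \<open>d' u = 0\<close>. The transpose of \<open>s d\<close> is a homotopy and
  that of \<open>u\<close> vanishes on boundaries.\<close>

lemma tr_lift_unique:
  assumes T: "tr_res R G1 G0 d N e B1 B0 D \<delta>" and T': "tr_res R G1' G0' d' N' e' B1' B0' D' \<delta>'"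
    and L: "tr_lift R G1 G0 d e B1 D \<delta> G1' G0' d' e' B1' D' \<delta>' f c1 c0 F"
    and L': "tr_lift R G1 G0 d e B1 D \<delta> G1' G0' d' e' B1' D' \<delta>' f b1 b0 F'"
  shows "coh_eq (op_ring R) D' \<delta>' D \<delta> (Suc k) (F (Suc k)) (F' (Suc k))"
proof -
  note t = tr_resD[OF T] and t' = tr_resD[OF T'] and l = tr_liftD[OF L] and l' = tr_liftD[OF L']
  note \<delta> = proj_complexD(3)[OF t(8), of 0, simplified] and \<delta>' = proj_complexD(3)[OF t'(8), of 0, simplified]
  interpret N': right_module R N' by (rule lin_modules(2)[OF t'(4)])
  interpret G0': right_module R G0' by (rule lin_modules(2)[OF t'(3)])
  interpret G1': right_module R G1' by (rule lin_modules(1)[OF t'(3)])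
  interpret D0: right_module "op_ring R" "D 0" by (rule proj_complexD(2)[OF t(8)])
  have "c0 y \<ominus>\<^bsub>G0'\<^esub> b0 y \<in> d' ` carrier G1'" if y: "y \<in> carrier G0" for y
  proof -
    note cy = lin_closed[OF l(2) y] and by' = lin_closed[OF l'(2) y]
    have "e' (c0 y \<ominus>\<^bsub>G0'\<^esub> b0 y) = \<zero>\<^bsub>N'\<^esub>"
      using lin_minus[OF t'(4) cy by'] l(4)[OF y] l'(4)[OF y] lin_closed[OF t'(4) by']
      by (simp add: N'.M.minus_eq_zero_iff)
    then show ?thesis using t'(6) G0'.M.minus_closed[OF cy by'] by blast
  qed
  then obtain s where s: "lin R G0 G1' s" "\<And>y. y \<in> carrier G0 \<Longrightarrow> d' (s y) = c0 y \<ominus>\<^bsub>G0'\<^esub> b0 y"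
    using projective_lift[OF t(2) lin_diff[OF l(2) l'(2)] t'(3)] by blast
  define u where "u x = (c1 x \<ominus>\<^bsub>G1'\<^esub> b1 x) \<ominus>\<^bsub>G1'\<^esub> s (d x)" for x
  have u: "lin R G1 G1' u"
    unfolding u_def by (rule lin_diff[OF lin_diff[OF l(1) l'(1)] lin_comp[OF t(3) s(1)]])
  have du: "d' (u x) = \<zero>\<^bsub>G0'\<^esub>" if x: "x \<in> carrier G1" for x
  proof -
    note cx = lin_closed[OF l(1) x] and bx = lin_closed[OF l'(1) x] and dx = lin_closed[OF t(3) x]
    have "d' (u x) = (c0 (d x) \<ominus>\<^bsub>G0'\<^esub> b0 (d x)) \<ominus>\<^bsub>G0'\<^esub> (c0 (d x) \<ominus>\<^bsub>G0'\<^esub> b0 (d x))"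
      unfolding u_def using cx bx lin_closed[OF s(1) dx]
      by (simp add: lin_minus[OF t'(3)] s(2)[OF dx] l(3)[OF x] l'(3)[OF x])
    then show ?thesis
      using lin_closed[OF l(2) dx] lin_closed[OF l'(2) dx] by (simp add: G0'.M.minus_eq_zero_iff)
  qed
  obtain \<sigma> where \<sigma>: "lin (op_ring R) (D' 0) (D 1) \<sigma>"
    "\<And>y w. y \<in> carrier G0 \<Longrightarrow> w \<in> carrier (D' 0) \<Longrightarrow> B1' (s y) w = B0 y (\<sigma> w)"
    using transpose_exists[OF t(10) t'(9) s(1)] by blast
  obtain v where v: "lin (op_ring R) (D' 0) (D 0) v"
    "\<And>x w. x \<in> carrier G1 \<Longrightarrow> w \<in> carrier (D' 0) \<Longrightarrow> B1' (u x) w = B1 x (v w)"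
    using transpose_exists[OF t(9) t'(9) u] by blast
  have "v (\<delta>' 1 w) = \<zero>\<^bsub>D 0\<^esub>" if w: "w \<in> carrier (D' 1)" for w
  proof (rule perfectD(7)[OF t(9)])
    have dw: "\<delta>' 1 w \<in> carrier (D' 0)" using lin_closed[OF \<delta>'] w by simp
    show "v (\<delta>' 1 w) \<in> carrier (D 0)" by (rule lin_closed[OF v(1) dw])
    fix x assume x: "x \<in> carrier G1"
    have "B1 x (v (\<delta>' 1 w)) = B0' (d' (u x)) w"
      using v(2)[OF x dw] t'(11)[OF lin_closed[OF u x] w] by simp
    then show "B1 x (v (\<delta>' 1 w)) = \<zero>\<^bsub>R\<^esub>"
      using du[OF x] lin_zero[OF perfectD(3)[OF t'(10) w]] by simp
  qed
  moreover have "F 0 w \<ominus>\<^bsub>D 0\<^esub> (F' 0 w \<oplus>\<^bsub>D 0\<^esub> v w) \<in> \<delta> 1 ` carrier (D 1)" if w: "w \<in> carrier (D' 0)" for w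
  proof -
    note sw = lin_closed[OF \<sigma>(1) w] and vw = lin_closed[OF v(1) w]
    have dsw: "\<delta> 1 (\<sigma> w) \<in> carrier (D 0)" using lin_closed[OF \<delta>] sw by simp
    note Fw = lin_closed[OF chain_mapD(1)[OF l(5)] w] and Fw' = lin_closed[OF chain_mapD(1)[OF l'(5)] w]
    have "F 0 w = \<delta> 1 (\<sigma> w) \<oplus>\<^bsub>D 0\<^esub> (F' 0 w \<oplus>\<^bsub>D 0\<^esub> v w)"
    proof (rule perfect_eqI[OF t(9)])
      fix x assume x: "x \<in> carrier G1"
      note cx = lin_closed[OF l(1) x] and bx = lin_closed[OF l'(1) x] and dx = lin_closed[OF t(3) x]
        and ux = lin_closed[OF u x]
      note sdx = lin_closed[OF s(1) dx]
      have "(u x \<oplus>\<^bsub>G1'\<^esub> s (d x)) \<oplus>\<^bsub>G1'\<^esub> b1 x = c1 x"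
        using cx bx sdx by (simp add: u_def G1'.M.minus_add_cancel)
      then have "c1 x = s (d x) \<oplus>\<^bsub>G1'\<^esub> (b1 x \<oplus>\<^bsub>G1'\<^esub> u x)"
        using ux bx sdx by (simp add: G1'.M.a_ac)
      then have "B1 x (F 0 w) = B1' (s (d x) \<oplus>\<^bsub>G1'\<^esub> (b1 x \<oplus>\<^bsub>G1'\<^esub> u x)) w"
        using l(6)[OF x w] by simp
      also have "\<dots> = B1' (s (d x)) w \<oplus>\<^bsub>R\<^esub> (B1' (b1 x) w \<oplus>\<^bsub>R\<^esub> B1' (u x) w)"
        using lin_add[OF perfectD(3)[OF t'(9) w]] sdx bx ux by simp
      also have "B1' (s (d x)) w = B1 x (\<delta> 1 (\<sigma> w))"
        using \<sigma>(2)[OF dx w] t(11)[OF x sw] by simp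
      also have "B1' (b1 x) w = B1 x (F' 0 w)" by (rule l'(6)[OF x w])
      also have "B1' (u x) w = B1 x (v w)" by (rule v(2)[OF x w])
      also have "B1 x (\<delta> 1 (\<sigma> w)) \<oplus>\<^bsub>R\<^esub> (B1 x (F' 0 w) \<oplus>\<^bsub>R\<^esub> B1 x (v w)) =
          B1 x (\<delta> 1 (\<sigma> w) \<oplus>\<^bsub>D 0\<^esub> (F' 0 w \<oplus>\<^bsub>D 0\<^esub> v w))"
        using lin_add[OF perfectD(4)[OF t(9) x]] dsw Fw' vw by simp
      finally show "B1 x (F 0 w) = B1 x (\<delta> 1 (\<sigma> w) \<oplus>\<^bsub>D 0\<^esub> (F' 0 w \<oplus>\<^bsub>D 0\<^esub> v w))" .
    qed (use Fw dsw Fw' vw in simp_all)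
    then have "F 0 w \<ominus>\<^bsub>D 0\<^esub> (F' 0 w \<oplus>\<^bsub>D 0\<^esub> v w) = \<delta> 1 (\<sigma> w)"
      using D0.M.eq_minus_iff[OF Fw D0.M.a_closed[OF Fw' vw] dsw] by simp
    then show ?thesis using sw by blast
  qed
  ultimately have "stably_eq (op_ring R) D' \<delta>' D \<delta> (F 0) (F' 0)"
    using v(1) unfolding stably_eq_def by blast
  then show ?thesis by (rule stably_eq_coh_eq[OF t'(8) t(7) l(5) l'(5)])
qed

lemma tr_lift_exists:
  assumes T: "tr_res R G1 G0 d N e B1 B0 D \<delta>" and T': "tr_res R G1' G0' d' N' e' B1' B0' D' \<delta>'"
    and f: "lin R N N' f"
  shows "\<exists>c1 c0 F. tr_lift R G1 G0 d e B1 D \<delta> G1' G0' d' e' B1' D' \<delta>' f c1 c0 F"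
proof -
  note t = tr_resD[OF T] and t' = tr_resD[OF T']
  note \<delta> = proj_complexD(3)[OF t(8), of 0, simplified] and \<delta>' = proj_complexD(3)[OF t'(8), of 0, simplified]
  have "f (e y) \<in> e' ` carrier G0'" if "y \<in> carrier G0" for y
    using t'(5) lin_closed[OF f lin_closed[OF t(4) that]] by simp
  then obtain c0 where c0: "lin R G0 G0' c0" "\<And>y. y \<in> carrier G0 \<Longrightarrow> e' (c0 y) = f (e y)"
    using projective_lift[OF t(2) lin_comp[OF t(4) f] t'(4)] by blast
  have "c0 (d x) \<in> d' ` carrier G1'" if x: "x \<in> carrier G1" for x
  proof -
    note dx = lin_closed[OF t(3) x]
    have "e (d x) = \<zero>\<^bsub>N\<^esub>" using t(6)[OF dx] x by blast
    then have "e' (c0 (d x)) = \<zero>\<^bsub>N'\<^esub>" using c0(2)[OF dx] lin_zero[OF f] by simp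
    then show ?thesis using t'(6)[OF lin_closed[OF c0(1) dx]] by simp
  qed
  then obtain c1 where c1: "lin R G1 G1' c1" "\<And>x. x \<in> carrier G1 \<Longrightarrow> d' (c1 x) = c0 (d x)"
    using projective_lift[OF t(1) lin_comp[OF t(3) c0(1)] t'(3)] by blast
  obtain F0 where F0: "lin (op_ring R) (D' 0) (D 0) F0"
    "\<And>x w. x \<in> carrier G1 \<Longrightarrow> w \<in> carrier (D' 0) \<Longrightarrow> B1' (c1 x) w = B1 x (F0 w)"
    using transpose_exists[OF t(9) t'(9) c1(1)] by blast
  \<comment> \<open>The adjoint of \<open>c0\<close> serves to see that \<open>F0\<close> maps
    boundaries to boundaries; the extension obtained below may differ from it in degree one.\<close>
  obtain F1 where F1: "lin (op_ring R) (D' 1) (D 1) F1"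
    "\<And>y w. y \<in> carrier G0 \<Longrightarrow> w \<in> carrier (D' 1) \<Longrightarrow> B0' (c0 y) w = B0 y (F1 w)"
    using transpose_exists[OF t(10) t'(10) c0(1)] by blast
  have "F0 (\<delta>' 1 w) \<in> \<delta> 1 ` carrier (D 1)" if w: "w \<in> carrier (D' 1)" for w
  proof -
    have dw: "\<delta>' 1 w \<in> carrier (D' 0)" using lin_closed[OF \<delta>'] w by simp
    note Fw = lin_closed[OF F1(1) w]
    have "F0 (\<delta>' 1 w) = \<delta> 1 (F1 w)"
    proof (rule perfect_eqI[OF t(9)])
      fix x assume x: "x \<in> carrier G1"
      show "B1 x (F0 (\<delta>' 1 w)) = B1 x (\<delta> 1 (F1 w))"
        using F0(2)[OF x dw] t'(11)[OF lin_closed[OF c1(1) x] w] c1(2)[OF x]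
          F1(2)[OF lin_closed[OF t(3) x] w] t(11)[OF x Fw] by simp
    qed (use lin_closed[OF F0(1) dw] lin_closed[OF \<delta>] Fw in simp_all)
    then show ?thesis using Fw by blast
  qed
  then obtain F where "chain_map (op_ring R) D' \<delta>' D \<delta> F" "F 0 = F0"
    using chain_map_extend[OF t'(8) t(7) F0(1)] by blast
  then have "tr_lift R G1 G0 d e B1 D \<delta> G1' G0' d' e' B1' D' \<delta>' f c1 c0 F"
    using c0 c1 F0 by (simp add: tr_lift_def)
  then show ?thesis by blast
qed

lemma tr_lift_comp:
  assumes L: "tr_lift R G1 G0 d e B1 D \<delta> G1' G0' d' e' B1' D' \<delta>' f c1 c0 F"
    and L': "tr_lift R G1' G0' d' e' B1' D' \<delta>' G1'' G0'' d'' e'' B1'' D'' \<delta>'' g b1 b0 F'"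
  shows "tr_lift R G1 G0 d e B1 D \<delta> G1'' G0'' d'' e'' B1'' D'' \<delta>'' (\<lambda>x. g (f x))
    (\<lambda>x. b1 (c1 x)) (\<lambda>x. b0 (c0 x)) (\<lambda>i w. F i (F' i w))"
proof -
  note l = tr_liftD[OF L] and l' = tr_liftD[OF L']
  show ?thesis
    unfolding tr_lift_def
    using lin_comp[OF l(1) l'(1)] lin_comp[OF l(2) l'(2)] chain_map_comp[OF l'(5) l(5)]
      lin_closed[OF l(1)] lin_closed[OF l(2)] lin_closed[OF chain_mapD(1)[OF l'(5)]]
    by (simp add: l(3,4,6) l'(3,4,6))
qed

lemma tr_lift_id:
  assumes T: "tr_res R G1 G0 d N e B1 B0 D \<delta>"
  shows "tr_lift R G1 G0 d e B1 D \<delta> G1 G0 d e B1 D \<delta> (\<lambda>x. x) (\<lambda>x. x) (\<lambda>x. x) (\<lambda>i x. x)"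
  using tr_resD[OF T] by (simp add: tr_lift_def lin_id chain_map_id fg_projective_module)

text \<open>Lifts of the identity in both directions compose to lifts of the identity, and by
  \<open>tr_lift_unique\<close> these act as the identity on cohomology in positive degrees.\<close>

lemma tr_lift_equivalence:
  assumes T: "tr_res R G1 G0 d N e B1 B0 D \<delta>" and T': "tr_res R G1' G0' d' N e' B1' B0' D' \<delta>'"
    and L: "tr_lift R G1 G0 d e B1 D \<delta> G1' G0' d' e' B1' D' \<delta>' (\<lambda>x. x) c1 c0 F"
  shows "coh_inj (op_ring R) D' \<delta>' D \<delta> (Suc k) (F (Suc k))"
    "coh_surj (op_ring R) D' \<delta>' D \<delta> (Suc k) (F (Suc k))"
proof -
  note t = tr_resD[OF T] and t' = tr_resD[OF T']
  obtain b1 b0 G where L': "tr_lift R G1' G0' d' e' B1' D' \<delta>' G1 G0 d e B1 D \<delta> (\<lambda>x. x) b1 b0 G"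
    using tr_lift_exists[OF T' T lin_id[OF lin_modules(2)[OF t(4)]]] by blast
  show "coh_inj (op_ring R) D' \<delta>' D \<delta> (Suc k) (F (Suc k))"
    "coh_surj (op_ring R) D' \<delta>' D \<delta> (Suc k) (F (Suc k))"
    using coh_equivalence[OF t'(8) t(8) tr_liftD(5)[OF L] tr_liftD(5)[OF L']
        tr_lift_unique[OF T' T' tr_lift_comp[OF L' L] tr_lift_id[OF T']]
        tr_lift_unique[OF T T tr_lift_comp[OF L L'] tr_lift_id[OF T]]] by blast+
qed

lemma tr_res_coh_zero:
  assumes T: "tr_res R G1 G0 d N e B1 B0 D \<delta>" and T': "tr_res R G1' G0' d' N e' B1' B0' D' \<delta>'"
  shows "coh_zero (op_ring R) D \<delta> (Suc k) \<longleftrightarrow> coh_zero (op_ring R) D' \<delta>' (Suc k)"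
proof -
  note t = tr_resD[OF T] and t' = tr_resD[OF T']
  obtain b1 b0 F where L: "tr_lift R G1 G0 d e B1 D \<delta> G1' G0' d' e' B1' D' \<delta>' (\<lambda>x. x) b1 b0 F"
    using tr_lift_exists[OF T T' lin_id[OF lin_modules(2)[OF t(4)]]] by blast
  note F = tr_liftD(5)[OF L] and e = tr_lift_equivalence[OF T T' L]
  show ?thesis
    using coh_zero_target[OF t'(8) F e(1)] coh_zero_source[OF t'(8) F e(2)] by blast
qed

lemma tr_res_dual:
  assumes "fg_projective R G1" "fg_projective R G0" "lin R G1 G0 d" "lin R G0 N e"
    "e ` carrier G0 = carrier N" "{y \<in> carrier G0. e y = \<zero>\<^bsub>N\<^esub>} = d ` carrier G1"
    "acyclic_complex (op_ring R) D \<delta>" "D 0 = dual R G1" "D 1 = dual R G0"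
    "\<And>g. g \<in> carrier (dual R G0) \<Longrightarrow> \<delta> 1 g = dual_map G1 d g"
  shows "tr_res R G1 G0 d N e (\<lambda>x g. g x) (\<lambda>x g. g x) D \<delta>"
  using assms perfect_dual[OF assms(1)] perfect_dual[OF assms(2)] by (simp add: tr_res_def dual_map_def)

text \<open>Each class of the middle complex comes from \<open>C''\<close> because \<open>G\<close>
  is onto on cohomology, and there injectivity of the composite decides whether it vanishes.\<close>

lemma coh_inj_cancel_left:
  assumes C: "proj_complex R C d" and C': "proj_complex R C' d'"
    and F: "chain_map R C d C' d' F" and G: "chain_map R C' d' C'' d'' G"
    and inj: "coh_inj R C d C'' d'' k (\<lambda>x. G k (F k x))" and surj: "coh_surj R C' d' C'' d'' k (G k)"
  shows "coh_inj R C d C' d' k (F k)"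
  unfolding coh_inj_def
proof (intro allI impI)
  fix g assume g: "cocycle R C' d' k g" "coboundary R C d k (\<lambda>x. g (F k x))"
  obtain h where h: "cocycle R C'' d'' k h" "coboundary R C' d' k (\<lambda>x. g x \<ominus>\<^bsub>R\<^esub> h (G k x))"
    using surj g(1) by (auto simp: coh_surj_def)
  note F' = lin_closed[OF chain_mapD(1)[OF F]] and G' = lin_closed[OF chain_mapD(1)[OF G]]
  have "coboundary R C d k (\<lambda>x. h (G k (F k x)))"
    using coboundary_eq_iff[OF C coboundary_comp[OF C F h(2)]] g(2) cocycle_value[OF g(1)]
      cocycle_value[OF h(1)] F' G' by simp
  then have "coboundary R C'' d'' k h" using inj h(1) by (simp add: coh_inj_def)
  then have "coboundary R C' d' k (\<lambda>x. h (G k x))" by (rule coboundary_comp[OF C' G])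
  then show "coboundary R C' d' k g"
    using coboundary_eq_iff[OF C' h(2)] cocycle_value[OF g(1)] cocycle_value[OF h(1)] G' by simp
qed

lemma coh_surj_cancel_left:
  assumes "proj_complex R C' d'" "chain_map R C' d' C'' d'' G"
    and "coh_surj R C d C'' d'' k (\<lambda>x. G k (f x))"
  shows "coh_surj R C d C' d' k f"
  using assms(3) cocycle_comp[OF assms(1,2)] unfolding coh_surj_def by blast


section \<open>The mapping cone\<close>

text \<open>If \<open>C\<close> resolves \<open>P/B\<close> and \<open>D\<close> resolves \<open>P/Z\<close> with \<open>C 0 = D 0 = P\<close> and \<open>B \<subseteq> Z\<close>, then the mapping
  cone of \<open>C \<rightarrow> D\<close>, with the two copies of \<open>P\<close> cancelled, resolves \<open>Z/B\<close>.\<close>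

context
  fixes R :: "('a, 'r) ring_scheme" and C D :: "nat \<Rightarrow> ('a, 'q) module" and d \<delta> :: "nat \<Rightarrow> 'q \<Rightarrow> 'q"
    and F :: "nat \<Rightarrow> 'q \<Rightarrow> 'q"
  assumes C: "acyclic_complex R C d" and D: "acyclic_complex R D \<delta>" and F: "chain_map R C d D \<delta> F"
    and CD: "C 0 = D 0" and F0: "\<And>x. x \<in> carrier (C 0) \<Longrightarrow> F 0 x = x"
begin

text \<open>The usual cone has \<open>D i\<close> next to \<open>C (i - 1)\<close>. Cancelling the
  common module \<open>C 0 = D 0\<close> lowers the index by one and empties the second factor in
  degree zero, where a zero module inside \<open>C 0\<close> keeps the type uniform.\<close>

definition cone where
  "cone i = prod_module (D (Suc i)) (case i of 0 \<Rightarrow> (C 0)\<lparr>carrier := {\<zero>\<^bsub>C 0\<^esub>}\<rparr> | Suc l \<Rightarrow> C (Suc l))"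

text \<open>In degree one the component into \<open>C 0\<close> is cancelled. Nothing is lost, since
  applying \<open>\<delta> 1\<close> to the first component recovers \<open>d 1\<close> of the
  second coordinate.\<close>

definition cone_bd where
  "cone_bd i p = (\<delta> (Suc i) (fst p) \<oplus>\<^bsub>D i\<^esub> F i (snd p),
     if i = 1 then \<zero>\<^bsub>C 0\<^esub> else \<ominus>\<^bsub>C (i - 1)\<^esub> d i (snd p))"

private lemmas PC = proj_complexD[OF acyclic_proj[OF C]] and PD = proj_complexD[OF acyclic_proj[OF D]]
  and FD = chain_mapD[OF F]

interpretation C: right_module R "C i" for i by (rule PC(2))
interpretation D: right_module R "D i" for i by (rule PD(2))

private lemma lin_values:
  "x \<in> carrier (C (Suc i)) \<Longrightarrow> d (Suc i) x \<in> carrier (C i)"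
  "x \<in> carrier (D (Suc i)) \<Longrightarrow> \<delta> (Suc i) x \<in> carrier (D i)"
  "x \<in> carrier (C i) \<Longrightarrow> F i x \<in> carrier (D i)"
  by (rule lin_closed[OF PC(3)] lin_closed[OF PD(3)] lin_closed[OF FD(1)]; assumption)+

private lemma \<delta>F1: "y \<in> carrier (C (Suc 0)) \<Longrightarrow> \<delta> (Suc 0) (F (Suc 0) y) = d (Suc 0) y"
  using FD(2)[of y 0] F0 lin_values(1) by simp

private abbreviation "C0z \<equiv> (C 0)\<lparr>carrier := {\<zero>\<^bsub>C 0\<^esub>}\<rparr>"

private lemma C0z: "fg_projective R C0z"
  by (rule fg_projective_zero[OF PC(2)])

lemma cone_simps:
  "cone 0 = prod_module (D (Suc 0)) C0z" "cone (Suc l) = prod_module (D (Suc (Suc l))) (C (Suc l))"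
  "cone_bd (Suc 0) p = (\<delta> (Suc (Suc 0)) (fst p) \<oplus>\<^bsub>D (Suc 0)\<^esub> F (Suc 0) (snd p), \<zero>\<^bsub>C 0\<^esub>)"
  "cone_bd (Suc (Suc l)) p = (\<delta> (Suc (Suc (Suc l))) (fst p) \<oplus>\<^bsub>D (Suc (Suc l))\<^esub> F (Suc (Suc l)) (snd p),
     \<ominus>\<^bsub>C (Suc l)\<^esub> d (Suc (Suc l)) (snd p))"
  by (simp_all add: cone_def cone_bd_def)

lemma lin_cone_bd: "lin R (cone (Suc i)) (cone i) (cone_bd (Suc i))"
proof -
  note pr = lin_prod[OF PD(2)[of "Suc (Suc i)"] PC(2)[of "Suc i"]]
  note fst = lin_sum[OF lin_comp[OF pr(1) PD(3)] lin_comp[OF pr(2) FD(1)]]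
  show ?thesis
  proof (cases i)
    case 0
    have "lin R (cone (Suc 0)) (cone 0) (\<lambda>p. (\<delta> (Suc (Suc 0)) (fst p) \<oplus>\<^bsub>D (Suc 0)\<^esub> F (Suc 0) (snd p), \<zero>\<^bsub>C0z\<^esub>))"
      unfolding cone_simps
      by (rule lin_pair[OF _ lin_const_zero]) (use fst 0 lin_modules(1)[OF fst] fg_projective_module[OF C0z] in simp_all)
    then show ?thesis using 0 by (simp add: cone_simps(3) lin_cong_iff[of _ "cone_bd (Suc 0)"])
  next
    case (Suc l)
    have "lin R (cone (Suc (Suc l))) (cone (Suc l)) (\<lambda>p. (\<delta> (Suc (Suc (Suc l))) (fst p)
        \<oplus>\<^bsub>D (Suc (Suc l))\<^esub> F (Suc (Suc l)) (snd p), \<ominus>\<^bsub>C (Suc l)\<^esub> d (Suc (Suc l)) (snd p)))"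
      unfolding cone_simps
      by (rule lin_pair[OF _ lin_uminus[OF lin_comp[OF _ PC(3)]]]) (use fst pr Suc in simp_all)
    then show ?thesis using Suc by (simp add: cone_simps(4) lin_cong_iff[of _ "cone_bd (Suc (Suc l))"])
  qed
qed

lemma acyclic_cone: "acyclic_complex R cone cone_bd"
  unfolding acyclic_complex_def proj_complex_def
proof (intro conjI allI ballI impI)
  show "fg_projective R (cone i)" for i
    by (cases i) (simp_all add: cone_simps fg_projective_prod PD(1) PC(1) C0z)
  show "lin R (cone (Suc i)) (cone i) (cone_bd (Suc i))" for i by (rule lin_cone_bd)
  fix i p assume p: "p \<in> carrier (cone (Suc (Suc i)))"
  obtain x y where xy: "p = (x, y)" "x \<in> carrier (D (Suc (Suc (Suc i))))" "y \<in> carrier (C (Suc (Suc i)))"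
    using p by (cases p) (simp add: cone_simps)
  note v = lin_values(2)[OF xy(2)] lin_values(3)[OF xy(3)] lin_values(1)[OF xy(3)]
  have "\<delta> (Suc (Suc i)) (\<delta> (Suc (Suc (Suc i))) x \<oplus>\<^bsub>D (Suc (Suc i))\<^esub> F (Suc (Suc i)) y) \<oplus>\<^bsub>D (Suc i)\<^esub>
      F (Suc i) (\<ominus>\<^bsub>C (Suc i)\<^esub> d (Suc (Suc i)) y) = \<zero>\<^bsub>D (Suc i)\<^esub>"
    using v lin_values(3)[OF v(3)]
    by (simp add: lin_add[OF PD(3)] PD(4)[OF xy(2)] lin_neg[OF FD(1)] FD(2)[OF xy(3)] D.M.r_neg)
  moreover have "\<ominus>\<^bsub>C i\<^esub> d (Suc i) (\<ominus>\<^bsub>C (Suc i)\<^esub> d (Suc (Suc i)) y) = \<zero>\<^bsub>C i\<^esub>"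
    using v(3) lin_neg[OF PC(3)] PC(4)[OF xy(3)] by (simp add: C.M.add.inv_one)
  ultimately show "cone_bd (Suc i) (cone_bd (Suc (Suc i)) p) = \<zero>\<^bsub>cone i\<^esub>"
    using xy(1) by (cases i) (simp_all add: cone_simps)
next
  fix i p assume p: "p \<in> carrier (cone (Suc i))" and z: "cone_bd (Suc i) p = \<zero>\<^bsub>cone i\<^esub>"
  obtain x y where xy: "p = (x, y)" "x \<in> carrier (D (Suc (Suc i)))" "y \<in> carrier (C (Suc i))"
    using p by (cases p) (simp add: cone_simps)
  note v = lin_values(2)[OF xy(2)] lin_values(3)[OF xy(3)] lin_values(1)[OF xy(3)]
  have z1: "\<delta> (Suc (Suc i)) x \<oplus>\<^bsub>D (Suc i)\<^esub> F (Suc i) y = \<zero>\<^bsub>D (Suc i)\<^esub>"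
    using z xy(1) by (cases i) (simp_all add: cone_simps)
  have z2: "d (Suc i) y = \<zero>\<^bsub>C i\<^esub>"
  proof (cases i)
    case 0
    have "\<delta> (Suc 0) (\<delta> (Suc (Suc 0)) x \<oplus>\<^bsub>D (Suc 0)\<^esub> F (Suc 0) y) = d (Suc 0) y"
      using v xy 0 by (simp add: lin_add[OF PD(3)] PD(4) \<delta>F1 CD)
    then show ?thesis using z1 0 lin_zero[OF PD(3)[of 0]] CD by simp
  next
    case (Suc l)
    then have "\<ominus>\<^bsub>C i\<^esub> d (Suc i) y = \<zero>\<^bsub>C i\<^esub>" using z xy(1) by (simp add: cone_simps)
    moreover have "d (Suc i) y = \<ominus>\<^bsub>C i\<^esub> (\<ominus>\<^bsub>C i\<^esub> d (Suc i) y)"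
      using v(3) by (simp add: C.M.minus_minus)
    ultimately show ?thesis by (simp add: C.M.add.inv_one)
  qed
  \<comment> \<open>Cycles are filled as in any cone: \<open>y\<close> bounds by exactness of
    \<open>C\<close>, and adding \<open>F\<close> of a filling to \<open>x\<close> gives a cycle of
    \<open>D\<close>, which bounds in turn.\<close>
  obtain y' where y': "y' \<in> carrier (C (Suc (Suc i)))" "y = d (Suc (Suc i)) y'"
    using acyclic_exact[OF C xy(3) z2] by blast
  note w = lin_values(3)[OF y'(1)]
  have "\<delta> (Suc (Suc i)) (x \<oplus>\<^bsub>D (Suc (Suc i))\<^esub> F (Suc (Suc i)) y') = \<zero>\<^bsub>D (Suc i)\<^esub>"
    using z1 xy(2) w by (simp add: lin_add[OF PD(3)] FD(2)[OF y'(1)] y'(2))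
  then obtain x' where x': "x' \<in> carrier (D (Suc (Suc (Suc i))))"
    "x \<oplus>\<^bsub>D (Suc (Suc i))\<^esub> F (Suc (Suc i)) y' = \<delta> (Suc (Suc (Suc i))) x'"
    using acyclic_exact[OF D D.M.a_closed[OF xy(2) w]] by blast
  let ?q = "(x', \<ominus>\<^bsub>C (Suc (Suc i))\<^esub> y')"
  have "\<delta> (Suc (Suc (Suc i))) x' \<oplus>\<^bsub>D (Suc (Suc i))\<^esub> F (Suc (Suc i)) (\<ominus>\<^bsub>C (Suc (Suc i))\<^esub> y') = x"
    using xy(2) w y'(1) by (simp flip: x'(2) add: lin_neg[OF FD(1)] D.M.a_assoc D.M.r_neg)
  moreover have "\<ominus>\<^bsub>C (Suc i)\<^esub> d (Suc (Suc i)) (\<ominus>\<^bsub>C (Suc (Suc i))\<^esub> y') = y"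
    using lin_values(1)[OF y'(1)] by (simp add: lin_neg[OF PC(3) y'(1)] y'(2))
  ultimately have "p = cone_bd (Suc (Suc i)) ?q" using xy(1) by (simp add: cone_simps)
  moreover have "?q \<in> carrier (cone (Suc (Suc i)))" using x'(1) y'(1) by (simp add: cone_simps)
  ultimately show "p \<in> cone_bd (Suc (Suc i)) ` carrier (cone (Suc (Suc i)))" by blast
qed

text \<open>The term in degree zero is essentially \<open>D 1\<close>, and \<open>e\<close>
  identifies two of its elements exactly when their images under \<open>\<delta> 1\<close> agree
  modulo boundaries of \<open>C\<close>. Thus \<open>E\<close> is the quotient of the boundaries of
  \<open>D\<close> by those of \<open>C\<close>.\<close>

lemma resolves_cone:
  assumes e: "lin R (D 1) E e" "e ` carrier (D 1) = carrier E"
    and ker: "\<And>x. x \<in> carrier (D 1) \<Longrightarrow> e x = \<zero>\<^bsub>E\<^esub> \<longleftrightarrow> \<delta> 1 x \<in> d 1 ` carrier (C 1)"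
  shows "resolves R cone cone_bd E (\<lambda>p. e (fst p))"
proof -
  have A: "lin R (cone 0) E (\<lambda>p. e (fst p))"
    using lin_comp[OF lin_prod(1)[OF PD(2)[of "Suc 0"] fg_projective_module[OF C0z]]] e(1) by (simp add: cone_simps)
  have B: "(\<lambda>p. e (fst p)) ` carrier (cone 0) = carrier E"
  proof -
    have "(\<lambda>p. e (fst p)) ` carrier (cone 0) = e ` fst ` carrier (cone 0)" by (simp only: image_image)
    also have "fst ` carrier (cone 0) = carrier (D 1)" by (simp add: cone_simps)
    finally show ?thesis using e(2) by simp
  qed
  have "e (fst p) = \<zero>\<^bsub>E\<^esub> \<longleftrightarrow> p \<in> cone_bd 1 ` carrier (cone 1)" if p: "p \<in> carrier (cone 0)" for p
  proof -
    obtain x where x: "p = (x, \<zero>\<^bsub>C 0\<^esub>)" "x \<in> carrier (D (Suc 0))"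
      using p by (cases p) (simp add: cone_simps)
    have "\<delta> (Suc 0) x \<in> d (Suc 0) ` carrier (C (Suc 0)) \<longleftrightarrow>
      (\<exists>x'\<in>carrier (D (Suc (Suc 0))). \<exists>y\<in>carrier (C (Suc 0)). x = \<delta> (Suc (Suc 0)) x' \<oplus>\<^bsub>D (Suc 0)\<^esub> F (Suc 0) y)"
      (is "?L \<longleftrightarrow> ?R")
    proof
      assume ?L
      then obtain y where y: "y \<in> carrier (C (Suc 0))" "\<delta> (Suc 0) x = \<delta> (Suc 0) (F (Suc 0) y)"
        using \<delta>F1 by auto
      note w = lin_values(3)[OF y(1)]
      have "\<delta> (Suc 0) (x \<ominus>\<^bsub>D (Suc 0)\<^esub> F (Suc 0) y) = \<zero>\<^bsub>D 0\<^esub>"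
        using y(2) lin_minus[OF PD(3) x(2) w] lin_values(2)[OF w] by (simp add: D.M.minus_eq_zero_iff)
      then obtain x' where x': "x' \<in> carrier (D (Suc (Suc 0)))" "x \<ominus>\<^bsub>D (Suc 0)\<^esub> F (Suc 0) y = \<delta> (Suc (Suc 0)) x'"
        using acyclic_exact[OF D D.M.minus_closed[OF x(2) w]] by blast
      then have "x = \<delta> (Suc (Suc 0)) x' \<oplus>\<^bsub>D (Suc 0)\<^esub> F (Suc 0) y"
        using D.M.eq_minus_iff[OF x(2) w lin_values(2)[OF x'(1)]] by simp
      then show ?R using x'(1) y(1) by blast
    next
      assume ?R
      then obtain x' y where xy: "x' \<in> carrier (D (Suc (Suc 0)))" "y \<in> carrier (C (Suc 0))"
        "x = \<delta> (Suc (Suc 0)) x' \<oplus>\<^bsub>D (Suc 0)\<^esub> F (Suc 0) y" by blast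
      have "\<delta> (Suc 0) x = d (Suc 0) y"
        using xy lin_values(1)[OF xy(2)] lin_values(2)[OF xy(1)] lin_values(3)[OF xy(2)]
        by (simp add: lin_add[OF PD(3)] PD(4) \<delta>F1 CD)
      then show ?L using xy(2) by blast
    qed
    also have "?R \<longleftrightarrow> p \<in> cone_bd 1 ` carrier (cone 1)"
    proof -
      have "p \<in> cone_bd 1 ` carrier (cone 1) \<longleftrightarrow> (\<exists>x'\<in>carrier (D (Suc (Suc 0))). \<exists>y\<in>carrier (C (Suc 0)).
          p = cone_bd (Suc 0) (x', y))"
        by (simp only: One_nat_def cone_simps(2) prod_module_simps image_iff) blast
      then show ?thesis using x(1) by (simp add: cone_simps(3))
    qed
    finally show ?thesis using ker[of x] x by simp
  qed
  moreover have "cone_bd 1 ` carrier (cone 1) \<subseteq> carrier (cone 0)"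
    using lin_closed[OF lin_cone_bd[of 0]] by auto
  ultimately have "{p \<in> carrier (cone 0). e (fst p) = \<zero>\<^bsub>E\<^esub>} = cone_bd 1 ` carrier (cone 1)" by blast
  then show ?thesis using acyclic_cone A B by (simp add: resolves_def)
qed

private lemma ringR: "ring R"
  using PC(2)[of 0] by (simp add: right_module_def)

private lemma incl_left: "lin R (D (Suc l)) (cone l) (\<lambda>x. (x, \<zero>\<^bsub>C l\<^esub>))"
  using lin_prod(3)[OF PD(2)[of "Suc l"] fg_projective_module[OF C0z]] lin_prod(3)[OF PD(2)[of "Suc l"] PC(2)[of l]]
  by (cases l) (simp_all add: cone_simps)

private lemma cone_bd_left:
  "x \<in> carrier (D (Suc (Suc l))) \<Longrightarrow> cone_bd (Suc l) (x, \<zero>\<^bsub>C (Suc l)\<^esub>) = (\<delta> (Suc (Suc l)) x, \<zero>\<^bsub>C l\<^esub>)"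
  using lin_values(2)[of x "Suc l"] lin_zero[OF FD(1), of "Suc l"] lin_zero[OF PC(3)[of l]]
  by (cases l) (simp_all add: cone_simps C.M.add.inv_one)

private lemma cone_bd_right:
  "y \<in> carrier (C (Suc l)) \<Longrightarrow> cone_bd (Suc l) (\<zero>\<^bsub>D (Suc (Suc l))\<^esub>, y) =
    (F (Suc l) y, case l of 0 \<Rightarrow> \<zero>\<^bsub>C 0\<^esub> | Suc _ \<Rightarrow> \<ominus>\<^bsub>C l\<^esub> d (Suc l) y)"
  using lin_values(3)[of y "Suc l"] lin_zero[OF PD(3), of "Suc l"]
  by (cases l) (simp_all add: cone_simps)

text \<open>The stretch of the long exact sequence around degree \<open>Suc l\<close> of the cone,
  done with explicit cocycles. A cocycle of \<open>C\<close> extends by zero to the cone, which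
  tests surjectivity; a cocycle of the cone restricts to \<open>D\<close> one degree higher, which
  tests injectivity.\<close>

lemma coh_zero_cone_Suc:
  "coh_zero R cone cone_bd (Suc l) \<longleftrightarrow>
    coh_surj R C d D \<delta> (Suc l) (F (Suc l)) \<and> coh_inj R C d D \<delta> (Suc (Suc l)) (F (Suc (Suc l)))"
proof (intro iffI conjI)
  note K = right_module_regular[OF ringR]
  note pr = lin_prod[OF PD(2)[of "Suc (Suc l)"] PC(2)[of "Suc l"], folded cone_simps(2)]
  assume Z: "coh_zero R cone cone_bd (Suc l)"
  show "coh_surj R C d D \<delta> (Suc l) (F (Suc l))"
    unfolding coh_surj_def
  proof (intro allI impI)
    fix v assume v: "cocycle R C d (Suc l) v"
    then have vl: "lin R (C (Suc l)) (regular_module R) v" by (simp add: cocycle_def)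
    have "cocycle R cone cone_bd (Suc l) (\<lambda>p. v (snd p))"
      unfolding cocycle_def
    proof (intro conjI ballI)
      show "lin R (cone (Suc l)) (regular_module R) (\<lambda>p. v (snd p))" by (rule lin_comp[OF pr(2) vl])
      fix p assume "p \<in> carrier (cone (Suc (Suc l)))"
      then have "snd p \<in> carrier (C (Suc (Suc l)))" by (auto simp: cone_simps)
      then show "v (snd (cone_bd (Suc (Suc l)) p)) = \<zero>\<^bsub>R\<^esub>"
        using v lin_neg[OF vl] lin_values(1) by (simp add: cone_simps cocycle_def)
    qed
    then obtain g where g: "lin R (cone l) (regular_module R) g"
      "\<And>p. p \<in> carrier (cone (Suc l)) \<Longrightarrow> v (snd p) = g (cone_bd (Suc l) p)"
      using Z unfolding coh_zero_def coboundary_Suc by blast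
    define u where "u x = g (x, \<zero>\<^bsub>C l\<^esub>)" for x
    have u: "lin R (D (Suc l)) (regular_module R) u"
      unfolding u_def by (rule lin_comp[OF incl_left g(1)])
    have "u (\<delta> (Suc (Suc l)) x) = \<zero>\<^bsub>R\<^esub>" if x: "x \<in> carrier (D (Suc (Suc l)))" for x
      using g(2)[of "(x, \<zero>\<^bsub>C (Suc l)\<^esub>)"] x cone_bd_left[OF x] lin_zero[OF vl] by (simp add: cone_simps(2) u_def)
    then have uc: "cocycle R D \<delta> (Suc l) u" using u by (simp add: cocycle_def)
    \<comment> \<open>The part of \<open>g\<close> on the second factor is the bounding functional,
      with the sign that undoes the one in \<open>cone_bd\<close>; for \<open>l = 0\<close> this
      factor is zero.\<close>
    define h where "h z = (case l of 0 \<Rightarrow> \<zero>\<^bsub>R\<^esub> | Suc _ \<Rightarrow> \<ominus>\<^bsub>R\<^esub> g (\<zero>\<^bsub>D (Suc l)\<^esub>, z))" for z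
    have h: "lin R (C l) (regular_module R) h"
    proof (cases l)
      case 0
      then show ?thesis using lin_const_zero[OF PC(2)[of 0] K] by (simp add: h_def[abs_def])
    next
      case (Suc m)
      then have "lin R (C l) (cone l) (\<lambda>z. (\<zero>\<^bsub>D (Suc l)\<^esub>, z))"
        using lin_prod(4)[OF PD(2)[of "Suc l"] PC(2)[of l]] by (simp add: cone_simps)
      then show ?thesis using lin_uminus[OF lin_comp[OF _ g(1)]] Suc by (simp add: h_def[abs_def])
    qed
    have "v y \<ominus>\<^bsub>R\<^esub> u (F (Suc l) y) = h (d (Suc l) y)" if y: "y \<in> carrier (C (Suc l))" for y
    proof -
      note Fy = lin_values(3)[OF y] and dy = lin_values(1)[OF y]
      define w where "w = (case l of 0 \<Rightarrow> \<zero>\<^bsub>C 0\<^esub> | Suc _ \<Rightarrow> \<ominus>\<^bsub>C l\<^esub> d (Suc l) y)"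
      have wc: "w \<in> carrier (C l)" "(\<zero>\<^bsub>D (Suc l)\<^esub>, w) \<in> carrier (cone l)" "(F (Suc l) y, \<zero>\<^bsub>C l\<^esub>) \<in> carrier (cone l)"
        using dy Fy by (cases l; simp add: cone_simps w_def)+
      have "v y = g (F (Suc l) y, w)"
        using g(2)[of "(\<zero>\<^bsub>D (Suc (Suc l))\<^esub>, y)"] y cone_bd_right[OF y] by (simp add: cone_simps(2) w_def)
      also have "(F (Suc l) y, w) = (\<zero>\<^bsub>D (Suc l)\<^esub>, w) \<oplus>\<^bsub>cone l\<^esub> (F (Suc l) y, \<zero>\<^bsub>C l\<^esub>)"
        using Fy wc(1) by (cases l) (simp_all add: cone_simps)
      also have "g \<dots> = g (\<zero>\<^bsub>D (Suc l)\<^esub>, w) \<oplus>\<^bsub>R\<^esub> u (F (Suc l) y)"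
        using lin_add[OF g(1) wc(2,3)] by (simp add: u_def)
      also have "g (\<zero>\<^bsub>D (Suc l)\<^esub>, w) = h (d (Suc l) y)"
      proof (cases l)
        case 0
        then show ?thesis using lin_zero[OF g(1)] by (simp add: h_def w_def cone_simps)
      next
        case (Suc m)
        have "(\<zero>\<^bsub>D (Suc l)\<^esub>, w) = \<ominus>\<^bsub>cone l\<^esub> (\<zero>\<^bsub>D (Suc l)\<^esub>, d (Suc l) y)"
          using lin_neg[OF lin_prod(4)[OF PD(2)[of "Suc l"] PC(2)[of l]] dy] Suc by (simp add: w_def cone_simps)
        moreover have "(\<zero>\<^bsub>D (Suc l)\<^esub>, d (Suc l) y) \<in> carrier (cone l)" using dy Suc by (simp add: cone_simps)
        ultimately show ?thesis using lin_neg[OF g(1)] Suc by (simp add: h_def)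
      qed
      finally show ?thesis
        using lin_closed[OF h dy] lin_closed[OF u Fy] by (simp add: C.R.add_minus_cancel)
    qed
    then have "coboundary R C d (Suc l) (\<lambda>y. v y \<ominus>\<^bsub>R\<^esub> u (F (Suc l) y))"
      using h unfolding coboundary_Suc by blast
    with uc show "\<exists>u. cocycle R D \<delta> (Suc l) u \<and> coboundary R C d (Suc l) (\<lambda>y. v y \<ominus>\<^bsub>R\<^esub> u (F (Suc l) y))"
      by blast
  qed
  show "coh_inj R C d D \<delta> (Suc (Suc l)) (F (Suc (Suc l)))"
    unfolding coh_inj_def
  proof (intro allI impI)
    fix u assume u: "cocycle R D \<delta> (Suc (Suc l)) u" and "coboundary R C d (Suc (Suc l)) (\<lambda>x. u (F (Suc (Suc l)) x))"
    then obtain v where v: "lin R (C (Suc l)) (regular_module R) v"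
      "\<And>y. y \<in> carrier (C (Suc (Suc l))) \<Longrightarrow> u (F (Suc (Suc l)) y) = v (d (Suc (Suc l)) y)"
      unfolding coboundary_Suc by blast
    have ul: "lin R (D (Suc (Suc l))) (regular_module R) u" using u by (simp add: cocycle_def)
    \<comment> \<open>Since \<open>u\<close> after \<open>F\<close> equals \<open>v\<close> after
      \<open>d\<close>, the minus sign in \<open>cone_bd\<close> makes the two contributions
      cancel.\<close>
    have "cocycle R cone cone_bd (Suc l) (\<lambda>p. u (fst p) \<oplus>\<^bsub>R\<^esub> v (snd p))"
      unfolding cocycle_def
    proof (intro conjI ballI)
      show "lin R (cone (Suc l)) (regular_module R) (\<lambda>p. u (fst p) \<oplus>\<^bsub>R\<^esub> v (snd p))"
        using lin_sum[OF lin_comp[OF pr(1) ul] lin_comp[OF pr(2) v(1)]] by simp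
      fix p assume p: "p \<in> carrier (cone (Suc (Suc l)))"
      obtain x y where xy: "p = (x, y)" "x \<in> carrier (D (Suc (Suc (Suc l))))" "y \<in> carrier (C (Suc (Suc l)))"
        using p by (cases p) (simp add: cone_simps)
      note w = lin_values(2)[OF xy(2)] lin_values(3)[OF xy(3)] lin_values(1)[OF xy(3)]
      have "u (\<delta> (Suc (Suc (Suc l))) x \<oplus>\<^bsub>D (Suc (Suc l))\<^esub> F (Suc (Suc l)) y) = v (d (Suc (Suc l)) y)"
        using lin_add[OF ul w(1,2)] u xy(2) v(2)[OF xy(3)] lin_closed[OF v(1) w(3)] by (simp add: cocycle_def)
      moreover have "v (\<ominus>\<^bsub>C (Suc l)\<^esub> d (Suc (Suc l)) y) = \<ominus>\<^bsub>R\<^esub> v (d (Suc (Suc l)) y)"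
        using lin_neg[OF v(1) w(3)] by simp
      ultimately show "u (fst (cone_bd (Suc (Suc l)) p)) \<oplus>\<^bsub>R\<^esub> v (snd (cone_bd (Suc (Suc l)) p)) = \<zero>\<^bsub>R\<^esub>"
        using lin_closed[OF v(1) w(3)] xy(1) by (simp add: cone_simps C.R.r_neg)
    qed
    then obtain g where g: "lin R (cone l) (regular_module R) g"
      "\<And>p. p \<in> carrier (cone (Suc l)) \<Longrightarrow> u (fst p) \<oplus>\<^bsub>R\<^esub> v (snd p) = g (cone_bd (Suc l) p)"
      using Z unfolding coh_zero_def coboundary_Suc by blast
    have "u x = g (\<delta> (Suc (Suc l)) x, \<zero>\<^bsub>C l\<^esub>)" if x: "x \<in> carrier (D (Suc (Suc l)))" for x
      using g(2)[of "(x, \<zero>\<^bsub>C (Suc l)\<^esub>)"] x cone_bd_left[OF x] lin_zero[OF v(1)] lin_closed[OF ul x]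
      by (simp add: cone_simps(2))
    then show "coboundary R D \<delta> (Suc (Suc l)) u"
      using lin_comp[OF incl_left g(1)] unfolding coboundary_Suc by blast
  qed
next
  note pr = lin_prod[OF PD(2)[of "Suc (Suc l)"] PC(2)[of "Suc l"], folded cone_simps(2)]
  assume *: "coh_surj R C d D \<delta> (Suc l) (F (Suc l)) \<and> coh_inj R C d D \<delta> (Suc (Suc l)) (F (Suc (Suc l)))"
  show "coh_zero R cone cone_bd (Suc l)"
    unfolding coh_zero_def
  proof (intro allI impI)
    fix g assume g: "cocycle R cone cone_bd (Suc l) g"
    then have gl: "lin R (cone (Suc l)) (regular_module R) g" by (simp add: cocycle_def)
    define u where "u x = g (x, \<zero>\<^bsub>C (Suc l)\<^esub>)" for x
    define v where "v y = g (\<zero>\<^bsub>D (Suc (Suc l))\<^esub>, y)" for y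
    have u: "lin R (D (Suc (Suc l))) (regular_module R) u" and v: "lin R (C (Suc l)) (regular_module R) v"
      unfolding u_def v_def by (rule lin_comp[OF pr(3) gl], rule lin_comp[OF pr(4) gl])
    have guv: "g (x, y) = u x \<oplus>\<^bsub>R\<^esub> v y" if "x \<in> carrier (D (Suc (Suc l)))" "y \<in> carrier (C (Suc l))" for x y
      using lin_add[OF gl, of "(x, \<zero>\<^bsub>C (Suc l)\<^esub>)" "(\<zero>\<^bsub>D (Suc (Suc l))\<^esub>, y)"] that
      by (simp add: u_def v_def cone_simps(2))
    have u\<delta>: "u (\<delta> (Suc (Suc (Suc l))) x) = \<zero>\<^bsub>R\<^esub>" if x: "x \<in> carrier (D (Suc (Suc (Suc l))))" for x
    proof -
      have "(x, \<zero>\<^bsub>C (Suc (Suc l))\<^esub>) \<in> carrier (cone (Suc (Suc l)))" using x by (simp add: cone_simps)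
      then have "g (cone_bd (Suc (Suc l)) (x, \<zero>\<^bsub>C (Suc (Suc l))\<^esub>)) = \<zero>\<^bsub>R\<^esub>"
        using g by (simp add: cocycle_def)
      then show ?thesis using cone_bd_left[OF x] by (simp add: u_def)
    qed
    have uF: "u (F (Suc (Suc l)) y) = v (d (Suc (Suc l)) y)" if y: "y \<in> carrier (C (Suc (Suc l)))" for y
    proof -
      note w = lin_values(3)[OF y] lin_values(1)[OF y]
      have "(\<zero>\<^bsub>D (Suc (Suc (Suc l)))\<^esub>, y) \<in> carrier (cone (Suc (Suc l)))" using y by (simp add: cone_simps)
      then have "g (cone_bd (Suc (Suc l)) (\<zero>\<^bsub>D (Suc (Suc (Suc l)))\<^esub>, y)) = \<zero>\<^bsub>R\<^esub>"
        using g by (simp add: cocycle_def)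
      then have "g (F (Suc (Suc l)) y, \<ominus>\<^bsub>C (Suc l)\<^esub> d (Suc (Suc l)) y) = \<zero>\<^bsub>R\<^esub>"
        using cone_bd_right[OF y] by simp
      then have "u (F (Suc (Suc l)) y) \<ominus>\<^bsub>R\<^esub> v (d (Suc (Suc l)) y) = \<zero>\<^bsub>R\<^esub>"
        using w by (simp add: guv lin_neg[OF v] a_minus_def)
      then show ?thesis using lin_closed[OF u w(1)] lin_closed[OF v w(2)] by (simp add: C.R.minus_eq_zero_iff)
    qed
    have "coboundary R C d (Suc (Suc l)) (\<lambda>y. u (F (Suc (Suc l)) y))"
      using v uF unfolding coboundary_Suc by blast
    moreover have "cocycle R D \<delta> (Suc (Suc l)) u" using u u\<delta> by (simp add: cocycle_def)
    ultimately obtain u' where u': "lin R (D (Suc l)) (regular_module R) u'"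
      "\<And>x. x \<in> carrier (D (Suc (Suc l))) \<Longrightarrow> u x = u' (\<delta> (Suc (Suc l)) x)"
      using * unfolding coh_inj_def coboundary_Suc by blast
    \<comment> \<open>Once \<open>u\<close> is bounded by \<open>u'\<close>, what remains of
      \<open>v\<close> after subtracting \<open>u'\<close> composed with \<open>F\<close> is a
      cocycle on \<open>C\<close>, to which surjectivity applies.\<close>
    have "cocycle R C d (Suc l) (\<lambda>y. v y \<ominus>\<^bsub>R\<^esub> u' (F (Suc l) y))"
      unfolding cocycle_def
    proof (intro conjI ballI)
      show "lin R (C (Suc l)) (regular_module R) (\<lambda>y. v y \<ominus>\<^bsub>R\<^esub> u' (F (Suc l) y))"
        using lin_diff[OF v lin_comp[OF FD(1) u'(1)]] by simp
      fix y assume y: "y \<in> carrier (C (Suc (Suc l)))"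
      show "v (d (Suc (Suc l)) y) \<ominus>\<^bsub>R\<^esub> u' (F (Suc l) (d (Suc (Suc l)) y)) = \<zero>\<^bsub>R\<^esub>"
        using uF[OF y] u'(2)[OF lin_values(3)[OF y]] FD(2)[OF y] lin_closed[OF v lin_values(1)[OF y]]
        by (simp add: C.R.minus_eq_zero_iff)
    qed
    then obtain z where z: "cocycle R D \<delta> (Suc l) z"
      "coboundary R C d (Suc l) (\<lambda>y. (v y \<ominus>\<^bsub>R\<^esub> u' (F (Suc l) y)) \<ominus>\<^bsub>R\<^esub> z (F (Suc l) y))"
      using * unfolding coh_surj_def by blast
    then obtain v' where v': "lin R (C l) (regular_module R) v'"
      "\<And>y. y \<in> carrier (C (Suc l)) \<Longrightarrow> (v y \<ominus>\<^bsub>R\<^esub> u' (F (Suc l) y)) \<ominus>\<^bsub>R\<^esub> z (F (Suc l) y) = v' (d (Suc l) y)"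
      unfolding coboundary_Suc by blast
    have zl: "lin R (D (Suc l)) (regular_module R) z"
      and z\<delta>: "\<And>x. x \<in> carrier (D (Suc (Suc l))) \<Longrightarrow> z (\<delta> (Suc (Suc l)) x) = \<zero>\<^bsub>R\<^esub>"
      using z(1) by (simp_all add: cocycle_def)
    define w where "w x = u' x \<oplus>\<^bsub>R\<^esub> z x" for x
    have wl: "lin R (D (Suc l)) (regular_module R) w"
      using lin_sum[OF u'(1) zl] by (simp add: w_def[abs_def])
    have w\<delta>: "w (\<delta> (Suc (Suc l)) x) = u x" if x: "x \<in> carrier (D (Suc (Suc l)))" for x
      using u'(2)[OF x] z\<delta>[OF x] lin_closed[OF u x] by (simp add: w_def)
    have wF: "v y = v' (d (Suc l) y) \<oplus>\<^bsub>R\<^esub> w (F (Suc l) y)" if y: "y \<in> carrier (C (Suc l))" for y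
    proof -
      note Fy = lin_values(3)[OF y] and dy = lin_values(1)[OF y]
      note c = lin_closed[OF v y] lin_closed[OF u'(1) Fy] lin_closed[OF zl Fy] lin_closed[OF v'(1) dy]
      have "v y = (v' (d (Suc l) y) \<oplus>\<^bsub>R\<^esub> z (F (Suc l) y)) \<oplus>\<^bsub>R\<^esub> u' (F (Suc l) y)"
        using v'(2)[OF y] c C.R.eq_minus_iff by simp
      then show ?thesis using c by (simp add: w_def C.R.a_ac)
    qed
    show "coboundary R cone cone_bd (Suc l) g"
    proof (cases l)
      case 0
      have \<delta>1: "lin R (D (Suc 0)) (regular_module R) (\<lambda>x. v' (\<delta> (Suc 0) x))"
        using lin_comp[OF PD(3)[of 0]] v'(1) 0 CD by simp
      \<comment> \<open>There is no second coordinate in degree zero, so \<open>v'\<close> is moved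
        to the first factor: \<open>D 0 = C 0\<close>, and \<open>\<delta> 1\<close> turns the first
        component of the differential into \<open>d 1\<close> of the second coordinate.\<close>
      define g' where "g' p = w (fst p) \<oplus>\<^bsub>R\<^esub> v' (\<delta> (Suc 0) (fst p))" for p :: "'q \<times> 'q"
      have "lin R (cone l) (regular_module R) g'"
        unfolding g'_def using 0
          lin_comp[OF lin_prod(1)[OF PD(2)[of "Suc 0"] fg_projective_module[OF C0z]] lin_sum[OF wl[unfolded 0] \<delta>1]]
        by (simp add: cone_simps)
      moreover have "g p = g' (cone_bd (Suc l) p)" if p: "p \<in> carrier (cone (Suc l))" for p
      proof -
        obtain x y where xy: "p = (x, y)" "x \<in> carrier (D (Suc (Suc l)))" "y \<in> carrier (C (Suc l))"
          using p by (cases p) (simp add: cone_simps)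
        note a = lin_values(2)[OF xy(2)] lin_values(3)[OF xy(3)] lin_values(1)[OF xy(3)]
        have "\<delta> (Suc 0) (\<delta> (Suc (Suc 0)) x \<oplus>\<^bsub>D (Suc 0)\<^esub> F (Suc 0) y) = d (Suc 0) y"
          using a xy 0 by (simp add: lin_add[OF PD(3)] PD(4) \<delta>F1 CD)
        then have "g' (cone_bd (Suc l) p) = (u x \<oplus>\<^bsub>R\<^esub> w (F (Suc l) y)) \<oplus>\<^bsub>R\<^esub> v' (d (Suc l) y)"
          using a xy 0 lin_add[OF wl a(1,2)] w\<delta>[OF xy(2)] by (simp add: g'_def cone_simps)
        also have "\<dots> = g p"
          using guv[OF xy(2,3)] wF[OF xy(3)] xy lin_closed[OF u xy(2)] lin_closed[OF wl a(2)] lin_closed[OF v'(1) a(3)]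
          by (simp add: C.R.a_ac)
        finally show ?thesis by simp
      qed
      ultimately show ?thesis unfolding coboundary_Suc by blast
    next
      case (Suc m)
      note pr' = lin_prod[OF PD(2)[of "Suc l"] PC(2)[of l]]
      define g' where "g' p = w (fst p) \<ominus>\<^bsub>R\<^esub> v' (snd p)" for p
      have "lin R (cone l) (regular_module R) g'"
        using lin_diff[OF lin_comp[OF pr'(1) wl] lin_comp[OF pr'(2) v'(1)]] Suc
        by (simp add: cone_simps g'_def[abs_def])
      moreover have "g p = g' (cone_bd (Suc l) p)" if p: "p \<in> carrier (cone (Suc l))" for p
      proof -
        obtain x y where xy: "p = (x, y)" "x \<in> carrier (D (Suc (Suc l)))" "y \<in> carrier (C (Suc l))"
          using p by (cases p) (simp add: cone_simps)
        note a = lin_values(2)[OF xy(2)] lin_values(3)[OF xy(3)] lin_values(1)[OF xy(3)]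
        have "g' (cone_bd (Suc l) p) = (u x \<oplus>\<^bsub>R\<^esub> w (F (Suc l) y)) \<ominus>\<^bsub>R\<^esub> (\<ominus>\<^bsub>R\<^esub> v' (d (Suc l) y))"
          using a xy Suc lin_add[OF wl a(1,2)] w\<delta>[OF xy(2)] lin_neg[OF v'(1) a(3)] by (simp add: g'_def cone_simps)
        also have "\<dots> = g p"
          using guv[OF xy(2,3)] wF[OF xy(3)] xy lin_closed[OF u xy(2)] lin_closed[OF wl a(2)] lin_closed[OF v'(1) a(3)]
          by (simp add: C.R.a_ac a_minus_def)
        finally show ?thesis by simp
      qed
      ultimately show ?thesis unfolding coboundary_Suc by blast
    qed
  qed
qed

text \<open>At the left end of the long exact sequence the assumption kills the map from degree zero
  of \<open>C\<close> to the cone. Degree zero of the cone is then the kernel of the map induced by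
  \<open>F\<close> in degree one.\<close>

lemma coh_zero_cone_0:
  assumes "coh_surj R C d D \<delta> 0 (F 0)"
  shows "coh_zero R cone cone_bd 0 \<longleftrightarrow> coh_inj R C d D \<delta> (Suc 0) (F (Suc 0))"
proof
  note pr = lin_prod[OF PD(2)[of "Suc 0"] fg_projective_module[OF C0z], folded cone_simps(1)]
  assume Z: "coh_zero R cone cone_bd 0"
  show "coh_inj R C d D \<delta> (Suc 0) (F (Suc 0))"
    unfolding coh_inj_def
  proof (intro allI impI)
    fix u assume u: "cocycle R D \<delta> (Suc 0) u" and "coboundary R C d (Suc 0) (\<lambda>x. u (F (Suc 0) x))"
    then obtain v where v: "lin R (C 0) (regular_module R) v"
      "\<And>y. y \<in> carrier (C (Suc 0)) \<Longrightarrow> u (F (Suc 0) y) = v (d (Suc 0) y)"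
      unfolding coboundary_Suc by blast
    have ul: "lin R (D (Suc 0)) (regular_module R) u" using u by (simp add: cocycle_def)
    \<comment> \<open>Subtracting \<open>v\<close> composed with \<open>\<delta> 1\<close> keeps the
      class of \<open>u\<close> and makes it vanish on the image of \<open>F 1\<close>, so that it
      becomes a cocycle of the cone in degree zero.\<close>
    define w where "w x = u x \<ominus>\<^bsub>R\<^esub> v (\<delta> (Suc 0) x)" for x
    have wl: "lin R (D (Suc 0)) (regular_module R) w"
      using lin_diff[OF ul lin_comp[OF PD(3)[of 0]]] v(1) CD by (simp add: w_def[abs_def])
    have "cocycle R cone cone_bd 0 (\<lambda>p. w (fst p))"
      unfolding cocycle_def
    proof (intro conjI ballI)
      show "lin R (cone 0) (regular_module R) (\<lambda>p. w (fst p))" by (rule lin_comp[OF pr(1) wl])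
      fix p assume p: "p \<in> carrier (cone (Suc 0))"
      obtain x y where xy: "p = (x, y)" "x \<in> carrier (D (Suc (Suc 0)))" "y \<in> carrier (C (Suc 0))"
        using p by (cases p) (simp add: cone_simps)
      note a = lin_values(2)[OF xy(2)] lin_values(3)[OF xy(3)] lin_values(1)[OF xy(3)]
      have "\<delta> (Suc 0) (\<delta> (Suc (Suc 0)) x \<oplus>\<^bsub>D (Suc 0)\<^esub> F (Suc 0) y) = d (Suc 0) y"
        using a xy by (simp add: lin_add[OF PD(3)] PD(4) \<delta>F1 CD)
      moreover have "u (\<delta> (Suc (Suc 0)) x \<oplus>\<^bsub>D (Suc 0)\<^esub> F (Suc 0) y) = v (d (Suc 0) y)"
        using lin_add[OF ul a(1,2)] u xy(2) v(2)[OF xy(3)] lin_closed[OF v(1) a(3)] by (simp add: cocycle_def)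
      ultimately show "w (fst (cone_bd (Suc 0) p)) = \<zero>\<^bsub>R\<^esub>"
        using xy(1) lin_closed[OF v(1) a(3)] by (simp add: cone_simps w_def C.R.minus_eq_zero_iff)
    qed
    then have wz: "w (fst p) = \<zero>\<^bsub>R\<^esub>" if "p \<in> carrier (cone 0)" for p
      using Z that by (simp add: coh_zero_def coboundary_0)
    have "u x = v (\<delta> (Suc 0) x)" if x: "x \<in> carrier (D (Suc 0))" for x
    proof -
      have "\<delta> (Suc 0) x \<in> carrier (C 0)" using lin_values(2)[OF x] CD by simp
      then show ?thesis
        using wz[of "(x, \<zero>\<^bsub>C 0\<^esub>)"] x lin_closed[OF ul x] lin_closed[OF v(1)]
        by (simp add: cone_simps w_def C.R.minus_eq_zero_iff)
    qed
    then show "coboundary R D \<delta> (Suc 0) u" using v(1) CD unfolding coboundary_Suc by auto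
  qed
next
  note pr = lin_prod[OF PD(2)[of "Suc 0"] fg_projective_module[OF C0z], folded cone_simps(1)]
  assume inj: "coh_inj R C d D \<delta> (Suc 0) (F (Suc 0))"
  show "coh_zero R cone cone_bd 0"
    unfolding coh_zero_def
  proof (intro allI impI)
    fix g assume g: "cocycle R cone cone_bd 0 g"
    then have gl: "lin R (cone 0) (regular_module R) g" by (simp add: cocycle_def)
    define u where "u x = g (x, \<zero>\<^bsub>C 0\<^esub>)" for x
    have u: "lin R (D (Suc 0)) (regular_module R) u" unfolding u_def by (rule lin_comp[OF incl_left gl])
    have gb: "g (cone_bd (Suc 0) p) = \<zero>\<^bsub>R\<^esub>" if "p \<in> carrier (cone (Suc 0))" for p
      using g that by (simp add: cocycle_def)
    have "u (\<delta> (Suc (Suc 0)) x) = \<zero>\<^bsub>R\<^esub>" if x: "x \<in> carrier (D (Suc (Suc 0)))" for x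
      using gb[of "(x, \<zero>\<^bsub>C (Suc 0)\<^esub>)"] cone_bd_left[OF x] x by (simp add: cone_simps(2) u_def)
    then have uc: "cocycle R D \<delta> (Suc 0) u" using u by (simp add: cocycle_def)
    have uF: "u (F (Suc 0) y) = \<zero>\<^bsub>R\<^esub>" if y: "y \<in> carrier (C (Suc 0))" for y
      using gb[of "(\<zero>\<^bsub>D (Suc (Suc 0))\<^esub>, y)"] cone_bd_right[OF y] y by (simp add: cone_simps(2) u_def)
    then have "coboundary R C d (Suc 0) (\<lambda>y. u (F (Suc 0) y))"
      using lin_const_zero[OF PC(2)[of 0] right_module_regular[OF ringR]] unfolding coboundary_Suc by auto
    then obtain v where v: "lin R (D 0) (regular_module R) v"
      "\<And>x. x \<in> carrier (D (Suc 0)) \<Longrightarrow> u x = v (\<delta> (Suc 0) x)"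
      using inj uc unfolding coh_inj_def coboundary_Suc by blast
    have "v (d (Suc 0) y) = \<zero>\<^bsub>R\<^esub>" if y: "y \<in> carrier (C (Suc 0))" for y
      using uF[OF y] v(2)[OF lin_values(3)[OF y]] \<delta>F1[OF y] by simp
    \<comment> \<open>The functional \<open>v\<close> bounds \<open>u\<close> on \<open>D\<close>.
      Vanishing on the boundaries of \<open>C\<close>, it agrees with a cocycle of \<open>D\<close>,
      which is zero on the image of \<open>\<delta> 1\<close>; hence \<open>u\<close> is
      zero.\<close>
    then have "cocycle R C d 0 v" using v(1) CD by (simp add: cocycle_def)
    then obtain v' where v': "cocycle R D \<delta> 0 v'" "coboundary R C d 0 (\<lambda>x. v x \<ominus>\<^bsub>R\<^esub> v' (F 0 x))"
      using assms unfolding coh_surj_def by blast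
    have "u x = \<zero>\<^bsub>R\<^esub>" if x: "x \<in> carrier (D (Suc 0))" for x
    proof -
      have c: "\<delta> (Suc 0) x \<in> carrier (C 0)" using lin_values(2)[OF x] CD by simp
      then have "v (\<delta> (Suc 0) x) \<ominus>\<^bsub>R\<^esub> v' (\<delta> (Suc 0) x) = \<zero>\<^bsub>R\<^esub>"
        using v'(2) F0 by (simp add: coboundary_0)
      moreover have "v' (\<delta> (Suc 0) x) = \<zero>\<^bsub>R\<^esub>" using v'(1) x by (simp add: cocycle_def)
      ultimately show ?thesis using v(2)[OF x] lin_closed[OF u x] by (simp add: C.R.minus_eq_zero_iff)
    qed
    then show "coboundary R cone cone_bd 0 g"
      unfolding coboundary_0 by (auto simp: cone_simps u_def)
  qed
qed

end

section \<open>Shifting and splicing\<close>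

lemma cocycle_shift:
  assumes "\<And>k. A k = C (k + n)" "\<And>k. a (Suc k) = d (Suc (k + n))"
  shows "cocycle R A a k g \<longleftrightarrow> cocycle R C d (k + n) g"
  using assms by (simp add: cocycle_def)

text \<open>Only positive degrees can be compared, because in degree zero the shifted complex loses
  the coboundaries that come from \<open>d n\<close>.\<close>

lemma coboundary_shift:
  assumes "\<And>k. A k = C (k + n)" "\<And>k. a (Suc k) = d (Suc (k + n))"
  shows "coboundary R A a (Suc k) g \<longleftrightarrow> coboundary R C d (Suc k + n) g"
  using assms by (simp add: coboundary_Suc)

lemma coh_shift:
  assumes "\<And>k. A k = C (k + n)" "\<And>k. a (Suc k) = d (Suc (k + n))"
    and "\<And>k. B k = D (k + n)" "\<And>k. b (Suc k) = \<delta> (Suc (k + n))"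
  shows "coh_inj R A a B b (Suc k) f \<longleftrightarrow> coh_inj R C d D \<delta> (Suc k + n) f"
    and "coh_surj R A a B b (Suc k) f \<longleftrightarrow> coh_surj R C d D \<delta> (Suc k + n) f"
  unfolding coh_inj_def coh_surj_def
  by (simp_all only: cocycle_shift[of A C n a d, OF assms(1,2)] coboundary_shift[of A C n a d, OF assms(1,2)]
      cocycle_shift[of B D n b \<delta>, OF assms(3,4)] coboundary_shift[of B D n b \<delta>, OF assms(3,4)])

lemma coh_zero_shift:
  assumes "\<And>k. A k = C (k + n)" "\<And>k. a (Suc k) = d (Suc (k + n))"
  shows "coh_zero R A a (Suc k) \<longleftrightarrow> coh_zero R C d (Suc k + n)"
  unfolding coh_zero_def
  by (simp only: cocycle_shift[of A C n a d, OF assms] coboundary_shift[of A C n a d, OF assms])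

lemma acyclic_shift:
  assumes "acyclic_complex R C d"
  shows "acyclic_complex R (\<lambda>k. C (k + n)) (\<lambda>k. d (k + n))"
  using assms unfolding acyclic_complex_def proj_complex_def by simp

lemma proj_complex_shift:
  assumes "proj_complex R C d"
  shows "proj_complex R (\<lambda>k. C (k + n)) (\<lambda>k. d (k + n))"
  using assms unfolding proj_complex_def by simp

text \<open>A chain map prescribed in low degrees is continued by applying
  \<open>chain_map_extend\<close> to both complexes shifted by \<open>Suc N\<close>; the last
  prescribed map becomes degree zero there.\<close>

lemma chain_map_extend_from:
  assumes C: "proj_complex R C d" and C': "acyclic_complex R C' d'"
    and h: "\<And>m. m \<le> Suc N \<Longrightarrow> lin R (C m) (C' m) (h m)"
    and hd: "\<And>m x. m \<le> N \<Longrightarrow> x \<in> carrier (C (Suc m)) \<Longrightarrow> d' (Suc m) (h (Suc m) x) = h m (d (Suc m) x)"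
  shows "\<exists>F. chain_map R C d C' d' F \<and> (\<forall>m\<le>Suc N. F m = h m)"
proof -
  note D = proj_complexD[OF C]
  have "h (Suc N) (d (Suc (Suc N)) x) \<in> d' (Suc (Suc N)) ` carrier (C' (Suc (Suc N)))"
    if x: "x \<in> carrier (C (Suc (Suc N)))" for x
  proof (rule acyclic_exact[OF C'])
    note dx = lin_closed[OF D(3) x]
    show "h (Suc N) (d (Suc (Suc N)) x) \<in> carrier (C' (Suc N))" by (rule lin_closed[OF h dx]) simp
    show "d' (Suc N) (h (Suc N) (d (Suc (Suc N)) x)) = \<zero>\<^bsub>C' N\<^esub>"
      using hd[OF _ dx] D(4)[OF x] lin_zero[OF h[of N]] by simp
  qed
  then obtain G where G: "chain_map R (\<lambda>k. C (k + Suc N)) (\<lambda>k. d (k + Suc N)) (\<lambda>k. C' (k + Suc N)) (\<lambda>k. d' (k + Suc N)) G"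
    "G 0 = h (Suc N)"
    using chain_map_extend[OF proj_complex_shift[OF C, of "Suc N"] acyclic_shift[OF C', of "Suc N"], of "h (Suc N)"]
      h[of "Suc N"] by auto
  define F where "F m = (if m \<le> N then h m else G (m - Suc N))" for m
  have "chain_map R C d C' d' F"
    unfolding chain_map_def
  proof (intro conjI allI ballI)
    show "lin R (C i) (C' i) (F i)" for i
    proof (cases "i \<le> N")
      case False
      then obtain j where "i = j + Suc N" by (metis add.commute le_iff_add not_less_eq_eq)
      then show ?thesis using chain_mapD(1)[OF G(1), of j] by (simp add: F_def)
    qed (use h[of i] in \<open>simp add: F_def\<close>)
    fix i x assume x: "x \<in> carrier (C (Suc i))"
    consider "i < N" | "i = N" | j where "i = j + Suc N"
      by (metis add.commute le_Suc_ex less_linear Suc_leI)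
    then show "d' (Suc i) (F (Suc i) x) = F i (d (Suc i) x)"
    proof cases
      case 3
      then show ?thesis using chain_mapD(2)[OF G(1), of x j] x by (simp add: F_def)
    qed (use hd[of i x] x G(2) in \<open>simp_all add: F_def\<close>)
  qed
  moreover have "F m = h m" if "m \<le> Suc N" for m
    using that G(2) by (auto simp: F_def le_Suc_eq)
  ultimately show ?thesis by blast
qed

lemma lin_factor:
  assumes e: "lin R C M e" "e ` carrier C = carrier M" and g: "lin R C N g"
    and f: "\<And>x. x \<in> carrier C \<Longrightarrow> f (e x) = g x"
  shows "lin R M N f"
proof (rule linI[OF lin_modules(2)[OF e(1)] lin_modules(2)[OF g]])
  interpret C: right_module R C by (rule lin_modules(1)[OF g])
  have pre: "\<exists>u. u \<in> carrier C \<and> x = e u" if "x \<in> carrier M" for x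
    using that e(2) by blast
  show "f x \<in> carrier N" if "x \<in> carrier M" for x
    using pre[OF that] f lin_closed[OF g] by auto
  fix x assume "x \<in> carrier M"
  then obtain u where u: "u \<in> carrier C" "x = e u" using pre by blast
  show "f (x \<oplus>\<^bsub>M\<^esub> y) = f x \<oplus>\<^bsub>N\<^esub> f y" if y: "y \<in> carrier M" for y
  proof -
    obtain v where v: "v \<in> carrier C" "y = e v" using pre[OF y] by blast
    have "f (x \<oplus>\<^bsub>M\<^esub> y) = f (e (u \<oplus>\<^bsub>C\<^esub> v))" using u v by (simp add: lin_add[OF e(1)])
    also have "\<dots> = g u \<oplus>\<^bsub>N\<^esub> g v" using f[OF C.M.a_closed[OF u(1) v(1)]] lin_add[OF g u(1) v(1)] by simp
    finally show ?thesis using f u v by simp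
  qed
  show "f (a \<odot>\<^bsub>M\<^esub> x) = a \<odot>\<^bsub>N\<^esub> f x" if a: "a \<in> carrier R" for a
  proof -
    have "f (a \<odot>\<^bsub>M\<^esub> x) = f (e (a \<odot>\<^bsub>C\<^esub> u))" using u a by (simp add: lin_smult[OF e(1)])
    also have "\<dots> = a \<odot>\<^bsub>N\<^esub> g u" using f[OF C.right_smult_closed[OF a u(1)]] lin_smult[OF g a u(1)] by simp
    finally show ?thesis using f u by simp
  qed
qed

section \<open>Ext of transposes\<close>

lemma fgen_cok_dual:
  assumes "fg_projective R P1" "fg_projective R P0" "lin R P1 P0 d"
  shows "fgen (op_ring R) (cok_dual R P1 P0 d)"
  unfolding cok_dual_def
  by (rule fgen_quot[OF fgen_projective[OF fg_projective_dual[OF assms(1)]] submodule_image[OF lin_dual_map[OF assms(3)]]])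

lemma resolves_cok_dual:
  assumes "acyclic_complex (op_ring R) D \<delta>" "D 0 = dual R P1" "D 1 = dual R P0"
    "\<And>g. g \<in> carrier (dual R P0) \<Longrightarrow> \<delta> 1 g = dual_map P1 d g"
  shows "resolves (op_ring R) D \<delta> (cok_dual R P1 P0 d)
    (\<lambda>g. dual_map P1 d ` carrier (dual R P0) +>\<^bsub>D 0\<^esub> g)"
proof -
  have "\<delta> 1 ` carrier (D 1) = dual_map P1 d ` carrier (dual R P0)"
    using assms(3,4) by (metis (no_types, lifting) image_cong)
  then show ?thesis using resolves_quot[OF assms(1)] by (simp only: cok_dual_def assms(2))
qed

lemma resolution_of_dual:
  fixes R :: "('a, 'r) ring_scheme" and P1 P0 :: "('a, nat \<Rightarrow> 'a) module"
  assumes "ring R" "right_noetherian (op_ring R)" "fg_projective R P1" "fg_projective R P0" "lin R P1 P0 d"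
  shows "\<exists>D \<delta>. acyclic_complex (op_ring R) D \<delta> \<and> D 0 = dual R P1 \<and> D 1 = dual R P0 \<and> \<delta> 1 = dual_map P1 d"
  by (rule acyclic_extend[OF assms(2) enough_projectives_dual[OF assms(1)] fg_projective_dual[OF assms(3)]
        fg_projective_dual[OF assms(4)] lin_dual_map[OF assms(5)]])

lemma tr_res_resol:
  assumes "resolves R (cx (resol R N)) (bd (resol R N)) N (aug (resol R N))"
    "acyclic_complex (op_ring R) D \<delta>" "D 0 = dual R (cx (resol R N) 1)" "D 1 = dual R (cx (resol R N) 0)"
    "\<And>g. g \<in> carrier (dual R (cx (resol R N) 0)) \<Longrightarrow> \<delta> 1 g = dual_map (cx (resol R N) 1) (bd (resol R N) 1) g"
  shows "tr_res R (cx (resol R N) 1) (cx (resol R N) 0) (bd (resol R N) 1) N (aug (resol R N))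
    (\<lambda>x g. g x) (\<lambda>x g. g x) D \<delta>"
proof -
  note r = resolvesD[OF assms(1)]
  have "{y \<in> carrier (cx (resol R N) 0). aug (resol R N) y = \<zero>\<^bsub>N\<^esub>} =
      bd (resol R N) 1 ` carrier (cx (resol R N) 1)"
    using assms(1) by (simp add: resolves_def)
  then show ?thesis
    using proj_complexD(3)[OF r(2), of 0]
    by (intro tr_res_dual[OF proj_complexD(1)[OF r(2)] proj_complexD(1)[OF r(2)] _ r(3,4) _ assms(2,3,4,5)])
      simp_all
qed

context
  fixes R :: "('a, 'r) ring_scheme"
  assumes ring: "ring R" and noeth: "right_noetherian R" and noeth_op: "right_noetherian (op_ring R)"
begin

text \<open>A resolution that starts with the dual of the chosen presentation satisfies both
  \<open>resolves\<close> and \<open>tr_res\<close>. It links the chosen resolution of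
  \<open>Tr R N\<close> to \<open>D\<close>, whose presentation of \<open>N\<close> is a different
  one.\<close>

lemma Ext_Tr_zero_iff:
  assumes N: "fgen R N" and T: "tr_res R G1 G0 d N e B1 B0 D \<delta>"
  shows "zero_module (Ext (op_ring R) (Suc k) (Tr R N)) \<longleftrightarrow> coh_zero (op_ring R) D \<delta> (Suc k)"
proof -
  let ?X = "resol R N"
  note X = resol_resolves[OF noeth N]
  note PX = proj_complexD[OF resolvesD(2)[OF X]]
  note b1 = PX(3)[of 0, folded One_nat_def]
  obtain W \<omega> where W: "acyclic_complex (op_ring R) W \<omega>" "W 0 = dual R (cx ?X 1)" "W 1 = dual R (cx ?X 0)"
    "\<omega> 1 = dual_map (cx ?X 1) (bd ?X 1)"
    using resolution_of_dual[OF ring noeth_op PX(1) PX(1) b1] by blast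
  have Tr: "Tr R N = cok_dual R (cx ?X 1) (cx ?X 0) (bd ?X 1)" by (simp add: Tr_def Let_def)
  have rW: "resolves (op_ring R) W \<omega> (Tr R N)
      (\<lambda>g. dual_map (cx ?X 1) (bd ?X 1) ` carrier (dual R (cx ?X 0)) +>\<^bsub>W 0\<^esub> g)"
    unfolding Tr by (rule resolves_cok_dual[OF W(1,2,3)]) (simp only: W(4))
  have rT: "resolves (op_ring R) (cx (resol (op_ring R) (Tr R N))) (bd (resol (op_ring R) (Tr R N))) (Tr R N)
      (aug (resol (op_ring R) (Tr R N)))"
    by (rule resol_resolves[OF noeth_op]) (simp only: Tr fgen_cok_dual[OF PX(1) PX(1) b1])
  have T': "tr_res R (cx ?X 1) (cx ?X 0) (bd ?X 1) N (aug ?X) (\<lambda>x g. g x) (\<lambda>x g. g x) W \<omega>"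
    by (rule tr_res_resol[OF X W(1,2,3)]) (simp only: W(4))
  show ?thesis
    unfolding Ext_zero_iff[OF rT] coh_zero_independent[OF rT rW] tr_res_coh_zero[OF T' T] ..
qed

text \<open>Two comparisons are chained. The chosen lift of \<open>Tr_map\<close> is replaced by
  \<open>F0\<close>, a lift to resolutions that begin with dual maps; and \<open>F0\<close> is
  compared with \<open>F\<close>, both being lifts of the transpose of \<open>f\<close> along
  different presentations of \<open>N\<close>. The second comparison holds in positive
  degrees.\<close>

lemma Ext_Tr_map_iff:
  assumes M: "fgen R M" and N: "fgen R N" and f: "lin R N M f"
    and W: "acyclic_complex (op_ring R) W \<omega>" "W 0 = dual R (cx (resol R M) 1)" "W 1 = dual R (cx (resol R M) 0)"
      "\<And>g. g \<in> carrier (dual R (cx (resol R M) 0)) \<Longrightarrow> \<omega> 1 g = dual_map (cx (resol R M) 1) (bd (resol R M) 1) g"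
    and T: "tr_res R G1 G0 d N e B1 B0 D \<delta>"
    and L: "tr_lift R G1 G0 d e B1 D \<delta> (cx (resol R M) 1) (cx (resol R M) 0) (bd (resol R M) 1) (aug (resol R M))
      (\<lambda>x g. g x) W \<omega> f c1 c0 F"
  shows "inj_on (Ext_map (op_ring R) (Suc k) (Tr R M) (Tr R N) (Tr_map R N M f)) (carrier (Ext (op_ring R) (Suc k) (Tr R N)))
      \<longleftrightarrow> coh_inj (op_ring R) W \<omega> D \<delta> (Suc k) (F (Suc k))" (is ?inj)
    and "bij_betw (Ext_map (op_ring R) (Suc k) (Tr R M) (Tr R N) (Tr_map R N M f))
        (carrier (Ext (op_ring R) (Suc k) (Tr R N))) (carrier (Ext (op_ring R) (Suc k) (Tr R M)))
      \<longleftrightarrow> coh_inj (op_ring R) W \<omega> D \<delta> (Suc k) (F (Suc k)) \<and> coh_surj (op_ring R) W \<omega> D \<delta> (Suc k) (F (Suc k))" (is ?bij)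
proof -
  let ?S = "op_ring R" and ?X = "resol R N" and ?Y = "resol R M" and ?\<chi> = "resol_lift R N M f"
  note X = resol_resolves[OF noeth N] and Y = resol_resolves[OF noeth M]
  note PX = proj_complexD[OF resolvesD(2)[OF X]] and PY = proj_complexD[OF resolvesD(2)[OF Y]]
  note bX = PX(3)[of 0, folded One_nat_def] and bY = PY(3)[of 0, folded One_nat_def]
  note \<chi> = resol_lift_chain_map[OF X Y f]
  note \<chi>1 = chain_mapD(1)[OF \<chi>(1), of 1] and \<chi>0 = chain_mapD(1)[OF \<chi>(1), of 0]
  have \<chi>b: "bd ?Y 1 (?\<chi> 1 x) = ?\<chi> 0 (bd ?X 1 x)" if "x \<in> carrier (cx ?X 1)" for x
    using chain_mapD(2)[OF \<chi>(1), of x 0] that by simp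
  obtain V v where V: "acyclic_complex ?S V v" "V 0 = dual R (cx ?X 1)" "V 1 = dual R (cx ?X 0)"
    "v 1 = dual_map (cx ?X 1) (bd ?X 1)"
    using resolution_of_dual[OF ring noeth_op PX(1) PX(1) bX] by blast
  have TrN: "Tr R N = cok_dual R (cx ?X 1) (cx ?X 0) (bd ?X 1)"
    and TrM: "Tr R M = cok_dual R (cx ?Y 1) (cx ?Y 0) (bd ?Y 1)" by (simp_all add: Tr_def Let_def)
  let ?H = "dual_map (cx ?Y 1) (bd ?Y 1) ` carrier (dual R (cx ?Y 0))"
  let ?K = "dual_map (cx ?X 1) (bd ?X 1) ` carrier (dual R (cx ?X 0))"
  have rV: "resolves ?S V v (Tr R N) (\<lambda>g. ?K +>\<^bsub>V 0\<^esub> g)"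
    unfolding TrN by (rule resolves_cok_dual[OF V(1,2,3)]) (simp only: V(4))
  have rW: "resolves ?S W \<omega> (Tr R M) (\<lambda>g. ?H +>\<^bsub>W 0\<^esub> g)"
    unfolding TrM by (rule resolves_cok_dual[OF W])
  have rN: "resolves ?S (cx (resol ?S (Tr R N))) (bd (resol ?S (Tr R N))) (Tr R N) (aug (resol ?S (Tr R N)))"
    by (rule resol_resolves[OF noeth_op]) (simp only: TrN fgen_cok_dual[OF PX(1) PX(1) bX])
  have rM: "resolves ?S (cx (resol ?S (Tr R M))) (bd (resol ?S (Tr R M))) (Tr R M) (aug (resol ?S (Tr R M)))"
    by (rule resol_resolves[OF noeth_op]) (simp only: TrM fgen_cok_dual[OF PY(1) PY(1) bY])
  have TN: "tr_res R (cx ?X 1) (cx ?X 0) (bd ?X 1) N (aug ?X) (\<lambda>x g. g x) (\<lambda>x g. g x) V v"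
    by (rule tr_res_resol[OF X V(1,2,3)]) (simp only: V(4))
  have TM: "tr_res R (cx ?Y 1) (cx ?Y 0) (bd ?Y 1) M (aug ?Y) (\<lambda>x g. g x) (\<lambda>x g. g x) W \<omega>"
    by (rule tr_res_resol[OF Y W])
  let ?h = "dual_map (cx ?X 1) (?\<chi> 1)"
  have h: "lin ?S (dual R (cx ?Y 1)) (dual R (cx ?X 1)) ?h" by (rule lin_dual_map[OF \<chi>1])
  have hb: "?h (dual_map (cx ?Y 1) (bd ?Y 1) g) = dual_map (cx ?X 1) (bd ?X 1) (dual_map (cx ?X 0) (?\<chi> 0) g)" for g
    using \<chi>b lin_closed[OF \<chi>1] lin_closed[OF bX] by (auto simp: dual_map_def intro!: restrict_ext)
  have \<chi>0d: "dual_map (cx ?X 0) (?\<chi> 0) g \<in> carrier (dual R (cx ?X 0))" if "g \<in> carrier (dual R (cx ?Y 0))" for g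
    by (rule lin_closed[OF lin_dual_map[OF \<chi>0] that])
  have hHK: "?h ` ?H \<subseteq> ?K" using hb \<chi>0d by auto
  note q = h submodule_image[OF lin_dual_map[OF bY]] submodule_image[OF lin_dual_map[OF bX]] hHK
  have Tm: "Tr_map R N M f = quot_map (dual R (cx ?X 1)) ?K ?h" by (simp add: Tr_map_def Let_def)
  have Trl: "lin ?S (Tr R M) (Tr R N) (Tr_map R N M f)"
    using lin_quot_map[OF q] unfolding Tm TrM TrN cok_dual_def .
  have "?h (\<omega> 1 w) \<in> v 1 ` carrier (V 1)" if "w \<in> carrier (W 1)" for w
    using that W(3,4) hb[of w] \<chi>0d[of w] V(3,4) by auto
  \<comment> \<open>\<open>F0\<close> has both parts to play: modulo boundaries it induces
    \<open>Tr_map R N M f\<close>, and in degree zero it is the adjoint of the chosen lift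
    \<open>?\<chi> 1\<close>.\<close>
  then obtain F0 where F0: "chain_map ?S W \<omega> V v F0" "F0 0 = ?h"
    using chain_map_extend[OF acyclic_proj[OF W(1)] V(1), of ?h] h W(2) V(2) by auto
  have F0_lift: "?K +>\<^bsub>V 0\<^esub> F0 0 g = Tr_map R N M f (?H +>\<^bsub>W 0\<^esub> g)" if "g \<in> carrier (W 0)" for g
    using quot_map_coset[OF q, of g] that W(2) V(2) F0(2) Tm by simp
  have L0: "tr_lift R (cx ?X 1) (cx ?X 0) (bd ?X 1) (aug ?X) (\<lambda>x g. g x) V v
      (cx ?Y 1) (cx ?Y 0) (bd ?Y 1) (aug ?Y) (\<lambda>x g. g x) W \<omega> f (?\<chi> 1) (?\<chi> 0) F0"
    unfolding tr_lift_def using \<chi>1 \<chi>0 \<chi>b \<chi>(2) F0 by (simp add: dual_map_def)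
  \<comment> \<open>Lifting the identity of \<open>N\<close> passes from the chosen presentation to
    the given one; \<open>A\<close> is bijective on cohomology in positive degrees.\<close>
  obtain a1 a0 A where A: "tr_lift R (cx ?X 1) (cx ?X 0) (bd ?X 1) (aug ?X) (\<lambda>x g. g x) V v G1 G0 d e B1 D \<delta> (\<lambda>x. x) a1 a0 A"
    using tr_lift_exists[OF TN T lin_id[OF fgen_module[OF N]]] by blast
  note Aeq = tr_lift_equivalence[OF TN T A]
  have eq: "coh_eq ?S W \<omega> V v (Suc k) (F0 (Suc k)) (\<lambda>w. A (Suc k) (F (Suc k) w))"
    by (rule tr_lift_unique[OF TN TM L0 tr_lift_comp[OF A L]])
  note PW = acyclic_proj[OF W(1)] and PD = tr_resD(8)[OF T] and FF = tr_liftD(5)[OF L] and AA = tr_liftD(5)[OF A]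
  note AF = chain_map_comp[OF FF AA]
  note l = chain_mapD(1)[OF F0(1), of "Suc k"] chain_mapD(1)[OF AF, of "Suc k"]
  have "coh_inj ?S W \<omega> V v (Suc k) (\<lambda>w. A (Suc k) (F (Suc k) w)) \<longleftrightarrow> coh_inj ?S W \<omega> D \<delta> (Suc k) (F (Suc k))"
    using coh_inj_cancel_left[OF PW PD FF AA _ Aeq(2)] coh_inj_comp[OF PD AA _ Aeq(1)] by blast
  then have i: "coh_inj ?S W \<omega> V v (Suc k) (F0 (Suc k)) \<longleftrightarrow> coh_inj ?S W \<omega> D \<delta> (Suc k) (F (Suc k))"
    using coh_inj_cong[OF PW l eq] by blast
  have "coh_surj ?S W \<omega> V v (Suc k) (\<lambda>w. A (Suc k) (F (Suc k) w)) \<longleftrightarrow> coh_surj ?S W \<omega> D \<delta> (Suc k) (F (Suc k))"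
    using coh_surj_cancel_left[OF PD AA] coh_surj_comp[OF PW FF AA _ Aeq(2)] by blast
  then have s: "coh_surj ?S W \<omega> V v (Suc k) (F0 (Suc k)) \<longleftrightarrow> coh_surj ?S W \<omega> D \<delta> (Suc k) (F (Suc k))"
    using coh_surj_cong[OF PW l eq] by blast
  note \<rho> = resol_lift_chain_map[OF rM rN Trl]
  note ind = coh_independent[where f = "Tr_map R N M f", OF rM rW rN rV \<rho>(1) _ F0(1), of "Suc k", OF \<rho>(2) F0_lift]
  show ?inj using Ext_map_iff(1)[OF rM rN Trl, of "Suc k"] ind(1) i by blast
  show ?bij using Ext_map_iff(2)[OF rM rN Trl, of "Suc k"] ind i s by blast
qed

end

section \<open>The natural maps\<close>

text \<open>The infimum of the empty set is infinite, so modules whose Ext groups all vanish are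
  covered as well.\<close>

lemma grade_ge_iff: "grade R M \<ge> enat m \<longleftrightarrow> (\<forall>k<m. zero_module (Ext R k M))"
proof -
  have "enat m \<le> Inf (enat ` A) \<longleftrightarrow> (\<forall>i\<in>A. m \<le> i)" for A
    by (simp add: le_Inf_iff)
  then show ?thesis unfolding grade_def by (metis (no_types, lifting) mem_Collect_eq not_le)
qed

text \<open>Separating the ranges, up to \<open>j\<close> for injectivity and below \<open>j\<close>
  for surjectivity, suits the induction, which treats the two by different cancellation rules. For
  \<open>j = 0\<close> both sides are void.\<close>

lemma T_condition_iff:
  fixes I J :: "nat \<Rightarrow> bool"
  shows "(j \<ge> 1 \<longrightarrow> (\<forall>k\<in>{1..j - 1}. I k \<and> J k) \<and> I j) \<longleftrightarrow>
    (\<forall>k. 1 \<le> k \<longrightarrow> k \<le> j \<longrightarrow> I k) \<and> (\<forall>k. 1 \<le> k \<longrightarrow> k < j \<longrightarrow> J k)"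
proof (cases "j = 0")
  case False
  then have "(\<forall>k\<in>{1..j - 1}. I k \<and> J k) \<longleftrightarrow> (\<forall>k. 1 \<le> k \<longrightarrow> k < j \<longrightarrow> I k \<and> J k)"
    by (metis Suc_pred' atLeastAtMost_iff diff_Suc_1 less_Suc_eq_le not_gr_zero)
  moreover have "(\<forall>k. 1 \<le> k \<longrightarrow> k \<le> j \<longrightarrow> I k) \<longleftrightarrow> (\<forall>k. 1 \<le> k \<longrightarrow> k < j \<longrightarrow> I k) \<and> I j"
    using False by (metis One_nat_def Suc_leI le_neq_implies_less less_imp_le not_gr_zero order_refl)
  ultimately show ?thesis using False by (simp add: Suc_le_eq) blast
qed simp

context
  fixes R :: "('a, 'r) ring_scheme" and M :: "('a, 'm) module"
  assumes ring: "ring R" and noeth: "right_noetherian R" and noeth_op: "right_noetherian (op_ring R)"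
    and M: "fgen R M"
begin

private abbreviation (input) "S \<equiv> op_ring R"
private abbreviation (input) "P \<equiv> cx (resol R M)"
private abbreviation (input) "d \<equiv> bd (resol R M)"

private lemmas resP = resol_resolves[OF noeth M]
private lemmas PP = proj_complexD[OF resolvesD(2)[OF resP]]

private lemma ringS: "ring S"
  by (rule ring_op_ring[OF ring])

private lemma dual_bd: "lin S (dual R (P i)) (dual R (P (Suc i))) (dual_map (P (Suc i)) (d (Suc i)))"
  by (rule lin_dual_map[OF PP(3)])

private lemma dual_bd_bd:
  assumes "g \<in> carrier (dual R (P i))"
  shows "dual_map (P (Suc (Suc i))) (d (Suc (Suc i))) (dual_map (P (Suc i)) (d (Suc i)) g) = \<zero>\<^bsub>dual R (P (Suc (Suc i)))\<^esub>"
  using lin_zero[OF dual_lin[OF PP(2) assms]] lin_closed[OF PP(3)] PP(4)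
  by (auto simp: dual_map_def dual_simps(2) intro!: restrict_ext)

text \<open>The complex \<open>\<dots> \<rightarrow> D 2 \<rightarrow> P 0\<^sup>* \<rightarrow> \<dots> \<rightarrow> P (i + 1)\<^sup>*\<close>, where \<open>D\<close> resolves \<open>Tr M\<close> with
  \<open>D 1 = P 0\<^sup>*\<close> and \<open>D 0 = P 1\<^sup>*\<close>.\<close>

private primrec splice where
  "splice D 0 = D"
| "splice D (Suc i) = (\<lambda>m. case m of 0 \<Rightarrow> dual R (P (Suc (Suc i))) | Suc k \<Rightarrow> splice D i k)"

private primrec splice_bd where
  "splice_bd \<delta> 0 = \<delta>"
| "splice_bd \<delta> (Suc i) = (\<lambda>m. case m of 0 \<Rightarrow> undefined | Suc k \<Rightarrow>
    (case k of 0 \<Rightarrow> dual_map (P (Suc (Suc i))) (d (Suc (Suc i))) | Suc l \<Rightarrow> splice_bd \<delta> i k))"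

private lemma splice_top: "splice D i (k + i) = D k"
  by (induction i) simp_all

private lemma splice_bd_top: "splice_bd \<delta> i (Suc (k + i)) = \<delta> (Suc k)"
  by (induction i) simp_all

text \<open>Resolutions of the transpose of the \<open>i\<close>th syzygy whose first differential
  is literally the dual of \<open>d (Suc i)\<close>. For neighbouring indices two such complexes
  share the dual of \<open>P (Suc i)\<close>, and there they are linked.\<close>

private definition starts_dual where
  "starts_dual i Q q \<longleftrightarrow> acyclic_complex S Q q \<and> Q 0 = dual R (P (Suc i)) \<and> Q 1 = dual R (P i) \<and>
    (\<forall>g\<in>carrier (dual R (P i)). q 1 g = dual_map (P (Suc i)) (d (Suc i)) g)"

private lemma starts_dualD:
  assumes "starts_dual i Q q"
  shows "acyclic_complex S Q q" "Q 0 = dual R (P (Suc i))" "Q (Suc 0) = dual R (P i)"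
    "g \<in> carrier (dual R (P i)) \<Longrightarrow> q (Suc 0) g = dual_map (P (Suc i)) (d (Suc i)) g" "proj_complex S Q q"
  using assms acyclic_proj unfolding starts_dual_def by auto

private lemma splice_low:
  assumes D: "starts_dual 0 D \<delta>"
  shows "m \<le> Suc i \<Longrightarrow> splice D i m = dual R (P (Suc i - m))"
    and "m \<le> i \<Longrightarrow> g \<in> carrier (dual R (P (i - m))) \<Longrightarrow>
      splice_bd \<delta> i (Suc m) g = dual_map (P (Suc i - m)) (d (Suc i - m)) g"
proof -
  note s = starts_dualD[OF D]
  show "m \<le> Suc i \<Longrightarrow> splice D i m = dual R (P (Suc i - m))"
  proof (induction i arbitrary: m)
    case 0
    then show ?case using s(2,3) by (auto simp: le_Suc_eq)
  next
    case (Suc i)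
    then show ?case by (cases m) simp_all
  qed
  show "m \<le> i \<Longrightarrow> g \<in> carrier (dual R (P (i - m))) \<Longrightarrow>
      splice_bd \<delta> i (Suc m) g = dual_map (P (Suc i - m)) (d (Suc i - m)) g"
  proof (induction i arbitrary: m)
    case 0
    then show ?case using s(4) by simp
  next
    case (Suc i)
    then show ?case by (cases m) simp_all
  qed
qed

text \<open>The seams are harmless because duals of consecutive differentials compose to zero. The
  splice is in general not exact, its homology in degrees 1 to \<open>i\<close> being Ext of
  \<open>M\<close>, so it appears as the source of comparison maps.\<close>

private lemma splice_proj:
  assumes D: "starts_dual 0 D \<delta>"
  shows "proj_complex S (splice D i) (splice_bd \<delta> i)"
proof (induction i)
  case 0
  then show ?case using starts_dualD(5)[OF D] by simp
next
  case (Suc i)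
  note p = proj_complexD[OF Suc]
  note low = splice_low[OF D]
  show ?case
    unfolding proj_complex_def
  proof (intro conjI allI ballI)
    show "fg_projective S (splice D (Suc i) m)" for m
      by (cases m) (simp_all add: p(1) fg_projective_dual PP(1))
    show "lin S (splice D (Suc i) (Suc m)) (splice D (Suc i) m) (splice_bd \<delta> (Suc i) (Suc m))" for m
      by (cases m) (simp_all add: p(3) low(1) dual_bd)
    fix m x assume x: "x \<in> carrier (splice D (Suc i) (Suc (Suc m)))"
    show "splice_bd \<delta> (Suc i) (Suc m) (splice_bd \<delta> (Suc i) (Suc (Suc m)) x) = \<zero>\<^bsub>splice D (Suc i) m\<^esub>"
    proof (cases m)
      case 0
      then have "x \<in> carrier (dual R (P i))" using x low(1)[of 1 i] by simp
      then show ?thesis using 0 low(2)[of 0 i x] dual_bd_bd by simp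
    next
      case (Suc l)
      then show ?thesis using x p(4) by simp
    qed
  qed
qed

private lemma starts_dual_exists: "\<exists>Q q. starts_dual i Q q"
  using resolution_of_dual[OF ring noeth_op PP(1) PP(1) PP(3)] unfolding starts_dual_def by metis

section \<open>The chosen data of the natural map\<close>

private abbreviation (input) "Q i \<equiv> cx (fst (psi_choice R i M))"
private abbreviation (input) "q i \<equiv> bd (fst (psi_choice R i M))"
private abbreviation (input) "h i \<equiv> snd (psi_choice R i M)"

text \<open>The identities in degrees 0 and 1 commute with the differentials because both complexes
  begin with the same dual map. Exactness of \<open>C\<close> extends them along the whole splice,
  and the degrees up to \<open>n + 1\<close> give the required maps.\<close>

private lemma psi_choice_data:
  assumes n: "n \<ge> 1"
  shows "psi_data R n (resol R M) (psi_choice R n M)"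
proof -
  obtain C c where C: "starts_dual n C c" using starts_dual_exists by blast
  obtain D \<delta> where D: "starts_dual 0 D \<delta>" using starts_dual_exists by blast
  note s = starts_dualD[OF C] and low = splice_low[OF D] and pr = splice_proj[OF D]
  obtain N where N: "n = Suc N" using n by (cases n) auto
  have "\<exists>F. chain_map S (splice D n) (splice_bd \<delta> n) C c F \<and> (\<forall>m\<le>Suc 0. F m = (\<lambda>g. g))"
  proof (rule chain_map_extend_from[OF pr s(1)])
    show "lin S (splice D n m) (C m) (\<lambda>g. g)" if "m \<le> Suc 0" for m
      using that low(1)[of 0 n] low(1)[of "Suc 0" n] lin_id[OF right_module_dual[OF PP(2)]] s(2,3)
      by (cases m) auto
    show "c (Suc m) x = splice_bd \<delta> n (Suc m) x" if "m \<le> 0" "x \<in> carrier (splice D n (Suc m))" for m x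
      using that low(1)[of "Suc 0" n] low(2)[of 0 n x] s(4) by simp
  qed
  then obtain F where F: "chain_map S (splice D n) (splice_bd \<delta> n) C c F" "F 0 = (\<lambda>g. g)" "F (Suc 0) = (\<lambda>g. g)"
    by auto
  let ?a = "\<lambda>g. dual_map (P (Suc n)) (d (Suc n)) ` carrier (dual R (P n)) +>\<^bsub>C 0\<^esub> g"
  let ?X = "\<lparr>cx = C, bd = c, aug = ?a\<rparr>"
  have r: "resolves S C c (cok_dual R (P (Suc n)) (P n) (d (Suc n))) ?a"
    by (rule resolves_cok_dual[OF s(1,2)]) (use s(3,4) in simp_all)
  have "projective_resolution S (cok_dual R (P (Suc n)) (P n) (d (Suc n))) ?X"
    using r by (simp add: resolves_iff[OF resolvesD(6)[OF r]])
  moreover have "F m \<in> mod_hom S (dual R (P (Suc n - m))) (C m)" if "m \<le> Suc n" for m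
    using lin_mod_hom[OF chain_mapD(1)[OF F(1), of m]] low(1)[OF that] by simp
  moreover have "c (Suc m) (F (Suc m) g) = F m (dual_map (P (Suc n - m)) (d (Suc n - m)) g)"
    if "m \<le> n" "g \<in> carrier (dual R (P (n - m)))" for m g
    using chain_mapD(2)[OF F(1), of g m] low(1)[of "Suc m" n] low(2)[OF that] that by simp
  ultimately have "psi_data R n (resol R M) (?X, F)"
    unfolding psi_data_def using s(2,3,4) F(2,3) by simp
  then show ?thesis unfolding psi_choice_def by (rule someI)
qed

private lemma psi_choiceD:
  assumes n: "n \<ge> 1"
  shows "starts_dual n (Q n) (q n)"
    "m \<le> Suc n \<Longrightarrow> lin S (dual R (P (Suc n - m))) (Q n m) (h n m)"
    "g \<in> carrier (dual R (P (Suc n))) \<Longrightarrow> h n 0 g = g"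
    "m \<le> n \<Longrightarrow> g \<in> carrier (dual R (P (n - m))) \<Longrightarrow>
      q n (Suc m) (h n (Suc m) g) = h n m (dual_map (P (Suc n - m)) (d (Suc n - m)) g)"
proof -
  obtain X F where XF: "psi_choice R n M = (X, F)" by fastforce
  have p: "psi_data R n (resol R M) (X, F)" using psi_choice_data[OF n] XF by simp
  have "right_module S (cok_dual R (P (n + 1)) (P n) (d (n + 1)))"
    using fgen_module[OF fgen_cok_dual[OF PP(1) PP(1) PP(3)]] by simp
  then have "resolves S (cx X) (bd X) (cok_dual R (P (n + 1)) (P n) (d (n + 1))) (aug X)"
    using p resolves_iff unfolding psi_data_def by blast
  then show st: "starts_dual n (Q n) (q n)"
    using p resolvesD(1) XF unfolding starts_dual_def psi_data_def by fastforce
  note s = starts_dualD[OF st]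
  have "F m \<in> mod_hom S (dual R (P (Suc n - m))) (cx X m)" if "m \<le> Suc n" for m
    using p that unfolding psi_data_def by simp
  then show "m \<le> Suc n \<Longrightarrow> lin S (dual R (P (Suc n - m))) (Q n m) (h n m)"
    using right_module_dual[OF PP(2)] proj_complexD(2)[OF s(5)] XF by (simp add: lin_def)
  show "g \<in> carrier (dual R (P (Suc n))) \<Longrightarrow> h n 0 g = g"
    using p XF unfolding psi_data_def by simp
  show "m \<le> n \<Longrightarrow> g \<in> carrier (dual R (P (n - m))) \<Longrightarrow>
      q n (Suc m) (h n (Suc m) g) = h n m (dual_map (P (Suc n - m)) (d (Suc n - m)) g)"
    using p XF unfolding psi_data_def by simp
qed

text \<open>By exactness of the chosen resolution, \<open>d (Suc (Suc i))\<close> presents the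
  syzygy, and the dual of this presentation is the start of \<open>C\<close>.\<close>

private lemma syzygy_tr_res:
  assumes st: "starts_dual (Suc i) C c"
  shows "tr_res R (P (Suc (Suc i))) (P (Suc i)) (d (Suc (Suc i))) (syzygy R (Suc i) M) (d (Suc i))
    (\<lambda>x g. g x) (\<lambda>x g. g x) C c" and "fgen R (syzygy R (Suc i) M)"
proof -
  note s = starts_dualD[OF st]
  have N: "syzygy R (Suc i) M = (P i)\<lparr>carrier := d (Suc i) ` carrier (P (Suc i))\<rparr>"
    by (simp add: syzygy_def Let_def)
  have e: "lin R (P (Suc i)) (syzygy R (Suc i) M) (d (Suc i))"
    unfolding N by (rule lin_restrict_cod[OF PP(3) submodule_image[OF PP(3)]]) blast
  have im: "d (Suc i) ` carrier (P (Suc i)) = carrier (syzygy R (Suc i) M)" by (simp add: N)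
  have "{y \<in> carrier (P (Suc i)). d (Suc i) y = \<zero>\<^bsub>P i\<^esub>} = d (Suc (Suc i)) ` carrier (P (Suc (Suc i)))"
    using acyclic_exact[OF resolvesD(1)[OF resP]] PP(4) lin_closed[OF PP(3)] by fast
  then have "{y \<in> carrier (P (Suc i)). d (Suc i) y = \<zero>\<^bsub>syzygy R (Suc i) M\<^esub>} = d (Suc (Suc i)) ` carrier (P (Suc (Suc i)))"
    by (simp add: N)
  then show "tr_res R (P (Suc (Suc i))) (P (Suc i)) (d (Suc (Suc i))) (syzygy R (Suc i) M) (d (Suc i))
      (\<lambda>x g. g x) (\<lambda>x g. g x) C c"
    using s(3,4) by (intro tr_res_dual[OF PP(1) PP(1) PP(3) e im _ s(1,2)]) simp_all
  show "fgen R (syzygy R (Suc i) M)" by (rule fgen_image[OF fgen_projective[OF PP(1)] e im])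
qed

private lemma torsionfree_syzygy_iff:
  assumes i: "i \<ge> 1"
  shows "torsionfree R i (syzygy R i M) \<longleftrightarrow> (\<forall>k\<in>{1..i}. coh_zero S (Q i) (q i) k)"
proof -
  obtain l where l: "i = Suc l" using i by (cases i) auto
  have st: "starts_dual (Suc l) (Q i) (q i)" using psi_choiceD(1)[OF i] l by simp
  have "zero_module (Ext S k (Tr R (syzygy R i M))) \<longleftrightarrow> coh_zero S (Q i) (q i) k" if "k \<in> {1..i}" for k
    using that Ext_Tr_zero_iff[OF ring noeth noeth_op syzygy_tr_res(2,1)[OF st], of "k - 1"] l by simp
  then show ?thesis by (simp add: torsionfree_def)
qed

section \<open>Condition \<open>(T\<^sub>j)\<close> for the natural map of a fixed index\<close>

context
  fixes n :: nat assumes n: "n \<ge> 1"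
begin

private abbreviation (input) "G0 \<equiv> dual S (Q n (Suc n))"
private abbreviation (input) "G1 \<equiv> dual S (Q n n)"
private abbreviation (input) "\<gamma> \<equiv> dual_map (Q n (Suc n)) (q n (Suc n))"

private lemmas st = psi_choiceD(1)[OF n]
private lemmas QQ = proj_complexD[OF starts_dualD(5)[OF st]]
private lemmas dS = fg_projective_dual[of S, unfolded op_ring_simps]
private lemmas dS_map = lin_dual_map[of S, unfolded op_ring_simps]

private lemma psi_domain_eq: "psi_domain R n M = cok_dual S (Q n (Suc n)) (Q n n) (q n (Suc n))"
  by (simp add: psi_domain_def Let_def)

private lemma im_\<gamma>: "submodule (\<gamma> ` carrier G1) R G0"
  by (rule submodule_image[OF dS_map[OF QQ(3)]])

private abbreviation (input) "\<epsilon> u \<equiv> \<gamma> ` carrier G1 +>\<^bsub>G0\<^esub> u"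

private lemma lin_\<epsilon>: "lin R G0 (psi_domain R n M) (\<lambda>u. \<epsilon> u)"
  unfolding psi_domain_eq cok_dual_def by (rule lin_quot[OF lin_modules(2)[OF dS_map[OF QQ(3)]] im_\<gamma>])

private lemma \<epsilon>_surj: "(\<lambda>u. \<epsilon> u) ` carrier G0 = carrier (psi_domain R n M)"
  by (simp add: psi_domain_eq cok_dual_def quot_module_simps(1))

private lemma fgen_psi_domain: "fgen R (psi_domain R n M)"
  by (rule fgen_image[OF fgen_projective[OF dS[OF QQ(1)]] lin_\<epsilon> \<epsilon>_surj])

text \<open>The presentation of \<open>psi_domain\<close> is dual to the differential from
  \<open>Q n (Suc n)\<close> to \<open>Q n n\<close>. Its transpose is therefore the cokernel of
  that differential, which the shifted complex resolves.\<close>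

private lemma psi_domain_tr_res:
  "tr_res R G1 G0 \<gamma> (psi_domain R n M) (\<lambda>u. \<epsilon> u) (\<lambda>u w. u w) (\<lambda>u w. u w)
    (\<lambda>k. Q n (k + n)) (\<lambda>k. q n (k + n))"
proof -
  have p: "perfect R (dual S (Q n k)) (Q n k) (\<lambda>u w. u w)" for k
    using perfect_swap[OF perfect_dual[OF QQ(1)[of k]]] by simp
  have "{u \<in> carrier G0. \<epsilon> u = \<zero>\<^bsub>psi_domain R n M\<^esub>} = \<gamma> ` carrier G1"
    using coset_zero_iff[OF lin_modules(2)[OF dS_map[OF QQ(3)]] im_\<gamma>] submoduleD(1)[OF im_\<gamma>]
    by (auto simp: psi_domain_eq cok_dual_def quot_module_simps(2))
  then show ?thesis
    unfolding tr_res_def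
    using dS[OF QQ(1)] dS_map[OF QQ(3)] lin_\<epsilon> \<epsilon>_surj acyclic_shift[OF starts_dualD(1)[OF st], of n] p
    by (simp add: dual_map_def)
qed

text \<open>The adjoints of \<open>h n (Suc n)\<close> and \<open>h n n\<close> form a map of
  presentations: the commuting square of \<open>h\<close> is adjoint to the one of \<open>c0\<close>
  and \<open>c1\<close>, and \<open>psi\<close> is what they induce on cokernels.\<close>

private lemma psi_lift:
  "\<exists>c1 c0. lin R (psi_domain R n M) M (psi R n M) \<and> lin R G1 (P 1) c1 \<and> lin R G0 (P 0) c0 \<and>
    (\<forall>u\<in>carrier G1. c0 (\<gamma> u) = d 1 (c1 u)) \<and>
    (\<forall>u\<in>carrier G0. aug (resol R M) (c0 u) = psi R n M (\<epsilon> u)) \<and>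
    (\<forall>u\<in>carrier G1. \<forall>g\<in>carrier (dual R (P 1)). g (c1 u) = u (h n n g))"
proof -
  note r = resolvesD[OF resP]
  have pP: "perfect S (dual R (P k)) (P k) (\<lambda>g p. g p)" for k
    using perfect_swap[OF perfect_dual[OF PP(1)[of k]]] by simp
  have pQ: "perfect S (Q n k) (dual S (Q n k)) (\<lambda>w u. u w)" for k
    by (rule perfect_dual[OF QQ(1)])
  have h0: "lin S (dual R (P 0)) (Q n (Suc n)) (h n (Suc n))" and h1: "lin S (dual R (P 1)) (Q n n) (h n n)"
    using psi_choiceD(2)[OF n, of "Suc n"] psi_choiceD(2)[OF n, of n] by simp_all
  obtain c0 where c0: "lin R G0 (P 0) c0"
    "\<And>g u. g \<in> carrier (dual R (P 0)) \<Longrightarrow> u \<in> carrier G0 \<Longrightarrow> u (h n (Suc n) g) = g (c0 u)"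
    using transpose_exists[OF pP pQ h0] by auto
  obtain c1 where c1: "lin R G1 (P 1) c1"
    "\<And>g u. g \<in> carrier (dual R (P 1)) \<Longrightarrow> u \<in> carrier G1 \<Longrightarrow> u (h n n g) = g (c1 u)"
    using transpose_exists[OF pP pQ h1] by auto
  note d1 = PP(3)[of 0, folded One_nat_def]
  have comm: "c0 (\<gamma> u) = d 1 (c1 u)" if u: "u \<in> carrier G1" for u
  proof (rule perfect_eqI[OF pP[of 0]])
    have \<gamma>u: "\<gamma> u \<in> carrier G0" by (rule lin_closed[OF dS_map[OF QQ(3)] u])
    show "c0 (\<gamma> u) \<in> carrier (P 0)" by (rule lin_closed[OF c0(1) \<gamma>u])
    show "d 1 (c1 u) \<in> carrier (P 0)" by (rule lin_closed[OF d1 lin_closed[OF c1(1) u]])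
    fix g assume g: "g \<in> carrier (dual R (P 0))"
    have dg: "dual_map (P 1) (d 1) g \<in> carrier (dual R (P 1))" by (rule lin_closed[OF lin_dual_map[OF d1] g])
    have "g (c0 (\<gamma> u)) = u (q n (Suc n) (h n (Suc n) g))"
      using c0(2)[OF g \<gamma>u] lin_closed[OF h0 g] by (simp add: dual_map_def)
    also have "q n (Suc n) (h n (Suc n) g) = h n n (dual_map (P 1) (d 1) g)"
      using psi_choiceD(4)[OF n, of n g] g by simp
    also have "u \<dots> = g (d 1 (c1 u))"
      using c1(2)[OF dg u] lin_closed[OF c1(1) u] by (simp add: dual_map_def)
    finally show "g (c0 (\<gamma> u)) = g (d 1 (c1 u))" .
  qed
  have psi: "psi R n M (\<epsilon> u) = aug (resol R M) (c0 u)" if u: "u \<in> carrier G0" for u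
  proof -
    \<comment> \<open>Functionals on \<open>P 0\<close> separate points, so the element
      \<open>p\<close> in the definition of \<open>psi\<close> is forced.\<close>
    have ev: "p = c0 v" if v: "v \<in> carrier G0" and p: "p \<in> carrier (P 0)"
      and e: "\<forall>g\<in>carrier (dual R (P 0)). g p = v (h n (Suc n) g)" for v p
    proof (rule perfect_eqI[OF pP[of 0] p lin_closed[OF c0(1) v]])
      show "g p = g (c0 v)" if "g \<in> carrier (dual R (P 0))" for g
        using bspec[OF e that] c0(2)[OF that v] by simp
    qed
    note G = lin_modules(2)[OF dS_map[OF QQ(3)]]
    interpret M: right_module R M by (rule r(6))
    \<comment> \<open>Another representative changes the value of \<open>c0\<close> by an element of
      the image of \<open>d 1\<close>, which the augmentation kills; hence the description in
      \<open>psi\<close> determines one element.\<close>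
    have au: "aug (resol R M) (c0 v) = aug (resol R M) (c0 u)" if v: "v \<in> \<epsilon> u" for v
    proof -
      note vc = coset_closed[OF G im_\<gamma> u v]
      obtain w where w: "w \<in> carrier G1" "v \<ominus>\<^bsub>G0\<^esub> u = \<gamma> w"
        using mem_coset_iff[OF G im_\<gamma> u vc] v by blast
      note cv = lin_closed[OF c0(1) vc] and cu = lin_closed[OF c0(1) u]
      have "aug (resol R M) (c0 v) \<ominus>\<^bsub>M\<^esub> aug (resol R M) (c0 u) = aug (resol R M) (c0 (v \<ominus>\<^bsub>G0\<^esub> u))"
        by (simp add: lin_minus[OF c0(1) vc u] lin_minus[OF r(3) cv cu])
      also have "\<dots> = \<zero>\<^bsub>M\<^esub>"
        using comm[OF w(1)] r(7)[OF lin_closed[OF c1(1) w(1)]] w(2) by simp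
      finally show ?thesis using lin_closed[OF r(3) cv] lin_closed[OF r(3) cu] by (simp add: M.M.minus_eq_zero_iff)
    qed
    have uu: "u \<in> \<epsilon> u"
      using mem_coset_iff[OF G im_\<gamma> u u] submoduleD(2)[OF im_\<gamma>] right_module.axioms(2)[OF G] u
      by (simp add: abelian_group.minus_eq_zero_iff[THEN iffD2])
    have "(\<exists>v\<in>\<epsilon> u. \<exists>p\<in>carrier (P 0). (\<forall>g\<in>carrier (dual R (P 0)). g p = v (h n (Suc n) g)) \<and> y = aug (resol R M) p)
        \<longleftrightarrow> y = aug (resol R M) (c0 u)" (is "?L \<longleftrightarrow> ?R") for y
    proof
      assume ?L
      then obtain v p where v: "v \<in> \<epsilon> u" and p: "p \<in> carrier (P 0)"
        "\<forall>g\<in>carrier (dual R (P 0)). g p = v (h n (Suc n) g)" and y: "y = aug (resol R M) p" by blast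
      have "p = c0 v" by (rule ev[OF coset_closed[OF G im_\<gamma> u v] p])
      then show ?R using y au[OF v] by simp
    next
      assume ?R
      moreover have "\<forall>g\<in>carrier (dual R (P 0)). g (c0 u) = u (h n (Suc n) g)"
        by (intro ballI) (rule c0(2)[OF _ u, symmetric])
      ultimately show ?L using uu lin_closed[OF c0(1) u] by blast
    qed
    then show ?thesis by (simp add: psi_def Let_def)
  qed
  have "lin R (psi_domain R n M) M (psi R n M)"
    by (rule lin_factor[OF lin_\<epsilon> \<epsilon>_surj lin_comp[OF c0(1) r(3)] psi])
  moreover have "\<forall>u\<in>carrier G1. \<forall>g\<in>carrier (dual R (P 1)). g (c1 u) = u (h n n g)"
    by (intro ballI) (rule c1(2)[symmetric])
  moreover have "\<forall>u\<in>carrier G1. c0 (\<gamma> u) = d 1 (c1 u)" by (intro ballI) (rule comm)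
  moreover have "\<forall>u\<in>carrier G0. aug (resol R M) (c0 u) = psi R n M (\<epsilon> u)"
    by (intro ballI) (rule psi[symmetric])
  ultimately show ?thesis using c0(1) c1(1) by (intro exI conjI)
qed

text \<open>From degree \<open>n\<close> on the splice is \<open>D\<close>, so the tail of
  \<open>\<Phi>\<close> is a chain map from a resolution of the transpose of \<open>M\<close> to one
  of the transpose of \<open>psi_domain\<close>. Agreement with \<open>h n n\<close> in degree
  \<open>n\<close> makes it adjoint to \<open>c1\<close>, hence a lift of the transpose of
  \<open>psi\<close>.\<close>

lemma satisfies_T_psi_iff:
  assumes D: "starts_dual 0 D \<delta>"
    and \<Phi>: "chain_map S (splice D n) (splice_bd \<delta> n) (Q n) (q n) \<Phi>" "\<Phi> n = h n n"
  shows "satisfies_T R j (psi_domain R n M) M (psi R n M) \<longleftrightarrow>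
    (\<forall>k. 1 \<le> k \<longrightarrow> k \<le> j \<longrightarrow> coh_inj S (splice D n) (splice_bd \<delta> n) (Q n) (q n) (k + n) (\<Phi> (k + n))) \<and>
    (\<forall>k. 1 \<le> k \<longrightarrow> k < j \<longrightarrow> coh_surj S (splice D n) (splice_bd \<delta> n) (Q n) (q n) (k + n) (\<Phi> (k + n)))"
proof -
  note s = starts_dualD[OF D]
  obtain c1 c0 where psi: "lin R (psi_domain R n M) M (psi R n M)" and c1: "lin R G1 (P 1) c1"
    and c0: "lin R G0 (P 0) c0" and comm: "\<And>u. u \<in> carrier G1 \<Longrightarrow> c0 (\<gamma> u) = d 1 (c1 u)"
    and au: "\<And>u. u \<in> carrier G0 \<Longrightarrow> aug (resol R M) (c0 u) = psi R n M (\<epsilon> u)"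
    and tr: "\<And>u g. u \<in> carrier G1 \<Longrightarrow> g \<in> carrier (dual R (P 1)) \<Longrightarrow> g (c1 u) = u (h n n g)"
    using psi_lift by blast
  let ?F = "\<lambda>k. \<Phi> (k + n)"
  have F: "chain_map S D \<delta> (\<lambda>k. Q n (k + n)) (\<lambda>k. q n (k + n)) ?F"
    unfolding chain_map_def
  proof (intro conjI allI ballI)
    show "lin S (D i) (Q n (i + n)) (\<Phi> (i + n))" for i
      using chain_mapD(1)[OF \<Phi>(1), of "i + n"] splice_top[of D n i] by simp
    show "q n (Suc i + n) (\<Phi> (Suc i + n) x) = \<Phi> (i + n) (\<delta> (Suc i) x)" if "x \<in> carrier (D (Suc i))" for i x
      using chain_mapD(2)[OF \<Phi>(1), of x "i + n"] splice_top[of D n "Suc i"] splice_bd_top[of \<delta> n i] that by simp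
  qed
  have L: "tr_lift R G1 G0 \<gamma> (\<lambda>u. \<epsilon> u) (\<lambda>u w. u w) (\<lambda>k. Q n (k + n)) (\<lambda>k. q n (k + n))
      (P 1) (P 0) (d 1) (aug (resol R M)) (\<lambda>x g. g x) D \<delta> (psi R n M) c1 c0 ?F"
    unfolding tr_lift_def using c1 c0 comm au F tr s(2) \<Phi>(2) by simp
  have D1: "D 0 = dual R (P 1)" "D 1 = dual R (P 0)"
    "\<And>g. g \<in> carrier (dual R (P 0)) \<Longrightarrow> \<delta> 1 g = dual_map (P 1) (d 1) g"
    using s(2,3,4) by simp_all
  note E = Ext_Tr_map_iff[OF ring noeth noeth_op M fgen_psi_domain psi s(1) D1 psi_domain_tr_res L]
  note sh = coh_shift[of D "splice D n" n \<delta> "splice_bd \<delta> n" "\<lambda>k. Q n (k + n)" "Q n" "\<lambda>k. q n (k + n)" "q n",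
      OF splice_top[symmetric] splice_bd_top[symmetric] refl, simplified]
  let ?E = "\<lambda>k. Ext_map S k (Tr R M) (Tr R (psi_domain R n M)) (Tr_map R (psi_domain R n M) M (psi R n M))"
  let ?I = "\<lambda>k. coh_inj S (splice D n) (splice_bd \<delta> n) (Q n) (q n) (k + n) (\<Phi> (k + n))"
  let ?J = "\<lambda>k. coh_surj S (splice D n) (splice_bd \<delta> n) (Q n) (q n) (k + n) (\<Phi> (k + n))"
  have inj: "inj_on (?E k) (carrier (Ext S k (Tr R (psi_domain R n M)))) \<longleftrightarrow> ?I k" if "k \<ge> 1" for k
    using that E(1)[of "k - 1"] sh(1)[of S "k - 1"] by simp
  have bij: "bij_betw (?E k) (carrier (Ext S k (Tr R (psi_domain R n M)))) (carrier (Ext S k (Tr R M))) \<longleftrightarrow> ?I k \<and> ?J k"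
    if "k \<ge> 1" for k
    using that E(2)[of "k - 1"] sh(1)[of S "k - 1"] sh(2)[of S "k - 1"] by simp
  have "satisfies_T R j (psi_domain R n M) M (psi R n M) \<longleftrightarrow>
      (j \<ge> 1 \<longrightarrow> (\<forall>k\<in>{1..j - 1}. ?I k \<and> ?J k) \<and> ?I j)"
    unfolding satisfies_T_def using lin_mod_hom[OF psi] inj bij by (auto)
  also have "\<dots> \<longleftrightarrow> (\<forall>k. 1 \<le> k \<longrightarrow> k \<le> j \<longrightarrow> ?I k) \<and> (\<forall>k. 1 \<le> k \<longrightarrow> k < j \<longrightarrow> ?J k)"
    by (rule T_condition_iff)
  finally show ?thesis .
qed

end

text \<open>Functionals separate the points of \<open>P i\<close>, so \<open>p\<close> is a cycle,
  and the chosen resolution is exact. The facts in degrees zero and one that hold for every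
  \<open>M\<close> rest on this.\<close>

private lemma dual_value_lift:
  assumes p: "p \<in> carrier (P (Suc i))"
    and z: "\<And>w. w \<in> carrier (dual R (P i)) \<Longrightarrow> dual_map (P (Suc i)) (d (Suc i)) w p = \<zero>\<^bsub>R\<^esub>"
  obtains p' where "p' \<in> carrier (P (Suc (Suc i)))" "p = d (Suc (Suc i)) p'"
proof -
  have "d (Suc i) p = \<zero>\<^bsub>P i\<^esub>"
    using perfectD(8)[OF perfect_dual[OF PP(1)] lin_closed[OF PP(3) p]] z p by (simp add: dual_map_def)
  then show ?thesis using acyclic_exact[OF resolvesD(1)[OF resP] p] that by blast
qed

text \<open>By reflexivity a cocycle in degree one is evaluation at some \<open>p\<close> in
  \<open>P (Suc i)\<close>. Functionals of the form \<open>w\<close> after \<open>d\<close> are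
  cycles of \<open>C\<close>, hence boundaries, so \<open>p\<close> is a cycle; if \<open>p\<close>
  is the image of \<open>p'\<close>, evaluation at \<open>p'\<close> bounds the cocycle.\<close>

private lemma coh_one_zero:
  assumes st: "starts_dual (Suc i) C c"
  shows "coh_zero S C c (Suc 0)"
  unfolding coh_zero_def
proof (intro allI impI)
  note s = starts_dualD[OF st]
  note QQ = proj_complexD[OF s(5)]
  fix g assume g: "cocycle S C c (Suc 0) g"
  then have gl: "lin S (dual R (P (Suc i))) (regular_module S) g"
    and gc: "\<And>x. x \<in> carrier (C (Suc (Suc 0))) \<Longrightarrow> g (c (Suc (Suc 0)) x) = \<zero>\<^bsub>R\<^esub>"
    using s(3) by (simp_all add: cocycle_def)
  obtain p where p: "p \<in> carrier (P (Suc i))" "\<And>w. w \<in> carrier (dual R (P (Suc i))) \<Longrightarrow> g w = w p"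
    using perfectD(6)[OF perfect_dual[OF PP(1)] gl] by blast
  have "dual_map (P (Suc i)) (d (Suc i)) w p = \<zero>\<^bsub>R\<^esub>" if w: "w \<in> carrier (dual R (P i))" for w
  proof -
    have dw: "dual_map (P (Suc i)) (d (Suc i)) w \<in> carrier (dual R (P (Suc i)))" by (rule lin_closed[OF dual_bd w])
    have "c (Suc 0) (dual_map (P (Suc i)) (d (Suc i)) w) = \<zero>\<^bsub>C 0\<^esub>"
      using s(2) s(4)[OF dw] dual_bd_bd[OF w] by simp
    then obtain x where "x \<in> carrier (C (Suc (Suc 0)))" "dual_map (P (Suc i)) (d (Suc i)) w = c (Suc (Suc 0)) x"
      using acyclic_exact[OF s(1), of _ 0] dw s(3) by auto
    then show ?thesis using gc p(2)[OF dw] by simp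
  qed
  then obtain p' where p': "p' \<in> carrier (P (Suc (Suc i)))" "p = d (Suc (Suc i)) p'"
    using dual_value_lift[OF p(1)] by blast
  have "g w = (c (Suc 0) w) p'" if "w \<in> carrier (C (Suc 0))" for w
    using that s(3) s(4)[of w] p(2)[of w] p' by (simp add: dual_map_def)
  then show "coboundary S C c (Suc 0) g"
    using lin_eval[OF PP(2) p'(1)] s(2) unfolding coboundary_Suc by (intro exI[of _ "\<lambda>w. w p'"]) simp
qed

section \<open>The map from one transpose to the syzygy of the next\<close>

context
  fixes i :: nat and C c Y y F
  assumes C: "starts_dual i C c" and Y: "starts_dual (Suc i) Y y"
    and F: "chain_map S C c (\<lambda>k. Y (Suc k)) (\<lambda>k. y (Suc k)) F"
    and F0: "\<And>g. g \<in> carrier (C 0) \<Longrightarrow> F 0 g = g"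
begin

private lemmas sC = starts_dualD[OF C] and sY = starts_dualD[OF Y]
private lemmas YY = proj_complexD[OF sY(5)]

private lemma acyclic_Y: "acyclic_complex S (\<lambda>k. Y (Suc k)) (\<lambda>k. y (Suc k))"
  using acyclic_shift[OF sY(1), of 1] by simp

text \<open>A functional that vanishes on the coboundaries coming from \<open>P i\<close> is
  evaluation at a cycle \<open>p\<close>, the image of some \<open>p'\<close>. Evaluation at such an
  element vanishes on all cocycles, so the functional already lives on the smaller quotient.\<close>

lemma connecting_coh_surj_0: "coh_surj S C c (\<lambda>k. Y (Suc k)) (\<lambda>k. y (Suc k)) 0 (F 0)"
  unfolding coh_surj_def
proof (intro allI impI)
  interpret S: ring S by (rule ringS)
  fix g assume g: "cocycle S C c 0 g"
  then have gl: "lin S (dual R (P (Suc i))) (regular_module S) g"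
    and gc: "\<And>w. w \<in> carrier (dual R (P i)) \<Longrightarrow> g (c (Suc 0) w) = \<zero>\<^bsub>R\<^esub>"
    using sC(2,3) by (simp_all add: cocycle_def)
  obtain p where p: "p \<in> carrier (P (Suc i))" "\<And>w. w \<in> carrier (dual R (P (Suc i))) \<Longrightarrow> g w = w p"
    using perfectD(6)[OF perfect_dual[OF PP(1)] gl] by blast
  have "dual_map (P (Suc i)) (d (Suc i)) w p = \<zero>\<^bsub>R\<^esub>" if w: "w \<in> carrier (dual R (P i))" for w
    using gc[OF w] sC(4)[OF w] p(2)[OF lin_closed[OF dual_bd w]] by simp
  then obtain p' where p': "p' \<in> carrier (P (Suc (Suc i)))" "p = d (Suc (Suc i)) p'"
    using dual_value_lift[OF p(1)] by blast
  have "g (y (Suc (Suc 0)) x) = \<zero>\<^bsub>R\<^esub>" if x: "x \<in> carrier (Y (Suc (Suc 0)))" for x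
  proof -
    have yx: "y (Suc (Suc 0)) x \<in> carrier (dual R (P (Suc i)))"
      using lin_closed[OF YY(3) x] sY(3) by simp
    have "g (y (Suc (Suc 0)) x) = (y (Suc 0) (y (Suc (Suc 0)) x)) p'"
      using p(2)[OF yx] p' sY(4)[OF yx] by (simp add: dual_map_def)
    then show ?thesis using YY(4)[OF x] sY(2) p'(1) by (simp add: dual_simps(2))
  qed
  then have g': "cocycle S (\<lambda>k. Y (Suc k)) (\<lambda>k. y (Suc k)) 0 g" using gl sY(3) by (simp add: cocycle_def)
  have "coboundary S C c 0 (\<lambda>x. g x \<ominus>\<^bsub>S\<^esub> g (F 0 x))"
    using cocycle_value[OF g] F0 S.minus_eq_zero_iff unfolding coboundary_0 by simp
  with g' show "\<exists>g'. cocycle S (\<lambda>k. Y (Suc k)) (\<lambda>k. y (Suc k)) 0 g' \<and>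
      coboundary S C c 0 (\<lambda>x. g x \<ominus>\<^bsub>S\<^esub> g' (F 0 x))" by blast
qed

text \<open>\<open>C\<close> resolves the dual of \<open>P (Suc i)\<close> modulo coboundaries, and
  \<open>Y\<close> shifted by one resolves it modulo cocycles, so the cone resolves Ext. For
  \<open>k = 0\<close> the surjectivity half is \<open>connecting_coh_surj_0\<close>.\<close>

lemma Ext_Ext_zero_iff:
  "zero_module (Ext S k (Ext R (Suc i) M)) \<longleftrightarrow>
    coh_surj S C c (\<lambda>k. Y (Suc k)) (\<lambda>k. y (Suc k)) k (F k) \<and>
    coh_inj S C c (\<lambda>k. Y (Suc k)) (\<lambda>k. y (Suc k)) (Suc k) (F (Suc k))"
proof -
  let ?X = "resol R M"
  note PX = resolvesD(2)[OF resP]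
  let ?Z = "ext_cocycles R ?X (Suc i)" and ?B = "ext_coboundaries R ?X (Suc i)"
  let ?N = "(dual R (P (Suc i)))\<lparr>carrier := ?Z\<rparr>"
  have E: "Ext R (Suc i) M = quot_module ?N ?B" by (simp add: Ext_def Let_def)
  note N = right_module_cocycles[OF PX, of "Suc i"] and B = submodule_coboundaries_cocycles[OF PX, of "Suc i"]
  have B': "?B = c 1 ` carrier (C 1)"
    using sC(3,4) by (auto simp: ext_coboundaries_def)
  have Z: "?Z = {g \<in> carrier (Y (Suc 0)). y (Suc 0) g = \<zero>\<^bsub>Y 0\<^esub>}"
    using sY(2,3,4) by (auto simp: ext_cocycles_def)
  \<comment> \<open>The second differential of \<open>Y\<close> maps onto the cocycles; followed by
    the projection to Ext it gives the augmentation of the cone.\<close>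
  have im: "y (Suc (Suc 0)) ` carrier (Y (Suc (Suc 0))) = ?Z"
    unfolding Z using acyclic_exact[OF sY(1), of _ 0] YY(4)[of _ 0] lin_closed[OF YY(3)[of "Suc 0"]] by auto
  have "lin S (Y (Suc (Suc 0))) (dual R (P (Suc i))) (y (Suc (Suc 0)))" using YY(3)[of "Suc 0"] sY(3) by simp
  then have l: "lin S (Y (Suc (Suc 0))) ?N (y (Suc (Suc 0)))"
    by (rule lin_restrict_cod[OF _ submodule_ext_cocycles[OF PX]]) (use im in blast)
  let ?e = "\<lambda>x. ?B +>\<^bsub>?N\<^esub> y (Suc (Suc 0)) x"
  have "?e ` carrier (Y (Suc (Suc 0))) = (\<lambda>g. ?B +>\<^bsub>?N\<^esub> g) ` ?Z" using im by (metis image_image)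
  then have e: "lin S (Y (Suc (Suc 0))) (Ext R (Suc i) M) ?e" "?e ` carrier (Y (Suc (Suc 0))) = carrier (Ext R (Suc i) M)"
    using lin_comp[OF l lin_quot[OF N B]] unfolding E by (simp_all add: quot_module_simps(1))
  have ker: "?e x = \<zero>\<^bsub>Ext R (Suc i) M\<^esub> \<longleftrightarrow> y (Suc (Suc 0)) x \<in> c 1 ` carrier (C 1)"
    if "x \<in> carrier (Y (Suc (Suc 0)))" for x
    using coset_zero_iff[OF N B lin_closed[OF l that]] unfolding E B' quot_module_simps(2) .
  have CY: "C 0 = Y (Suc 0)" using sC(2) sY(3) by simp
  have r: "resolves S (cone C (\<lambda>k. Y (Suc k))) (cone_bd C (\<lambda>k. Y (Suc k)) c (\<lambda>k. y (Suc k)) F) (Ext R (Suc i) M) (\<lambda>p. ?e (fst p))"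
    by (rule resolves_cone[OF sC(1) acyclic_Y F CY F0]) (use e ker in simp_all)
  have rE: "resolves S (cx (resol S (Ext R (Suc i) M))) (bd (resol S (Ext R (Suc i) M))) (Ext R (Suc i) M)
      (aug (resol S (Ext R (Suc i) M)))"
    by (rule resol_resolves[OF noeth_op Ext_fgen[OF noeth_op resP]])
  have "zero_module (Ext S k (Ext R (Suc i) M)) \<longleftrightarrow>
      coh_zero S (cone C (\<lambda>k. Y (Suc k))) (cone_bd C (\<lambda>k. Y (Suc k)) c (\<lambda>k. y (Suc k)) F) k"
    unfolding Ext_zero_iff[OF rE] by (rule coh_zero_independent[OF rE r])
  then show ?thesis
    using coh_zero_cone_Suc[OF sC(1) acyclic_Y F CY F0] coh_zero_cone_0[OF sC(1) acyclic_Y F CY F0 connecting_coh_surj_0] connecting_coh_surj_0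
    by (cases k) simp_all
qed

text \<open>The composite of \<open>F\<close> and \<open>\<Phi>\<close>, moved up by one degree and
  completed by the identity in degree zero, is a chain map out of the longer splice. It agrees with
  \<open>\<Psi>\<close> in degree zero, so the two are homotopic; this passes from the natural map
  of index \<open>i\<close> to the next one.\<close>

private lemma splice_step_coh_eq:
  assumes D: "starts_dual 0 D \<delta>"
    and \<Phi>: "chain_map S (splice D i) (splice_bd \<delta> i) C c \<Phi>" "\<And>g. g \<in> carrier (C 0) \<Longrightarrow> \<Phi> 0 g = g"
    and \<Psi>: "chain_map S (splice D (Suc i)) (splice_bd \<delta> (Suc i)) Y y \<Psi>" "\<And>g. g \<in> carrier (Y 0) \<Longrightarrow> \<Psi> 0 g = g"
  shows "lin S (splice D (Suc i) (Suc k)) (Y (Suc k)) (\<lambda>g. F k (\<Phi> k g))"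
    and "coh_eq S (splice D (Suc i)) (splice_bd \<delta> (Suc i)) Y y (Suc k) (\<Psi> (Suc k)) (\<lambda>g. F k (\<Phi> k g))"
proof -
  note pr = splice_proj[OF D, of "Suc i"]
  note F\<Phi> = chain_map_comp[OF \<Phi>(1) F]
  have l: "lin S (splice D (Suc i) (Suc k)) (Y (Suc k)) (\<lambda>g. F k (\<Phi> k g))" for k
    using chain_mapD(1)[OF F\<Phi>, of k] by simp
  then show "lin S (splice D (Suc i) (Suc k)) (Y (Suc k)) (\<lambda>g. F k (\<Phi> k g))" .
  define T where "T m = (case m of 0 \<Rightarrow> (\<lambda>g. g) | Suc k \<Rightarrow> (\<lambda>g. F k (\<Phi> k g)))" for m
  have C0: "splice D i 0 = dual R (P (Suc i))" using splice_low(1)[OF D, of 0 i] by simp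
  have "chain_map S (splice D (Suc i)) (splice_bd \<delta> (Suc i)) Y y T"
    unfolding chain_map_def
  proof (intro conjI allI ballI)
    show "lin S (splice D (Suc i) m) (Y m) (T m)" for m
      using l lin_id[OF right_module_dual[OF PP(2)]] sY(2) by (cases m) (simp_all add: T_def)
    show "y (Suc m) (T (Suc m) g) = T m (splice_bd \<delta> (Suc i) (Suc m) g)"
      if g: "g \<in> carrier (splice D (Suc i) (Suc m))" for m g
    proof (cases m)
      case 0
      then have "g \<in> carrier (dual R (P (Suc i)))" using g C0 by simp
      then show ?thesis using 0 sC(2) sY(4) \<Phi>(2) F0 by (simp add: T_def)
    next
      case (Suc k)
      then show ?thesis using chain_mapD(2)[OF F\<Phi>, of g k] g by (simp add: T_def)
    qed
  qed
  moreover have "\<Psi> 0 g \<ominus>\<^bsub>Y 0\<^esub> T 0 g \<in> y 1 ` carrier (Y 1)" if g: "g \<in> carrier (splice D (Suc i) 0)" for g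
  proof -
    interpret Y0: right_module S "Y 0" by (rule YY(2))
    interpret Y1: right_module S "Y (Suc 0)" by (rule YY(2))
    have "g \<in> carrier (Y 0)" using g sY(2) by simp
    then have "\<Psi> 0 g \<ominus>\<^bsub>Y 0\<^esub> T 0 g = \<zero>\<^bsub>Y 0\<^esub>" using \<Psi>(2) by (simp add: T_def Y0.M.minus_eq_zero_iff)
    also have "\<dots> = y 1 \<zero>\<^bsub>Y 1\<^esub>" using lin_zero[OF YY(3)[of 0]] by simp
    finally show ?thesis using Y1.M.zero_closed by simp
  qed
  ultimately have "coh_eq S (splice D (Suc i)) (splice_bd \<delta> (Suc i)) Y y (Suc k) (\<Psi> (Suc k)) (T (Suc k))"
    by (rule homotopic_coh_eq[OF pr sY(1) \<Psi>(1)])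
  then show "coh_eq S (splice D (Suc i)) (splice_bd \<delta> (Suc i)) Y y (Suc k) (\<Psi> (Suc k)) (\<lambda>g. F k (\<Phi> k g))"
    by (simp add: T_def)
qed

text \<open>Shifting by one preserves cohomology only in positive degrees, whence the offset of two
  on the left.\<close>

lemma splice_step_iff:
  assumes D: "starts_dual 0 D \<delta>"
    and \<Phi>: "chain_map S (splice D i) (splice_bd \<delta> i) C c \<Phi>" "\<And>g. g \<in> carrier (C 0) \<Longrightarrow> \<Phi> 0 g = g"
    and \<Psi>: "chain_map S (splice D (Suc i)) (splice_bd \<delta> (Suc i)) Y y \<Psi>" "\<And>g. g \<in> carrier (Y 0) \<Longrightarrow> \<Psi> 0 g = g"
  shows "coh_inj S (splice D (Suc i)) (splice_bd \<delta> (Suc i)) Y y (Suc (Suc k)) (\<Psi> (Suc (Suc k))) \<longleftrightarrow>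
      coh_inj S (splice D i) (splice_bd \<delta> i) (\<lambda>k. Y (Suc k)) (\<lambda>k. y (Suc k)) (Suc k) (\<lambda>g. F (Suc k) (\<Phi> (Suc k) g))"
    and "coh_surj S (splice D (Suc i)) (splice_bd \<delta> (Suc i)) Y y (Suc (Suc k)) (\<Psi> (Suc (Suc k))) \<longleftrightarrow>
      coh_surj S (splice D i) (splice_bd \<delta> i) (\<lambda>k. Y (Suc k)) (\<lambda>k. y (Suc k)) (Suc k) (\<lambda>g. F (Suc k) (\<Phi> (Suc k) g))"
proof -
  note e = splice_step_coh_eq[OF D \<Phi> \<Psi>, of "Suc k"]
  note c = splice_proj[OF D, of "Suc i"] chain_mapD(1)[OF \<Psi>(1), of "Suc (Suc k)"] e
  note sh = coh_shift[where A = "splice D i" and C = "splice D (Suc i)" and n = 1 and a = "splice_bd \<delta> i"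
      and d = "splice_bd \<delta> (Suc i)" and B = "\<lambda>k. Y (Suc k)" and D = Y and b = "\<lambda>k. y (Suc k)" and \<delta> = y
      and R = S and k = k and f = "\<lambda>g. F (Suc k) (\<Phi> (Suc k) g)", unfolded add_Suc add_0_right One_nat_def add_Suc_right]
  show "coh_inj S (splice D (Suc i)) (splice_bd \<delta> (Suc i)) Y y (Suc (Suc k)) (\<Psi> (Suc (Suc k))) \<longleftrightarrow>
      coh_inj S (splice D i) (splice_bd \<delta> i) (\<lambda>k. Y (Suc k)) (\<lambda>k. y (Suc k)) (Suc k) (\<lambda>g. F (Suc k) (\<Phi> (Suc k) g))"
    by (rule trans[OF coh_inj_cong[OF c] sh(1)[symmetric]]) simp_all
  show "coh_surj S (splice D (Suc i)) (splice_bd \<delta> (Suc i)) Y y (Suc (Suc k)) (\<Psi> (Suc (Suc k))) \<longleftrightarrow>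
      coh_surj S (splice D i) (splice_bd \<delta> i) (\<lambda>k. Y (Suc k)) (\<lambda>k. y (Suc k)) (Suc k) (\<lambda>g. F (Suc k) (\<Phi> (Suc k) g))"
    by (rule trans[OF coh_surj_cong[OF c] sh(2)[symmetric]]) simp_all
qed

end

text \<open>The dual of \<open>d (Suc i)\<close> lands in the kernel of the next dual map, which the
  second differential of \<open>Y\<close> covers; so the identity of the common term extends to a
  chain map.\<close>

private lemma connecting_map_exists:
  assumes C: "starts_dual i C c" and Y: "starts_dual (Suc i) Y y"
  shows "\<exists>F. chain_map S C c (\<lambda>k. Y (Suc k)) (\<lambda>k. y (Suc k)) F \<and> F 0 = (\<lambda>g. g)"
proof -
  note sC = starts_dualD[OF C] and sY = starts_dualD[OF Y]
  have a: "acyclic_complex S (\<lambda>k. Y (Suc k)) (\<lambda>k. y (Suc k))" using acyclic_shift[OF sY(1), of 1] by simp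
  have l: "lin S (C 0) (Y (Suc 0)) (\<lambda>g. g)" using lin_id[OF right_module_dual[OF PP(2)]] sC(2) sY(3) by simp
  have "c 1 x \<in> y (Suc (Suc 0)) ` carrier (Y (Suc (Suc 0)))" if "x \<in> carrier (C 1)" for x
  proof (rule acyclic_exact[OF sY(1)])
    have x: "x \<in> carrier (dual R (P i))" using that sC(3) by simp
    note dx = lin_closed[OF dual_bd x]
    show "c 1 x \<in> carrier (Y (Suc 0))" using sC(4)[OF x] sY(3) dx by simp
    show "y (Suc 0) (c 1 x) = \<zero>\<^bsub>Y 0\<^esub>" using sC(4)[OF x] sY(2) sY(4)[OF dx] dual_bd_bd[OF x] by simp
  qed
  then show ?thesis using chain_map_extend[OF sC(5) a l] by simp
qed

text \<open>The given maps \<open>h n m\<close> stop in degree \<open>n + 1\<close>. Continuing them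
  gives a chain map, which is needed to speak of induced maps on Ext in all higher degrees.\<close>

private lemma psi_chain_map_exists:
  assumes n: "n \<ge> 1" and D: "starts_dual 0 D \<delta>"
  shows "\<exists>\<Phi>. chain_map S (splice D n) (splice_bd \<delta> n) (Q n) (q n) \<Phi> \<and> \<Phi> n = h n n \<and>
    (\<forall>g\<in>carrier (Q n 0). \<Phi> 0 g = g)"
proof -
  note s = psi_choiceD[OF n] and low = splice_low[OF D]
  have "\<exists>\<Phi>. chain_map S (splice D n) (splice_bd \<delta> n) (Q n) (q n) \<Phi> \<and> (\<forall>m\<le>Suc n. \<Phi> m = h n m)"
  proof (rule chain_map_extend_from[OF splice_proj[OF D] starts_dualD(1)[OF s(1)]])
    show "lin S (splice D n m) (Q n m) (h n m)" if "m \<le> Suc n" for m using s(2)[OF that] low(1)[OF that] by simp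
    show "q n (Suc m) (h n (Suc m) x) = h n m (splice_bd \<delta> n (Suc m) x)"
      if "m \<le> n" "x \<in> carrier (splice D n (Suc m))" for m x
      using that s(4)[OF that(1), of x] low(1)[of "Suc m" n] low(2)[OF that(1), of x] by simp
  qed
  then obtain \<Phi> where \<Phi>: "chain_map S (splice D n) (splice_bd \<delta> n) (Q n) (q n) \<Phi>"
    "\<And>m. m \<le> Suc n \<Longrightarrow> \<Phi> m = h n m" by blast
  have "\<Phi> 0 g = g" if "g \<in> carrier (Q n 0)" for g
    using \<Phi>(2)[of 0] s(3) starts_dualD(2)[OF s(1)] that by simp
  moreover have "\<Phi> n = h n n" by (rule \<Phi>(2)) simp
  ultimately show ?thesis using \<Phi>(1) by blast
qed

text \<open>With \<open>X i\<close> the resolution of \<open>Tr \<Omega>\<^sup>i M\<close>, \<open>a i k\<close> and \<open>s i k\<close> say that \<open>Ext\<^sup>k\<close> of the map \<open>X (i - 1) \<rightarrow> X i\<close> of degree one is injective and surjective, \<open>I i k\<close> and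
  \<open>J i k\<close> the same for the composite \<open>X 0 \<rightarrow> X i\<close>, and \<open>Z i k\<close> that \<open>Ext\<^sup>k\<close> of \<open>X i\<close> vanishes.\<close>

private lemma induction_scheme:
  fixes a s Z I J :: "nat \<Rightarrow> nat \<Rightarrow> bool"
  assumes s0: "\<And>i. s (Suc i) 0" and Z1: "\<And>i. Z (Suc i) (Suc 0)"
    and Zstep: "\<And>i k. Z i (Suc k) \<Longrightarrow> a (Suc i) (Suc k) \<Longrightarrow> Z (Suc i) (Suc (Suc k))"
    and Za: "\<And>i k. Z (Suc i) (Suc (Suc k)) \<Longrightarrow> a (Suc i) (Suc k)"
    and Zs: "\<And>i k. Z i (Suc k) \<Longrightarrow> s (Suc i) (Suc k)"
    and I0: "\<And>k. I 0 (Suc k)" and J0: "\<And>k. J 0 (Suc k)"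
    and Icomp: "\<And>i k. I i (Suc k) \<Longrightarrow> a (Suc i) (Suc k + i) \<Longrightarrow> I (Suc i) (Suc k)"
    and Jcomp: "\<And>i k. J i (Suc k) \<Longrightarrow> s (Suc i) (Suc k + i) \<Longrightarrow> J (Suc i) (Suc k)"
    and Icanc: "\<And>i k. I (Suc i) (Suc k) \<Longrightarrow> a (Suc i) (Suc k + i)"
    and Jcanc: "\<And>i k. J (Suc i) (Suc k) \<Longrightarrow> I i (Suc k) \<Longrightarrow> s (Suc i) (Suc k + i)"
  shows "(\<forall>i\<in>{1..n}. \<forall>k<i + j - 1. s i k \<and> a i (Suc k)) \<longleftrightarrow>
    (\<forall>i\<in>{1..n}. (\<forall>k\<in>{1..i}. Z i k) \<and> (\<forall>k. 1 \<le> k \<longrightarrow> k \<le> j \<longrightarrow> I i k) \<and> (\<forall>k. 1 \<le> k \<longrightarrow> k < j \<longrightarrow> J i k))"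
    (is "?L \<longleftrightarrow> ?R")
proof
  assume L: ?L
  \<comment> \<open>The invariant starts at stage \<open>0\<close>, where the vanishing is void and
    \<open>I\<close> and \<open>J\<close> are given. Positive degrees are written as
    successors.\<close>
  have "(\<forall>k<i. Z i (Suc k)) \<and> (\<forall>k<j. I i (Suc k)) \<and> (\<forall>k. Suc k < j \<longrightarrow> J i (Suc k))" if "i \<le> n" for i
    using that
  proof (induction i)
    case 0
    then show ?case using I0 J0 by simp
  next
    case (Suc i)
    \<comment> \<open>At stage \<open>Suc i\<close> the bound \<open>Suc i + j - 1\<close> is
      \<open>i + j\<close>.\<close>
    have L': "s (Suc i) k" "a (Suc i) (Suc k)" if "k < i + j" for k
      using bspec[OF L, of "Suc i"] Suc.prems that by simp_all
    have "Z (Suc i) (Suc k)" if "k < Suc i" for k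
      using that Z1 Zstep Suc L'(2) by (cases k) auto
    moreover have "I (Suc i) (Suc k)" if "k < j" for k
      using that Suc by (intro Icomp) (auto intro: L'(2)[simplified])
    moreover have "J (Suc i) (Suc k)" if "Suc k < j" for k
      using that Suc by (intro Jcomp) (auto intro: L'(1))
    ultimately show ?case by blast
  qed
  note * = this
  show ?R
  proof (intro ballI conjI allI impI)
    fix i k assume "i \<in> {1..n}" "k \<in> {1..i}"
    then show "Z i k" using *[of i] by (cases k) auto
  next
    fix i k assume "i \<in> {1..n}" "1 \<le> k" "k \<le> j"
    then show "I i k" using *[of i] by (cases k) auto
  next
    fix i k assume "i \<in> {1..n}" "1 \<le> k" "k < j"
    then show "J i k" using *[of i] by (cases k) auto
  qed
next
  assume R: ?R
  have Z: "Z i (Suc k)" if "i \<le> n" "k < i" for i k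
    using bspec[OF R, of i] that by auto
  have I: "I i (Suc k)" if "i \<le> n" "k < j" for i k
    using bspec[OF R, of i] that I0 by (cases "i = 0") auto
  have J: "J i (Suc k)" if "i \<le> n" "Suc k < j" for i k
    using bspec[OF R, of i] that J0 by (cases "i = 0") auto
  show ?L
  proof (intro ballI allI impI)
    fix i' k assume i': "i' \<in> {1..n}" and k: "k < i' + j - 1"
    then obtain i where i: "i' = Suc i" "Suc i \<le> n" by (cases i') auto
    \<comment> \<open>Up to degree \<open>i\<close> vanishing at stage \<open>i\<close> gives
      surjectivity, with degree zero supplied by \<open>s0\<close>; beyond it the last factor is
      cancelled from the composite.\<close>
    have "s (Suc i) k"
    proof (cases "k \<le> i")
      case True
      then show ?thesis using s0 Zs[OF Z] i by (cases k) auto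
    next
      case False
      then obtain m where m: "k = Suc m + i" by (metis add.commute less_imp_Suc_add not_le add_Suc)
      then have "Suc m < j" using k i by simp
      then show ?thesis using Jcanc[of i m] J[of "Suc i" m] I[of i m] i m by simp
    qed
    \<comment> \<open>Injectivity follows from vanishing at stage \<open>Suc i\<close> one degree
      higher, known exactly when \<open>Suc k \<le> i\<close>; from there on it is cancelled from
      the composite.\<close>
    moreover have "a (Suc i) (Suc k)"
    proof (cases "Suc k \<le> i")
      case True
      then show ?thesis using Za[OF Z] i by simp
    next
      case False
      then obtain m where m: "Suc k = Suc m + i" by (metis add.commute less_imp_Suc_add not_le add_Suc)
      then have "m < j" using k i by simp
      then show ?thesis using Icanc[of i m] I[of "Suc i" m] i m by simp
    qed
    ultimately show "s i' k \<and> a i' (Suc k)" using i by simp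
  qed
qed

lemma grade_Ext_iff_torsionfree_and_T:
  "(\<forall>i\<in>{1..n}. grade S (Ext R i M) \<ge> enat (i + j - 1)) \<longleftrightarrow>
   (\<forall>i\<in>{1..n}. torsionfree R i (syzygy R i M) \<and> satisfies_T R j (psi_domain R i M) M (psi R i M))"
proof -
  obtain D \<delta> where D: "starts_dual 0 D \<delta>" using starts_dual_exists by blast
  \<comment> \<open>The data of the natural map are available for positive index; stage
    \<open>0\<close> is filled by the resolution \<open>D\<close> of the transpose of
    \<open>M\<close>.\<close>
  define X where "X i = (if i = 0 then D else Q i)" for i
  define x where "x i = (if i = 0 then \<delta> else q i)" for i
  have st: "starts_dual i (X i) (x i)" for i
    using D psi_choiceD(1)[of i] by (simp add: X_def x_def)
  note sX = starts_dualD[OF st]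
  have "\<forall>i. \<exists>F. chain_map S (X i) (x i) (\<lambda>k. X (Suc i) (Suc k)) (\<lambda>k. x (Suc i) (Suc k)) F \<and> F 0 = (\<lambda>g. g)"
    using connecting_map_exists[OF st st] by blast
  then obtain F where F: "\<And>i. chain_map S (X i) (x i) (\<lambda>k. X (Suc i) (Suc k)) (\<lambda>k. x (Suc i) (Suc k)) (F i)"
    "\<And>i. F i 0 = (\<lambda>g. g)" by metis
  \<comment> \<open>At stage \<open>0\<close> the splice is \<open>D\<close> itself, and choosing
    the identity makes the induced maps bijective there.\<close>
  have "\<exists>\<Phi>. chain_map S (splice D i) (splice_bd \<delta> i) (X i) (x i) \<Phi> \<and> (i \<ge> 1 \<longrightarrow> \<Phi> i = h i i) \<and>
      (\<forall>g\<in>carrier (X i 0). \<Phi> 0 g = g) \<and> (i = 0 \<longrightarrow> \<Phi> = (\<lambda>k g. g))" for i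
  proof (cases "i = 0")
    case True
    then show ?thesis
      using chain_map_id[OF starts_dualD(5)[OF D]] by (intro exI[of _ "\<lambda>k g. g"]) (simp add: X_def x_def)
  next
    case False
    then show ?thesis using psi_chain_map_exists[OF _ D, of i] by (simp add: X_def x_def)
  qed
  then obtain \<Phi> where \<Phi>: "\<And>i. chain_map S (splice D i) (splice_bd \<delta> i) (X i) (x i) (\<Phi> i)"
    "\<And>i. i \<ge> 1 \<Longrightarrow> \<Phi> i i = h i i" "\<And>i g. g \<in> carrier (X i 0) \<Longrightarrow> \<Phi> i 0 g = g" "\<Phi> 0 = (\<lambda>k g. g)" by metis
  define a where "a i k = coh_inj S (X (i - 1)) (x (i - 1)) (\<lambda>k. X i (Suc k)) (\<lambda>k. x i (Suc k)) k (F (i - 1) k)" for i k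
  define s where "s i k = coh_surj S (X (i - 1)) (x (i - 1)) (\<lambda>k. X i (Suc k)) (\<lambda>k. x i (Suc k)) k (F (i - 1) k)" for i k
  define Z where "Z i k = coh_zero S (X i) (x i) k" for i k
  \<comment> \<open>Degree \<open>k\<close> of \<open>D\<close> sits in degree \<open>k + i\<close>
    of the splice, so the index \<open>k\<close> counts degrees on the transpose of
    \<open>M\<close>.\<close>
  define I where "I i k = coh_inj S (splice D i) (splice_bd \<delta> i) (X i) (x i) (k + i) (\<Phi> i (k + i))" for i k
  define J where "J i k = coh_surj S (splice D i) (splice_bd \<delta> i) (X i) (x i) (k + i) (\<Phi> i (k + i))" for i k
  have F0: "F i 0 g = g" for i g using F(2) by simp
  have shift_proj: "proj_complex S (\<lambda>k. X i (Suc k)) (\<lambda>k. x i (Suc k))" for i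
    using proj_complex_shift[OF sX(5)[of i], of 1] by simp
  have zs: "coh_zero S (\<lambda>k. X i (Suc k)) (\<lambda>k. x i (Suc k)) (Suc k) \<longleftrightarrow> Z i (Suc (Suc k))" for i k
    using coh_zero_shift[where A = "\<lambda>k. X i (Suc k)" and C = "X i" and n = 1 and a = "\<lambda>k. x i (Suc k)" and d = "x i"
        and R = S and k = k] by (simp add: Z_def)
  note step = splice_step_iff[OF st st F(1) F0 D \<Phi>(1,3) \<Phi>(1,3)]
  have Istep: "I (Suc i) (Suc k) \<longleftrightarrow> coh_inj S (splice D i) (splice_bd \<delta> i) (\<lambda>k. X (Suc i) (Suc k)) (\<lambda>k. x (Suc i) (Suc k))
      (Suc k + i) (\<lambda>g. F i (Suc k + i) (\<Phi> i (Suc k + i) g))" for i k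
    using step(1)[of i "k + i"] by (simp add: I_def)
  have Jstep: "J (Suc i) (Suc k) \<longleftrightarrow> coh_surj S (splice D i) (splice_bd \<delta> i) (\<lambda>k. X (Suc i) (Suc k)) (\<lambda>k. x (Suc i) (Suc k))
      (Suc k + i) (\<lambda>g. F i (Suc k + i) (\<Phi> i (Suc k + i) g))" for i k
    using step(2)[of i "k + i"] by (simp add: J_def)
  note pD = splice_proj[OF D]
  have id: "coh_eq S D \<delta> D \<delta> k (\<lambda>g. g) (\<lambda>g. g)" for k
    by (rule coh_eq_refl[OF starts_dualD(5)[OF D] lin_id[OF proj_complexD(2)[OF starts_dualD(5)[OF D]]]])
  have eqv: "coh_inj S D \<delta> D \<delta> k (\<lambda>g. g)" "coh_surj S D \<delta> D \<delta> k (\<lambda>g. g)" for k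
    using id[of k] unfolding coh_inj_def coh_surj_def coh_eq_def by blast+
  have induct_iff: "(\<forall>i\<in>{1..n}. \<forall>k<i + j - 1. s i k \<and> a i (Suc k)) \<longleftrightarrow>
    (\<forall>i\<in>{1..n}. (\<forall>k\<in>{1..i}. Z i k) \<and> (\<forall>k. 1 \<le> k \<longrightarrow> k \<le> j \<longrightarrow> I i k) \<and> (\<forall>k. 1 \<le> k \<longrightarrow> k < j \<longrightarrow> J i k))"
  proof (rule induction_scheme)
    show "s (Suc i) 0" for i using connecting_coh_surj_0[OF st st F(1) F0] by (simp add: s_def)
    show "Z (Suc i) (Suc 0)" for i using coh_one_zero[OF st] by (simp add: Z_def)
    show "Z (Suc i) (Suc (Suc k))" if "Z i (Suc k)" "a (Suc i) (Suc k)" for i k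
    proof -
      have "coh_zero S (\<lambda>k. X (Suc i) (Suc k)) (\<lambda>k. x (Suc i) (Suc k)) (Suc k)"
        by (rule coh_zero_target[OF sX(5) F(1)]) (use that in \<open>simp_all add: Z_def a_def\<close>)
      then show ?thesis by (simp only: zs)
    qed
    show "a (Suc i) (Suc k)" if "Z (Suc i) (Suc (Suc k))" for i k
    proof -
      have "coh_zero S (\<lambda>k. X (Suc i) (Suc k)) (\<lambda>k. x (Suc i) (Suc k)) (Suc k)"
        using that by (simp only: zs)
      then show ?thesis unfolding a_def by (rule coh_zero_imp_inj)
    qed
    show "s (Suc i) (Suc k)" if "Z i (Suc k)" for i k
      using coh_zero_imp_surj[OF sX(5) shift_proj chain_mapD(1)[OF F(1)]] that by (simp add: s_def Z_def)
    show "I 0 (Suc k)" "J 0 (Suc k)" for k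
      using eqv[of "Suc k"] by (simp_all add: I_def J_def X_def x_def \<Phi>(4))
    show "I (Suc i) (Suc k)" if "I i (Suc k)" "a (Suc i) (Suc k + i)" for i k
      unfolding Istep by (rule coh_inj_comp[OF sX(5) F(1)]) (use that in \<open>simp_all add: I_def a_def\<close>)
    show "J (Suc i) (Suc k)" if "J i (Suc k)" "s (Suc i) (Suc k + i)" for i k
      unfolding Jstep by (rule coh_surj_comp[OF pD \<Phi>(1) F(1)]) (use that in \<open>simp_all add: J_def s_def\<close>)
    show "a (Suc i) (Suc k + i)" if "I (Suc i) (Suc k)" for i k
      using coh_inj_cancel[OF pD \<Phi>(1)] that unfolding Istep by (simp add: a_def)
    show "s (Suc i) (Suc k + i)" if "J (Suc i) (Suc k)" "I i (Suc k)" for i k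
      using coh_surj_cancel[OF pD sX(5) \<Phi>(1) F(1), of i "Suc k + i"] that unfolding Jstep by (simp add: s_def I_def)
  qed
  have "grade S (Ext R i M) \<ge> enat (i + j - 1) \<longleftrightarrow> (\<forall>k<i + j - 1. s i k \<and> a i (Suc k))" if i: "i \<in> {1..n}" for i
  proof -
    obtain l where "i = Suc l" using i by (cases i) auto
    then show ?thesis
      unfolding grade_ge_iff using Ext_Ext_zero_iff[OF st[of l] st[of "Suc l"] F(1)[of l] F0] by (simp add: a_def s_def)
  qed
  moreover have "torsionfree R i (syzygy R i M) \<and> satisfies_T R j (psi_domain R i M) M (psi R i M) \<longleftrightarrow>
      (\<forall>k\<in>{1..i}. Z i k) \<and> (\<forall>k. 1 \<le> k \<longrightarrow> k \<le> j \<longrightarrow> I i k) \<and> (\<forall>k. 1 \<le> k \<longrightarrow> k < j \<longrightarrow> J i k)" if "i \<in> {1..n}" for i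
  proof -
    have i: "i \<ge> 1" using that by simp
    have Xi: "X i = Q i" "x i = q i" using i by (simp_all add: X_def x_def)
    show ?thesis
      using torsionfree_syzygy_iff[OF i] satisfies_T_psi_iff[OF i D \<Phi>(1)[of i, unfolded Xi] \<Phi>(2)[OF i], of j]
      by (simp add: Z_def I_def J_def Xi)
  qed
  ultimately show ?thesis using induct_iff by simp
qed

end

theorem theorem1p3:
  fixes R :: "('a, 'r) ring_scheme" and M :: "('a, 'm) module" and n j :: nat
  assumes "two_sided_noetherian R"
    and "n \<ge> 1"
    and "right_module R M"
    and "fin_gen R M"
  shows "(\<forall>i \<in> {1..n}. grade (op_ring R) (Ext R i M) \<ge> enat (i + j - 1)) \<longleftrightarrow>
         (\<forall>i \<in> {1..n}. torsionfree R i (syzygy R i M) \<and>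
            satisfies_T R j (psi_domain R i M) M (psi R i M))"
  using assms(1) fin_gen_imp_fgen[OF assms(3,4)] unfolding two_sided_noetherian_def
  by (intro grade_Ext_iff_torsionfree_and_T) blast+

end
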